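(* Let $d \ge 2$ be an integer and let $\alpha \in \mathbb{R}^d$ be such that the translation flow $\mathbb{R} \ni x \mapsto \omega + x\alpha \in \mathbb{T}^d$ on $\mathbb{T}^d$ is minimal. Then there is a dense $G_\delta$-set $\mathcal{S} \subseteq C(\mathbb{T}^d)$ such that for every $f \in \mathcal{S}$ and every $\omega \in \mathbb{T}^d$, the Schrödinger operator $[H\psi](x) = -\psi''(x) + V(x)\psi(x)$ in $L^2(\mathbb{R})$ with potential $V(x) = f(\omega + x\alpha)$ has purely singular spectrum.
   Context: $\mathbb{T}^d = \mathbb{R}^d/\mathbb{Z}^d$, and $\omega + x\alpha$ is understood modulo $\mathbb{Z}^d$. $C(\mathbb{T}^d)$ denotes the space of real-valued continuous functions on $\mathbb{T}^d$ with the supremum norm topology. The translation flow is minimal if all orbits $\{\omega + x\alpha : x \in \mathbb{R}\}$, $\omega \in \mathbb{T}^d$, are dense in $\mathbb{T}^d$. The Schrödinger operator is the self-adjoint operator in $L^2(\mathbb{R})$ given by $-\frac{d^2}{dx^2} + V$ with bounded potential $V$ (domain $H^2(\mathbb{R})$). It has purely singular spectrum if its absolutely continuous spectrum is empty, i.e. all its spectral measures are singular with respect to Lebesgue measure. *)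

theory Defs
  imports "HOL-Analysis.Analysis"
begin

section \<open>The torus $\mathbb{R}^d/\mathbb{Z}^d$\<close>

definition torus_rel :: "real ^ 'd \<Rightarrow> real ^ 'd \<Rightarrow> bool" where
  "torus_rel x y \<longleftrightarrow> (\<forall>i. x $ i - y $ i \<in> \<int>)"

lemma torus_rel_equivp: "equivp torus_rel"
proof (rule equivpI)
  show "reflp torus_rel" by (auto simp: reflp_def torus_rel_def)
  show "symp torus_rel"
    unfolding symp_def torus_rel_def by (metis Ints_minus minus_diff_eq)
  show "transp torus_rel"
    unfolding transp_def torus_rel_def
  proof (intro allI impI)
    fix x y z :: "real ^ 'd" and i
    assume "\<forall>i. x $ i - y $ i \<in> \<int>" "\<forall>i. y $ i - z $ i \<in> \<int>"
    then have "(x $ i - y $ i) + (y $ i - z $ i) \<in> \<int>" by (intro Ints_add) auto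
    then show "x $ i - z $ i \<in> \<int>" by simp
  qed
qed

quotient_type (overloaded) 'd torus = "real ^ 'd::finite" / torus_rel
  morphisms rep_torus to_torus
  by (rule torus_rel_equivp)

instantiation torus :: (finite) ab_group_add
begin

lift_definition zero_torus :: "'a torus" is 0 .

lift_definition plus_torus :: "'a torus \<Rightarrow> 'a torus \<Rightarrow> 'a torus" is "(+)"
  unfolding torus_rel_def by (metis Ints_add add_diff_add vector_add_component)

lift_definition uminus_torus :: "'a torus \<Rightarrow> 'a torus" is uminus
  unfolding torus_rel_def by (metis Ints_minus minus_diff_minus vector_uminus_component)

definition minus_torus :: "'a torus \<Rightarrow> 'a torus \<Rightarrow> 'a torus" where
  "minus_torus x y = x + - y"

instance
  by standard (transfer; simp add: torus_rel_def minus_torus_def; fail | simp add: minus_torus_def)+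

end

instantiation torus :: (finite) topological_space
begin

text \<open>The quotient topology.\<close>

definition open_torus :: "'a torus set \<Rightarrow> bool" where
  "open_torus U \<longleftrightarrow> open (to_torus -` U)"

instance
  by standard (auto simp: open_torus_def vimage_Union intro!: open_Int)

end

lemma continuous_to_torus: "continuous_on UNIV to_torus"
  by (simp add: continuous_on_open_vimage open_torus_def)

lemma compact_torus: "compact (UNIV :: 'd::finite torus set)"
proof -
  have "to_torus x \<in> to_torus ` cbox 0 1" for x :: "real ^ 'd"
  proof
    have "x $ i - frac (x $ i) \<in> \<int>" for i by (simp add: frac_def)
    then show "to_torus x = to_torus (\<chi> i. frac (x $ i))"
      by (auto simp: torus.abs_eq_iff torus_rel_def)
    show "(\<chi> i. frac (x $ i)) \<in> cbox 0 (1 :: real ^ 'd)"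
      by (auto simp: mem_box_cart frac_lt_1 less_imp_le)
  qed
  then have "\<omega> \<in> to_torus ` cbox 0 (1 :: real ^ 'd)" for \<omega>
    by (induction \<omega> rule: torus.abs_induct)
  then have "UNIV = to_torus ` cbox 0 (1 :: real ^ 'd)"
    by (rule UNIV_eq_I)
  moreover have "compact (to_torus ` cbox 0 (1 :: real ^ 'd))"
    by (intro compact_continuous_image compact_cbox continuous_on_subset[OF continuous_to_torus]) simp
  ultimately show ?thesis by simp
qed

text \<open>Boundedness being automatic, the type of bounded continuous functions
  \<^typ>\<open>'d::finite torus \<Rightarrow>\<^sub>C real\<close>, with its supremum distance, is the space of all
  continuous real functions on the torus.\<close>

lemma continuous_torus_bcontfun:
  fixes f :: "'d::finite torus \<Rightarrow> real"
  shows "f \<in> bcontfun \<longleftrightarrow> continuous_on UNIV f"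
  using compact_continuous_image[OF _ compact_torus, of f]
  by (auto simp: bcontfun_def compact_imp_bounded)

definition minimal_flow :: "(real \<Rightarrow> 'a \<Rightarrow> 'a::topological_space) \<Rightarrow> bool" where
  "minimal_flow \<Phi> \<longleftrightarrow> (\<forall>\<omega>. closure (range (\<lambda>x. \<Phi> x \<omega>)) = UNIV)"


section \<open>The complex Hilbert space $L^2(\mathbb{R})$\<close>

definition square_integrable :: "(real \<Rightarrow> complex) \<Rightarrow> bool" where
  "square_integrable f \<longleftrightarrow>
     f \<in> borel_measurable lborel \<and> integrable lborel (\<lambda>x. (cmod (f x))\<^sup>2)"

definition L2_rel :: "(real \<Rightarrow> complex) \<Rightarrow> (real \<Rightarrow> complex) \<Rightarrow> bool" where
  "L2_rel f g \<longleftrightarrow> square_integrable f \<and> square_integrable g \<and> (AE x in lborel. f x = g x)"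

lemma L2_rel_part_equivp: "part_equivp L2_rel"
proof (rule part_equivpI)
  show "\<exists>f. L2_rel f f"
    by (rule exI[of _ "\<lambda>_. 0"]) (simp add: L2_rel_def square_integrable_def)
  show "symp L2_rel"
    by (auto simp: symp_def L2_rel_def eq_commute)
  show "transp L2_rel"
    unfolding transp_def L2_rel_def
  proof (intro allI impI, elim conjE, intro conjI)
    fix f g h :: "real \<Rightarrow> complex"
    assume "AE x in lborel. f x = g x" "AE x in lborel. g x = h x"
    then show "AE x in lborel. f x = h x" by eventually_elim simp
  qed auto
qed

quotient_type L2 = "real \<Rightarrow> complex" / partial: L2_rel
  by (rule L2_rel_part_equivp)

lemma square_integrable_cmult:
  assumes "square_integrable f"
  shows "square_integrable (\<lambda>x. c * f x)"
  using assms by (auto simp: square_integrable_def norm_mult power_mult_distrib)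

lemma square_integrable_mult:
  assumes "square_integrable f" "square_integrable g"
  shows "integrable lborel (\<lambda>x. cnj (f x) * g x)"
proof (rule Bochner_Integration.integrable_bound)
  show "integrable lborel (\<lambda>x. (cmod (f x))\<^sup>2 + (cmod (g x))\<^sup>2)"
    using assms by (auto simp: square_integrable_def)
  have [measurable]: "f \<in> borel_measurable lborel" "g \<in> borel_measurable lborel"
    using assms by (auto simp: square_integrable_def)
  show "(\<lambda>x. cnj (f x) * g x) \<in> borel_measurable lborel"
    by (intro borel_measurable_times measurable_compose[OF _ borel_measurable_continuous_onI[of cnj]])
      (auto intro!: continuous_intros)
  show "AE x in lborel. norm (cnj (f x) * g x) \<le> norm ((cmod (f x))\<^sup>2 + (cmod (g x))\<^sup>2)"
  proof (rule AE_I2)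
    fix x
    have "2 * (cmod (f x) * cmod (g x)) \<le> (cmod (f x))\<^sup>2 + (cmod (g x))\<^sup>2"
      using sum_squares_bound[of "cmod (f x)" "cmod (g x)"] by (simp add: mult.assoc)
    moreover have "0 \<le> cmod (f x) * cmod (g x)" by simp
    ultimately show "norm (cnj (f x) * g x) \<le> norm ((cmod (f x))\<^sup>2 + (cmod (g x))\<^sup>2)"
      unfolding norm_mult complex_mod_cnj real_norm_def by linarith
  qed
qed

lemma square_integrable_add:
  assumes "square_integrable f" "square_integrable g"
  shows "square_integrable (\<lambda>x. f x + g x)"
proof -
  have [measurable]: "f \<in> borel_measurable lborel" "g \<in> borel_measurable lborel"
    using assms by (auto simp: square_integrable_def)
  have "integrable lborel (\<lambda>x. (cmod (f x + g x))\<^sup>2)"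
  proof (rule Bochner_Integration.integrable_bound)
    show "integrable lborel (\<lambda>x. 2 * (cmod (f x))\<^sup>2 + 2 * (cmod (g x))\<^sup>2)"
      using assms by (auto simp: square_integrable_def)
    show "AE x in lborel. norm ((cmod (f x + g x))\<^sup>2) \<le> norm (2 * (cmod (f x))\<^sup>2 + 2 * (cmod (g x))\<^sup>2)"
    proof (rule AE_I2)
      fix x
      have "(cmod (f x + g x))\<^sup>2 \<le> (cmod (f x) + cmod (g x))\<^sup>2"
        by (intro power_mono norm_triangle_ineq) auto
      also have "\<dots> \<le> 2 * (cmod (f x))\<^sup>2 + 2 * (cmod (g x))\<^sup>2"
        using sum_squares_bound[of "cmod (f x)" "cmod (g x)"] by (simp add: power2_sum)
      finally show "norm ((cmod (f x + g x))\<^sup>2) \<le> norm (2 * (cmod (f x))\<^sup>2 + 2 * (cmod (g x))\<^sup>2)"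
        by simp
    qed
  qed measurable
  then show ?thesis by (auto simp: square_integrable_def)
qed

lift_definition scaleC_L2 :: "complex \<Rightarrow> L2 \<Rightarrow> L2" is "\<lambda>c f x. c * f x"
  by (auto simp: L2_rel_def square_integrable_cmult elim: eventually_mono)

lift_definition cinner_L2 :: "L2 \<Rightarrow> L2 \<Rightarrow> complex"
  is "\<lambda>f g. LINT x|lborel. cnj (f x) * g x"
proof -
  fix f f' g g' :: "real \<Rightarrow> complex"
  assume "L2_rel f f'" "L2_rel g g'"
  then show "(LINT x|lborel. cnj (f x) * g x) = (LINT x|lborel. cnj (f' x) * g' x)"
    by (intro integral_cong_AE borel_measurable_integrable square_integrable_mult)
      (auto simp: L2_rel_def elim: eventually_elim2)
qed

instantiation L2 :: real_inner
begin

lift_definition zero_L2 :: L2 is "\<lambda>_. 0"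
  by (simp add: L2_rel_def square_integrable_def)

lift_definition plus_L2 :: "L2 \<Rightarrow> L2 \<Rightarrow> L2" is "\<lambda>f g x. f x + g x"
  by (auto simp: L2_rel_def square_integrable_add elim: eventually_elim2)

definition scaleR_L2 :: "real \<Rightarrow> L2 \<Rightarrow> L2" where
  "scaleR_L2 r \<psi> = scaleC_L2 (of_real r) \<psi>"

definition uminus_L2 :: "L2 \<Rightarrow> L2" where
  "uminus_L2 \<psi> = scaleC_L2 (- 1) \<psi>"

definition minus_L2 :: "L2 \<Rightarrow> L2 \<Rightarrow> L2" where
  "minus_L2 \<phi> \<psi> = \<phi> + - \<psi>"

definition inner_L2 :: "L2 \<Rightarrow> L2 \<Rightarrow> real" where
  "inner_L2 \<phi> \<psi> = Re (cinner_L2 \<phi> \<psi>)"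

definition norm_L2 :: "L2 \<Rightarrow> real" where
  "norm_L2 \<psi> = sqrt (inner \<psi> \<psi>)"

definition sgn_L2 :: "L2 \<Rightarrow> L2" where
  "sgn_L2 \<psi> = inverse (norm \<psi>) *\<^sub>R \<psi>"

definition dist_L2 :: "L2 \<Rightarrow> L2 \<Rightarrow> real" where
  "dist_L2 \<phi> \<psi> = norm (\<phi> - \<psi>)"

definition uniformity_L2 :: "(L2 \<times> L2) filter" where
  "uniformity_L2 = (INF e\<in>{0<..}. principal {(\<phi>, \<psi>). dist \<phi> \<psi> < e})"

definition open_L2 :: "L2 set \<Rightarrow> bool" where
  "open_L2 U = (\<forall>\<phi>\<in>U. \<forall>\<^sub>F (\<phi>', \<psi>) in uniformity. \<phi>' = \<phi> \<longrightarrow> \<psi> \<in> U)"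

instance
proof
  fix \<phi> \<psi> \<xi> :: L2 and r s :: real
  show "\<phi> + \<psi> + \<xi> = \<phi> + (\<psi> + \<xi>)"
    by transfer (simp add: L2_rel_def square_integrable_add add.assoc)
  show "\<phi> + \<psi> = \<psi> + \<phi>"
    by transfer (simp add: L2_rel_def square_integrable_add add.commute)
  show "0 + \<phi> = \<phi>"
    by transfer (simp add: L2_rel_def)
  show "- \<phi> + \<phi> = 0"
    unfolding uminus_L2_def
    by transfer (simp add: L2_rel_def square_integrable_def)
  show "\<phi> - \<psi> = \<phi> + - \<psi>"
    by (simp add: minus_L2_def)
  show "r *\<^sub>R (\<phi> + \<psi>) = r *\<^sub>R \<phi> + r *\<^sub>R \<psi>"
    unfolding scaleR_L2_def
    by transfer (simp add: L2_rel_def square_integrable_add square_integrable_cmult distrib_left)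
  show "(r + s) *\<^sub>R \<phi> = r *\<^sub>R \<phi> + s *\<^sub>R \<phi>"
    unfolding scaleR_L2_def
  proof transfer
    fix r s :: real and f :: "real \<Rightarrow> complex"
    assume "L2_rel f f"
    moreover have "(\<lambda>x. complex_of_real (r + s) * f x)
        = (\<lambda>x. complex_of_real r * f x + complex_of_real s * f x)"
      by (simp add: distrib_right)
    ultimately show "L2_rel (\<lambda>x. complex_of_real (r + s) * f x)
        (\<lambda>x. complex_of_real r * f x + complex_of_real s * f x)"
      by (simp add: L2_rel_def square_integrable_add square_integrable_cmult)
  qed
  show "r *\<^sub>R s *\<^sub>R \<phi> = (r * s) *\<^sub>R \<phi>"
    unfolding scaleR_L2_def
    by transfer (simp add: L2_rel_def square_integrable_cmult mult.assoc[symmetric] 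
        square_integrable_cmult[of _ "complex_of_real _ * complex_of_real _"])
  show "1 *\<^sub>R \<phi> = \<phi>"
    unfolding scaleR_L2_def by transfer (simp add: L2_rel_def)
  show "dist \<phi> \<psi> = norm (\<phi> - \<psi>)"
    by (simp add: dist_L2_def)
  show "sgn \<phi> = inverse (norm \<phi>) *\<^sub>R \<phi>"
    by (simp add: sgn_L2_def)
  show "(uniformity :: (L2 \<times> L2) filter) = (INF e\<in>{0<..}. principal {(\<phi>, \<psi>). dist \<phi> \<psi> < e})"
    by (simp add: uniformity_L2_def)
  show "open U = (\<forall>\<phi>\<in>U. \<forall>\<^sub>F (\<phi>', \<psi>) in uniformity. \<phi>' = \<phi> \<longrightarrow> \<psi> \<in> U)" for U :: "L2 set"
    by (simp add: open_L2_def)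
  show "inner \<phi> \<psi> = inner \<psi> \<phi>"
    unfolding inner_L2_def
  proof transfer
    fix f g :: "real \<Rightarrow> complex"
    have "(LINT x|lborel. cnj (f x) * g x) = (LINT x|lborel. cnj (cnj (g x) * f x))"
      by (simp add: mult.commute)
    also have "\<dots> = cnj (LINT x|lborel. cnj (g x) * f x)"
      by (rule Bochner_Integration.integral_cnj)
    finally show "Re (LINT x|lborel. cnj (f x) * g x) = Re (LINT x|lborel. cnj (g x) * f x)"
      by simp
  qed
  show "inner (\<phi> + \<psi>) \<xi> = inner \<phi> \<xi> + inner \<psi> \<xi>"
    unfolding inner_L2_def
    by transfer (simp add: L2_rel_def distrib_right square_integrable_mult)
  show "inner (r *\<^sub>R \<phi>) \<psi> = r * inner \<phi> \<psi>"
    unfolding inner_L2_def scaleR_L2_def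
    by transfer (simp add: mult.assoc)
  have norm_sq: "Re (LINT x|lborel. cnj (f x) * f x) = (LINT x|lborel. (cmod (f x))\<^sup>2)"
    for f :: "real \<Rightarrow> complex"
  proof -
    have "(LINT x|lborel. cnj (f x) * f x) = (LINT x|lborel. complex_of_real ((cmod (f x))\<^sup>2))"
      by (simp only: complex_norm_square mult.commute)
    then show ?thesis by (simp only: integral_complex_of_real Re_complex_of_real)
  qed
  show "0 \<le> inner \<phi> \<phi>"
    unfolding inner_L2_def by transfer (simp add: norm_sq)
  show "inner \<phi> \<phi> = 0 \<longleftrightarrow> \<phi> = 0"
    unfolding inner_L2_def
  proof transfer
    fix f :: "real \<Rightarrow> complex"
    assume f: "L2_rel f f"
    then have "(LINT x|lborel. (cmod (f x))\<^sup>2) = 0 \<longleftrightarrow> (AE x in lborel. (cmod (f x))\<^sup>2 = 0)"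
      by (intro integral_nonneg_eq_0_iff_AE) (auto simp: L2_rel_def square_integrable_def)
    then show "Re (LINT x|lborel. cnj (f x) * f x) = 0 \<longleftrightarrow> L2_rel f (\<lambda>_. 0)"
      using f by (auto simp: norm_sq L2_rel_def square_integrable_def)
  qed
  show "norm \<phi> = sqrt (inner \<phi> \<phi>)"
    by (simp add: norm_L2_def)
qed

end


section \<open>Schroedinger operators on the line\<close>

definition test_function :: "(real \<Rightarrow> real) \<Rightarrow> bool" where
  "test_function \<phi> \<longleftrightarrow>
     (\<forall>n. (deriv ^^ n) \<phi> differentiable_on UNIV) \<and> compact (closure {x. \<phi> x \<noteq> 0})"

text \<open>\<open>has_weak_deriv \<psi> \<eta>\<close>: the distributional derivative of \<open>\<psi>\<close> is \<open>\<eta>\<close>.\<close>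

lift_definition has_weak_deriv :: "L2 \<Rightarrow> L2 \<Rightarrow> bool"
  is "\<lambda>f g. \<forall>\<phi>. test_function \<phi> \<longrightarrow>
        (LINT x|lborel. deriv \<phi> x *\<^sub>R f x) = - (LINT x|lborel. \<phi> x *\<^sub>R g x)"
proof -
  fix f f' g g' :: "real \<Rightarrow> complex"
  assume f: "L2_rel f f'" and g: "L2_rel g g'"
  have "(LINT x|lborel. deriv \<phi> x *\<^sub>R f x) = (LINT x|lborel. deriv \<phi> x *\<^sub>R f' x)"
    "(LINT x|lborel. \<phi> x *\<^sub>R g x) = (LINT x|lborel. \<phi> x *\<^sub>R g' x)" if "test_function \<phi>" for \<phi>
  proof -
    have "(deriv ^^ n) \<phi> \<in> borel_measurable borel" for n
      using that by (intro borel_measurable_continuous_onI differentiable_imp_continuous_on)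
        (auto simp: test_function_def)
    from this[of 0] this[of 1]
    have [measurable]: "\<phi> \<in> borel_measurable borel" "deriv \<phi> \<in> borel_measurable borel"
      by simp_all
    have [measurable]: "f \<in> borel_measurable borel" "f' \<in> borel_measurable borel"
      "g \<in> borel_measurable borel" "g' \<in> borel_measurable borel"
      using f g by (auto simp: L2_rel_def square_integrable_def)
    show "(LINT x|lborel. deriv \<phi> x *\<^sub>R f x) = (LINT x|lborel. deriv \<phi> x *\<^sub>R f' x)"
      using f by (intro integral_cong_AE) (auto simp: L2_rel_def elim: eventually_mono)
    show "(LINT x|lborel. \<phi> x *\<^sub>R g x) = (LINT x|lborel. \<phi> x *\<^sub>R g' x)"
      using g by (intro integral_cong_AE) (auto simp: L2_rel_def elim: eventually_mono)
  qed
  then show "(\<forall>\<phi>. test_function \<phi> \<longrightarrow>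
      (LINT x|lborel. deriv \<phi> x *\<^sub>R f x) = - (LINT x|lborel. \<phi> x *\<^sub>R g x)) \<longleftrightarrow>
    (\<forall>\<phi>. test_function \<phi> \<longrightarrow>
      (LINT x|lborel. deriv \<phi> x *\<^sub>R f' x) = - (LINT x|lborel. \<phi> x *\<^sub>R g' x))"
    by simp
qed

lift_definition is_product :: "(real \<Rightarrow> real) \<Rightarrow> L2 \<Rightarrow> L2 \<Rightarrow> bool"
  is "\<lambda>V f g. AE x in lborel. g x = V x *\<^sub>R f x"
proof -
  fix V and f f' g g' :: "real \<Rightarrow> complex"
  assume "L2_rel f f'" "L2_rel g g'"
  then have "AE x in lborel. f x = f' x" "AE x in lborel. g x = g' x"
    by (auto simp: L2_rel_def)
  then have "AE x in lborel. (g x = V x *\<^sub>R f x) = (g' x = V x *\<^sub>R f' x)"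
    by eventually_elim simp
  then show "(AE x in lborel. g x = V x *\<^sub>R f x) = (AE x in lborel. g' x = V x *\<^sub>R f' x)"
    by (rule eventually_subst)
qed

text \<open>Unbounded operators are given by their graphs. The domain of
  \<open>schrodinger V\<close> is the Sobolev space $H^2(\mathbb{R})$ whenever \<open>V\<close> is bounded and
  measurable, since \<open>V\<psi>\<close> is then automatically in \<^typ>\<open>L2\<close>.\<close>

definition schrodinger :: "(real \<Rightarrow> real) \<Rightarrow> (L2 \<times> L2) set" where
  "schrodinger V = {(\<psi>, \<eta>). \<exists>\<psi>' \<psi>'' \<xi>.
     has_weak_deriv \<psi> \<psi>' \<and> has_weak_deriv \<psi>' \<psi>'' \<and> is_product V \<psi> \<xi> \<and> \<eta> = - \<psi>'' + \<xi>}"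


section \<open>Spectral measures\<close>

definition orthogonal_projection :: "(L2 \<Rightarrow> L2) \<Rightarrow> bool" where
  "orthogonal_projection P \<longleftrightarrow>
     (\<forall>c \<phi> \<psi>. P (scaleC_L2 c \<phi> + \<psi>) = scaleC_L2 c (P \<phi>) + P \<psi>) \<and>
     (\<forall>\<psi>. P (P \<psi>) = P \<psi>) \<and>
     (\<forall>\<phi> \<psi>. cinner_L2 (P \<phi>) \<psi> = cinner_L2 \<phi> (P \<psi>))"

definition projection_valued_measure :: "(real set \<Rightarrow> L2 \<Rightarrow> L2) \<Rightarrow> bool" where
  "projection_valued_measure E \<longleftrightarrow>
     (\<forall>B\<in>sets borel. orthogonal_projection (E B)) \<and>
     (\<forall>\<psi>. E {} \<psi> = 0) \<and> (\<forall>\<psi>. E UNIV \<psi> = \<psi>) \<and>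
     (\<forall>A\<in>sets borel. \<forall>B\<in>sets borel. \<forall>\<psi>. E (A \<inter> B) \<psi> = E A (E B \<psi>)) \<and>
     (\<forall>B :: nat \<Rightarrow> real set. range B \<subseteq> sets borel \<longrightarrow> disjoint_family B \<longrightarrow>
        (\<forall>\<psi>. (\<lambda>n. E (B n) \<psi>) sums E (\<Union>n. B n) \<psi>))"

definition spectral_measure :: "(real set \<Rightarrow> L2 \<Rightarrow> L2) \<Rightarrow> L2 \<Rightarrow> real measure" where
  "spectral_measure E \<psi> = measure_of UNIV (sets borel) (\<lambda>B. ennreal (Re (cinner_L2 \<psi> (E B \<psi>))))"

lemma sets_spectral_measure [simp]: "sets (spectral_measure E \<psi>) = sets borel"
  using sets.sigma_sets_eq[of "borel :: real measure"] by (simp add: spectral_measure_def)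

lemma emeasure_spectral_measure:
  assumes E: "projection_valued_measure E" and B: "B \<in> sets borel"
  shows "emeasure (spectral_measure E \<psi>) B = ennreal (Re (cinner_L2 \<psi> (E B \<psi>)))"
proof (rule emeasure_measure_of[OF spectral_measure_def])
  have nonneg: "0 \<le> inner \<psi> (E B \<psi>)" if "B \<in> sets borel" for B
  proof -
    have "orthogonal_projection (E B)"
      using E that by (simp add: projection_valued_measure_def)
    then have "cinner_L2 \<psi> (E B \<psi>) = cinner_L2 (E B \<psi>) (E B \<psi>)"
      by (metis orthogonal_projection_def)
    then show ?thesis by (metis inner_L2_def inner_ge_zero)
  qed
  show "sets borel \<subseteq> Pow (UNIV :: real set)" by simp
  show "B \<in> sets (spectral_measure E \<psi>)" using B by simp
  show "positive (sets (spectral_measure E \<psi>)) (\<lambda>B. ennreal (Re (cinner_L2 \<psi> (E B \<psi>))))"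
    using E by (simp add: positive_def projection_valued_measure_def inner_L2_def[symmetric])
  show "countably_additive (sets (spectral_measure E \<psi>)) (\<lambda>B. ennreal (Re (cinner_L2 \<psi> (E B \<psi>))))"
    unfolding countably_additive_def inner_L2_def[symmetric]
  proof (intro allI impI)
    fix A :: "nat \<Rightarrow> real set"
    assume A: "range A \<subseteq> sets (spectral_measure E \<psi>)" and "disjoint_family A"
    then have "(\<lambda>n. E (A n) \<psi>) sums E (\<Union>n. A n) \<psi>"
      using E by (simp add: projection_valued_measure_def)
    then have "(\<lambda>n. inner \<psi> (E (A n) \<psi>)) sums inner \<psi> (E (\<Union>n. A n) \<psi>)"
      by (rule bounded_linear.sums[OF bounded_linear_inner_right])
    moreover have "0 \<le> inner \<psi> (E (A n) \<psi>)" for n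
      using A by (intro nonneg) auto
    ultimately show "(\<Sum>n. ennreal (inner \<psi> (E (A n) \<psi>))) = ennreal (inner \<psi> (E (\<Union>n. A n) \<psi>))"
      by (metis suminf_ennreal_eq)
  qed
qed

text \<open>\<open>E\<close> is the spectral resolution of the operator with graph \<open>H\<close>, i.e.
  $H = \int \lambda\, dE(\lambda)$. For a linear operator the values $\langle\psi, H\psi\rangle$
  determine $H$ on its domain by polarization, so testing the quadratic form suffices.\<close>

definition spectral_resolution :: "(L2 \<times> L2) set \<Rightarrow> (real set \<Rightarrow> L2 \<Rightarrow> L2) \<Rightarrow> bool" where
  "spectral_resolution H E \<longleftrightarrow>
     projection_valued_measure E \<and>
     Domain H = {\<psi>. integrable (spectral_measure E \<psi>) (\<lambda>x. x\<^sup>2)} \<and>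
     (\<forall>(\<psi>, \<eta>)\<in>H. cinner_L2 \<psi> \<eta> = of_real (LINT x|spectral_measure E \<psi>. x))"

definition singular_lebesgue :: "real measure \<Rightarrow> bool" where
  "singular_lebesgue \<mu> \<longleftrightarrow>
     (\<exists>N\<in>sets borel. emeasure lborel N = 0 \<and> emeasure \<mu> (- N) = 0)"

text \<open>By the spectral theorem a self-adjoint operator has exactly one spectral resolution,
  so the quantifier over \<open>E\<close> ranges over a single element (up to the irrelevant values of
  \<open>E\<close> on non-Borel sets).\<close>

definition purely_singular_spectrum :: "(L2 \<times> L2) set \<Rightarrow> bool" where
  "purely_singular_spectrum H \<longleftrightarrow>
     (\<forall>E. spectral_resolution H E \<longrightarrow> (\<forall>\<psi>. singular_lebesgue (spectral_measure E \<psi>)))"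

end

theory Submission
  imports Defs "HOL-Computational_Algebra.Polynomial" "HOL-Real_Asymp.Real_Asymp"
begin

text \<open>For $n \ge 1$, consider the continuous functions $g$ whose samples along a finite orbit segment
  have windows on which, for each energy $|E| \le n$, some solution of $v'' = (V - E) v$ grows by a
  large factor. They are dense: by induction on the determinant of a quadratic form, arbitrarily
  small perturbations of the potential make solutions grow, and since the orbit is injective
  ($d \ge 2$), Tietze's theorem extends the perturbation from the segment to the torus. A function that
  lies, for every $n$, in a small ball around such a $g$ yields, by recurrence of the flow, potentials
  in which these windows reappear arbitrarily far to the left and to the right.

  Such a potential has no absolutely continuous spectrum. Otherwise there is $\varphi \neq 0$ whose
  spectral measure lies in $[-n_0, n_0)$ and is bounded by $c$ times Lebesgue measure. Cut the energies
  into intervals of length $\delta$; the spectral pieces $g_k$ of $\varphi$ are orthogonal approximate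
  eigenfunctions with $\|g_k\|^2 \le c \delta$. With the approximate resolvents
  $G_l = \sum_k g_k / (E_k - E_l - i \eta)$, the quantity $\|\varphi\|^2 / 2$ is, up to errors that vanish
  as $\delta \to 0$ and then $\eta \to 0$, at most the total flux
  $\delta \sum_l |\mathrm{Im}(\overline{G_l} G_l')|$ through two distant points. The growing solutions
  force this flux to be $O(1/n)$ in the windows.\<close>


section \<open>Initial value problems\<close>

text \<open>A gain in norm produced by one bump may be undone by the unperturbed evolution, whereas
  every propagator preserves determinants. This is why the induction watches the determinant of a
  form. Each bump is used with both signs, and the determinant of a mean of two forms is the mean of
  the determinants minus the determinant of half the difference, which is strictly negative here.
  Once the determinant is 4 the trace is at least 4, and some choice of signs attains the mean. The
  width \<open>\<kappa>\<close> of the energy band served by one window must not depend on the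
  growth demanded: there are about \<open>\<Lambda> / \<kappa>\<close> windows, and the growth has
  to beat their number. A cone argument for solutions at nearby energies provides this. Window
  lengths and solution bounds depend on n without any control, so n goes to infinity last, after
  \<delta>, \<eta> and the mass in the tails have been sent to 0. The operator is tied to its
  spectral resolution only by domain and quadratic form; invariance of spectral subspaces and
  approximate eigenvectors are derived from these.\<close>

definition sol :: "(real \<Rightarrow> real) \<Rightarrow> (real \<Rightarrow> real) \<Rightarrow> (real \<Rightarrow> real) \<Rightarrow> bool" where
  "sol V v v' \<longleftrightarrow> (\<forall>x. (v has_real_derivative v' x) (at x)) \<and>
                  (\<forall>x. (v' has_real_derivative V x * v x) (at x))"

section \<open>Existence of solutions by Picard iteration\<close>

lemma antiderivative_real:
  fixes f :: "real \<Rightarrow> real"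
  assumes "continuous_on UNIV f"
  obtains F where "\<And>x. (F has_real_derivative f x) (at x)" "F a = 0"
proof -
  have "\<exists>F. \<forall>x :: real. -\<infinity> < ereal x \<longrightarrow> ereal x < \<infinity> \<longrightarrow> (F has_vector_derivative f x) (at x)"
    by (rule einterval_antiderivative) (use assms in \<open>auto simp: continuous_on_eq_continuous_at\<close>)
  then obtain F where F: "\<And>x. (F has_real_derivative f x) (at x)"
    by (auto simp: has_real_derivative_iff_has_vector_derivative)
  show ?thesis
    by (rule that[of "\<lambda>x. F x - F a"]) (auto intro!: derivative_eq_intros F)
qed

text \<open>Replaces the integral estimate of Picard iteration: to the right of \<open>a\<close>,
  the function minus the claimed bound is nonincreasing. The left half-line follows by the
  reflection x -> 2 a - x.\<close>

lemma deriv_power_bound: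
  fixes f :: "real \<Rightarrow> real"
  assumes f: "\<And>x. (f has_real_derivative f' x) (at x)" "f a = 0"
    and b: "\<And>x. \<bar>f' x\<bar> \<le> c * \<bar>x - a\<bar> ^ n"
  shows "\<bar>f x\<bar> \<le> c * \<bar>x - a\<bar> ^ Suc n / real (Suc n)"
proof -
  have right: "g x \<le> c * (x - a) ^ Suc n / real (Suc n)"
    if g: "\<And>x. (g has_real_derivative g' x) (at x)" "g a = 0"
      and b: "\<And>x. \<bar>g' x\<bar> \<le> c * \<bar>x - a\<bar> ^ n" and x: "a \<le> x" for g g' :: "real \<Rightarrow> real" and x
  proof -
    have "g x - c * (x - a) ^ Suc n / real (Suc n) \<le> g a - c * (a - a) ^ Suc n / real (Suc n)"
    proof (rule DERIV_nonpos_imp_nonincreasing[OF x])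
      fix t assume "a \<le> t"
      have "((\<lambda>x. g x - c * (x - a) ^ Suc n / real (Suc n)) has_real_derivative
        (g' t - c * (t - a) ^ n)) (at t)"
        by (auto intro!: derivative_eq_intros g(1) simp del: power_Suc)
      moreover have "g' t \<le> c * (t - a) ^ n"
        using b[of t] \<open>a \<le> t\<close> by simp
      ultimately show "\<exists>y. ((\<lambda>x. g x - c * (x - a) ^ Suc n / real (Suc n)) has_real_derivative y) (at t) \<and> y \<le> 0"
        by auto
    qed
    then show ?thesis using g(2) by simp
  qed
  show ?thesis
  proof (cases "a \<le> x")
    case True
    have "f x \<le> c * (x - a) ^ Suc n / real (Suc n)"
      by (rule right[OF f b True])
    moreover have "- f x \<le> c * (x - a) ^ Suc n / real (Suc n)"
      by (rule right[of "\<lambda>x. - f x" "\<lambda>x. - f' x", OF _ _ _ True]) (use f b in \<open>auto intro!: derivative_intros\<close>)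
    ultimately show ?thesis using True by simp
  next
    case False
    have m: "((\<lambda>x. f (2 * a - x)) has_real_derivative - f' (2 * a - x)) (at x)" for x
      by (rule DERIV_cong, rule DERIV_chain2[OF f(1)]) (auto intro!: derivative_eq_intros)
    have bm: "\<bar>f' (2 * a - x)\<bar> \<le> c * \<bar>x - a\<bar> ^ n" for x
      using b[of "2 * a - x"] by (simp add: abs_minus_commute)
    have x': "a \<le> 2 * a - x" using False by simp
    have "f (2 * a - (2 * a - x)) \<le> c * ((2 * a - x) - a) ^ Suc n / real (Suc n)"
      by (rule right[of "\<lambda>x. f (2 * a - x)", OF m _ _ x']) (use f bm in auto)
    moreover have "- f (2 * a - (2 * a - x)) \<le> c * ((2 * a - x) - a) ^ Suc n / real (Suc n)"
      by (rule right[of "\<lambda>x. - f (2 * a - x)" "\<lambda>x. f' (2 * a - x)", OF _ _ _ x'])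
        (use f bm m DERIV_minus[OF m] in auto)
    ultimately show ?thesis using False by (simp del: power_Suc)
  qed
qed

lemma power_abs_bound_step:
  fixes A L t :: real
  assumes "0 \<le> A" "1 \<le> L" "0 \<le> t" "c \<le> A * L ^ n"
  shows "(c / fact n) * t ^ Suc n / real (Suc n) \<le> A * L ^ Suc n * t ^ Suc n / fact (Suc n)"
proof -
  have "c \<le> A * L ^ Suc n"
    using assms(4) mult_left_mono[of "L ^ n" "L ^ Suc n" A] assms(1,2)
    by (simp add: power_increasing del: power_Suc)
  then have "c * t ^ Suc n / fact (Suc n) \<le> A * L ^ Suc n * t ^ Suc n / fact (Suc n)"
    by (intro divide_right_mono mult_right_mono) (use assms(3) in auto)
  then show ?thesis by (simp add: field_simps)
qed

lemma sol_exists: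
  fixes V :: "real \<Rightarrow> real"
  assumes cV: "continuous_on UNIV V" and bV: "\<And>x. \<bar>V x\<bar> \<le> C"
  obtains v v' where "sol V v v'" "v x0 = a" "v' x0 = b"
proof -
  define I where "I f = (SOME F. (\<forall>x. (F has_real_derivative f x) (at x)) \<and> F x0 = 0)" for f :: "real \<Rightarrow> real"
  have I: "(\<forall>x. (I f has_real_derivative f x) (at x)) \<and> I f x0 = 0" if cf: "continuous_on UNIV f" for f
  proof -
    obtain F where "\<And>x. (F has_real_derivative f x) (at x)" "F x0 = 0"
      using antiderivative_real[OF cf, where a = x0] by blast
    then show ?thesis unfolding I_def by (intro someI_ex[of "\<lambda>F. (\<forall>x. (F has_real_derivative f x) (at x)) \<and> F x0 = 0"]) blast
  qed
  \<comment> \<open>The increments of the Picard iteration, not its partial sums: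
    \<open>p (Suc n)\<close> integrates \<open>q n\<close>, and \<open>q (Suc n)\<close> integrates
    \<open>V * p n\<close>, both from \<open>x0\<close>. The solution is the sum of the series, and
    the initial values sit in index 0 alone.\<close>
  define Z where "Z = rec_nat (\<lambda>_ :: real. a, \<lambda>_ :: real. b) (\<lambda>_ z. (I (snd z), I (\<lambda>x. V x * fst z x)))"
  define p where "p n = fst (Z n)" for n
  define q where "q n = snd (Z n)" for n
  have p0: "p 0 = (\<lambda>_. a)" and q0: "q 0 = (\<lambda>_. b)" and pS: "p (Suc n) = I (q n)"
    and qS: "q (Suc n) = I (\<lambda>x. V x * p n x)" for n
    by (auto simp: p_def q_def Z_def)
  have cont: "continuous_on UNIV (p n) \<and> continuous_on UNIV (q n)" for n
  proof (induction n)
    case 0 then show ?case by (simp add: p0 q0)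
  next
    case (Suc n)
    then have "continuous_on UNIV (\<lambda>x. V x * p n x)" by (intro continuous_intros cV) auto
    with Suc I[of "q n"] I[of "\<lambda>x. V x * p n x"] show ?case
      by (auto simp: pS qS continuous_on_eq_continuous_at intro: DERIV_isCont)
  qed
  have cVp: "continuous_on UNIV (\<lambda>x. V x * p n x)" for n
    using cont by (intro continuous_intros cV) auto
  have dp: "(p (Suc n) has_real_derivative q n x) (at x)" "p (Suc n) x0 = 0"
    and dq: "(q (Suc n) has_real_derivative V x * p n x) (at x)" "q (Suc n) x0 = 0" for n x
    using I[of "q n"] I[OF cVp] cont by (auto simp: pS qS)
  define L where "L = max 1 C"
  define A where "A = max \<bar>a\<bar> \<bar>b\<bar>"
  have L: "1 \<le> L" and A: "0 \<le> A" and CL: "C \<le> L" by (auto simp: L_def A_def)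
  have bd: "(\<forall>x. \<bar>p n x\<bar> \<le> A * L ^ n * \<bar>x - x0\<bar> ^ n / fact n) \<and>
            (\<forall>x. \<bar>q n x\<bar> \<le> A * L ^ n * \<bar>x - x0\<bar> ^ n / fact n)" for n
  proof (induction n)
    case 0 then show ?case by (auto simp: p0 q0 A_def)
  next
    case (Suc n)
    show ?case
    proof (intro conjI allI)
      fix x
      have "\<bar>p (Suc n) x\<bar> \<le> (A * L ^ n / fact n) * \<bar>x - x0\<bar> ^ Suc n / real (Suc n)"
        by (rule deriv_power_bound[OF dp]) (use Suc in \<open>auto simp: field_simps\<close>)
      also have "\<dots> \<le> A * L ^ Suc n * \<bar>x - x0\<bar> ^ Suc n / fact (Suc n)"
        by (rule power_abs_bound_step[OF A L]) auto
      finally show "\<bar>p (Suc n) x\<bar> \<le> A * L ^ Suc n * \<bar>x - x0\<bar> ^ Suc n / fact (Suc n)" .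
    next
      fix x
      have "\<bar>q (Suc n) x\<bar> \<le> (A * L ^ Suc n / fact n) * \<bar>x - x0\<bar> ^ Suc n / real (Suc n)"
      proof (rule deriv_power_bound[OF dq])
        fix x
        have "\<bar>V x * p n x\<bar> \<le> L * (A * L ^ n * \<bar>x - x0\<bar> ^ n / fact n)"
          unfolding abs_mult using Suc bV[of x] CL L by (intro mult_mono) auto
        then show "\<bar>V x * p n x\<bar> \<le> A * L ^ Suc n / fact n * \<bar>x - x0\<bar> ^ n"
          by (simp add: field_simps)
      qed
      also have "\<dots> = A * L ^ Suc n * \<bar>x - x0\<bar> ^ Suc n / fact (Suc n)"
        by (simp add: field_simps)
      finally show "\<bar>q (Suc n) x\<bar> \<le> A * L ^ Suc n * \<bar>x - x0\<bar> ^ Suc n / fact (Suc n)" .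
    qed
  qed
  have key: "summable (\<lambda>n. p n x) \<and> ((\<lambda>x. \<Sum>n. p n x) has_real_derivative (\<Sum>n. q n x)) (at x) \<and>
     ((\<lambda>x. \<Sum>n. q n x) has_real_derivative V x * (\<Sum>n. p n x)) (at x)" for x
  proof -
    define R where "R = \<bar>x - x0\<bar> + 1"
    define S where "S = {x0 - R..x0 + R}"
    have S: "convex S" "x0 \<in> S" "x \<in> interior S" and R: "0 \<le> R"
      by (auto simp: S_def R_def)
    have bS: "\<bar>p n t\<bar> \<le> A * ((L * R) ^ n / fact n)" "\<bar>q n t\<bar> \<le> A * ((L * R) ^ n / fact n)" if "t \<in> S" for n t
    proof -
      have "\<bar>t - x0\<bar> \<le> R" using that by (auto simp: S_def)
      then have "A * L ^ n * \<bar>t - x0\<bar> ^ n / fact n \<le> A * L ^ n * R ^ n / fact n"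
        using A L by (intro divide_right_mono mult_left_mono power_mono) auto
      then show "\<bar>p n t\<bar> \<le> A * ((L * R) ^ n / fact n)" "\<bar>q n t\<bar> \<le> A * ((L * R) ^ n / fact n)"
        using bd[of n] by (auto simp: power_mult_distrib field_simps intro: order_trans)
    qed
    have sumE: "summable (\<lambda>n. A * ((L * R) ^ n / fact n))"
      using summable_exp[of "L * R"] by (intro summable_mult) (simp add: field_simps)
    \<comment> \<open>Term n of one series differentiates into term n - 1 of the other (times V for
      \<open>q\<close>), hence the shift; at index 0 the terms are constant and the derivative is
      0.\<close>
    define p' where "p' n = (case n of 0 \<Rightarrow> (\<lambda>_. 0) | Suc k \<Rightarrow> q k)" for n
    define q' where "q' n = (case n of 0 \<Rightarrow> (\<lambda>_. 0) | Suc k \<Rightarrow> (\<lambda>x. V x * p k x))" for n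
    have dp': "(p n has_real_derivative p' n t) (at t within S)" for n t
      by (cases n) (auto simp: p'_def p0 intro: has_field_derivative_at_within[OF dp(1)])
    have dq': "(q n has_real_derivative q' n t) (at t within S)" for n t
      by (cases n) (auto simp: q'_def q0 intro: has_field_derivative_at_within[OF dq(1)])
    have M: "summable (\<lambda>n. case n of 0 \<Rightarrow> 0 | Suc k \<Rightarrow> L * (A * ((L * R) ^ k / fact k)))"
      by (subst summable_Suc_iff[symmetric]) (use summable_mult[OF sumE] in simp)
    have M1: "summable (\<lambda>n. case n of 0 \<Rightarrow> 0 | Suc k \<Rightarrow> A * ((L * R) ^ k / fact k))"
      by (subst summable_Suc_iff[symmetric]) (use sumE in simp)
    have up: "uniformly_convergent_on S (\<lambda>n x. \<Sum>i<n. p' i x)"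
      by (rule Weierstrass_m_test'[OF _ M1]) (use bS in \<open>auto simp: p'_def split: nat.split\<close>)
    have "norm (q' n t) \<le> (case n of 0 \<Rightarrow> 0 | Suc k \<Rightarrow> L * (A * ((L * R) ^ k / fact k)))" if "t \<in> S" for n t
    proof (cases n)
      case (Suc k)
      have "\<bar>V t * p k t\<bar> \<le> L * (A * ((L * R) ^ k / fact k))"
        unfolding abs_mult using bS(1)[OF that, of k] bV[of t] CL L by (intro mult_mono) auto
      then show ?thesis by (simp add: Suc q'_def)
    qed (simp add: q'_def)
    then have uq: "uniformly_convergent_on S (\<lambda>n x. \<Sum>i<n. q' i x)"
      by (intro Weierstrass_m_test'[OF _ M])
    have sp0: "summable (\<lambda>n. p n t)" "summable (\<lambda>n. q n t)" if "t \<in> S" for t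
      using bS[OF that] by (auto intro!: summable_comparison_test'[OF sumE, of 0])
    note Dp = has_field_derivative_series'[OF S(1) dp' up S(2) sp0(1)[OF S(2)] S(3)]
    note Dq = has_field_derivative_series'[OF S(1) dq' uq S(2) sp0(2)[OF S(2)] S(3)]
    have xS: "x \<in> S" using S(3) interior_subset by blast
    have "summable (\<lambda>n. p' (Suc n) x)" using sp0(2)[OF xS] by (simp add: p'_def)
    then have "summable (\<lambda>n. p' n x)" by (subst (asm) summable_Suc_iff)
    from suminf_split_head[OF this] have "(\<Sum>n. p' n x) = (\<Sum>n. q n x)"
      by (simp add: p'_def)
    moreover have "summable (\<lambda>n. q' (Suc n) x)" using summable_mult[OF sp0(1)[OF xS]] by (simp add: q'_def)
    then have "summable (\<lambda>n. q' n x)" by (subst (asm) summable_Suc_iff)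
    from suminf_split_head[OF this] have "(\<Sum>n. q' n x) = (\<Sum>n. V x * p n x)"
      by (simp add: q'_def)
    moreover have "(\<Sum>n. V x * p n x) = V x * (\<Sum>n. p n x)"
      by (intro suminf_mult sp0 xS)
    ultimately show ?thesis using Dp Dq by simp
  qed
  show ?thesis
  proof (rule that)
    show "sol V (\<lambda>x. \<Sum>n. p n x) (\<lambda>x. \<Sum>n. q n x)"
      using key by (simp add: sol_def)
    have "p n x0 = 0" "q n x0 = 0" if "n \<noteq> 0" for n
      using that dp(2) dq(2) by (cases n; auto)+
    then have "(\<Sum>n. p n x0) = (\<Sum>n\<in>{0}. p n x0)" "(\<Sum>n. q n x0) = (\<Sum>n\<in>{0}. q n x0)"
      by (intro suminf_finite; simp)+
    then show "(\<Sum>n. p n x0) = a" "(\<Sum>n. q n x0) = b"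
      by (simp_all add: p0 q0)
  qed
qed

section \<open>Gronwall estimates, uniqueness and the Wronskian\<close>

lemma gronwall:
  fixes n :: "real \<Rightarrow> real"
  assumes ab: "a \<le> b"
    and n: "\<And>x. \<lbrakk>a \<le> x; x \<le> b\<rbrakk> \<Longrightarrow> (n has_real_derivative n' x) (at x)"
    and n': "\<And>x. \<lbrakk>a \<le> x; x \<le> b\<rbrakk> \<Longrightarrow> n' x \<le> K * n x + m"
    and "0 \<le> K" "0 \<le> m"
  shows "n b \<le> exp (K * (b - a)) * (n a + m * (b - a))"
proof -
  \<comment> \<open>Integrating factor minus the accumulated source. The source may be counted with
    full weight \<open>m\<close>, since the exponential factor is at most 1.\<close>
  define g where "g x = exp (- K * (x - a)) * n x - m * (x - a)" for x
  have "g b \<le> g a"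
  proof (rule DERIV_nonpos_imp_nonincreasing[OF ab])
    fix x assume x: "a \<le> x" "x \<le> b"
    have "(g has_real_derivative exp (- K * (x - a)) * (n' x - K * n x) - m) (at x)"
      unfolding g_def by (auto intro!: derivative_eq_intros n x simp: algebra_simps)
    moreover have "exp (- K * (x - a)) * (n' x - K * n x) \<le> exp (- K * (x - a)) * m"
      using n'[OF x] by (intro mult_left_mono) auto
    moreover have "exp (- K * (x - a)) * m \<le> 1 * m"
      using \<open>0 \<le> K\<close> \<open>0 \<le> m\<close> x by (intro mult_right_mono) auto
    ultimately show "\<exists>y. (g has_real_derivative y) (at x) \<and> y \<le> 0"
      by (intro exI[of _ "exp (- K * (x - a)) * (n' x - K * n x) - m"] conjI) linarith+
  qed
  then have "exp (- K * (b - a)) * n b \<le> n a + m * (b - a)"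
    by (simp add: g_def)
  then have "exp (K * (b - a)) * (exp (- K * (b - a)) * n b) \<le> exp (K * (b - a)) * (n a + m * (b - a))"
    by (intro mult_left_mono) auto
  moreover have "exp (K * (b - a)) * (exp (- K * (b - a)) * n b) = n b"
    by (simp add: mult.assoc[symmetric] exp_add[symmetric])
  ultimately show ?thesis by metis
qed

text \<open>The free weight \<open>w\<close> comes from 2 d' s <= w d'^2 + s^2 / w. On an interval
  of length h the choice w = 1 / h keeps the exponential bounded and gains a factor h^2 in the
  source term; w = 1 serves for plain bounds.\<close>

lemma sol_source_bound:
  fixes d d' :: "real \<Rightarrow> real"
  assumes ab: "a \<le> b" and w: "0 < w"
    and d: "\<And>t. a \<le> t \<Longrightarrow> t \<le> b \<Longrightarrow> (d has_real_derivative d' t) (at t)"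
    and d': "\<And>t. a \<le> t \<Longrightarrow> t \<le> b \<Longrightarrow> (d' has_real_derivative (V t * d t + s t)) (at t)"
    and V: "\<And>t. a \<le> t \<Longrightarrow> t \<le> b \<Longrightarrow> \<bar>V t\<bar> \<le> C"
    and s: "\<And>t. a \<le> t \<Longrightarrow> t \<le> b \<Longrightarrow> \<bar>s t\<bar> \<le> \<sigma>"
  shows "(d b)\<^sup>2 + (d' b)\<^sup>2 \<le> exp ((1 + C + w) * (b - a)) * ((d a)\<^sup>2 + (d' a)\<^sup>2 + \<sigma>\<^sup>2 / w * (b - a))"
proof (rule gronwall[OF ab])
  show "((\<lambda>t. (d t)\<^sup>2 + (d' t)\<^sup>2) has_real_derivative
      (2 * d t * d' t * (1 + V t) + 2 * d' t * s t)) (at t)" if "a \<le> t" "t \<le> b" for t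
    by (rule derivative_eq_intros d[OF that] d'[OF that] refl)+ (simp add: algebra_simps)
  show "2 * d t * d' t * (1 + V t) + 2 * d' t * s t \<le> (1 + C + w) * ((d t)\<^sup>2 + (d' t)\<^sup>2) + \<sigma>\<^sup>2 / w"
    if t: "a \<le> t" "t \<le> b" for t
  proof -
    have "2 * d t * d' t * (1 + V t) \<le> \<bar>2 * d t * d' t\<bar> * \<bar>1 + V t\<bar>"
      by (metis abs_ge_self abs_mult)
    also have "\<dots> \<le> ((d t)\<^sup>2 + (d' t)\<^sup>2) * (1 + C)"
    proof (rule mult_mono)
      show "\<bar>2 * d t * d' t\<bar> \<le> (d t)\<^sup>2 + (d' t)\<^sup>2"
        using sum_squares_bound[of "\<bar>d t\<bar>" "\<bar>d' t\<bar>"] by (simp add: abs_mult)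
    qed (use V[OF t] in auto)
    finally have 1: "2 * d t * d' t * (1 + V t) \<le> ((d t)\<^sup>2 + (d' t)\<^sup>2) * (1 + C)" .
    have "0 \<le> (w * d' t - s t)\<^sup>2 / w" using w by simp
    also have "(w * d' t - s t)\<^sup>2 / w = w * (d' t)\<^sup>2 - 2 * d' t * s t + (s t)\<^sup>2 / w"
      using w by (simp add: power2_eq_square field_simps)
    also have "\<dots> \<le> w * (d' t)\<^sup>2 - 2 * d' t * s t + \<sigma>\<^sup>2 / w"
      using s[OF t] w by (intro add_left_mono divide_right_mono) (auto simp: abs_le_square_iff[symmetric])
    finally have 2: "2 * d' t * s t \<le> w * (d' t)\<^sup>2 + \<sigma>\<^sup>2 / w" by linarith
    have "0 \<le> w * (d t)\<^sup>2" using w by simp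
    with 1 2 show ?thesis by (simp add: algebra_simps)
  qed
  show "0 \<le> 1 + C + w" using V[of a] ab w by force
  show "0 \<le> \<sigma>\<^sup>2 / w" using w by simp
qed

lemma sol_bound:
  assumes s: "sol V v v'" and ab: "a \<le> b" and V: "\<And>t. \<bar>V t\<bar> \<le> C"
  shows "(v b)\<^sup>2 + (v' b)\<^sup>2 \<le> exp ((2 + C) * (b - a)) * ((v a)\<^sup>2 + (v' a)\<^sup>2)"
  using sol_source_bound[OF ab, of 1 v v' V "\<lambda>_. 0" C 0] s V by (simp add: sol_def)

lemma sol_lincomb:
  assumes "sol V v v'" "sol V w w'"
  shows "sol V (\<lambda>t. a * v t + b * w t) (\<lambda>t. a * v' t + b * w' t)"
  using assms unfolding sol_def
  by (auto intro!: derivative_eq_intros simp: algebra_simps)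

text \<open>Uniqueness for two potentials that agree on [a, b] only: perturbations are glued
  interval by interval, while \<open>sol\<close> refers to the whole line.\<close>

lemma sol_eq:
  assumes v: "sol V v v'" and w: "sol W w w'" and ab: "a \<le> b" and V: "\<And>t. \<bar>V t\<bar> \<le> C"
    and VW: "\<And>t. a \<le> t \<Longrightarrow> t \<le> b \<Longrightarrow> V t = W t"
    and init: "v a = w a" "v' a = w' a"
  shows "v b = w b" "v' b = w' b"
proof -
  have "(v b - w b)\<^sup>2 + (v' b - w' b)\<^sup>2 \<le> exp ((1 + C + 1) * (b - a)) * ((v a - w a)\<^sup>2 + (v' a - w' a)\<^sup>2 + 0\<^sup>2 / 1 * (b - a))"
  proof (rule sol_source_bound[OF ab, where V = V and s = "\<lambda>_. 0"])
    fix t assume t: "a \<le> t" "t \<le> b"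
    show "((\<lambda>t. v t - w t) has_real_derivative v' t - w' t) (at t)"
      using v w by (auto simp: sol_def intro!: derivative_intros)
    have "((\<lambda>t. v' t - w' t) has_real_derivative V t * v t - W t * w t) (at t)"
      using v w by (intro derivative_intros) (auto simp: sol_def)
    then show "((\<lambda>t. v' t - w' t) has_real_derivative V t * (v t - w t) + 0) (at t)"
      by (simp add: VW[OF t] algebra_simps)
  qed (use V in auto)
  then have "(v b - w b)\<^sup>2 + (v' b - w' b)\<^sup>2 \<le> 0" using init by simp
  then show "v b = w b" "v' b = w' b"
    by (auto simp: sum_power2_le_zero_iff)
qed

lemma sol_wronskian:
  assumes v: "sol V v v'" and w: "sol V w w'"
  shows "v b * w' b - v' b * w b = v a * w' a - v' a * w a"
proof -
  have "((\<lambda>t. v t * w' t - v' t * w t) has_real_derivative 0) (at t)" for t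
    using v w unfolding sol_def by (auto intro!: derivative_eq_intros simp: algebra_simps)
  from DERIV_isconst_all[of "\<lambda>t. v t * w' t - v' t * w t"] this show ?thesis by blast
qed


section \<open>Growth of solutions under small perturbations\<close>

text \<open>A parabolic arch of height \<open>\<epsilon>\<close> over [x, x + h], cut off at 0.
  Continuity is all that is asked of it, and its integral 2/3 \<epsilon> h is explicit; twice that
  value is the 4/3 of the perturbation estimates.\<close>

definition bump :: "real \<Rightarrow> real \<Rightarrow> real \<Rightarrow> real \<Rightarrow> real" where
  "bump \<epsilon> x h t = \<epsilon> * max 0 (4 * (t - x) * (x + h - t) / h\<^sup>2)"

text \<open>Vanishing at the end points too allows perturbations on adjacent intervals to be added
  without losing continuity or the bound \<open>\<epsilon>\<close>.\<close>

definition adm :: "real \<Rightarrow> real \<Rightarrow> real \<Rightarrow> (real \<Rightarrow> real) \<Rightarrow> bool" where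
  "adm \<epsilon> x y W \<longleftrightarrow> continuous_on UNIV W \<and> (\<forall>t. \<bar>W t\<bar> \<le> \<epsilon>) \<and> (\<forall>t. t \<le> x \<or> y \<le> t \<longrightarrow> W t = 0)"

lemma adm_add:
  assumes "adm \<epsilon> x y W" "adm \<epsilon> y z W'" "x \<le> y" "y \<le> z"
  shows "adm \<epsilon> x z (\<lambda>t. W t + W' t)"
  unfolding adm_def
proof (intro conjI allI impI)
  show "continuous_on UNIV (\<lambda>t. W t + W' t)"
    using assms by (auto simp: adm_def intro!: continuous_intros)
  fix t
  have "W t = 0 \<or> W' t = 0" using assms by (cases "t \<le> y") (auto simp: adm_def)
  then show "\<bar>W t + W' t\<bar> \<le> \<epsilon>" using assms by (auto simp: adm_def)
  assume "t \<le> x \<or> z \<le> t"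
  then show "W t + W' t = 0" using assms by (auto simp: adm_def)
qed

lemma adm_zero: "0 \<le> \<epsilon> \<Longrightarrow> adm \<epsilon> x y (\<lambda>_. 0)"
  by (auto simp: adm_def)

lemma bump_bounds:
  assumes "0 < h" "0 \<le> \<epsilon>"
  shows "0 \<le> bump \<epsilon> x h t" "bump \<epsilon> x h t \<le> \<epsilon>"
proof -
  show "0 \<le> bump \<epsilon> x h t" using assms by (simp add: bump_def)
  have "0 \<le> (2 * (t - x) - h)\<^sup>2" by simp
  then have "4 * (t - x) * (x + h - t) \<le> h\<^sup>2" by (simp add: power2_eq_square algebra_simps)
  then have "4 * (t - x) * (x + h - t) / h\<^sup>2 \<le> 1" using assms by simp
  then have "max 0 (4 * (t - x) * (x + h - t) / h\<^sup>2) \<le> 1" by simp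
  then show "bump \<epsilon> x h t \<le> \<epsilon>"
    unfolding bump_def using mult_left_mono[of _ 1 \<epsilon>] assms(2) by simp
qed

lemma bump_adm:
  assumes h: "0 < h" and \<epsilon>: "0 \<le> \<epsilon>" and \<sigma>: "\<sigma> = 1 \<or> \<sigma> = -1"
  shows "adm \<epsilon> x (x + h) (\<lambda>t. \<sigma> * bump \<epsilon> x h t)"
  unfolding adm_def
proof (intro conjI allI impI)
  show "continuous_on UNIV (\<lambda>t. \<sigma> * bump \<epsilon> x h t)"
    unfolding bump_def using h by (intro continuous_intros) auto
  fix t
  show "\<bar>\<sigma> * bump \<epsilon> x h t\<bar> \<le> \<epsilon>"
    using bump_bounds[OF h \<epsilon>, of x t] \<sigma> by auto
  assume "t \<le> x \<or> x + h \<le> t"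
  then have "4 * (t - x) * (x + h - t) \<le> 0"
    using h by (auto simp: mult_le_0_iff)
  then have "4 * (t - x) * (x + h - t) / h\<^sup>2 \<le> 0" using h by (simp add: divide_le_0_iff)
  then show "\<sigma> * bump \<epsilon> x h t = 0" by (simp add: bump_def max_def)
qed

lemma bump_eq:
  assumes "0 < h" "x \<le> t" "t \<le> x + h"
  shows "bump \<epsilon> x h t = \<epsilon> * (4 * (t - x) * (x + h - t) / h\<^sup>2)"
  using assms by (simp add: bump_def)

lemma real_deriv_bound:
  fixes f :: "real \<Rightarrow> real"
  assumes "a \<le> b" "\<And>t. a \<le> t \<Longrightarrow> t \<le> b \<Longrightarrow> (f has_real_derivative f' t) (at t)"
    and "\<And>t. a \<le> t \<Longrightarrow> t \<le> b \<Longrightarrow> \<bar>f' t\<bar> \<le> m"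
  shows "\<bar>f b - f a\<bar> \<le> m * (b - a)"
proof (cases "a = b")
  case False
  with assms(1) have "a < b" by simp
  from MVT2[OF this assms(2)] obtain z where z: "z > a" "z < b" "f b - f a = (b - a) * f' z" by auto
  then have "\<bar>f b - f a\<bar> = (b - a) * \<bar>f' z\<bar>" using \<open>a < b\<close> by (simp add: abs_mult)
  also have "\<dots> \<le> (b - a) * m" using assms(3)[of z] z \<open>a < b\<close> by (intro mult_left_mono) auto
  finally show ?thesis by (simp add: mult.commute)
qed simp

lemma square_bound_abs:
  fixes a b m :: real
  assumes "a\<^sup>2 + b\<^sup>2 \<le> m\<^sup>2" "0 \<le> m"
  shows "\<bar>a\<bar> \<le> m" "\<bar>b\<bar> \<le> m"
proof -
  have "a\<^sup>2 \<le> m\<^sup>2" "b\<^sup>2 \<le> m\<^sup>2"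
    using assms(1) zero_le_power2[of a] zero_le_power2[of b] by linarith+
  then show "\<bar>a\<bar> \<le> m" "\<bar>b\<bar> \<le> m" using abs_le_square_iff[of _ m] assms(2) by auto
qed

text \<open>The difference D of the two solutions satisfies D'' = u D + bump (p + q), where p + q is
  close to 2 \<alpha>. So D' at the end is 2 \<alpha> times the integral of the bump up to an error
  of order \<epsilon> h^2, and D itself is of that order. \<open>K\<close> is one generous constant
  for all six estimates.\<close>

lemma bump_perturbation:
  fixes u :: "real \<Rightarrow> real"
  assumes u: "\<And>t. \<bar>u t\<bar> \<le> C" and h: "0 < h" "h \<le> 1" and \<epsilon>: "0 < \<epsilon>" "\<epsilon> \<le> 1"
    and s1: "sol (\<lambda>t. u t + 1 * bump \<epsilon> x h t) p p'" and s2: "sol (\<lambda>t. u t + (-1) * bump \<epsilon> x h t) q q'"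
    and init: "p x = \<alpha>" "q x = \<alpha>" "p' x = \<beta>" "q' x = \<beta>" and ab: "\<alpha>\<^sup>2 + \<beta>\<^sup>2 = 1"
    and K: "K = 20 * (C + 1) * exp (2 * C + 6)"
  shows "\<bar>p (x + h) - \<alpha>\<bar> \<le> K * h" "\<bar>p' (x + h) - \<beta>\<bar> \<le> K * h"
    "\<bar>q (x + h) - \<alpha>\<bar> \<le> K * h" "\<bar>q' (x + h) - \<beta>\<bar> \<le> K * h"
    "\<bar>p (x + h) - q (x + h)\<bar> \<le> K * h * (\<epsilon> * h)"
    "\<bar>p' (x + h) - q' (x + h) - 4 / 3 * \<epsilon> * h * \<alpha>\<bar> \<le> K * h * (\<epsilon> * h)"
proof -
  define M where "M = exp (C + 3)"
  have C0: "0 \<le> C" using u[of 0] by linarith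
  have M1: "1 \<le> M" using C0 by (simp add: M_def)
  have MM: "M * M = exp (2 * C + 6)" by (simp add: M_def exp_add[symmetric])
  have K': "K = 20 * (C + 1) * (M * M)" by (simp add: K MM)
  have MMM: "M \<le> M * M" using M1 by simp
  have B: "0 \<le> bump \<epsilon> x h t" "bump \<epsilon> x h t \<le> \<epsilon>" for t using bump_bounds[of h \<epsilon>] h \<epsilon> by auto
  have V1: "\<bar>u t + 1 * bump \<epsilon> x h t\<bar> \<le> C + 1" and V2: "\<bar>u t + (-1) * bump \<epsilon> x h t\<bar> \<le> C + 1" for t
    using B[of t] u[of t] \<epsilon> by auto
  have bnd: "\<bar>f t\<bar> \<le> M \<and> \<bar>f' t\<bar> \<le> M"
    if f: "sol V f f'" and V: "\<And>t. \<bar>V t\<bar> \<le> C + 1" and i: "f x = \<alpha>" "f' x = \<beta>" and t: "x \<le> t" "t \<le> x + h" for f f' V t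
  proof -
    have "(f t)\<^sup>2 + (f' t)\<^sup>2 \<le> exp ((2 + (C + 1)) * (t - x))"
      using sol_bound[OF f t(1) V] i ab by simp
    also have "\<dots> \<le> exp ((C + 3) * 1)"
      using t h C0 by (subst exp_le_cancel_iff, intro mult_mono) auto
    also have "\<dots> \<le> M\<^sup>2" using M1 MMM by (simp add: M_def power2_eq_square)
    finally show ?thesis using square_bound_abs[of "f t" "f' t" M] M1 by auto
  qed
  note bp = bnd[OF s1 V1 init(1,3)] and bq = bnd[OF s2 V2 init(2,4)]
  have dev: "\<bar>f t - \<alpha>\<bar> \<le> M * h \<and> \<bar>f' t - \<beta>\<bar> \<le> (C + 1) * M * h"
    if f: "sol V f f'" and V: "\<And>t. \<bar>V t\<bar> \<le> C + 1" and i: "f x = \<alpha>" "f' x = \<beta>" and t: "x \<le> t" "t \<le> x + h" for f f' V t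
  proof
    have "\<bar>f t - f x\<bar> \<le> M * (t - x)"
      by (rule real_deriv_bound[OF t(1), of f f']) (use f bnd[OF f V i] t in \<open>auto simp: sol_def\<close>)
    also have "\<dots> \<le> M * h" using M1 t by (intro mult_left_mono) auto
    finally show "\<bar>f t - \<alpha>\<bar> \<le> M * h" using i by simp
    have "\<bar>f' t - f' x\<bar> \<le> ((C + 1) * M) * (t - x)"
    proof (rule real_deriv_bound[OF t(1)])
      fix z assume z: "x \<le> z" "z \<le> t"
      show "(f' has_real_derivative V z * f z) (at z)" using f by (auto simp: sol_def)
      show "\<bar>V z * f z\<bar> \<le> (C + 1) * M"
        unfolding abs_mult using V[of z] bnd[OF f V i, of z] z t C0 by (intro mult_mono) auto
    qed
    also have "\<dots> \<le> (C + 1) * M * h" using M1 C0 t by (intro mult_left_mono) auto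
    finally show "\<bar>f' t - \<beta>\<bar> \<le> (C + 1) * M * h" using i by simp
  qed
  note dp = dev[OF s1 V1 init(1,3)] and dq = dev[OF s2 V2 init(2,4)]
  have xh: "x \<le> x + h" "x + h \<le> x + h" using h by auto
  have MK: "M \<le> K" "(C + 1) * M \<le> K"
  proof -
    have "1 * M \<le> 20 * (C + 1) * (M * M)" by (intro mult_mono) (use C0 M1 MMM in auto)
    then show "M \<le> K" by (simp add: K')
    have "(C + 1) * M \<le> (20 * (C + 1)) * (M * M)" by (intro mult_mono) (use C0 M1 MMM in auto)
    then show "(C + 1) * M \<le> K" by (simp add: K')
  qed
  have Kh: "M * h \<le> K * h" "(C + 1) * M * h \<le> K * h" using MK h by (auto intro: mult_right_mono)
  show "\<bar>p (x + h) - \<alpha>\<bar> \<le> K * h" "\<bar>p' (x + h) - \<beta>\<bar> \<le> K * h"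
    "\<bar>q (x + h) - \<alpha>\<bar> \<le> K * h" "\<bar>q' (x + h) - \<beta>\<bar> \<le> K * h"
    using dp[OF xh] dq[OF xh] Kh by auto
  define D where "D t = p t - q t" for t
  define D' where "D' t = p' t - q' t" for t
  have dD: "(D has_real_derivative D' t) (at t)" for t
    unfolding D_def D'_def using s1 s2 by (auto simp: sol_def intro!: derivative_intros)
  have dD': "(D' has_real_derivative u t * D t + bump \<epsilon> x h t * (p t + q t)) (at t)" for t
  proof -
    have "(D' has_real_derivative (u t + 1 * bump \<epsilon> x h t) * p t - (u t + (-1) * bump \<epsilon> x h t) * q t) (at t)"
      unfolding D'_def using s1 s2 by (intro derivative_intros) (auto simp: sol_def)
    then show ?thesis by (simp add: D_def algebra_simps)
  qed
  have bD: "\<bar>D t\<bar> \<le> 2 * M * M * (\<epsilon> * h) \<and> \<bar>D' t\<bar> \<le> 2 * M * M * (\<epsilon> * h)" if t: "x \<le> t" "t \<le> x + h" for t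
  proof -
    \<comment> \<open>Weight 1 / h: over a length of at most h the exponential stays below
      \<open>M\<close>, and the squared source is multiplied by h^2.\<close>
    have "(D t)\<^sup>2 + (D' t)\<^sup>2 \<le> exp ((1 + C + 1 / h) * (t - x)) * ((D x)\<^sup>2 + (D' x)\<^sup>2 + (2 * \<epsilon> * M)\<^sup>2 / (1 / h) * (t - x))"
    proof (rule sol_source_bound[OF t(1)])
      fix z assume z: "x \<le> z" "z \<le> t"
      then have "\<bar>p z + q z\<bar> \<le> 2 * M" using bp[of z] bq[of z] t by linarith
      then have "\<bar>bump \<epsilon> x h z * (p z + q z)\<bar> \<le> \<epsilon> * (2 * M)"
        unfolding abs_mult using B[of z] by (intro mult_mono) auto
      then show "\<bar>bump \<epsilon> x h z * (p z + q z)\<bar> \<le> 2 * \<epsilon> * M" by simp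
    qed (use dD dD' u h in auto)
    also have "\<dots> = exp ((1 + C + 1 / h) * (t - x)) * ((2 * \<epsilon> * M)\<^sup>2 * h * (t - x))"
      using init by (simp add: D_def D'_def)
    also have "\<dots> \<le> M * ((2 * \<epsilon> * M)\<^sup>2 * h * h)"
    proof (rule mult_mono)
      have "(1 + C + 1 / h) * (t - x) \<le> (1 + C + 1 / h) * h"
        using t h C0 by (intro mult_left_mono) auto
      also have "\<dots> = (1 + C) * h + 1" using h by (simp add: field_simps)
      also have "\<dots> \<le> (1 + C) * 1 + 1" using h C0 by (intro add_right_mono mult_left_mono) auto
      finally show "exp ((1 + C + 1 / h) * (t - x)) \<le> M" unfolding M_def by simp
    qed (use t h M1 in \<open>auto intro!: mult_left_mono\<close>)
    also have "\<dots> \<le> M * M * ((2 * \<epsilon> * M)\<^sup>2 * h * h)"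
      using M1 h by (intro mult_right_mono MMM) auto
    also have "\<dots> = (2 * M * M * (\<epsilon> * h))\<^sup>2" by (simp add: power2_eq_square)
    finally show ?thesis
      using square_bound_abs[of "D t" "D' t" "2 * M * M * (\<epsilon> * h)"] M1 h \<epsilon> by auto
  qed
  have "\<bar>D (x + h) - D x\<bar> \<le> (2 * M * M * (\<epsilon> * h)) * (x + h - x)"
    by (rule real_deriv_bound[OF xh(1) dD]) (use bD in auto)
  then have "\<bar>D (x + h)\<bar> \<le> (2 * M * M) * (h * (\<epsilon> * h))" using init by (simp add: D_def mult_ac)
  also have "\<dots> \<le> K * (h * (\<epsilon> * h))"
  proof (rule mult_right_mono)
    have "2 * (M * M) \<le> (20 * (C + 1)) * (M * M)"
      by (intro mult_right_mono) (use C0 in auto)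
    then show "2 * M * M \<le> K" by (simp add: K' mult.assoc)
  qed (use h \<epsilon> in auto)
  finally show "\<bar>p (x + h) - q (x + h)\<bar> \<le> K * h * (\<epsilon> * h)" by (simp add: D_def mult.assoc)
  \<comment> \<open>\<open>P\<close> is the integral of the bump from x, with P (x + h) = 2/3
    \<epsilon> h. Subtracting \<open>2 * \<alpha> * P\<close> from D' removes the main term and
    leaves \<open>Q\<close>, whose derivative is of order \<epsilon> h.\<close>
  define P where "P t = \<epsilon> * (4 / h\<^sup>2) * (h * (t - x)\<^sup>2 / 2 - (t - x) ^ 3 / 3)" for t
  define Q where "Q t = D' t - 2 * \<alpha> * P t" for t
  have dP: "(P has_real_derivative \<epsilon> * (4 * (t - x) * (x + h - t) / h\<^sup>2)) (at t)" for t
  proof -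
    have "((\<lambda>t. h * (t - x)\<^sup>2 / 2 - (t - x) ^ 3 / 3) has_real_derivative (h * (t - x) - (t - x)\<^sup>2)) (at t)"
      by (auto intro!: derivative_eq_intros)
    then have "(P has_real_derivative \<epsilon> * (4 / h\<^sup>2) * (h * (t - x) - (t - x)\<^sup>2)) (at t)"
      unfolding P_def by (rule DERIV_cmult)
    moreover have "h * (t - x) - (t - x)\<^sup>2 = (t - x) * (x + h - t)"
      by (simp add: power2_eq_square algebra_simps)
    moreover have "\<epsilon> * (4 / h\<^sup>2) * ((t - x) * (x + h - t)) = \<epsilon> * (4 * (t - x) * (x + h - t) / h\<^sup>2)"
      by (simp only: times_divide_eq_right times_divide_eq_left ac_simps)
    ultimately show ?thesis by metis
  qed
  have dQ: "(Q has_real_derivative u t * D t + bump \<epsilon> x h t * (p t + q t - 2 * \<alpha>)) (at t)"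
    if "x \<le> t" "t \<le> x + h" for t
  proof -
    have "(P has_real_derivative bump \<epsilon> x h t) (at t)"
      unfolding bump_eq[OF h(1) that] by (rule dP)
    then have "(Q has_real_derivative (u t * D t + bump \<epsilon> x h t * (p t + q t)) - 2 * \<alpha> * bump \<epsilon> x h t) (at t)"
      unfolding Q_def by (intro derivative_intros dD' DERIV_cmult)
    then show ?thesis by (simp add: algebra_simps)
  qed
  have dQb: "\<bar>Q (x + h) - Q x\<bar> \<le> (C * (2 * M * M * (\<epsilon> * h)) + \<epsilon> * (2 * M * h)) * (x + h - x)"
  proof (rule real_deriv_bound[OF xh(1) dQ])
    fix t assume t: "x \<le> t" "t \<le> x + h"
    have "\<bar>u t * D t\<bar> \<le> C * (2 * M * M * (\<epsilon> * h))"
      unfolding abs_mult using u[of t] bD[OF t] C0 by (intro mult_mono) auto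
    moreover have "\<bar>p t + q t - 2 * \<alpha>\<bar> \<le> 2 * M * h" using dp[OF t] dq[OF t] by linarith
    then have "\<bar>bump \<epsilon> x h t * (p t + q t - 2 * \<alpha>)\<bar> \<le> \<epsilon> * (2 * M * h)"
      unfolding abs_mult using B[of t] \<epsilon> by (intro mult_mono) auto
    ultimately show "\<bar>u t * D t + bump \<epsilon> x h t * (p t + q t - 2 * \<alpha>)\<bar> \<le> C * (2 * M * M * (\<epsilon> * h)) + \<epsilon> * (2 * M * h)"
      by linarith
  qed
  have Qx: "Q x = 0" using init by (simp add: Q_def D'_def P_def)
  have Pxh: "P (x + h) = 2 / 3 * \<epsilon> * h" using h by (simp add: P_def power2_eq_square power3_eq_cube field_simps)
  have "\<bar>D' (x + h) - 4 / 3 * \<epsilon> * h * \<alpha>\<bar> \<le> (C * (2 * M * M * (\<epsilon> * h)) + \<epsilon> * (2 * M * h)) * h"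
  proof -
    have "D' (x + h) - 4 / 3 * \<epsilon> * h * \<alpha> = Q (x + h) - Q x"
      unfolding Qx by (simp add: Q_def Pxh)
    then show ?thesis using dQb by simp
  qed
  then have "\<bar>D' (x + h) - 4 / 3 * \<epsilon> * h * \<alpha>\<bar> \<le> (2 * C * (M * M) + 2 * M) * (h * (\<epsilon> * h))"
    by (simp only: algebra_simps)
  also have "\<dots> \<le> K * (h * (\<epsilon> * h))"
  proof (rule mult_right_mono)
    have "2 * C * (M * M) + 2 * M \<le> 2 * C * (M * M) + 2 * (M * M)" using MMM by simp
    also have "\<dots> = (2 * (C + 1)) * (M * M)" by (simp add: algebra_simps)
    also have "\<dots> \<le> (20 * (C + 1)) * (M * M)" by (intro mult_right_mono) (use C0 in auto)
    finally show "2 * C * (M * M) + 2 * M \<le> K" by (simp add: K')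
  qed (use h \<epsilon> in auto)
  finally show "\<bar>p' (x + h) - q' (x + h) - 4 / 3 * \<epsilon> * h * \<alpha>\<bar> \<le> K * h * (\<epsilon> * h)"
    by (simp add: D'_def mult.assoc)
qed

text \<open>The forms obtained from a perturbation and from its negative have an average of strictly larger
  determinant, because the two propagators differ to first order in the entry \<open>k\<close>.\<close>

lemma average_det_gain:
  fixes p q r :: real
  defines "f c s \<equiv> p * c\<^sup>2 + 2 * q * (c * s) + r * s\<^sup>2"
  defines "g c c' s s' \<equiv> p * (c * c') + q * (c * s' + s * c') + r * (s * s')"
  assumes p: "0 < p0" "p0 \<le> p" and r: "0 \<le> r" and q: "q\<^sup>2 \<le> p * r" and pr: "p + r < 4"
    and \<eta>: "0 \<le> \<eta>" "\<eta> \<le> p0\<^sup>2 / 40000" and k: "0 \<le> k"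
    and c1: "\<bar>c1 - 1\<bar> \<le> \<eta>" "\<bar>c1'\<bar> \<le> \<eta>" "\<bar>s1\<bar> \<le> \<eta>" "\<bar>s1' - 1\<bar> \<le> \<eta>" "c1 * s1' - s1 * c1' = 1"
    and c2: "\<bar>c2 - 1\<bar> \<le> \<eta>" "\<bar>c2'\<bar> \<le> \<eta>" "\<bar>s2\<bar> \<le> \<eta>" "\<bar>s2' - 1\<bar> \<le> \<eta>" "c2 * s2' - s2 * c2' = 1"
    and d: "\<bar>c1 - c2\<bar> \<le> \<eta> * k" "\<bar>s1 - s2\<bar> \<le> \<eta> * k" "\<bar>c1' - c2' - k\<bar> \<le> \<eta> * k" "\<bar>s1' - s2'\<bar> \<le> \<eta> * k"
  shows "0 \<le> (f c1 s1 + f c2 s2) / 2" "0 \<le> (f c1' s1' + f c2' s2') / 2"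
    "p * r - q\<^sup>2 + k\<^sup>2 * p0\<^sup>2 / 8 \<le>
      (f c1 s1 + f c2 s2) / 2 * ((f c1' s1' + f c2' s2') / 2) - ((g c1 c1' s1 s1' + g c2 c2' s2 s2') / 2)\<^sup>2"
proof -
  have p4: "p0 < 4" "p < 4" "r < 4" using p r pr by linarith+
  have f0: "0 \<le> f c s" for c s
  proof -
    have "0 \<le> (p * c + q * s)\<^sup>2 + (p * r - q\<^sup>2) * s\<^sup>2" using q by simp
    also have "\<dots> = p * f c s" by (simp add: f_def power2_eq_square algebra_simps)
    finally show ?thesis using p by (simp add: zero_le_mult_iff)
  qed
  show "0 \<le> (f c1 s1 + f c2 s2) / 2" "0 \<le> (f c1' s1' + f c2' s2') / 2"
    using f0[of c1 s1] f0[of c2 s2] f0[of c1' s1'] f0[of c2' s2'] by auto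
  have q2: "\<bar>q\<bar> \<le> 2"
  proof -
    have "0 \<le> (p - r)\<^sup>2" by simp
    then have "4 * (p * r) \<le> (p + r)\<^sup>2" by (simp add: power2_eq_square algebra_simps)
    also have "\<dots> \<le> 4\<^sup>2" using p r pr by (intro power_mono) auto
    finally have "q\<^sup>2 \<le> 2\<^sup>2" using q by simp
    then show ?thesis using abs_le_square_iff[of q 2] by simp
  qed
  have "p0\<^sup>2 \<le> 4 * p0" using p p4 by (simp add: power2_eq_square)
  then have \<eta>p: "\<eta> \<le> p0 / 10000" and \<eta>1: "\<eta> \<le> 1 / 2" using \<eta> p4 by auto
  have nk: "\<eta> * k \<le> k" using \<eta>1 k by (simp add: mult_left_le_one_le \<eta>)
  have nk0: "0 \<le> \<eta> * k" using \<eta> k by simp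
  have m: "\<bar>a * b\<bar> \<le> A * B" if "\<bar>a\<bar> \<le> A" "\<bar>b\<bar> \<le> B" for a b A B :: real
    unfolding abs_mult using that by (intro mult_mono) auto
  have near1: "\<bar>x\<bar> \<le> 3/2" if "\<bar>x - 1\<bar> \<le> \<eta>" for x using that \<eta>1 by linarith
  have near0: "\<bar>x\<bar> \<le> 1" if "\<bar>x\<bar> \<le> \<eta>" for x using that \<eta>1 by linarith
  note b1 = near1[OF c1(1)] near0[OF c1(3)] near0[OF c1(2)] near1[OF c1(4)]
    and b2 = near1[OF c2(1)] near0[OF c2(3)] near0[OF c2(2)] near1[OF c2(4)]
  have dc: "\<bar>c1' - c2'\<bar> \<le> 2 * k" using d(3) nk k by linarith
  \<comment> \<open>Differences of the entries of the two forms. Only the off-diagonal one,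
    \<open>dq\<close>, has a main term, namely p * k; \<open>dp\<close> is of order \<eta> * k and
    \<open>dr\<close> of order k, so that dp * dr is small against dq^2.\<close>
  define dp where "dp = f c1 s1 - f c2 s2"
  define dq where "dq = g c1 c1' s1 s1' - g c2 c2' s2 s2'"
  define dr where "dr = f c1' s1' - f c2' s2'"
  have tri: "\<bar>a + b\<bar> \<le> A + B" if "\<bar>a\<bar> \<le> A" "\<bar>b\<bar> \<le> B" for a b A B :: real
    using that abs_triangle_ineq[of a b] by linarith
  have b3: "\<bar>c1 + c2\<bar> \<le> 3" "\<bar>s1 + s2\<bar> \<le> 2" "\<bar>c1' + c2'\<bar> \<le> 2" "\<bar>s1' + s2'\<bar> \<le> 3"
    using tri[OF b1(1) b2(1)] tri[OF b1(2) b2(2)] tri[OF b1(3) b2(3)] tri[OF b1(4) b2(4)] by simp_all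
  have eA: "\<bar>c1\<^sup>2 - c2\<^sup>2\<bar> \<le> 3 * (\<eta> * k)"
  proof -
    have "c1\<^sup>2 - c2\<^sup>2 = (c1 - c2) * (c1 + c2)" by (simp add: power2_eq_square algebra_simps)
    moreover have "\<bar>(c1 - c2) * (c1 + c2)\<bar> \<le> (\<eta> * k) * 3" by (intro m d b3)
    ultimately show ?thesis by (simp only: mult.commute[of 3])
  qed
  have eB: "\<bar>c1 * s1 - c2 * s2\<bar> \<le> 3 * (\<eta> * k)"
  proof -
    have "c1 * s1 - c2 * s2 = (c1 - c2) * s1 + c2 * (s1 - s2)" by (simp add: algebra_simps)
    moreover have "\<bar>(c1 - c2) * s1\<bar> \<le> (\<eta> * k) * 1" "\<bar>c2 * (s1 - s2)\<bar> \<le> (3/2) * (\<eta> * k)" by (intro m d b1 b2)+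
    ultimately show ?thesis using nk0 by linarith
  qed
  have eC: "\<bar>s1\<^sup>2 - s2\<^sup>2\<bar> \<le> 2 * (\<eta> * k)"
  proof -
    have "s1\<^sup>2 - s2\<^sup>2 = (s1 - s2) * (s1 + s2)" by (simp add: power2_eq_square algebra_simps)
    moreover have "\<bar>(s1 - s2) * (s1 + s2)\<bar> \<le> (\<eta> * k) * 2" by (intro m d b3)
    ultimately show ?thesis by (simp only: mult.commute[of 2])
  qed
  have "dp = p * (c1\<^sup>2 - c2\<^sup>2) + 2 * q * (c1 * s1 - c2 * s2) + r * (s1\<^sup>2 - s2\<^sup>2)"
    by (simp add: dp_def f_def algebra_simps)
  moreover have "\<bar>p * (c1\<^sup>2 - c2\<^sup>2)\<bar> \<le> 4 * (3 * (\<eta> * k))" "\<bar>2 * q * (c1 * s1 - c2 * s2)\<bar> \<le> 4 * (3 * (\<eta> * k))"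
    "\<bar>r * (s1\<^sup>2 - s2\<^sup>2)\<bar> \<le> 4 * (2 * (\<eta> * k))"
    using p p4 r q2 by (intro m eA eB eC; simp)+
  ultimately have dp: "\<bar>dp\<bar> \<le> 32 * (\<eta> * k)" by linarith
  have eE: "\<bar>c1 * c1' - c2 * c2' - k\<bar> \<le> 4 * (\<eta> * k)"
  proof -
    have "c1 * c1' - c2 * c2' - k = (c1 - c2) * c1' + (c2 - 1) * (c1' - c2') + (c1' - c2' - k)"
      by (simp add: algebra_simps)
    moreover have "\<bar>(c1 - c2) * c1'\<bar> \<le> (\<eta> * k) * 1" "\<bar>(c2 - 1) * (c1' - c2')\<bar> \<le> \<eta> * (2 * k)"
      by (intro m d b1 c2 dc)+
    ultimately show ?thesis using d(3) by linarith
  qed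
  have eF: "\<bar>(c1 * s1' + s1 * c1') - (c2 * s2' + s2 * c2')\<bar> \<le> 7 * (\<eta> * k)"
  proof -
    have "(c1 * s1' + s1 * c1') - (c2 * s2' + s2 * c2') = (c1 - c2) * s1' + c2 * (s1' - s2') + ((s1 - s2) * c1' + s2 * (c1' - c2'))"
      by (simp add: algebra_simps)
    moreover have "\<bar>(c1 - c2) * s1'\<bar> \<le> (\<eta> * k) * (3/2)" "\<bar>c2 * (s1' - s2')\<bar> \<le> (3/2) * (\<eta> * k)"
      "\<bar>(s1 - s2) * c1'\<bar> \<le> (\<eta> * k) * 1" "\<bar>s2 * (c1' - c2')\<bar> \<le> \<eta> * (2 * k)"
      by (intro m d b1 b2 c2 dc)+
    ultimately show ?thesis using nk0 by linarith
  qed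
  have eH: "\<bar>s1 * s1' - s2 * s2'\<bar> \<le> 3 * (\<eta> * k)"
  proof -
    have "s1 * s1' - s2 * s2' = (s1 - s2) * s1' + s2 * (s1' - s2')" by (simp add: algebra_simps)
    moreover have "\<bar>(s1 - s2) * s1'\<bar> \<le> (\<eta> * k) * (3/2)" "\<bar>s2 * (s1' - s2')\<bar> \<le> 1 * (\<eta> * k)" by (intro m d b1 b2)+
    ultimately show ?thesis using nk0 by linarith
  qed
  have "dq - p * k = p * (c1 * c1' - c2 * c2' - k) + q * ((c1 * s1' + s1 * c1') - (c2 * s2' + s2 * c2')) + r * (s1 * s1' - s2 * s2')"
    by (simp add: dq_def g_def algebra_simps)
  moreover have "\<bar>p * (c1 * c1' - c2 * c2' - k)\<bar> \<le> 4 * (4 * (\<eta> * k))"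
    "\<bar>q * ((c1 * s1' + s1 * c1') - (c2 * s2' + s2 * c2'))\<bar> \<le> 2 * (7 * (\<eta> * k))"
    "\<bar>r * (s1 * s1' - s2 * s2')\<bar> \<le> 4 * (3 * (\<eta> * k))"
    using p p4 r q2 by (intro m eE eF eH; simp)+
  ultimately have dq: "\<bar>dq - p * k\<bar> \<le> 42 * (\<eta> * k)" by linarith
  have "dr = p * ((c1' - c2') * (c1' + c2')) + 2 * q * ((c1' - c2') * s1' + c2' * (s1' - s2')) + r * ((s1' - s2') * (s1' + s2'))"
    by (simp add: dr_def f_def power2_eq_square algebra_simps)
  moreover have "\<bar>p * ((c1' - c2') * (c1' + c2'))\<bar> \<le> 4 * ((2 * k) * 2)"
    by (intro m dc b3) (use p p4 in auto)
  moreover have "\<bar>2 * q * ((c1' - c2') * s1' + c2' * (s1' - s2'))\<bar> \<le> 4 * (4 * k)"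
  proof (intro m)
    have "\<bar>(c1' - c2') * s1'\<bar> \<le> (2 * k) * (3/2)" "\<bar>c2' * (s1' - s2')\<bar> \<le> 1 * (\<eta> * k)"
      by (intro m dc b1 b2 d)+
    then show "\<bar>(c1' - c2') * s1' + c2' * (s1' - s2')\<bar> \<le> 4 * k" using nk by linarith
  qed (use q2 in simp)
  moreover have "\<bar>r * ((s1' - s2') * (s1' + s2'))\<bar> \<le> 4 * ((\<eta> * k) * 3)"
    by (intro m d b3) (use r p4 in auto)
  ultimately have dr: "\<bar>dr\<bar> \<le> 44 * k" using nk by linarith
  \<comment> \<open>Each transported form keeps the determinant p * r - q^2 because the propagators
    have determinant 1.\<close>
  have det: "f c s * f c' s' - (g c c' s s')\<^sup>2 = (p * r - q\<^sup>2) * (c * s' - s * c')\<^sup>2" for c c' s s'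
    by (simp add: f_def g_def power2_eq_square algebra_simps)
  \<comment> \<open>The mean of the two equal determinants, minus the determinant of half the
    difference of the forms.\<close>
  have main: "(f c1 s1 + f c2 s2) / 2 * ((f c1' s1' + f c2' s2') / 2) - ((g c1 c1' s1 s1' + g c2 c2' s2 s2') / 2)\<^sup>2
    = p * r - q\<^sup>2 + (dq\<^sup>2 - dp * dr) / 4"
  proof -
    have "((a + a') / 2) * ((b + b') / 2) - ((e + e') / 2)\<^sup>2 =
      ((a * b - e\<^sup>2) + (a' * b' - e'\<^sup>2)) / 2 + ((e - e')\<^sup>2 - (a - a') * (b - b')) / 4" for a a' b b' e e' :: real
      by (simp add: power2_eq_square field_simps)
    then show ?thesis using det[of c1 s1 c1' s1'] det[of c2 s2 c2' s2'] c1(5) c2(5)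
      by (simp add: dp_def dq_def dr_def)
  qed
  have "\<eta> * k \<le> p0 / 10000 * k" using \<eta>p k by (intro mult_right_mono) auto
  moreover have "p0 * k \<le> p * k" using p k by (intro mult_right_mono) auto
  ultimately have "p0 * k * (99/100) \<le> \<bar>dq\<bar>" using dq by (simp add: algebra_simps)
  then have "(p0 * k * (99/100))\<^sup>2 \<le> dq\<^sup>2" using p k by (subst abs_le_square_iff[symmetric]) auto
  then have "(p0 * k)\<^sup>2 * (98/100) \<le> dq\<^sup>2"
  proof -
    have "(p0 * k * (99/100))\<^sup>2 = (p0 * k)\<^sup>2 * (9801/10000)"
      by (simp only: power_mult_distrib[of _ "99/100"]) (simp add: power2_eq_square)
    then show ?thesis using \<open>(p0 * k * (99/100))\<^sup>2 \<le> dq\<^sup>2\<close> zero_le_power2[of "p0 * k"] by linarith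
  qed
  \<comment> \<open>This fixes the constant in the smallness of \<eta>: 32 * 44 = 1408, and 1408 /
    40000 is below 4 / 100.\<close>
  moreover have "dp * dr \<le> (p0 * k)\<^sup>2 * (4/100)"
  proof -
    have "\<bar>dp * dr\<bar> \<le> (32 * (\<eta> * k)) * (44 * k)" by (intro m dp dr)
    also have "\<dots> = 1408 * \<eta> * k\<^sup>2" by (simp add: power2_eq_square)
    also have "\<dots> \<le> 1408 * (p0\<^sup>2 / 40000) * k\<^sup>2" by (intro mult_right_mono mult_left_mono \<eta>) auto
    also have "\<dots> \<le> (p0 * k)\<^sup>2 * (4/100)" by (simp add: power_mult_distrib)
    finally show ?thesis by linarith
  qed
  ultimately have "(p0 * k)\<^sup>2 * (1/2) \<le> dq\<^sup>2 - dp * dr"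
    using zero_le_power2[of "p0 * k"] by linarith
  then show "p * r - q\<^sup>2 + k\<^sup>2 * p0\<^sup>2 / 8 \<le>
      (f c1 s1 + f c2 s2) / 2 * ((f c1' s1' + f c2' s2') / 2) - ((g c1 c1' s1 s1' + g c2 c2' s2 s2') / 2)\<^sup>2"
    unfolding main by (simp add: power_mult_distrib algebra_simps)
qed

section \<open>Transfer matrices and reachable growth\<close>

text \<open>The transfer matrix with rows (c, s) and (c', s'); the letters recall the cosine-like
  and the sine-like solution. As a relation it does not single out solutions beyond their initial
  values.\<close>

definition transfer :: "(real \<Rightarrow> real) \<Rightarrow> real \<Rightarrow> real \<Rightarrow> real \<Rightarrow> real \<Rightarrow> real \<Rightarrow> real \<Rightarrow> bool" where
  "transfer V x y c c' s s' \<longleftrightarrow> (\<exists>v v' w w'. sol V v v' \<and> sol V w w' \<and>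
     v x = 1 \<and> v' x = 0 \<and> w x = 0 \<and> w' x = 1 \<and> v y = c \<and> v' y = c' \<and> w y = s \<and> w' y = s')"

lemma transfer_apply:
  assumes T: "transfer V x y c c' s s'" and v: "sol V v v'" and xy: "x \<le> y" and V: "\<And>t. \<bar>V t\<bar> \<le> C"
  shows "v y = v x * c + v' x * s" "v' y = v x * c' + v' x * s'"
proof -
  obtain f f' g g' where *: "sol V f f'" "sol V g g'" "f x = 1" "f' x = 0" "g x = 0" "g' x = 1"
    "f y = c" "f' y = c'" "g y = s" "g' y = s'"
    using T unfolding transfer_def by blast
  show "v y = v x * c + v' x * s" "v' y = v x * c' + v' x * s'"
    using sol_eq[OF v sol_lincomb[OF *(1,2), of "v x" "v' x"] xy V] * by auto
qed

lemma transfer_det: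
  assumes "transfer V x y c c' s s'"
  shows "c * s' - s * c' = 1"
proof -
  obtain f f' g g' where *: "sol V f f'" "sol V g g'" "f x = 1" "f' x = 0" "g x = 0" "g' x = 1"
    "f y = c" "f' y = c'" "g y = s" "g' y = s'"
    using assms unfolding transfer_def by blast
  show ?thesis using sol_wronskian[OF *(1,2), of y x] * by (simp add: mult.commute)
qed

lemma transfer_exists:
  assumes "continuous_on UNIV V" "\<And>t. \<bar>V t\<bar> \<le> C"
  obtains c c' s s' where "transfer V x y c c' s s'"
proof -
  obtain v v' where "sol V v v'" "v x = 1" "v' x = 0" by (rule sol_exists[OF assms])
  moreover obtain w w' where "sol V w w'" "w x = 0" "w' x = 1" by (rule sol_exists[OF assms])
  ultimately have "transfer V x y (v y) (v' y) (w y) (w' y)" unfolding transfer_def by blast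
  then show ?thesis by (rule that)
qed

lemma transfer_id:
  assumes "continuous_on UNIV V" "\<And>t. \<bar>V t\<bar> \<le> C"
  shows "transfer V x x 1 0 0 1"
proof -
  obtain v v' where "sol V v v'" "v x = 1" "v' x = 0" by (rule sol_exists[OF assms])
  moreover obtain w w' where "sol V w w'" "w x = 0" "w' x = 1" by (rule sol_exists[OF assms])
  ultimately show ?thesis unfolding transfer_def by blast
qed

text \<open>A solution for \<open>W\<close> is traded for a global solution for \<open>V\<close>
  that follows it where the two potentials agree. This glues transfers over consecutive
  intervals.\<close>

lemma sol_restart:
  assumes "continuous_on UNIV V" "\<And>t. \<bar>V t\<bar> \<le> C" "\<And>t. \<bar>W t\<bar> \<le> C"
    and w: "sol W w w'" and eq: "\<And>t. x \<le> t \<Longrightarrow> t \<le> y \<Longrightarrow> W t = V t"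
  obtains v v' where "sol V v v'" "v x = w x" "v' x = w' x"
    "\<forall>t\<in>{x..y}. v t = w t \<and> v' t = w' t"
proof -
  obtain v v' where v: "sol V v v'" "v x = w x" "v' x = w' x" by (rule sol_exists[OF assms(1,2)])
  have *: "w t = v t \<and> w' t = v' t" if "x \<le> t" "t \<le> y" for t
    using sol_eq[OF w v(1) that(1) assms(3) _ v(2,3)[symmetric]] eq that by auto
  show ?thesis by (rule that[OF v]) (use * in auto)
qed

text \<open>The symmetric matrix with entries \<open>p\<close>, \<open>q\<close>, \<open>r\<close> stands for $\sum_i w_i w_i^T$ over a family
  of initial vectors $w_i$, and the quantity bounded below is then $\sum_i |T w_i|^2$.\<close>

definition reach :: "(real \<Rightarrow> real) \<Rightarrow> real \<Rightarrow> real \<Rightarrow> real \<Rightarrow> real \<Rightarrow> real \<Rightarrow> real \<Rightarrow> bool" where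
  "reach u \<epsilon> x L p q r \<longleftrightarrow> (\<exists>y W c c' s s'. x \<le> y \<and> y \<le> x + L \<and> adm \<epsilon> x y W \<and>
     transfer (\<lambda>t. u t + W t) x y c c' s s' \<and>
     4 \<le> p * (c\<^sup>2 + c'\<^sup>2) + 2 * q * (c * s + c' * s') + r * (s\<^sup>2 + s'\<^sup>2))"

lemma adm_bound:
  assumes "adm \<epsilon> x y W" "\<And>t. \<bar>u t\<bar> \<le> C" "\<epsilon> \<le> 1"
  shows "\<bar>u t + W t\<bar> \<le> C + 1"
proof -
  have "\<bar>W t\<bar> \<le> \<epsilon>" using assms(1) by (simp add: adm_def)
  then show ?thesis using assms(2)[of t] assms(3) by linarith
qed

lemma reach_trivial:
  assumes cu: "continuous_on UNIV u" and bu: "\<And>t. \<bar>u t\<bar> \<le> C" and "0 \<le> \<epsilon>" "0 \<le> L" "4 \<le> p + r"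
  shows "reach u \<epsilon> x L p q r"
  unfolding reach_def
  using assms(3-5) adm_zero[OF assms(3), of x x] transfer_id[OF cu bu, of x]
  by (intro exI[of _ x] exI[of _ "\<lambda>_. 0"] exI[of _ 1] exI[of _ 0]) auto

text \<open>The quantity bounded below in \<open>reach\<close> is linear in the form. A continuation
  that works for the mean of the forms left behind by a bump and by its negative therefore works for
  one of the two, and the sign is chosen only afterwards.\<close>

lemma reach_step:
  fixes u :: "real \<Rightarrow> real"
  assumes cu: "continuous_on UNIV u" and bu: "\<And>t. \<bar>u t\<bar> \<le> C" and \<epsilon>: "0 < \<epsilon>" "\<epsilon> \<le> 1" and L: "0 \<le> L"
    and p: "0 < p0" "p0 \<le> p" and r: "0 \<le> r" and q: "q\<^sup>2 \<le> p * r"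
    and K: "K = 20 * (C + 1) * exp (2 * C + 6)" and h: "0 < h" "h \<le> 1" "K * h \<le> p0\<^sup>2 / 40000"
    and more: "\<And>P Q R. \<lbrakk>0 \<le> P; 0 \<le> R; p * r - q\<^sup>2 + (4/3 * \<epsilon> * h)\<^sup>2 * p0\<^sup>2 / 8 \<le> P * R - Q\<^sup>2\<rbrakk> \<Longrightarrow> reach u \<epsilon> (x + h) L P Q R"
  shows "reach u \<epsilon> x (h + L) p q r"
proof (cases "4 \<le> p + r")
  case True
  then show ?thesis using reach_trivial[OF cu bu, of \<epsilon> "h + L"] \<epsilon> h L by auto
next
  case False
  have C0: "0 \<le> C" using bu[of 0] by linarith
  have K0: "0 \<le> K" using C0 by (simp add: K)
  define k where "k = 4/3 * \<epsilon> * h"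
  define V where "V \<sigma> t = u t + \<sigma> * bump \<epsilon> x h t" for \<sigma> t
  have adm1: "adm \<epsilon> x (x + h) (\<lambda>t. 1 * bump \<epsilon> x h t)" and adm2: "adm \<epsilon> x (x + h) (\<lambda>t. (-1) * bump \<epsilon> x h t)"
    by (rule bump_adm; use h \<epsilon> in simp)+
  have V: "continuous_on UNIV (V 1)" "continuous_on UNIV (V (-1))" "\<bar>V 1 t\<bar> \<le> C + 1" "\<bar>V (-1) t\<bar> \<le> C + 1" for t
    using adm1 adm2 adm_bound[OF adm1 bu \<epsilon>(2)] adm_bound[OF adm2 bu \<epsilon>(2)] cu
    unfolding V_def adm_def by (auto intro!: continuous_intros)
  obtain c1 c1' s1 s1' where T1: "transfer (V 1) x (x + h) c1 c1' s1 s1'" by (rule transfer_exists[OF V(1,3)])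
  obtain c2 c2' s2 s2' where T2: "transfer (V (-1)) x (x + h) c2 c2' s2 s2'" by (rule transfer_exists[OF V(2,4)])
  obtain f f' g g' where fg: "sol (V 1) f f'" "sol (V 1) g g'" "f x = 1" "f' x = 0" "g x = 0" "g' x = 1"
    "f (x + h) = c1" "f' (x + h) = c1'" "g (x + h) = s1" "g' (x + h) = s1'"
    using T1 unfolding transfer_def by blast
  obtain F F' G G' where FG: "sol (V (-1)) F F'" "sol (V (-1)) G G'" "F x = 1" "F' x = 0" "G x = 0" "G' x = 1"
    "F (x + h) = c2" "F' (x + h) = c2'" "G (x + h) = s2" "G' (x + h) = s2'"
    using T2 unfolding transfer_def by blast
  have one: "(1::real)\<^sup>2 + 0\<^sup>2 = 1" "(0::real)\<^sup>2 + 1\<^sup>2 = 1" by simp_all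
  note b1 = bump_perturbation[OF bu h(1,2) \<epsilon> fg(1)[unfolded V_def] FG(1)[unfolded V_def] fg(3) FG(3) fg(4) FG(4) one(1) K, unfolded fg(7-10) FG(7-10)]
  note b2 = bump_perturbation[OF bu h(1,2) \<epsilon> fg(2)[unfolded V_def] FG(2)[unfolded V_def] fg(5) FG(5) fg(6) FG(6) one(2) K, unfolded fg(7-10) FG(7-10)]
  have "K * h * (\<epsilon> * h) \<le> K * h * k" using K0 h \<epsilon> by (intro mult_left_mono) (auto simp: k_def)
  then have kk: "a \<le> K * h * k" if "a \<le> K * h * (\<epsilon> * h)" for a using that by linarith
  have "\<bar>c1' - c2' - k\<bar> \<le> K * h * (\<epsilon> * h)" using b1(6) by (simp only: k_def mult_1_right)
  moreover have "\<bar>s1' - s2'\<bar> \<le> K * h * (\<epsilon> * h)" using b2(6) by (simp only: mult_zero_right diff_zero)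
  ultimately have d: "\<bar>c1 - c2\<bar> \<le> K * h * k" "\<bar>s1 - s2\<bar> \<le> K * h * k" "\<bar>c1' - c2' - k\<bar> \<le> K * h * k" "\<bar>s1' - s2'\<bar> \<le> K * h * k"
    using b1(5) b2(5) kk by blast+
  define P where "P = (p * c1\<^sup>2 + 2 * q * (c1 * s1) + r * s1\<^sup>2 + (p * c2\<^sup>2 + 2 * q * (c2 * s2) + r * s2\<^sup>2)) / 2"
  define R where "R = (p * c1'\<^sup>2 + 2 * q * (c1' * s1') + r * s1'\<^sup>2 + (p * c2'\<^sup>2 + 2 * q * (c2' * s2') + r * s2'\<^sup>2)) / 2"
  define Q where "Q = (p * (c1 * c1') + q * (c1 * s1' + s1 * c1') + r * (s1 * s1') + (p * (c2 * c2') + q * (c2 * s2' + s2 * c2') + r * (s2 * s2'))) / 2"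
  have pr4: "p + r < 4" and \<eta>0: "0 \<le> K * h" and k0: "0 \<le> k" using False K0 h \<epsilon> by (auto simp: k_def)
  note gain = average_det_gain[OF p r q pr4 \<eta>0 h(3) k0 b1(1) b1(2)[unfolded diff_zero] b2(1)[unfolded diff_zero] b2(2) transfer_det[OF T1]
      b1(3) b1(4)[unfolded diff_zero] b2(3)[unfolded diff_zero] b2(4) transfer_det[OF T2] d, folded P_def Q_def R_def]
  have "reach u \<epsilon> (x + h) L P Q R"
    using more[OF gain(1,2) gain(3)[unfolded k_def]] .
  then obtain y W c c' s s' where y: "x + h \<le> y" "y \<le> x + h + L" and W: "adm \<epsilon> (x + h) y W"
    and T: "transfer (\<lambda>t. u t + W t) (x + h) y c c' s s'"
    and 4: "4 \<le> P * (c\<^sup>2 + c'\<^sup>2) + 2 * Q * (c * s + c' * s') + R * (s\<^sup>2 + s'\<^sup>2)"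
    unfolding reach_def by blast
  \<comment> \<open>The quantity of \<open>reach\<close> for the initial form under the composed
    transfer: the matrix with rows (a, b) and (a', b') over the bump, then the one with rows (c, s)
    and (c', s').\<close>
  define Z where "Z a a' b b' = p * ((a * c + a' * s)\<^sup>2 + (a * c' + a' * s')\<^sup>2)
      + 2 * q * ((a * c + a' * s) * (b * c + b' * s) + (a * c' + a' * s') * (b * c' + b' * s'))
      + r * ((b * c + b' * s)\<^sup>2 + (b * c' + b' * s')\<^sup>2)" for a a' b b'
  have Zavg: "P * (c\<^sup>2 + c'\<^sup>2) + 2 * Q * (c * s + c' * s') + R * (s\<^sup>2 + s'\<^sup>2) = (Z c1 c1' s1 s1' + Z c2 c2' s2 s2') / 2"
    by (simp add: Z_def P_def Q_def R_def power2_eq_square field_simps)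
  have "4 \<le> a \<or> 4 \<le> b" if "4 \<le> z" "z = (a + b) / 2" for a b z :: real
    using that by (cases "4 \<le> a") auto
  from this[OF 4 Zavg] have "4 \<le> Z c1 c1' s1 s1' \<or> 4 \<le> Z c2 c2' s2 s2'" .
  moreover have "reach u \<epsilon> x (h + L) p q r"
    if Z: "4 \<le> Z a a' b b'" and Ta: "transfer (V \<sigma>) x (x + h) a a' b b'" and \<sigma>: "\<sigma> = 1 \<or> \<sigma> = -1" for a a' b b' \<sigma>
  proof -
    define W' where "W' t = \<sigma> * bump \<epsilon> x h t + W t" for t
    have b\<sigma>: "adm \<epsilon> x (x + h) (\<lambda>t. \<sigma> * bump \<epsilon> x h t)" using bump_adm[OF h(1) _ \<sigma>] \<epsilon> by auto
    have W': "adm \<epsilon> x y W'" unfolding W'_def using adm_add[OF b\<sigma> W] h y by auto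
    define U where "U t = u t + W' t" for t
    have U: "continuous_on UNIV U" "\<And>t. \<bar>U t\<bar> \<le> C + 1"
      using W' cu adm_bound[OF W' bu \<epsilon>(2)] unfolding U_def adm_def by (auto intro!: continuous_intros)
    have V\<sigma>: "\<And>t. \<bar>V \<sigma> t\<bar> \<le> C + 1" using V \<sigma> by auto
    have UW: "\<And>t. \<bar>u t + W t\<bar> \<le> C + 1" by (rule adm_bound[OF W bu \<epsilon>(2)])
    have first: "V \<sigma> t = U t" if "x \<le> t" "t \<le> x + h" for t
      using W that by (auto simp: V_def U_def W'_def adm_def)
    have second: "U t = u t + W t" if "x + h \<le> t" "t \<le> y" for t
      using b\<sigma> that by (auto simp: U_def W'_def adm_def)
    obtain f f' g g' where fg: "sol (V \<sigma>) f f'" "sol (V \<sigma>) g g'" "f x = 1" "f' x = 0" "g x = 0" "g' x = 1"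
      "f (x + h) = a" "f' (x + h) = a'" "g (x + h) = b" "g' (x + h) = b'"
      using Ta unfolding transfer_def by blast
    have xh: "x \<le> x + h" "x + h \<le> x + h" using h by auto
    obtain e e' where e: "sol U e e'" "e x = f x" "e' x = f' x"
      "\<forall>t\<in>{x..x + h}. e t = f t \<and> e' t = f' t"
      by (rule sol_restart[OF U V\<sigma> fg(1) first])
    obtain i i' where i: "sol U i i'" "i x = g x" "i' x = g' x"
      "\<forall>t\<in>{x..x + h}. i t = g t \<and> i' t = g' t"
      by (rule sol_restart[OF U V\<sigma> fg(2) first])
    have ei: "e (x + h) = a" "e' (x + h) = a'" "i (x + h) = b" "i' (x + h) = b'"
      using bspec[OF e(4), of "x + h"] bspec[OF i(4), of "x + h"] xh fg by auto
    have cUW: "continuous_on UNIV (\<lambda>t. u t + W t)" using W cu by (auto simp: adm_def intro!: continuous_intros)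
    obtain E E' where E: "sol (\<lambda>t. u t + W t) E E'" "E (x + h) = e (x + h)" "E' (x + h) = e' (x + h)"
      "\<forall>t\<in>{x + h..y}. E t = e t \<and> E' t = e' t"
      by (rule sol_restart[OF cUW UW U(2) e(1) second])
    obtain I I' where I: "sol (\<lambda>t. u t + W t) I I'" "I (x + h) = i (x + h)" "I' (x + h) = i' (x + h)"
      "\<forall>t\<in>{x + h..y}. I t = i t \<and> I' t = i' t"
      by (rule sol_restart[OF cUW UW U(2) i(1) second])
    have EI: "E y = e y" "E' y = e' y" "I y = i y" "I' y = i' y"
      using bspec[OF E(4), of y] bspec[OF I(4), of y] y by auto
    have TU: "transfer (\<lambda>t. u t + W' t) x y (a * c + a' * s) (a * c' + a' * s') (b * c + b' * s) (b * c' + b' * s')"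
      unfolding U_def[symmetric]
      unfolding transfer_def
    proof (intro exI conjI)
      show "sol U e e'" "sol U i i'" "e x = 1" "e' x = 0" "i x = 0" "i' x = 1"
        using e(1-3) i(1-3) fg by auto
      show "e y = a * c + a' * s" "e' y = a * c' + a' * s'"
        using transfer_apply[OF T E(1) y(1) UW] EI E(2,3) ei fg by simp_all
      show "i y = b * c + b' * s" "i' y = b * c' + b' * s'"
        using transfer_apply[OF T I(1) y(1) UW] EI I(2,3) ei fg by simp_all
    qed
    have "x \<le> y" "y \<le> x + (h + L)" using y h by linarith+
    then show ?thesis unfolding reach_def using TU W' Z[unfolded Z_def] by blast
  qed
  ultimately show ?thesis using T1 T2 by blast
qed


text \<open>Each bump raises the determinant by at least \<open>\<kappa>\<close>, and a form with
  nonnegative diagonal and determinant at least 4 has trace at least 4. Hence about 4 / \<kappa>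
  bumps suffice, a number governed by C, \<epsilon> and d0 and not by \<open>u\<close>.\<close>

lemma reach_uniform:
  fixes C \<epsilon> d0 :: real
  assumes C: "0 \<le> C" and \<epsilon>: "0 < \<epsilon>" "\<epsilon> \<le> 1" and d0: "0 < d0"
  obtains L where "0 \<le> L"
    "\<And>u x p q r. \<lbrakk>continuous_on UNIV u; \<And>t. \<bar>u t\<bar> \<le> C; 0 \<le> p; 0 \<le> r; d0 \<le> p * r - q\<^sup>2\<rbrakk> \<Longrightarrow> reach u \<epsilon> x L p q r"
proof -
  define K where "K = 20 * (C + 1) * exp (2 * C + 6)"
  have K: "0 < K" using C by (simp add: K_def)
  \<comment> \<open>As long as the trace is below 4, d0 <= p * r <= 4 * p keeps \<open>p\<close>
    away from 0, as the gain of a bump requires.\<close>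
  define p0 where "p0 = d0 / 4"
  define h where "h = min 1 (p0\<^sup>2 / 40000 / K)"
  have p0: "0 < p0" using d0 by (simp add: p0_def)
  have h: "0 < h" "h \<le> 1" using p0 K by (auto simp: h_def)
  have "K * h \<le> K * (p0\<^sup>2 / 40000 / K)" using K by (intro mult_left_mono) (auto simp: h_def)
  then have Kh: "K * h \<le> p0\<^sup>2 / 40000" using K by simp
  define \<kappa> where "\<kappa> = (4/3 * \<epsilon> * h)\<^sup>2 * p0\<^sup>2 / 8"
  have \<kappa>: "0 < \<kappa>" using \<epsilon> h p0 by (simp add: \<kappa>_def)
  have step: "reach u \<epsilon> x (real n * h) p q r"
    if u: "continuous_on UNIV u" "\<And>t. \<bar>u t\<bar> \<le> C" and "0 \<le> p" "0 \<le> r" "d0 \<le> p * r - q\<^sup>2" "4 \<le> p * r - q\<^sup>2 + n * \<kappa>"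
    for u x p q r and n :: nat
    using that(3-)
  proof (induction n arbitrary: x p q r)
    case 0
    then have "4 \<le> p * r - q\<^sup>2" by simp
    then have "4 \<le> p * r" using zero_le_power2[of q] by linarith
    moreover have "0 \<le> (p - r)\<^sup>2" by simp
    ultimately have "4\<^sup>2 \<le> (p + r)\<^sup>2" by (simp add: power2_eq_square algebra_simps)
    then have "4 \<le> p + r" using 0 by (meson add_nonneg_nonneg power2_le_imp_le)
    then show ?case using reach_trivial[OF u, of \<epsilon> 0] \<epsilon> by simp
  next
    case (Suc n)
    show ?case
    proof (cases "4 \<le> p + r")
      case True
      then show ?thesis using reach_trivial[OF u, of \<epsilon> "real (Suc n) * h"] \<epsilon> h by simp
    next
      case False
      have "d0 \<le> p * r" using Suc.prems(3) zero_le_power2[of q] by linarith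
      also have "\<dots> \<le> p * 4" using Suc.prems False by (intro mult_left_mono) auto
      finally have pp: "p0 \<le> p" by (simp add: p0_def)
      have q: "q\<^sup>2 \<le> p * r" using Suc.prems(3) d0 by linarith
      have "reach u \<epsilon> x (h + real n * h) p q r"
      proof (rule reach_step[OF u \<epsilon> _ p0 pp Suc.prems(2) q K_def h Kh])
        fix P Q R :: real
        assume PQR: "0 \<le> P" "0 \<le> R" "p * r - q\<^sup>2 + (4/3 * \<epsilon> * h)\<^sup>2 * p0\<^sup>2 / 8 \<le> P * R - Q\<^sup>2"
        then have PQR': "p * r - q\<^sup>2 + \<kappa> \<le> P * R - Q\<^sup>2" by (simp add: \<kappa>_def)
        show "reach u \<epsilon> (x + h) (real n * h) P Q R"
        proof (rule Suc.IH[OF PQR(1,2)])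
          show "d0 \<le> P * R - Q\<^sup>2" using PQR' Suc.prems(3) \<kappa> by linarith
          show "4 \<le> P * R - Q\<^sup>2 + real n * \<kappa>" using PQR' Suc.prems(4) by (simp add: algebra_simps)
        qed
      qed (use h in simp)
      then show ?thesis by (simp add: algebra_simps)
    qed
  qed
  obtain N :: nat where N: "4 / \<kappa> \<le> N" using real_arch_simple by blast
  then have N': "4 \<le> N * \<kappa>" using \<kappa> by (simp add: field_simps)
  show ?thesis
  proof (rule that)
    show "0 \<le> real N * h" using h by simp
    fix u :: "real \<Rightarrow> real" and x p q r :: real
    assume *: "continuous_on UNIV u" "\<And>t. \<bar>u t\<bar> \<le> C" "0 \<le> p" "0 \<le> r" "d0 \<le> p * r - q\<^sup>2"
    then show "reach u \<epsilon> x (real N * h) p q r" using N' d0 by (intro step) auto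
  qed
qed

text \<open>A single vector gives a form of rank one, with determinant 0. One bump lifts the
  determinant to \<open>d0\<close> provided that the first component is not too small, and then
  \<open>reach_uniform\<close> takes over. If it is small, the derivative is not, and a free run of
  length \<open>h0\<close> moves the first component away from 0. The final 4 is a squared norm, so
  the norm doubles.\<close>

lemma steer_doubling:
  fixes C \<epsilon> :: real
  assumes C: "0 \<le> C" and \<epsilon>: "0 < \<epsilon>" "\<epsilon> \<le> 1"
  obtains L where "0 < L"
    "\<And>u x a b. \<lbrakk>continuous_on UNIV u; \<And>t. \<bar>u t\<bar> \<le> C; a\<^sup>2 + b\<^sup>2 = 1\<rbrakk> \<Longrightarrow>
      \<exists>y W v v'. x < y \<and> y \<le> x + L \<and> adm \<epsilon> x y W \<and> sol (\<lambda>t. u t + W t) v v' \<and>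
        v x = a \<and> v' x = b \<and> 4 \<le> (v y)\<^sup>2 + (v' y)\<^sup>2"
proof -
  define M where "M = exp (C + 2)"
  have M: "1 \<le> M" using C by (simp add: M_def)
  \<comment> \<open>Short enough that the derivative varies by at most 1/4. Starting with size at
    least 1/2, it displaces the first component by at least h0 / 4, against an initial value below
    \<tau> = h0 / 8.\<close>
  define h0 where "h0 = 1 / (4 * (C + 1) * M)"
  have CM: "1 \<le> (C + 1) * M" using C M by (simp add: mult_ge1_I)
  have h0: "0 < h0" "h0 \<le> 1/4" using C M CM by (auto simp: h0_def field_simps)
  have CMh: "C * M * h0 \<le> 1/4"
  proof -
    define N where "N = (C + 1) * M"
    have "h0 = 1 / (4 * N)" "0 < N" using CM by (auto simp: h0_def N_def mult.assoc)
    then have "N * h0 = 1/4" by simp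
    moreover have "C * M * h0 \<le> N * h0" unfolding N_def using C M h0 by (intro mult_right_mono) auto
    ultimately show ?thesis by simp
  qed
  define \<tau> where "\<tau> = h0 / 8"
  have \<tau>: "0 < \<tau>" "\<tau> \<le> 1/4" using h0 by (auto simp: \<tau>_def)
  define K where "K = 20 * (C + 1) * exp (2 * C + 6)"
  have K: "0 < K" using C by (simp add: K_def)
  define p0 where "p0 = \<tau>\<^sup>2"
  define h where "h = min 1 (p0\<^sup>2 / 40000 / K)"
  have p0: "0 < p0" using \<tau> by (simp add: p0_def)
  have h: "0 < h" "h \<le> 1" using p0 K by (auto simp: h_def)
  have "K * h \<le> K * (p0\<^sup>2 / 40000 / K)" using K by (intro mult_left_mono) (auto simp: h_def)
  then have Kh: "K * h \<le> p0\<^sup>2 / 40000" using K by simp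
  \<comment> \<open>The determinant after the first bump, starting from 0; it is the lower bound
    with which \<open>reach_uniform\<close> is entered.\<close>
  define d0 where "d0 = (4/3 * \<epsilon> * h)\<^sup>2 * p0\<^sup>2 / 8"
  have d0: "0 < d0" using \<epsilon> h p0 by (simp add: d0_def)
  obtain L0 where L0: "0 \<le> L0"
    "\<And>u x p q r. \<lbrakk>continuous_on UNIV u; \<And>t. \<bar>u t\<bar> \<le> C; 0 \<le> p; 0 \<le> r; d0 \<le> p * r - q\<^sup>2\<rbrakk> \<Longrightarrow> reach u \<epsilon> x L0 p q r"
    by (rule reach_uniform[OF C \<epsilon> d0]) blast
  show ?thesis
  proof (rule that[of "h0 + (h + L0)"])
    show "0 < h0 + (h + L0)" using h0 h L0 by simp
    fix u :: "real \<Rightarrow> real" and x a b :: real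
    assume cu: "continuous_on UNIV u" and bu: "\<And>t. \<bar>u t\<bar> \<le> C" and ab: "a\<^sup>2 + b\<^sup>2 = 1"
    have good: "reach u \<epsilon> z (h + L0) (\<alpha>\<^sup>2) (\<alpha> * \<beta>) (\<beta>\<^sup>2)" if "\<tau> \<le> \<bar>\<alpha>\<bar>" for z \<alpha> \<beta>
    proof (rule reach_step[OF cu bu \<epsilon> L0(1) p0 _ _ _ K_def h Kh])
      show "p0 \<le> \<alpha>\<^sup>2" unfolding p0_def using that \<tau> by (simp add: abs_le_square_iff[symmetric])
      show "(\<alpha> * \<beta>)\<^sup>2 \<le> \<alpha>\<^sup>2 * \<beta>\<^sup>2" by (simp add: power_mult_distrib)
      fix P Q R :: real
      assume "0 \<le> P" "0 \<le> R" "\<alpha>\<^sup>2 * \<beta>\<^sup>2 - (\<alpha> * \<beta>)\<^sup>2 + (4/3 * \<epsilon> * h)\<^sup>2 * p0\<^sup>2 / 8 \<le> P * R - Q\<^sup>2"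
      then show "reach u \<epsilon> (z + h) L0 P Q R"
        by (intro L0(2)[OF cu bu]) (auto simp: d0_def power_mult_distrib)
    qed auto
    have fin: "\<exists>y W v v'. z \<le> y \<and> y \<le> z + (h + L0) \<and> adm \<epsilon> z y W \<and> sol (\<lambda>t. u t + W t) v v' \<and>
        v z = \<alpha> \<and> v' z = \<beta> \<and> 4 \<le> (v y)\<^sup>2 + (v' y)\<^sup>2" if \<alpha>: "\<tau> \<le> \<bar>\<alpha>\<bar>" for z \<alpha> \<beta>
    proof -
      obtain y W c c' s s' where y: "z \<le> y" "y \<le> z + (h + L0)" and W: "adm \<epsilon> z y W"
        and T: "transfer (\<lambda>t. u t + W t) z y c c' s s'"
        and 4: "4 \<le> \<alpha>\<^sup>2 * (c\<^sup>2 + c'\<^sup>2) + 2 * (\<alpha> * \<beta>) * (c * s + c' * s') + \<beta>\<^sup>2 * (s\<^sup>2 + s'\<^sup>2)"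
        using good[OF \<alpha>, of z \<beta>] unfolding reach_def by blast
      have U: "continuous_on UNIV (\<lambda>t. u t + W t)" "\<bar>u t + W t\<bar> \<le> C + 1" for t
        using W cu adm_bound[OF W bu \<epsilon>(2)] by (auto simp: adm_def intro!: continuous_intros)
      obtain v v' where v: "sol (\<lambda>t. u t + W t) v v'" "v z = \<alpha>" "v' z = \<beta>" by (rule sol_exists[OF U])
      have "(v y)\<^sup>2 + (v' y)\<^sup>2 = \<alpha>\<^sup>2 * (c\<^sup>2 + c'\<^sup>2) + 2 * (\<alpha> * \<beta>) * (c * s + c' * s') + \<beta>\<^sup>2 * (s\<^sup>2 + s'\<^sup>2)"
        unfolding transfer_apply[OF T v(1) y(1) U(2)] v by (simp add: power2_eq_square algebra_simps)
      with 4 y W v show ?thesis by metis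
    qed
    have main: "\<exists>y W v v'. x \<le> y \<and> y \<le> x + (h0 + (h + L0)) \<and> adm \<epsilon> x y W \<and> sol (\<lambda>t. u t + W t) v v' \<and>
        v x = a \<and> v' x = b \<and> 4 \<le> (v y)\<^sup>2 + (v' y)\<^sup>2"
    proof (cases "\<tau> \<le> \<bar>a\<bar>")
      case True
      obtain y W v v' where "x \<le> y" "y \<le> x + (h + L0)" "adm \<epsilon> x y W" "sol (\<lambda>t. u t + W t) v v'"
        "v x = a" "v' x = b" "4 \<le> (v y)\<^sup>2 + (v' y)\<^sup>2" using fin[OF True, of x b] by blast
      moreover have "y \<le> x + (h0 + (h + L0))" using h0 \<open>y \<le> x + (h + L0)\<close> by simp
      ultimately show ?thesis by blast
    next
      case False
      obtain f f' where f: "sol u f f'" "f x = a" "f' x = b" by (rule sol_exists[OF cu bu])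
      have bf: "\<bar>f t\<bar> \<le> M" if t: "x \<le> t" "t \<le> x + h0" for t
      proof -
        have "(f t)\<^sup>2 + (f' t)\<^sup>2 \<le> exp ((2 + C) * (t - x)) * 1"
          using sol_bound[OF f(1) t(1) bu] f ab by simp
        also have "\<dots> \<le> exp ((C + 2) * 1)"
          using t h0 C by (simp add: add.commute mult_left_le)
        also have "\<dots> \<le> M\<^sup>2" using M by (simp add: M_def power2_eq_square)
        finally show ?thesis using square_bound_abs(1)[of "f t" "f' t" M] M by auto
      qed
      have f'b: "\<bar>f' t - b\<bar> \<le> 1/4" if t: "x \<le> t" "t \<le> x + h0" for t
      proof -
        have "\<bar>f' t - f' x\<bar> \<le> (C * M) * (t - x)"
        proof (rule real_deriv_bound[OF t(1)])
          fix s assume s: "x \<le> s" "s \<le> t"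
          show "(f' has_real_derivative u s * f s) (at s)" using f by (simp add: sol_def)
          show "\<bar>u s * f s\<bar> \<le> C * M" unfolding abs_mult using bu[of s] bf[of s] s t C by (intro mult_mono) auto
        qed
        also have "\<dots> \<le> C * M * h0" using C M t by (intro mult_left_mono) auto
        finally show ?thesis using CMh f by simp
      qed
      have "\<bar>(f (x + h0) - b * (x + h0)) - (f x - b * x)\<bar> \<le> 1/4 * (x + h0 - x)"
      proof (rule real_deriv_bound)
        show "((\<lambda>t. f t - b * t) has_real_derivative f' t - b) (at t)" for t
          using f by (auto simp: sol_def intro!: derivative_eq_intros)
      qed (use f'b h0 in auto)
      then have dev: "\<bar>f (x + h0) - a - b * h0\<bar> \<le> h0 / 4" using f by (simp add: algebra_simps)
      have "\<bar>a\<bar> \<le> 1/4" using False \<tau> by simp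
      then have "a\<^sup>2 \<le> (1/4)\<^sup>2" by (subst abs_le_square_iff[symmetric]) simp
      then have "(1/2)\<^sup>2 \<le> b\<^sup>2" using ab by (simp add: power2_eq_square)
      then have "1/2 \<le> \<bar>b\<bar>" by (subst (asm) abs_le_square_iff[symmetric]) simp
      then have "h0 / 2 \<le> \<bar>b * h0\<bar>" using h0 by (simp add: abs_mult)
      moreover have "\<bar>z\<bar> \<le> \<bar>c\<bar> + \<bar>a\<bar> + \<bar>c - a - z\<bar>" for c z :: real by linarith
      then have "\<bar>b * h0\<bar> \<le> \<bar>f (x + h0)\<bar> + \<bar>a\<bar> + \<bar>f (x + h0) - a - b * h0\<bar>" .
      moreover have "\<bar>a\<bar> < h0 / 8" using False by (simp add: \<tau>_def)
      ultimately have "h0 / 8 \<le> \<bar>f (x + h0)\<bar>" using dev by argo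
      then have big: "\<tau> \<le> \<bar>f (x + h0)\<bar>" by (simp add: \<tau>_def)
      obtain y W v v' where y: "x + h0 \<le> y" "y \<le> x + h0 + (h + L0)" and W: "adm \<epsilon> (x + h0) y W"
        and v: "sol (\<lambda>t. u t + W t) v v'" "v (x + h0) = f (x + h0)" "v' (x + h0) = f' (x + h0)" "4 \<le> (v y)\<^sup>2 + (v' y)\<^sup>2"
        using fin[OF big, of "x + h0" "f' (x + h0)"] by blast
      have W0: "adm \<epsilon> x y W" using W h0 by (auto simp: adm_def)
      have U: "continuous_on UNIV (\<lambda>t. u t + W t)" "\<bar>u t + W t\<bar> \<le> C + 1" for t
        using W cu adm_bound[OF W bu \<epsilon>(2)] by (auto simp: adm_def intro!: continuous_intros)
      have bu1: "\<bar>u t\<bar> \<le> C + 1" for t using bu[of t] by simp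
      obtain w w' where w: "sol (\<lambda>t. u t + W t) w w'" "w x = f x" "w' x = f' x"
        "\<forall>t\<in>{x..x + h0}. w t = f t \<and> w' t = f' t"
      proof (rule sol_restart[OF U bu1 f(1), of x "x + h0"])
        show "u t = u t + W t" if "x \<le> t" "t \<le> x + h0" for t using W that by (auto simp: adm_def)
      qed
      have "w y = v y" "w' y = v' y"
        using sol_eq[OF w(1) v(1) y(1) U(2)] bspec[OF w(4), of "x + h0"] v h0 by auto
      then show ?thesis using y W0 w f v h0 by (intro exI[of _ y] exI[of _ W] exI[of _ w] exI[of _ w']) auto
    qed
    then obtain y W v v' where *: "x \<le> y" "y \<le> x + (h0 + (h + L0))" "adm \<epsilon> x y W" "sol (\<lambda>t. u t + W t) v v'"
        "v x = a" "v' x = b" "4 \<le> (v y)\<^sup>2 + (v' y)\<^sup>2" by blast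
    then have "x \<noteq> y" using ab by auto
    with * show "\<exists>y W v v'. x < y \<and> y \<le> x + (h0 + (h + L0)) \<and> adm \<epsilon> x y W \<and> sol (\<lambda>t. u t + W t) v v' \<and>
        v x = a \<and> v' x = b \<and> 4 \<le> (v y)\<^sup>2 + (v' y)\<^sup>2"
      by (metis order_le_less)
  qed
qed

section \<open>Shadowing: growth that persists at nearby energies\<close>

text \<open>Here and below, \<open>Complex (v x) (v' x)\<close> merely stands for the vector (v, v')
  with its Euclidean norm.\<close>

lemma sol_bound_norm:
  assumes s: "sol V v v'" and ab: "a \<le> b" "b \<le> a + L" and V: "\<And>t. \<bar>V t\<bar> \<le> C"
  shows "norm (Complex (v b) (v' b)) \<le> exp ((C + 2) * L) * norm (Complex (v a) (v' a))"
proof -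
  have C: "0 \<le> C" using V[of 0] by linarith
  have "(v b)\<^sup>2 + (v' b)\<^sup>2 \<le> exp ((2 + C) * (b - a)) * ((v a)\<^sup>2 + (v' a)\<^sup>2)"
    by (rule sol_bound[OF s ab(1) V])
  also have "\<dots> \<le> (exp ((C + 2) * L))\<^sup>2 * ((v a)\<^sup>2 + (v' a)\<^sup>2)"
  proof (intro mult_right_mono)
    have "(2 + C) * (b - a) \<le> (C + 2) * L + (C + 2) * L"
      using ab C by (intro order_trans[OF mult_left_mono[of "b - a" L "2 + C"]]) (auto simp: algebra_simps)
    then show "exp ((2 + C) * (b - a)) \<le> (exp ((C + 2) * L))\<^sup>2"
      by (simp add: power2_eq_square exp_add[symmetric])
  qed auto
  also have "\<dots> = (exp ((C + 2) * L) * norm (Complex (v a) (v' a)))\<^sup>2"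
    by (simp add: power_mult_distrib complex_norm)
  finally have "(norm (Complex (v b) (v' b)))\<^sup>2 \<le> (exp ((C + 2) * L) * norm (Complex (v a) (v' a)))\<^sup>2"
    by (simp add: complex_norm)
  then show ?thesis by (rule power2_le_imp_le) auto
qed

text \<open>The Wronskian divided by both norms is the sine of the angle between the two solution
  vectors. Over one step the Wronskian drifts by at most \<rho> R S, so its bound at most doubles,
  while the norm of \<open>v\<close> doubles and that of \<open>w\<close> does not shrink. The cone
  of opening \<rho> is thus preserved, and the step can be repeated any number of times with the
  same \<open>\<kappa>\<close>.\<close>

lemma shadow_step:
  fixes L C \<rho> \<kappa> B :: real
  defines "B \<equiv> exp ((C + 4) * L)"
  assumes U: "\<And>t. \<bar>U t\<bar> \<le> C + 1" and v: "sol U v v'" and w: "sol (\<lambda>t. U t - e) w w'"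
    and y: "y \<le> y2" "y2 \<le> y + L" and L: "0 < L"
    and \<rho>: "\<rho> = 1 / (8 * B)" and \<kappa>: "\<kappa> = \<rho> / (B\<^sup>2 * (L + 1))" and e: "\<bar>e\<bar> \<le> \<kappa>"
    and \<Omega>: "\<bar>v y * w' y - v' y * w y\<bar> \<le> \<rho> * norm (Complex (v y) (v' y)) * norm (Complex (w y) (w' y))"
    and r: "0 < norm (Complex (v y) (v' y))" "2 * norm (Complex (v y) (v' y)) \<le> norm (Complex (v y2) (v' y2))"
  shows "3/2 * norm (Complex (w y) (w' y)) \<le> norm (Complex (w y2) (w' y2))"
    "\<bar>v y2 * w' y2 - v' y2 * w y2\<bar> \<le> \<rho> * norm (Complex (v y2) (v' y2)) * norm (Complex (w y2) (w' y2))"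
proof -
  define R where "R = norm (Complex (v y) (v' y))"
  define S where "S = norm (Complex (w y) (w' y))"
  define R2 where "R2 = norm (Complex (v y2) (v' y2))"
  define S2 where "S2 = norm (Complex (w y2) (w' y2))"
  define \<Omega>0 where "\<Omega>0 = v y * w' y - v' y * w y"
  have C: "0 \<le> C + 1" using U[of 0] by linarith
  have B: "1 \<le> B" using C L by (simp add: B_def)
  have \<rho>': "0 < \<rho>" "\<rho> \<le> 1/8" using B by (auto simp: \<rho> field_simps)
  have R: "0 < R" "2 * R \<le> R2" using r by (auto simp: R_def R2_def)
  have S: "0 \<le> S" by (simp add: S_def)
  have om: "\<bar>\<Omega>0\<bar> \<le> \<rho> * R * S" using \<Omega> by (simp add: \<Omega>0_def R_def S_def)
  have \<kappa>0: "0 < \<kappa>" using \<rho>' B L by (simp add: \<kappa>)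
  \<comment> \<open>This relation determines \<kappa>: solutions grow at most by B in a step, so the
    Wronskian drifts by at most \<kappa> B^2 L R S, which is at most \<rho> R S.\<close>
  have \<kappa>B: "\<kappa> * B\<^sup>2 * (L + 1) = \<rho>" using B L by (simp add: \<kappa>)
  have "\<kappa> * 1 \<le> \<kappa> * (B\<^sup>2 * (L + 1))"
    using \<kappa>0 B L by (intro mult_left_mono mult_ge1_I) auto
  then have \<kappa>1: "\<kappa> \<le> 1" using \<kappa>B \<rho>' by (simp add: mult.assoc)
  have \<kappa>L: "\<kappa> * B\<^sup>2 * L \<le> \<rho>"
  proof -
    have "\<kappa> * B\<^sup>2 * L \<le> \<kappa> * B\<^sup>2 * (L + 1)" using \<kappa>0 by (intro mult_left_mono) auto
    then show ?thesis using \<kappa>B by simp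
  qed
  have Ue: "\<bar>U t - e\<bar> \<le> C + 2" "\<bar>U t\<bar> \<le> C + 2" for t using U[of t] e \<kappa>1 by linarith+
  have CC: "(C + 2 + 2) * L = (C + 4) * L" by simp
  have bv: "\<bar>v t\<bar> \<le> B * R" and bw: "\<bar>w t\<bar> \<le> B * S" if t: "y \<le> t" "t \<le> y2" for t
  proof -
    have tL: "t \<le> y + L" using t y by simp
    show "\<bar>v t\<bar> \<le> B * R"
      using sol_bound_norm[OF v t(1) tL Ue(2), unfolded CC] abs_Re_le_cmod[of "Complex (v t) (v' t)", unfolded complex.sel]
      unfolding B_def R_def by linarith
    show "\<bar>w t\<bar> \<le> B * S"
      using sol_bound_norm[OF w t(1) tL Ue(1), unfolded CC] abs_Re_le_cmod[of "Complex (w t) (w' t)", unfolded complex.sel]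
      unfolding B_def S_def by linarith
  qed
  have "\<bar>(v y2 * w' y2 - v' y2 * w y2) - (v y * w' y - v' y * w y)\<bar> \<le> (\<kappa> * (B * R) * (B * S)) * (y2 - y)"
  proof (rule real_deriv_bound[OF y(1)])
    fix t assume t: "y \<le> t" "t \<le> y2"
    show "((\<lambda>t. v t * w' t - v' t * w t) has_real_derivative - e * v t * w t) (at t)"
      using v w unfolding sol_def by (auto intro!: derivative_eq_intros simp: algebra_simps)
    show "\<bar>- e * v t * w t\<bar> \<le> \<kappa> * (B * R) * (B * S)"
      unfolding abs_mult using e bv[OF t] bw[OF t] \<kappa>0 B R S by (intro mult_mono) auto
  qed
  also have "\<dots> \<le> (\<kappa> * (B * R) * (B * S)) * L"
    using y \<kappa>0 B R S by (intro mult_left_mono) auto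
  also have "\<dots> = (\<kappa> * B\<^sup>2 * L) * (R * S)" by (simp add: power2_eq_square)
  also have "\<dots> \<le> \<rho> * (R * S)" using \<kappa>L R S by (intro mult_right_mono) auto
  finally have om2: "\<bar>v y2 * w' y2 - v' y2 * w y2\<bar> \<le> 2 * \<rho> * R * S"
    using om by (simp add: \<Omega>0_def)
  \<comment> \<open>Splits w = c v + d with d orthogonal to v at y. There |d| = |\<Omega>0| / R <=
    \<rho> S and |c| R >= (1 - \<rho>) S >= 7/8 S, and d is still below S / 4 at y2. This gives the
    growth factor 2 * 7/8 - 1/4 = 3/2.\<close>
  define c where "c = (v y * w y + v' y * w' y) / R\<^sup>2"
  define d where "d t = w t - c * v t" for t
  define d' where "d' t = w' t - c * v' t" for t
  have R2v: "R\<^sup>2 = (v y)\<^sup>2 + (v' y)\<^sup>2" and S2w: "S\<^sup>2 = (w y)\<^sup>2 + (w' y)\<^sup>2"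
    by (auto simp: R_def S_def complex_norm)
  have cR: "c * R\<^sup>2 = v y * w y + v' y * w' y" using R by (simp add: c_def)
  have id: "(c * R\<^sup>2)\<^sup>2 + \<Omega>0\<^sup>2 = R\<^sup>2 * S\<^sup>2"
    unfolding cR unfolding R2v S2w \<Omega>0_def by (simp add: power2_eq_square algebra_simps)
  have dy: "d y * R\<^sup>2 = - v' y * \<Omega>0" "d' y * R\<^sup>2 = v y * \<Omega>0"
  proof -
    have "d y * R\<^sup>2 = w y * R\<^sup>2 - (c * R\<^sup>2) * v y" by (simp add: d_def algebra_simps)
    then show "d y * R\<^sup>2 = - v' y * \<Omega>0" unfolding cR unfolding R2v \<Omega>0_def by (simp add: power2_eq_square algebra_simps)
    have "d' y * R\<^sup>2 = w' y * R\<^sup>2 - (c * R\<^sup>2) * v' y" by (simp add: d'_def algebra_simps)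
    then show "d' y * R\<^sup>2 = v y * \<Omega>0" unfolding cR unfolding R2v \<Omega>0_def by (simp add: power2_eq_square algebra_simps)
  qed
  have om_sq: "\<Omega>0\<^sup>2 \<le> (\<rho> * S)\<^sup>2 * R\<^sup>2"
  proof -
    have "\<Omega>0\<^sup>2 \<le> (\<rho> * R * S)\<^sup>2" using om \<rho>' R S by (subst abs_le_square_iff[symmetric]) auto
    then show ?thesis by (simp add: power_mult_distrib mult_ac)
  qed
  have dn: "(d y)\<^sup>2 + (d' y)\<^sup>2 \<le> (\<rho> * S)\<^sup>2"
  proof -
    have "((d y)\<^sup>2 + (d' y)\<^sup>2) * (R\<^sup>2)\<^sup>2 = (d y * R\<^sup>2)\<^sup>2 + (d' y * R\<^sup>2)\<^sup>2" by (simp add: power_mult_distrib algebra_simps)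
    also have "\<dots> = \<Omega>0\<^sup>2 * R\<^sup>2" unfolding dy unfolding R2v by (simp add: power2_eq_square algebra_simps)
    also have "\<dots> \<le> ((\<rho> * S)\<^sup>2 * R\<^sup>2) * R\<^sup>2" by (intro mult_right_mono om_sq) auto
    also have "\<dots> = (\<rho> * S)\<^sup>2 * (R\<^sup>2)\<^sup>2" by (simp add: power2_eq_square)
    finally show ?thesis using R by simp
  qed
  have cu: "\<bar>c\<bar> * R \<le> S"
  proof (rule power2_le_imp_le)
    have "(c * R\<^sup>2)\<^sup>2 \<le> R\<^sup>2 * S\<^sup>2" using id zero_le_power2[of \<Omega>0] by linarith
    then have "(\<bar>c\<bar> * R)\<^sup>2 * R\<^sup>2 \<le> S\<^sup>2 * R\<^sup>2" by (simp add: power_mult_distrib power2_eq_square mult_ac)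
    then show "(\<bar>c\<bar> * R)\<^sup>2 \<le> S\<^sup>2" using R by simp
  qed (rule S)
  have cl: "(1 - \<rho>) * S \<le> \<bar>c\<bar> * R"
  proof (rule power2_le_imp_le)
    have "(1 - \<rho>)\<^sup>2 \<le> 1 - \<rho>\<^sup>2" using \<rho>' by (simp add: power2_eq_square algebra_simps)
    then have "((1 - \<rho>) * S)\<^sup>2 \<le> (1 - \<rho>\<^sup>2) * S\<^sup>2" by (simp add: power_mult_distrib mult_right_mono)
    then have "((1 - \<rho>) * S)\<^sup>2 * R\<^sup>2 \<le> (1 - \<rho>\<^sup>2) * S\<^sup>2 * R\<^sup>2" by (intro mult_right_mono) auto
    also have "\<dots> = R\<^sup>2 * S\<^sup>2 - (\<rho> * S)\<^sup>2 * R\<^sup>2" by (simp add: algebra_simps power_mult_distrib)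
    also have "\<dots> \<le> (c * R\<^sup>2)\<^sup>2" using id om_sq by linarith
    also have "\<dots> = (\<bar>c\<bar> * R)\<^sup>2 * R\<^sup>2" by (simp add: power_mult_distrib power2_eq_square mult_ac)
    finally show "((1 - \<rho>) * S)\<^sup>2 \<le> (\<bar>c\<bar> * R)\<^sup>2" using R by simp
  qed (use R in auto)
  have "(d y2)\<^sup>2 + (d' y2)\<^sup>2 \<le> exp ((1 + (C + 2) + 1) * (y2 - y)) * ((d y)\<^sup>2 + (d' y)\<^sup>2 + (\<kappa> * B * S)\<^sup>2 / 1 * (y2 - y))"
  proof (rule sol_source_bound[OF y(1), where V = "\<lambda>t. U t - e" and s = "\<lambda>t. - e * (c * v t)"])
    fix t assume t: "y \<le> t" "t \<le> y2"
    show "(d has_real_derivative d' t) (at t)"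
      unfolding d_def d'_def using v w by (auto simp: sol_def intro!: derivative_eq_intros)
    show "(d' has_real_derivative (U t - e) * d t + - e * (c * v t)) (at t)"
      unfolding d_def d'_def using v w unfolding sol_def by (auto intro!: derivative_eq_intros simp: algebra_simps)
    show "\<bar>U t - e\<bar> \<le> C + 2" by (rule Ue)
    have "\<bar>c\<bar> * \<bar>v t\<bar> \<le> \<bar>c\<bar> * (B * R)" using bv[OF t] by (intro mult_left_mono) auto
    also have "\<dots> = B * (\<bar>c\<bar> * R)" by simp
    also have "\<dots> \<le> B * S" using cu B by (intro mult_left_mono) auto
    finally have "\<bar>e\<bar> * (\<bar>c\<bar> * \<bar>v t\<bar>) \<le> \<kappa> * (B * S)"
      by (rule mult_mono[OF e]) (use \<kappa>0 in auto)
    then show "\<bar>- e * (c * v t)\<bar> \<le> \<kappa> * B * S" by (simp add: abs_mult mult.assoc)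
  qed simp
  also have "\<dots> \<le> B * ((\<rho> * S)\<^sup>2 + (\<rho> * S)\<^sup>2)"
  proof (rule mult_mono)
    have "(1 + (C + 2) + 1) * (y2 - y) \<le> (C + 4) * L" using y C L by (intro mult_mono) auto
    then show "exp ((1 + (C + 2) + 1) * (y2 - y)) \<le> B" by (simp add: B_def)
    have "\<kappa> * B * S \<ge> 0" using \<kappa>0 B S by simp
    have "(\<kappa> * B * S)\<^sup>2 * (y2 - y) \<le> (\<kappa> * B * S)\<^sup>2 * (L + 1)\<^sup>2"
    proof (intro mult_left_mono)
      have "y2 - y \<le> (L + 1) * 1" using y by simp
      also have "\<dots> \<le> (L + 1)\<^sup>2" unfolding power2_eq_square using L by (intro mult_left_mono) auto
      finally show "y2 - y \<le> (L + 1)\<^sup>2" .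
    qed auto
    also have "\<dots> = ((\<kappa> * B * (L + 1)) * S)\<^sup>2" by (simp add: power_mult_distrib)
    also have "\<dots> \<le> (\<rho> * S)\<^sup>2"
    proof (intro power_mono mult_right_mono S)
      have "\<kappa> * (B * 1) * (L + 1) \<le> \<kappa> * (B * B) * (L + 1)"
        using \<kappa>0 B L by (intro mult_right_mono mult_left_mono) auto
      then show "\<kappa> * B * (L + 1) \<le> \<rho>" using \<kappa>B by (simp add: power2_eq_square)
    qed (use \<kappa>0 B L S in auto)
    finally show "(d y)\<^sup>2 + (d' y)\<^sup>2 + (\<kappa> * B * S)\<^sup>2 / 1 * (y2 - y) \<le> (\<rho> * S)\<^sup>2 + (\<rho> * S)\<^sup>2"
      using dn by simp
  qed (use B y in auto)
  also have "\<dots> = 2 * B * (\<rho> * S)\<^sup>2" by simp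
  also have "\<dots> \<le> (4 * (B * B)) * (\<rho> * S)\<^sup>2"
  proof (rule mult_right_mono)
    have "1 * B \<le> B * B" using B by (intro mult_right_mono) auto
    then show "2 * B \<le> 4 * (B * B)" using B by linarith
  qed simp
  also have "\<dots> = (2 * B * \<rho> * S)\<^sup>2" by (simp add: power_mult_distrib power2_eq_square)
  also have "2 * B * \<rho> = 1/4" using B by (simp add: \<rho>)
  finally have "(norm (Complex (d y2) (d' y2)))\<^sup>2 \<le> (1/4 * S)\<^sup>2" by (simp add: complex_norm)
  then have dS: "norm (Complex (d y2) (d' y2)) \<le> 1/4 * S" by (rule power2_le_imp_le) (use S in simp)
  have "Complex (w y2) (w' y2) = of_real c * Complex (v y2) (v' y2) + Complex (d y2) (d' y2)"
    by (simp add: d_def d'_def complex_eq_iff)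
  then have "norm (of_real c * Complex (v y2) (v' y2)) - norm (Complex (d y2) (d' y2)) \<le> S2"
    unfolding S2_def by (metis norm_diff_ineq)
  then have "\<bar>c\<bar> * R2 - 1/4 * S \<le> S2" using dS by (simp add: norm_mult R2_def)
  moreover have "\<bar>c\<bar> * (2 * R) \<le> \<bar>c\<bar> * R2" using R by (intro mult_left_mono) auto
  moreover have "7/8 * S \<le> (1 - \<rho>) * S" using \<rho>' S by (intro mult_right_mono) auto
  ultimately have S2: "3/2 * S \<le> S2" using cl by linarith
  then show "3/2 * norm (Complex (w y) (w' y)) \<le> norm (Complex (w y2) (w' y2))"
    by (simp add: S_def S2_def)
  have "(2 * R) * S \<le> R2 * S2" using R S S2 by (intro mult_mono) auto
  then have "\<rho> * (2 * R * S) \<le> \<rho> * (R2 * S2)" using \<rho>' by (intro mult_left_mono) auto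
  with om2 show "\<bar>v y2 * w' y2 - v' y2 * w y2\<bar> \<le> \<rho> * norm (Complex (v y2) (v' y2)) * norm (Complex (w y2) (w' y2))"
    by (simp add: R2_def S2_def mult.assoc mult.left_commute)
qed


text \<open>The order of quantifiers is the point: \<open>\<kappa>\<close> is fixed before the
  growth \<open>M\<close>. The steering is applied again and again to a normalized reference
  solution at e = 0, and by \<open>shadow_step\<close> the solutions at all energies within \<kappa>
  are dragged along.\<close>

lemma robust_growth:
  fixes C \<epsilon> :: real
  assumes C: "0 \<le> C" and \<epsilon>: "0 < \<epsilon>" "\<epsilon> \<le> 1"
  obtains \<kappa> where "0 < \<kappa>"
    "\<And>u x M. \<lbrakk>continuous_on UNIV u; \<And>t. \<bar>u t\<bar> \<le> C\<rbrakk> \<Longrightarrow>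
      \<exists>y W. x < y \<and> adm \<epsilon> x y W \<and> (\<forall>e w w'. \<bar>e\<bar> \<le> \<kappa> \<longrightarrow> sol (\<lambda>t. u t + W t - e) w w' \<longrightarrow> w x = 1 \<longrightarrow> w' x = 0 \<longrightarrow>
        M \<le> norm (Complex (w y) (w' y)))"
proof -
  obtain L where L: "0 < L"
    "\<And>u x a b. \<lbrakk>continuous_on UNIV u; \<And>t. \<bar>u t\<bar> \<le> C; a\<^sup>2 + b\<^sup>2 = 1\<rbrakk> \<Longrightarrow>
      \<exists>y W v v'. x < y \<and> y \<le> x + L \<and> adm \<epsilon> x y W \<and> sol (\<lambda>t. u t + W t) v v' \<and>
        v x = a \<and> v' x = b \<and> 4 \<le> (v y)\<^sup>2 + (v' y)\<^sup>2"
    by (rule steer_doubling[OF C \<epsilon>]) blast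
  define B where "B = exp ((C + 4) * L)"
  define \<rho> where "\<rho> = 1 / (8 * B)"
  define \<kappa> where "\<kappa> = \<rho> / (B\<^sup>2 * (L + 1))"
  have B: "0 < B" by (simp add: B_def)
  have \<kappa>: "0 < \<kappa>" using B L(1) by (simp add: \<kappa>_def \<rho>_def)
  show ?thesis
  proof (rule that[OF \<kappa>])
    fix u :: "real \<Rightarrow> real" and x M :: real
    assume cu: "continuous_on UNIV u" and bu: "\<And>t. \<bar>u t\<bar> \<le> C"
    have pot: "continuous_on UNIV (\<lambda>t. u t + W t - e)" "\<bar>u t + W t - e\<bar> \<le> C + 1 + \<bar>e\<bar>" if "adm \<epsilon> x y W" for e t W y
    proof -
      show "continuous_on UNIV (\<lambda>t. u t + W t - e)" using that cu by (auto simp: adm_def intro!: continuous_intros)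
      show "\<bar>u t + W t - e\<bar> \<le> C + 1 + \<bar>e\<bar>" using adm_bound[where u = u and t = t, OF that bu \<epsilon>(2)] by linarith
    qed
    have ind: "\<exists>y W v v'. x \<le> y \<and> adm \<epsilon> x y W \<and> sol (\<lambda>t. u t + W t) v v' \<and> v x = 1 \<and> v' x = 0 \<and>
       (\<forall>e w w'. \<bar>e\<bar> \<le> \<kappa> \<longrightarrow> sol (\<lambda>t. u t + W t - e) w w' \<longrightarrow> w x = 1 \<longrightarrow> w' x = 0 \<longrightarrow>
         (3/2) ^ n \<le> norm (Complex (w y) (w' y)) \<and>
         \<bar>v y * w' y - v' y * w y\<bar> \<le> \<rho> * norm (Complex (v y) (v' y)) * norm (Complex (w y) (w' y)))" for n
    proof (induction n)
      case 0
      have W: "adm \<epsilon> x x (\<lambda>_. 0)" using adm_zero \<epsilon> by simp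
      obtain v v' where "sol (\<lambda>t. u t + 0 - 0) v v'" "v x = 1" "v' x = 0"
        by (rule sol_exists[OF pot[OF W, where e = 0]])
      then show ?case using W B
        by (intro exI[of _ x] exI[of _ "\<lambda>_. 0"] exI[of _ v] exI[of _ v']) (auto simp: \<rho>_def complex_norm)
    next
      case (Suc n)
      then obtain y W v v' where y: "x \<le> y" and W: "adm \<epsilon> x y W" and v: "sol (\<lambda>t. u t + W t) v v'" "v x = 1" "v' x = 0"
        and IH: "\<And>e w w'. \<lbrakk>\<bar>e\<bar> \<le> \<kappa>; sol (\<lambda>t. u t + W t - e) w w'; w x = 1; w' x = 0\<rbrakk> \<Longrightarrow>
         (3/2) ^ n \<le> norm (Complex (w y) (w' y)) \<and>
         \<bar>v y * w' y - v' y * w y\<bar> \<le> \<rho> * norm (Complex (v y) (v' y)) * norm (Complex (w y) (w' y))"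
        by blast
      define R where "R = norm (Complex (v y) (v' y))"
      \<comment> \<open>The reference solution is itself the case e = 0 of the induction hypothesis;
        so it is nonzero and can be normalized.\<close>
      have "(3/2) ^ n \<le> R" using IH[of 0 v v'] v \<kappa> by (simp add: R_def)
      then have R: "0 < R" using less_le_trans[of 0 "(3/2 :: real) ^ n" R] by simp
      have "(v y / R)\<^sup>2 + (v' y / R)\<^sup>2 = ((v y)\<^sup>2 + (v' y)\<^sup>2) / R\<^sup>2" by (simp add: power_divide add_divide_distrib)
      also have "(v y)\<^sup>2 + (v' y)\<^sup>2 = R\<^sup>2" by (simp add: R_def complex_norm)
      finally have unit: "(v y / R)\<^sup>2 + (v' y / R)\<^sup>2 = 1" using R by simp
      obtain y2 W2 f f' where y2: "y < y2" "y2 \<le> y + L" and W2: "adm \<epsilon> y y2 W2" and f: "sol (\<lambda>t. u t + W2 t) f f'"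
        "f y = v y / R" "f' y = v' y / R" "4 \<le> (f y2)\<^sup>2 + (f' y2)\<^sup>2"
        using L(2)[OF cu bu unit, of y] by blast
      define W3 where "W3 t = W t + W2 t" for t
      have W3: "adm \<epsilon> x y2 W3" unfolding W3_def by (rule adm_add[OF W W2]) (use y y2 in auto)
      have first: "W3 t = W t" if "x \<le> t" "t \<le> y" for t using that W2 by (auto simp: W3_def adm_def)
      have second: "W3 t = W2 t" if "y \<le> t" "t \<le> y2" for t using that W by (auto simp: W3_def adm_def)
      have v0: "sol (\<lambda>t. u t + W t - 0) v v'" using v by simp
      obtain V V' where V: "sol (\<lambda>t. u t + W3 t - 0) V V'" "V x = v x" "V' x = v' x"
        "\<forall>t\<in>{x..y}. V t = v t \<and> V' t = v' t"
        by (rule sol_restart[OF pot[OF W3, where e = 0] pot(2)[OF W, where e = 0] v0, of x y]) (use first in simp)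
      then have Vs: "sol (\<lambda>t. u t + W3 t) V V'" by simp
      have Vy: "V y = v y" "V' y = v' y" using V(4) y by auto
      have bW3: "\<bar>u t + W3 t\<bar> \<le> C + 1" for t using pot(2)[OF W3, where e = 0 and t = t] by simp
      have RV: "2 * norm (Complex (V y) (V' y)) \<le> norm (Complex (V y2) (V' y2))"
      proof -
        have lc: "sol (\<lambda>t. u t + W2 t) (\<lambda>t. R * f t + 0 * f t) (\<lambda>t. R * f' t + 0 * f' t)"
          by (rule sol_lincomb[OF f(1) f(1)])
        have eqs: "V y2 = R * f y2" "V' y2 = R * f' y2"
          using sol_eq[OF Vs lc less_imp_le[OF y2(1)] bW3] second f R Vy by auto
        have "Complex (V y2) (V' y2) = of_real R * Complex (f y2) (f' y2)"
          by (simp add: eqs complex_eq_iff)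
        then have "norm (Complex (V y2) (V' y2)) = R * norm (Complex (f y2) (f' y2))"
          using R by (simp add: norm_mult)
        moreover have "2 \<le> norm (Complex (f y2) (f' y2))"
          using f(4) by (simp add: complex_norm real_le_rsqrt)
        ultimately show ?thesis unfolding Vy R_def[symmetric] using R by (simp add: mult.commute)
      qed
      have "(3/2) ^ Suc n \<le> norm (Complex (w y2) (w' y2)) \<and>
         \<bar>V y2 * w' y2 - V' y2 * w y2\<bar> \<le> \<rho> * norm (Complex (V y2) (V' y2)) * norm (Complex (w y2) (w' y2))"
        if e: "\<bar>e\<bar> \<le> \<kappa>" and w: "sol (\<lambda>t. u t + W3 t - e) w w'" "w x = 1" "w' x = 0" for e w w'
      proof -
        obtain w0 w0' where w0: "sol (\<lambda>t. u t + W t - e) w0 w0'" "w0 x = w x" "w0' x = w' x"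
          "\<forall>t\<in>{x..y}. w0 t = w t \<and> w0' t = w' t"
          by (rule sol_restart[OF pot[OF W, where e = e] pot(2)[OF W3, where e = e] w(1), of x y]) (use first in simp)
        have wy: "w0 y = w y" "w0' y = w' y" using w0(4) y by auto
        note I = IH[OF e w0(1) w0(2)[unfolded w] w0(3)[unfolded w], unfolded wy]
        have "3/2 * norm (Complex (w y) (w' y)) \<le> norm (Complex (w y2) (w' y2))"
          "\<bar>V y2 * w' y2 - V' y2 * w y2\<bar> \<le> \<rho> * norm (Complex (V y2) (V' y2)) * norm (Complex (w y2) (w' y2))"
          using shadow_step[OF bW3 Vs w(1) less_imp_le[OF y2(1)] y2(2) L(1) \<rho>_def[unfolded B_def] \<kappa>_def[unfolded B_def] e] I R RV
          unfolding Vy R_def by auto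
        then show ?thesis using I by simp
      qed
      then show ?case
        using y y2 W3 Vs V(2,3) v by (intro exI[of _ y2] exI[of _ W3] exI[of _ V] exI[of _ V']) auto
    qed
    \<comment> \<open>The 2 pushes the final norm above the initial norm 1 even if \<open>M\<close>
      is small, so the interval is not degenerate.\<close>
    obtain n where n: "max M 2 < (3/2 :: real) ^ n" using real_arch_pow[of "3/2" "max M 2"] by auto
    obtain y W v v' where y: "x \<le> y" and W: "adm \<epsilon> x y W"
      and g: "\<And>e w w'. \<lbrakk>\<bar>e\<bar> \<le> \<kappa>; sol (\<lambda>t. u t + W t - e) w w'; w x = 1; w' x = 0\<rbrakk> \<Longrightarrow>
         (3/2) ^ n \<le> norm (Complex (w y) (w' y))"
      using ind[of n] by blast
    have "x \<noteq> y"
    proof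
      assume xy: "x = y"
      obtain w w' where w: "sol (\<lambda>t. u t + W t - 0) w w'" "w x = 1" "w' x = 0" by (rule sol_exists[OF pot[OF W, where e = 0]])
      then have "(3/2) ^ n \<le> norm (Complex 1 0)" using g[of 0 w w'] \<kappa> xy by simp
      then show False using n by (simp add: complex_norm)
    qed
    then show "\<exists>y W. x < y \<and> adm \<epsilon> x y W \<and> (\<forall>e w w'. \<bar>e\<bar> \<le> \<kappa> \<longrightarrow> sol (\<lambda>t. u t + W t - e) w w' \<longrightarrow> w x = 1 \<longrightarrow> w' x = 0 \<longrightarrow>
        M \<le> norm (Complex (w y) (w' y)))"
      using y W g n by (intro exI[of _ y] exI[of _ W]) (fastforce intro: order_trans[of M "(3/2) ^ n"])
  qed
qed

text \<open>The growth demanded of a single energy is proportional to the number \<open>m\<close> of windows, so that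
  in the end the errors of all windows can be added up.\<close>

definition growth_windows :: "real \<Rightarrow> (real \<Rightarrow> real) \<Rightarrow> nat \<Rightarrow> (nat \<Rightarrow> real) \<Rightarrow> real \<Rightarrow> bool" where
  "growth_windows \<Lambda> U m y D \<longleftrightarrow> 0 < m \<and> (\<forall>j<m. y j < y (Suc j)) \<and> 1 \<le> D \<and>
     (\<forall>E. \<bar>E\<bar> \<le> \<Lambda> \<longrightarrow> (\<exists>j<m. \<exists>v v'. sol (\<lambda>x. U x - E) v v' \<and> norm (Complex (v (y j)) (v' (y j))) = 1 \<and>
        \<Lambda> * m \<le> norm (Complex (v (y (Suc j))) (v' (y (Suc j)))) \<and> (\<forall>x\<in>{y j..y (Suc j)}. \<bar>v x\<bar> \<le> D)))"

lemma increasing_nodes: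
  fixes y :: "nat \<Rightarrow> real"
  assumes "\<forall>j<m. y j < y (Suc j)" "i \<le> j" "j \<le> m"
  shows "y i \<le> y j"
  using assms(2,3)
proof (induction rule: dec_induct)
  case (step k)
  then show ?case using assms(1)[rule_format, of k] by simp
qed simp

text \<open>On consecutive intervals \<open>robust_growth\<close> is applied to u - e_j, where the
  e_j cover [-\<Lambda>, \<Lambda>] up to distance \<kappa>. As \<kappa> does not depend on the
  growth, the number \<open>m\<close> is known before the growth \<Lambda> * m is demanded.\<close>

lemma growth_windows_exist:
  fixes C \<epsilon> \<Lambda> :: real
  assumes C: "0 \<le> C" and \<epsilon>: "0 < \<epsilon>" "\<epsilon> \<le> 1" and \<Lambda>: "0 \<le> \<Lambda>"
    and cu: "continuous_on UNIV u" and bu: "\<And>t. \<bar>u t\<bar> \<le> C"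
  shows "\<exists>m y W D. y 0 = 0 \<and> adm \<epsilon> 0 (y m) W \<and> growth_windows \<Lambda> (\<lambda>t. u t + W t) m y D"
proof -
  have C\<Lambda>: "0 \<le> C + \<Lambda>" using C \<Lambda> by simp
  obtain \<kappa> where \<kappa>: "0 < \<kappa>"
    and grow: "\<And>u x M. \<lbrakk>continuous_on UNIV u; \<And>t. \<bar>u t\<bar> \<le> C + \<Lambda>\<rbrakk> \<Longrightarrow>
      \<exists>y W. x < y \<and> adm \<epsilon> x y W \<and> (\<forall>e w w'. \<bar>e\<bar> \<le> \<kappa> \<longrightarrow> sol (\<lambda>t. u t + W t - e) w w' \<longrightarrow> w x = 1 \<longrightarrow> w' x = 0 \<longrightarrow>
        M \<le> norm (Complex (w y) (w' y)))"
    by (rule robust_growth[OF C\<Lambda> \<epsilon>]) blast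
  define m where "m = nat \<lfloor>\<Lambda> / \<kappa>\<rfloor> + 1"
  \<comment> \<open>Cell centres, clamped at \<Lambda> so that every shifted potential obeys the
    bound C + \<Lambda> for which \<kappa> was obtained.\<close>
  define e where "e j = min \<Lambda> (- \<Lambda> + (2 * real j + 1) * \<kappa>)" for j :: nat
  have cover: "\<exists>j<m. \<bar>E - e j\<bar> \<le> \<kappa>" if "\<bar>E\<bar> \<le> \<Lambda>" for E
  proof -
    define q where "q = (E + \<Lambda>) / (2 * \<kappa>)"
    define j where "j = nat \<lfloor>q\<rfloor>"
    have q0: "0 \<le> q" using that \<kappa> by (auto simp: q_def)
    have "q \<le> \<Lambda> / \<kappa>" using that \<kappa> by (auto simp: q_def field_simps)
    then have "j < m" unfolding j_def m_def using nat_mono[OF floor_mono] by (metis Suc_eq_plus1 le_imp_less_Suc)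
    have j: "real j \<le> q" "q < real j + 1" using q0 by (auto simp: j_def)
    have E: "E = - \<Lambda> + q * (2 * \<kappa>)" using \<kappa> by (simp add: q_def)
    have "real j * (2 * \<kappa>) \<le> q * (2 * \<kappa>)" "q * (2 * \<kappa>) \<le> (real j + 1) * (2 * \<kappa>)"
      using j \<kappa> by (intro mult_right_mono; simp)+
    then have "\<bar>E - (- \<Lambda> + (2 * real j + 1) * \<kappa>)\<bar> \<le> \<kappa>"
      unfolding E by (simp add: algebra_simps)
    then have "\<bar>E - e j\<bar> \<le> \<kappa>" using that unfolding e_def by (simp add: min_def) linarith
    with \<open>j < m\<close> show ?thesis by blast
  qed
  have e\<Lambda>: "\<bar>e j\<bar> \<le> \<Lambda>" for j using \<Lambda> \<kappa> by (auto simp: e_def min_def abs_le_iff)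
  have ind: "\<exists>y W. y 0 = 0 \<and> (\<forall>j<k. y j < y (Suc j)) \<and> adm \<epsilon> 0 (y k) W \<and>
    (\<forall>j<k. \<forall>E w w'. \<bar>E - e j\<bar> \<le> \<kappa> \<longrightarrow> sol (\<lambda>t. u t + W t - E) w w' \<longrightarrow> w (y j) = 1 \<longrightarrow> w' (y j) = 0 \<longrightarrow>
       \<Lambda> * m \<le> norm (Complex (w (y (Suc j))) (w' (y (Suc j)))))" for k
  proof (induction k)
    case 0
    show ?case using adm_zero \<epsilon> by (intro exI[of _ "\<lambda>_. 0"]) auto
  next
    case (Suc k)
    then obtain y W where y0: "y 0 = 0" and y: "\<forall>j<k. y j < y (Suc j)" and W: "adm \<epsilon> 0 (y k) W"
      and g: "\<And>j E w w'. \<lbrakk>j < k; \<bar>E - e j\<bar> \<le> \<kappa>; sol (\<lambda>t. u t + W t - E) w w'; w (y j) = 1; w' (y j) = 0\<rbrakk> \<Longrightarrow>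
       \<Lambda> * m \<le> norm (Complex (w (y (Suc j))) (w' (y (Suc j))))" by blast
    have cue: "continuous_on UNIV (\<lambda>t. u t - e k)" using cu by (intro continuous_intros)
    have bue: "\<bar>u t - e k\<bar> \<le> C + \<Lambda>" for t using bu[of t] e\<Lambda>[of k] by linarith
    obtain z W2 where z: "y k < z" and W2: "adm \<epsilon> (y k) z W2"
      and g2: "\<And>d w w'. \<lbrakk>\<bar>d\<bar> \<le> \<kappa>; sol (\<lambda>t. (u t - e k) + W2 t - d) w w'; w (y k) = 1; w' (y k) = 0\<rbrakk> \<Longrightarrow>
        \<Lambda> * m \<le> norm (Complex (w z) (w' z))"
      using grow[OF cue bue, of "y k" "\<Lambda> * m"] by blast
    have yk0: "0 \<le> y k" using increasing_nodes[OF y, of 0 k] y0 by simp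
    define W3 where "W3 t = W t + W2 t" for t
    have W3: "adm \<epsilon> 0 z W3" unfolding W3_def by (rule adm_add[OF W W2]) (use yk0 z in auto)
    \<comment> \<open>One more node. The new perturbation vanishes on the earlier windows and the
      old one vanishes on the new window, so neither disturbs the growth of the other.\<close>
    define Y where "Y j = (if j \<le> k then y j else z)" for j
    have pot: "continuous_on UNIV (\<lambda>t. u t + A t - E)" "\<bar>u t + A t - E\<bar> \<le> C + 1 + \<bar>E\<bar>" if "adm \<epsilon> a b A" for A a b E t
    proof -
      show "continuous_on UNIV (\<lambda>t. u t + A t - E)" using that cu by (auto simp: adm_def intro!: continuous_intros)
      show "\<bar>u t + A t - E\<bar> \<le> C + 1 + \<bar>E\<bar>" using adm_bound[where u = u and t = t, OF that bu \<epsilon>(2)] by linarith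
    qed
    have G: "\<Lambda> * m \<le> norm (Complex (w (Y (Suc j))) (w' (Y (Suc j))))"
      if j: "j < Suc k" and E: "\<bar>E - e j\<bar> \<le> \<kappa>" and w: "sol (\<lambda>t. u t + W3 t - E) w w'" "w (Y j) = 1" "w' (Y j) = 0" for j E w w'
    proof (cases "j = k")
      case True
      have "W3 t = W2 t" if "y k \<le> t" for t using W that by (auto simp: W3_def adm_def)
      then have eq: "u t + W3 t - E = u t + W2 t - E" if "y k \<le> t" "t \<le> z" for t using that by simp
      obtain f f' where f: "sol (\<lambda>t. u t + W2 t - E) f f'" "f (y k) = w (y k)" "f' (y k) = w' (y k)"
        "\<forall>t\<in>{y k..z}. f t = w t \<and> f' t = w' t"
        by (rule sol_restart[OF pot[OF W2, where E = E] pot(2)[OF W3, where E = E] w(1) eq])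
      have "sol (\<lambda>t. (u t - e k) + W2 t - (E - e k)) f f'" using f(1) by (simp add: algebra_simps)
      from g2[OF _ this] have "\<Lambda> * m \<le> norm (Complex (f z) (f' z))" using E f w True by (simp add: Y_def)
      then show ?thesis using f(4) z True by (simp add: Y_def)
    next
      case False
      then have jk: "j < k" using j by simp
      have yy: "y (Suc j) \<le> y k" "y j < y (Suc j)" using increasing_nodes[OF y, of "Suc j" k] jk y by auto
      have "W3 t = W t" if "t \<le> y k" for t using W2 that by (auto simp: W3_def adm_def)
      then have eq: "u t + W3 t - E = u t + W t - E" if "y j \<le> t" "t \<le> y (Suc j)" for t using that yy by simp
      obtain f f' where f: "sol (\<lambda>t. u t + W t - E) f f'" "f (y j) = w (y j)" "f' (y j) = w' (y j)"
        "\<forall>t\<in>{y j..y (Suc j)}. f t = w t \<and> f' t = w' t"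
        by (rule sol_restart[OF pot[OF W, where E = E] pot(2)[OF W3, where E = E] w(1) eq])
      have "\<Lambda> * m \<le> norm (Complex (f (y (Suc j))) (f' (y (Suc j))))" using g[OF jk E f(1)] f w jk by (simp add: Y_def)
      then show ?thesis using f(4) yy jk by (simp add: Y_def)
    qed
    have "Y 0 = 0" "\<forall>j<Suc k. Y j < Y (Suc j)" using y0 y z by (auto simp: Y_def less_Suc_eq)
    moreover have "adm \<epsilon> 0 (Y (Suc k)) W3" using W3 by (simp add: Y_def)
    ultimately show ?case using G by blast
  qed
  obtain y W where y0: "y 0 = 0" and y: "\<forall>j<m. y j < y (Suc j)" and W: "adm \<epsilon> 0 (y m) W"
      and g: "\<And>j E w w'. \<lbrakk>j < m; \<bar>E - e j\<bar> \<le> \<kappa>; sol (\<lambda>t. u t + W t - E) w w'; w (y j) = 1; w' (y j) = 0\<rbrakk> \<Longrightarrow>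
       \<Lambda> * m \<le> norm (Complex (w (y (Suc j))) (w' (y (Suc j))))"
    using ind[of m] by blast
  \<comment> \<open>The largest factor by which a solution at an energy in [-\<Lambda>, \<Lambda>]
    can grow over all windows together.\<close>
  define D where "D = exp ((C + \<Lambda> + 1 + 2) * y m)"
  have ym: "0 \<le> y m" using increasing_nodes[OF y, of 0 m] y0 by simp
  have "growth_windows \<Lambda> (\<lambda>t. u t + W t) m y D"
    unfolding growth_windows_def
  proof (intro conjI allI impI)
    show "0 < m" by (simp add: m_def)
    show "y j < y (Suc j)" if "j < m" for j using y that by blast
    show "1 \<le> D" using C \<Lambda> ym by (simp add: D_def)
    fix E assume E: "\<bar>E\<bar> \<le> \<Lambda>"
    obtain j where j: "j < m" "\<bar>E - e j\<bar> \<le> \<kappa>" using cover[OF E] by blast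
    have pot: "continuous_on UNIV (\<lambda>t. u t + W t - E)" "\<bar>u t + W t - E\<bar> \<le> C + \<Lambda> + 1" for t
    proof -
      show "continuous_on UNIV (\<lambda>t. u t + W t - E)" using W cu by (auto simp: adm_def intro!: continuous_intros)
      show "\<bar>u t + W t - E\<bar> \<le> C + \<Lambda> + 1" using adm_bound[where u = u and t = t, OF W bu \<epsilon>(2)] E by linarith
    qed
    obtain v v' where v: "sol (\<lambda>t. u t + W t - E) v v'" "v (y j) = 1" "v' (y j) = 0" by (rule sol_exists[OF pot])
    have yy: "0 \<le> y j" "y (Suc j) \<le> y m"
      using increasing_nodes[OF y, of 0 j] increasing_nodes[OF y, of "Suc j" m] y0 j by auto
    have "\<bar>v x\<bar> \<le> D" if "x \<in> {y j..y (Suc j)}" for x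
    proof -
      have "norm (Complex (v x) (v' x)) \<le> D * norm (Complex (v (y j)) (v' (y j)))"
        unfolding D_def by (rule sol_bound_norm[OF v(1) _ _ pot(2)]) (use that yy in auto)
      then show ?thesis
        using abs_Re_le_cmod[of "Complex (v x) (v' x)", unfolded complex.sel] v by (simp add: complex_norm[of 1 0])
    qed
    then show "\<exists>j<m. \<exists>v v'. sol (\<lambda>x. u x + W x - E) v v' \<and> norm (Complex (v (y j)) (v' (y j))) = 1 \<and>
        \<Lambda> * m \<le> norm (Complex (v (y (Suc j))) (v' (y (Suc j)))) \<and> (\<forall>x\<in>{y j..y (Suc j)}. \<bar>v x\<bar> \<le> D)"
      using j v g[OF j v] by (intro exI[of _ j] conjI exI[of _ v] exI[of _ v']) (auto simp: complex_norm)
  qed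
  with y0 W show ?thesis by blast
qed


section \<open>Square-integrable functions\<close>

definition L2sq :: "(real \<Rightarrow> complex) \<Rightarrow> real" where
  "L2sq f = (LINT x|lborel. (cmod (f x))\<^sup>2)"

lemma L2sq_nonneg: "0 \<le> L2sq f"
  by (simp add: L2sq_def)

lemma square_integrable_sum:
  assumes "\<And>k. k \<in> A \<Longrightarrow> square_integrable (f k)"
  shows "square_integrable (\<lambda>x. \<Sum>k\<in>A. b k * f k x)"
proof -
  have 0: "square_integrable (\<lambda>_. 0)" by (simp add: square_integrable_def)
  show ?thesis using assms
  proof (induction A rule: infinite_finite_induct)
    case (insert a A)
    then have "square_integrable (\<lambda>x. b a * f a x + (\<Sum>k\<in>A. b k * f k x))"
      by (intro square_integrable_add square_integrable_cmult) auto
    then show ?case using insert by simp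
  qed (use 0 in auto)
qed

lemma of_real_L2sq: "(LINT x|lborel. cnj (f x) * f x) = complex_of_real (L2sq f)"
proof -
  have "(LINT x|lborel. cnj (f x) * f x) = (LINT x|lborel. complex_of_real ((cmod (f x))\<^sup>2))"
    by (simp only: complex_norm_square mult.commute)
  then show ?thesis unfolding L2sq_def by (simp only: integral_complex_of_real)
qed

lemma orthogonal_sum:
  fixes N :: nat
  assumes f: "\<And>k. k < N \<Longrightarrow> square_integrable (f k)"
    and o: "\<And>j k. \<lbrakk>j < N; k < N\<rbrakk> \<Longrightarrow> (LINT x|lborel. cnj (f j x) * f k x) = (if j = k then complex_of_real (w k) else 0)"
  shows "(LINT x|lborel. cnj (\<Sum>j<N. a j * f j x) * (\<Sum>k<N. b k * f k x)) = (\<Sum>k<N. cnj (a k) * b k * w k)"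
proof -
  have "(LINT x|lborel. cnj (\<Sum>j<N. a j * f j x) * (\<Sum>k<N. b k * f k x)) =
    (LINT x|lborel. (\<Sum>j<N. \<Sum>k<N. (cnj (a j) * b k) * (cnj (f j x) * f k x)))"
    unfolding cnj_sum sum_product by (intro Bochner_Integration.integral_cong refl sum.cong) (simp add: mult_ac)
  also have "\<dots> = (\<Sum>j<N. \<Sum>k<N. (cnj (a j) * b k) * (LINT x|lborel. cnj (f j x) * f k x))"
    by (subst Bochner_Integration.integral_sum, (intro Bochner_Integration.integrable_sum integrable_mult_right square_integrable_mult f; simp))
      (intro sum.cong refl, subst Bochner_Integration.integral_sum, (intro integrable_mult_right square_integrable_mult f; simp), simp)
  also have "\<dots> = (\<Sum>j<N. \<Sum>k<N. if j = k then cnj (a j) * b k * w k else 0)"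
    by (intro sum.cong refl) (auto simp: o)
  also have "\<dots> = (\<Sum>k<N. cnj (a k) * b k * w k)"
  proof (intro sum.cong refl)
    fix j assume "j \<in> {..<N}"
    then show "(\<Sum>k<N. if j = k then cnj (a j) * b k * complex_of_real (w k) else 0) = cnj (a j) * b j * w j"
      by (subst sum.delta') auto
  qed
  finally show ?thesis .
qed

lemma L2sq_orthogonal_sum:
  fixes N :: nat
  assumes f: "\<And>k. k < N \<Longrightarrow> square_integrable (f k)"
    and o: "\<And>j k. \<lbrakk>j < N; k < N\<rbrakk> \<Longrightarrow> (LINT x|lborel. cnj (f j x) * f k x) = (if j = k then complex_of_real (w k) else 0)"
  shows "L2sq (\<lambda>x. \<Sum>k<N. b k * f k x) = (\<Sum>k<N. (cmod (b k))\<^sup>2 * w k)"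
proof -
  have "complex_of_real (L2sq (\<lambda>x. \<Sum>k<N. b k * f k x)) = (\<Sum>k<N. cnj (b k) * b k * w k)"
    unfolding of_real_L2sq[symmetric] by (rule orthogonal_sum[OF assms])
  also have "\<dots> = complex_of_real (\<Sum>k<N. (cmod (b k))\<^sup>2 * w k)"
    by (simp add: complex_norm_square mult.commute[of "cnj _"] del: of_real_power)
  finally show ?thesis by (simp only: of_real_eq_iff)
qed

lemma square_integrable_set:
  assumes "square_integrable f" "A \<in> sets borel"
  shows "set_integrable lborel A (\<lambda>x. (cmod (f x))\<^sup>2)"
  using assms unfolding set_integrable_def square_integrable_def
  by (intro integrable_mult_indicator) auto

lemma integral_norm_sq_le_L2sq:
  assumes "square_integrable f"
  shows "integral {a..b} (\<lambda>x. (cmod (f x))\<^sup>2) \<le> L2sq f"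
proof -
  have "integral {a..b} (\<lambda>x. (cmod (f x))\<^sup>2) = (LINT x:{a..b}|lborel. (cmod (f x))\<^sup>2)"
    using set_borel_integral_eq_integral(2)[OF square_integrable_set[OF assms, of "{a..b}"]] by simp
  also have "\<dots> \<le> L2sq f"
    unfolding set_lebesgue_integral_def L2sq_def
    using assms square_integrable_set[OF assms, of "{a..b}"]
    by (intro integral_mono) (auto simp: set_integrable_def square_integrable_def indicator_def)
  finally show ?thesis .
qed

text \<open>Cauchy-Schwarz outside [a, b] in weighted additive form. The weight balances an
  \<open>f\<close> whose norm is of order 1 / \<delta> against a small tail of
  \<open>h\<close>.\<close>

lemma inner_outside_bound:
  assumes f: "square_integrable f" and h: "square_integrable h" and \<theta>: "0 < \<theta>"
  shows "cmod ((LINT x|lborel. cnj (f x) * h x) - integral {a..b} (\<lambda>x. cnj (f x) * h x))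
     \<le> (\<theta> * L2sq f + (L2sq h - integral {a..b} (\<lambda>x. (cmod (h x))\<^sup>2)) / \<theta>) / 2"
proof -
  note fh = square_integrable_mult[OF f h]
  have si: "set_integrable lborel {a..b} (\<lambda>x. cnj (f x) * h x)" "set_integrable lborel (-{a..b}) (\<lambda>x. cnj (f x) * h x)"
    using fh by (auto simp: set_integrable_def intro!: integrable_mult_indicator)
  have h2: "set_integrable lborel {a..b} (\<lambda>x. (cmod (h x))\<^sup>2)" "set_integrable lborel (-{a..b}) (\<lambda>x. (cmod (h x))\<^sup>2)"
    "set_integrable lborel (-{a..b}) (\<lambda>x. (cmod (f x))\<^sup>2)"
    using square_integrable_set[OF h] square_integrable_set[OF f] by auto
  have split: "(LINT x|lborel. g x) = (LINT x:{a..b}|lborel. g x) + (LINT x:-{a..b}|lborel. g x)"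
    if "set_integrable lborel {a..b} g" "set_integrable lborel (-{a..b}) g" for g :: "real \<Rightarrow> 'a::{banach,second_countable_topology}"
  proof -
    have "(LINT x:{a..b} \<union> -{a..b}|lborel. g x) = (LINT x:{a..b}|lborel. g x) + (LINT x:-{a..b}|lborel. g x)"
      by (rule set_integral_Un[OF _ that]) auto
    then show ?thesis by (simp add: Compl_partition set_lebesgue_integral_def)
  qed
  have 1: "(LINT x|lborel. cnj (f x) * h x) - integral {a..b} (\<lambda>x. cnj (f x) * h x) = (LINT x:-{a..b}|lborel. cnj (f x) * h x)"
    using split[OF si] set_borel_integral_eq_integral(2)[OF si(1)] by simp
  have 2: "L2sq h - integral {a..b} (\<lambda>x. (cmod (h x))\<^sup>2) = (LINT x:-{a..b}|lborel. (cmod (h x))\<^sup>2)"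
    using split[OF h2(1,2)] set_borel_integral_eq_integral(2)[OF h2(1)] by (simp add: L2sq_def)
  have 3: "(LINT x:-{a..b}|lborel. (cmod (f x))\<^sup>2) \<le> L2sq f"
    unfolding set_lebesgue_integral_def L2sq_def using f h2(3)
    by (intro integral_mono) (auto simp: set_integrable_def square_integrable_def indicator_def)
  have "cmod (LINT x:-{a..b}|lborel. cnj (f x) * h x) \<le> (LINT x:-{a..b}|lborel. norm (cnj (f x) * h x))"
    by (rule set_integral_norm_bound[OF si(2)])
  also have "\<dots> \<le> (LINT x:-{a..b}|lborel. \<theta>/2 * (cmod (f x))\<^sup>2 + 1/(2*\<theta>) * (cmod (h x))\<^sup>2)"
  proof (rule set_integral_mono)
    show "set_integrable lborel (-{a..b}) (\<lambda>x. norm (cnj (f x) * h x))"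
      using si(2) by (rule set_integrable_norm)
    show "set_integrable lborel (-{a..b}) (\<lambda>x. \<theta>/2 * (cmod (f x))\<^sup>2 + 1/(2*\<theta>) * (cmod (h x))\<^sup>2)"
      using h2 by (intro set_integral_add set_integrable_mult_right) auto
    fix x
    have "0 \<le> (\<theta> * cmod (f x) - cmod (h x))\<^sup>2 / (2 * \<theta>)" using \<theta> by simp
    then show "norm (cnj (f x) * h x) \<le> \<theta>/2 * (cmod (f x))\<^sup>2 + 1/(2*\<theta>) * (cmod (h x))\<^sup>2"
      using \<theta> by (simp add: norm_mult power2_eq_square field_simps)
  qed
  also have "\<dots> = \<theta>/2 * (LINT x:-{a..b}|lborel. (cmod (f x))\<^sup>2) + 1/(2*\<theta>) * (LINT x:-{a..b}|lborel. (cmod (h x))\<^sup>2)"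
    using h2 by (subst set_integral_add) (auto intro!: set_integrable_mult_right)
  also have "\<dots> \<le> \<theta>/2 * L2sq f + 1/(2*\<theta>) * (LINT x:-{a..b}|lborel. (cmod (h x))\<^sup>2)"
    using 3 \<theta> by (intro add_right_mono mult_left_mono) auto
  finally show ?thesis unfolding 1 2 using \<theta> by (simp add: field_simps)
qed

lemma cauchy_schwarz_interval:
  fixes f :: "real \<Rightarrow> real"
  assumes f: "continuous_on {a..b} f" and ab: "a \<le> b"
  shows "(integral {a..b} f)\<^sup>2 \<le> (b - a) * integral {a..b} (\<lambda>x. (f x)\<^sup>2)"
proof (cases "a = b")
  case False
  define L where "L = b - a"
  define I where "I = integral {a..b} f"
  have L: "0 < L" using ab False by (simp add: L_def)
  have int: "f integrable_on {a..b}" "(\<lambda>x. (f x)\<^sup>2) integrable_on {a..b}"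
    by (auto intro!: integrable_continuous_interval continuous_intros f)
  have "0 \<le> integral {a..b} (\<lambda>x. (L * f x - I)\<^sup>2)"
    by (intro integral_nonneg integrable_continuous_interval continuous_intros f) auto
  also have "integral {a..b} (\<lambda>x. (L * f x - I)\<^sup>2) = integral {a..b} (\<lambda>x. L\<^sup>2 * (f x)\<^sup>2 - 2 * L * I * f x + I\<^sup>2)"
    by (intro integral_cong) (simp add: power2_eq_square algebra_simps)
  also have "\<dots> = L\<^sup>2 * integral {a..b} (\<lambda>x. (f x)\<^sup>2) - 2 * L * I * I + I\<^sup>2 * L"
  proof -
    have "((\<lambda>x. L\<^sup>2 * (f x)\<^sup>2 - 2 * L * I * f x + I\<^sup>2) has_integral
       (L\<^sup>2 * integral {a..b} (\<lambda>x. (f x)\<^sup>2) - 2 * L * I * I + (b - a) *\<^sub>R I\<^sup>2)) {a..b}"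
      using has_integral_const_real[of "I\<^sup>2" a b] ab unfolding I_def
      by (intro has_integral_add has_integral_diff has_integral_mult_right integrable_integral int) auto
    then show ?thesis by (simp add: integral_unique L_def mult.commute)
  qed
  finally have "L * I\<^sup>2 \<le> L * (L * integral {a..b} (\<lambda>x. (f x)\<^sup>2))"
    by (simp add: power2_eq_square algebra_simps)
  then show ?thesis using L by (simp add: L_def I_def)
qed simp

text \<open>Integration by parts over [y, y + 1] against polynomials with a double zero at y + 1, so
  that only boundary terms at y survive. The weight (x - y) (x - y - 1)^2 isolates G y, and (x - y -
  1)^2 gives 2 G y + G' y up to sign. Cauchy-Schwarz on the unit interval turns the integrals into
  L2 norms.\<close>

lemma sobolev_pointwise:
  fixes G G' H :: "real \<Rightarrow> complex"
  assumes G: "\<And>x. (G has_vector_derivative G' x) (at x)" and G': "\<And>x. (G' has_vector_derivative H x) (at x)"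
    and cH: "continuous_on UNIV H" and sG: "square_integrable G" and sH: "square_integrable H"
  shows "(cmod (G y))\<^sup>2 \<le> 32 * (L2sq G + L2sq H)" "(cmod (G' y))\<^sup>2 \<le> 200 * (L2sq G + L2sq H)"
proof -
  have cG: "continuous_on UNIV G"
    using G by (auto simp: continuous_on_eq_continuous_at intro: has_vector_derivative_continuous)
  define A where "A = integral {y..y+1} (\<lambda>x. cmod (G x))"
  define B where "B = integral {y..y+1} (\<lambda>x. cmod (H x))"
  have contG: "continuous_on {y..y+1} (\<lambda>x. cmod (G x))" and contH: "continuous_on {y..y+1} (\<lambda>x. cmod (H x))"
    by (intro continuous_intros continuous_on_subset[OF cG] continuous_on_subset[OF cH]; simp)+
  have A2: "A\<^sup>2 \<le> L2sq G" and B2: "B\<^sup>2 \<le> L2sq H"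
    unfolding A_def B_def
    using cauchy_schwarz_interval[OF contG] integral_norm_sq_le_L2sq[OF sG, of y "y+1"]
      cauchy_schwarz_interval[OF contH] integral_norm_sq_le_L2sq[OF sH, of y "y+1"] by simp_all
  have AB: "0 \<le> A" "0 \<le> B" by (auto simp: A_def B_def intro!: integral_nonneg integrable_continuous_interval contG contH)
  have key: "cmod (w' y * G y - w y * G' y) \<le> 4 * A + B"
    if w: "\<And>x. (w has_real_derivative w' x) (at x)" and w': "\<And>x. (w' has_real_derivative w'' x) (at x)"
      and z: "w (y + 1) = 0" "w' (y + 1) = 0" and bw: "\<And>x. y \<le> x \<Longrightarrow> x \<le> y + 1 \<Longrightarrow> \<bar>w x\<bar> \<le> 1"
      and bw': "\<And>x. y \<le> x \<Longrightarrow> x \<le> y + 1 \<Longrightarrow> \<bar>w'' x\<bar> \<le> 4" for w w' w'' :: "real \<Rightarrow> real"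
  proof -
    have wv: "(w has_vector_derivative w' x) (at x)" "(w' has_vector_derivative w'' x) (at x)" for x
      using w w' by (auto simp: has_real_derivative_iff_has_vector_derivative)
    have d: "((\<lambda>x. w x *\<^sub>R G' x - w' x *\<^sub>R G x) has_vector_derivative (w x *\<^sub>R H x - w'' x *\<^sub>R G x)) (at x within {y..y+1})" for x
    proof -
      have "((\<lambda>x. w x *\<^sub>R G' x - w' x *\<^sub>R G x) has_vector_derivative
        ((w x *\<^sub>R H x + w' x *\<^sub>R G' x) - (w' x *\<^sub>R G' x + w'' x *\<^sub>R G x))) (at x)"
        by (intro has_vector_derivative_diff has_vector_derivative_scaleR G G' w w')
      then show ?thesis by (simp add: has_vector_derivative_at_within)
    qed
    have "((\<lambda>x. w x *\<^sub>R H x - w'' x *\<^sub>R G x) has_integral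
       ((w (y+1) *\<^sub>R G' (y+1) - w' (y+1) *\<^sub>R G (y+1)) - (w y *\<^sub>R G' y - w' y *\<^sub>R G y))) {y..y+1}"
      by (rule fundamental_theorem_of_calculus[OF _ d]) simp
    then have I: "((\<lambda>x. w x *\<^sub>R H x - w'' x *\<^sub>R G x) has_integral (w' y * G y - w y * G' y)) {y..y+1}"
      by (simp add: z scaleR_conv_of_real)
    have "cmod (w' y * G y - w y * G' y) \<le> integral {y..y+1} (\<lambda>x. cmod (H x) + 4 * cmod (G x))"
      unfolding integral_unique[OF I, symmetric]
    proof (rule integral_norm_bound_integral)
      show "(\<lambda>x. w x *\<^sub>R H x - w'' x *\<^sub>R G x) integrable_on {y..y+1}" using I by blast
      show "(\<lambda>x. cmod (H x) + 4 * cmod (G x)) integrable_on {y..y+1}"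
        by (intro integrable_continuous_interval continuous_intros contG contH)
      fix x assume x: "x \<in> {y..y+1}"
      have "cmod (w x *\<^sub>R H x - w'' x *\<^sub>R G x) \<le> \<bar>w x\<bar> * cmod (H x) + \<bar>w'' x\<bar> * cmod (G x)"
        by (rule order_trans[OF norm_triangle_ineq4]) simp
      also have "\<dots> \<le> 1 * cmod (H x) + 4 * cmod (G x)"
        using bw[of x] bw'[of x] x by (intro add_mono mult_right_mono) auto
      finally show "cmod (w x *\<^sub>R H x - w'' x *\<^sub>R G x) \<le> cmod (H x) + 4 * cmod (G x)" by simp
    qed
    also have "\<dots> = B + 4 * A"
      unfolding A_def B_def using contG contH
      by (subst integral_add) (auto intro!: integrable_continuous_interval continuous_intros)
    finally show ?thesis by simp
  qed
  have 1: "cmod (G y) \<le> 4 * A + B"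
  proof -
    have "cmod (of_real ((\<lambda>x. (x - y - 1)\<^sup>2 + 2 * (x - y) * (x - y - 1)) y) * G y - of_real ((\<lambda>x. (x - y) * (x - y - 1)\<^sup>2) y) * G' y) \<le> 4 * A + B"
    proof (rule key[where w = "\<lambda>x. (x - y) * (x - y - 1)\<^sup>2" and w' = "\<lambda>x. (x - y - 1)\<^sup>2 + 2 * (x - y) * (x - y - 1)" and w'' = "\<lambda>x. 4 * (x - y - 1) + 2 * (x - y)"])
      fix x
      show "((\<lambda>x. (x - y) * (x - y - 1)\<^sup>2) has_real_derivative (x - y - 1)\<^sup>2 + 2 * (x - y) * (x - y - 1)) (at x)"
        by (auto intro!: derivative_eq_intros simp: power2_eq_square algebra_simps)
      show "((\<lambda>x. (x - y - 1)\<^sup>2 + 2 * (x - y) * (x - y - 1)) has_real_derivative 4 * (x - y - 1) + 2 * (x - y)) (at x)"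
        by (auto intro!: derivative_eq_intros simp: power2_eq_square algebra_simps)
      assume x: "y \<le> x" "x \<le> y + 1"
      have "(x - y) * (x - y - 1)\<^sup>2 \<le> 1 * 1"
        using x by (intro mult_mono) (auto simp: abs_square_le_1 abs_le_iff)
      then show "\<bar>(x - y) * (x - y - 1)\<^sup>2\<bar> \<le> 1" using x by simp
      show "\<bar>4 * (x - y - 1) + 2 * (x - y)\<bar> \<le> 4" using x by (auto simp: abs_le_iff)
    qed auto
    then show ?thesis by simp
  qed
  have 2: "cmod (2 * G y + G' y) \<le> 4 * A + B"
  proof -
    have "cmod (of_real ((\<lambda>x. 2 * (x - y - 1)) y) * G y - of_real ((\<lambda>x. (x - y - 1)\<^sup>2) y) * G' y) \<le> 4 * A + B"
    proof (rule key[where w = "\<lambda>x. (x - y - 1)\<^sup>2" and w' = "\<lambda>x. 2 * (x - y - 1)" and w'' = "\<lambda>x. 2"])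
      fix x
      show "((\<lambda>x. (x - y - 1)\<^sup>2) has_real_derivative 2 * (x - y - 1)) (at x)"
        by (auto intro!: derivative_eq_intros)
      show "((\<lambda>x. 2 * (x - y - 1)) has_real_derivative 2) (at x)"
        by (auto intro!: derivative_eq_intros)
      assume x: "y \<le> x" "x \<le> y + 1"
      show "\<bar>(x - y - 1)\<^sup>2\<bar> \<le> 1" using x by (auto simp: abs_square_le_1 abs_le_iff)
    qed auto
    then have "cmod (- (2 * G y + G' y)) \<le> 4 * A + B" by simp
    then show ?thesis by (simp only: norm_minus_cancel)
  qed
  have 3: "cmod (G' y) \<le> 3 * (4 * A + B)"
  proof -
    have "G' y = (2 * G y + G' y) - 2 * G y" by simp
    then have "cmod (G' y) \<le> cmod (2 * G y + G' y) + cmod (2 * G y)" by (metis norm_triangle_ineq4)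
    then show ?thesis using 1 2 by (simp add: norm_mult)
  qed
  have AB2: "(4 * A + B)\<^sup>2 \<le> 20 * (L2sq G + L2sq H)"
  proof -
    have "0 \<le> (A - 2 * B)\<^sup>2" by simp
    then have "(4 * A + B)\<^sup>2 \<le> 18 * A\<^sup>2 + 9 * B\<^sup>2" by (simp add: power2_eq_square algebra_simps)
    also have "18 * A\<^sup>2 + 9 * B\<^sup>2 \<le> 20 * (L2sq G + L2sq H)"
    proof -
      have "18 * a + 9 * b \<le> 20 * (g + h)" if "a \<le> g" "b \<le> h" "0 \<le> g" "0 \<le> h" for a b g h :: real
        using that by (simp add: algebra_simps)
      then show ?thesis using A2 B2 L2sq_nonneg by blast
    qed
    finally show ?thesis .
  qed
  define T where "T = L2sq G + L2sq H"
  have T: "0 \<le> T" by (simp add: T_def L2sq_nonneg)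
  note AB2 = AB2[folded T_def]
  have "(cmod (G y))\<^sup>2 \<le> (4 * A + B)\<^sup>2" using 1 by (intro power_mono) auto
  also note AB2
  also have "20 * T \<le> 32 * T" using T by simp
  finally show "(cmod (G y))\<^sup>2 \<le> 32 * (L2sq G + L2sq H)" by (simp only: T_def)
  have "(cmod (G' y))\<^sup>2 \<le> (3 * (4 * A + B))\<^sup>2" using 3 by (intro power_mono) auto
  also have "\<dots> = 9 * (4 * A + B)\<^sup>2" by (simp only: power_mult_distrib) simp
  also have "\<dots> \<le> 9 * (20 * T)" using AB2 by simp
  also have "\<dots> \<le> 200 * T" using T by simp
  finally show "(cmod (G' y))\<^sup>2 \<le> 200 * (L2sq G + L2sq H)" by (simp only: T_def)
qed

section \<open>Fourier analysis on one period and the discrete resolvent\<close>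

text \<open>Over a full period P the oscillating factor returns to 1, so only the damping
  distinguishes the end points and the numerator does not depend on n.\<close>

lemma cis_integral:
  fixes \<delta> \<eta> P :: real and n :: int
  assumes \<delta>: "0 < \<delta>" and P: "P = 2 * pi / \<delta>" and nz: "\<eta> \<noteq> 0 \<or> n \<noteq> 0"
  shows "((\<lambda>t. of_real (exp (- \<eta> * t)) * cis (\<delta> * n * t)) has_integral
     (1 - of_real (exp (- \<eta> * P))) / (of_real \<eta> - \<i> * of_real (\<delta> * n))) {0..P}"
proof -
  define z where "z = - of_real \<eta> + \<i> * of_real (\<delta> * n)"
  have z: "z \<noteq> 0" using nz \<delta> by (auto simp: z_def complex_eq_iff)
  have e: "of_real (exp (- \<eta> * t)) * cis (\<delta> * n * t) = exp (z * of_real t)" for t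
    unfolding cis_conv_exp exp_of_real[symmetric] exp_add[symmetric] by (simp add: z_def algebra_simps)
  have d: "((\<lambda>t. exp (z * of_real t) / z) has_vector_derivative exp (z * of_real t)) (at t within {0..P})" for t
  proof -
    have "((\<lambda>w. exp (z * w) / z) has_field_derivative exp (z * of_real t)) (at (of_real t))"
      using z by (auto intro!: derivative_eq_intros)
    then show ?thesis by (rule has_vector_derivative_real_field)
  qed
  have "((\<lambda>t. exp (z * of_real t)) has_integral (exp (z * of_real P) / z - exp (z * of_real 0) / z)) {0..P}"
    using \<delta> by (intro fundamental_theorem_of_calculus d) (auto simp: P)
  moreover have "exp (z * of_real P) = of_real (exp (- \<eta> * P))"
  proof -
    have "\<delta> * n * P = 2 * pi * n" using \<delta> by (simp add: P)
    then have "cis (\<delta> * n * P) = cis (2 * pi * n)" by (simp only:)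
    also have "\<dots> = 1" by (rule cis_multiple_2pi) auto
    finally show ?thesis using e[of P] by simp
  qed
  moreover have "(w / z - exp (z * of_real 0) / z) = (1 - w) / (of_real \<eta> - \<i> * of_real (\<delta> * n))" for w
  proof -
    have "of_real \<eta> - \<i> * of_real (\<delta> * n) = - z" by (simp add: z_def)
    moreover have "w / z - exp (z * of_real 0) / z = (1 - w) / - z" using z by (simp add: field_simps)
    ultimately show ?thesis by (simp only:)
  qed
  ultimately show ?thesis unfolding e by simp
qed

lemma cis_orthogonal:
  fixes \<delta> P :: real and n :: int
  assumes \<delta>: "0 < \<delta>" and P: "P = 2 * pi / \<delta>"
  shows "((\<lambda>t. cis (\<delta> * n * t)) has_integral (if n = 0 then of_real P else 0)) {0..P}"
proof (cases "n = 0")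
  case True
  have "0 \<le> P" using \<delta> by (simp add: P)
  then show ?thesis using True has_integral_const_real[of "1::complex" 0 P] by (simp add: scaleR_conv_of_real)
next
  case False
  then show ?thesis using cis_integral[OF \<delta> P, of 0 n] by simp
qed

lemma parseval_finite:
  fixes \<delta> P :: real and N :: nat and a :: "nat \<Rightarrow> complex"
  assumes \<delta>: "0 < \<delta>" and P: "P = 2 * pi / \<delta>"
  shows "((\<lambda>t. (cmod (\<Sum>k<N. a k * cis (- \<delta> * k * t)))\<^sup>2) has_integral P * (\<Sum>k<N. (cmod (a k))\<^sup>2)) {0..P}"
proof -
  have 1: "((\<lambda>t. \<Sum>j<N. \<Sum>k<N. a j * cnj (a k) * cis (\<delta> * of_int (int k - int j) * t)) has_integral
     (\<Sum>j<N. \<Sum>k<N. a j * cnj (a k) * (if int k - int j = 0 then of_real P else 0))) {0..P}"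
    by (intro has_integral_sum has_integral_mult_right cis_orthogonal[OF \<delta> P]) auto
  have "of_real ((cmod (\<Sum>k<N. a k * cis (- \<delta> * k * t)))\<^sup>2) =
     (\<Sum>j<N. \<Sum>k<N. a j * cnj (a k) * cis (\<delta> * of_int (int k - int j) * t))" for t
  proof -
    have "of_real ((cmod (\<Sum>k<N. a k * cis (- \<delta> * k * t)))\<^sup>2) =
      (\<Sum>j<N. \<Sum>k<N. (a j * cis (- \<delta> * j * t)) * cnj (a k * cis (- \<delta> * k * t)))"
      unfolding complex_norm_square cnj_sum sum_product ..
    also have "\<dots> = (\<Sum>j<N. \<Sum>k<N. a j * cnj (a k) * cis (\<delta> * of_int (int k - int j) * t))"
    proof (intro sum.cong refl)
      fix j k :: nat
      have "cis (- \<delta> * j * t) * cis (\<delta> * k * t) = cis (\<delta> * of_int (int k - int j) * t)"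
        by (simp add: cis_mult algebra_simps)
      then show "(a j * cis (- \<delta> * j * t)) * cnj (a k * cis (- \<delta> * k * t)) = a j * cnj (a k) * cis (\<delta> * of_int (int k - int j) * t)"
        by (simp add: cis_cnj mult_ac)
    qed
    finally show ?thesis .
  qed
  moreover have "(\<Sum>j<N. \<Sum>k<N. a j * cnj (a k) * (if int k - int j = 0 then of_real P else 0)) = of_real (P * (\<Sum>k<N. (cmod (a k))\<^sup>2))"
  proof -
    have "(\<Sum>k<N. a j * cnj (a k) * (if int k - int j = 0 then of_real P else 0)) = of_real (P * (cmod (a j))\<^sup>2)" if "j < N" for j
    proof -
      have "(\<Sum>k<N. a j * cnj (a k) * (if int k - int j = 0 then of_real P else 0)) =
        (\<Sum>k<N. if k = j then a j * cnj (a j) * of_real P else 0)"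
        by (intro sum.cong refl) auto
      also have "\<dots> = a j * cnj (a j) * of_real P" using that by simp
      finally show ?thesis by (simp add: complex_norm_square del: of_real_power)
    qed
    then show ?thesis by (simp add: sum_distrib_left)
  qed
  ultimately have "((\<lambda>t. complex_of_real ((cmod (\<Sum>k<N. a k * cis (- \<delta> * k * t)))\<^sup>2)) has_integral
     of_real (P * (\<Sum>k<N. (cmod (a k))\<^sup>2))) {0..P}"
    using 1 by (simp only:)
  from has_integral_linear[OF this bounded_linear_Re] show ?thesis by (simp add: o_def)
qed

text \<open>Expands the nonnegative integral of |h - F / P|^2. The \<open>\<beta>\<close> are
  coefficients without the normalization 1 / P, which accounts for the factor P on the
  right.\<close>

lemma bessel_finite:
  fixes \<delta> P :: real and N :: nat and h :: "real \<Rightarrow> complex" and \<beta> :: "nat \<Rightarrow> complex"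
  assumes \<delta>: "0 < \<delta>" and P: "P = 2 * pi / \<delta>" and h: "continuous_on {0..P} h"
    and \<beta>: "\<And>l. l < N \<Longrightarrow> ((\<lambda>t. h t * cis (\<delta> * l * t)) has_integral \<beta> l) {0..P}"
  shows "(\<Sum>l<N. (cmod (\<beta> l))\<^sup>2) \<le> P * integral {0..P} (\<lambda>t. (cmod (h t))\<^sup>2)"
proof -
  have P0: "0 < P" using \<delta> by (simp add: P)
  define S where "S = (\<Sum>l<N. (cmod (\<beta> l))\<^sup>2)"
  define F where "F t = (\<Sum>l<N. \<beta> l * cis (- \<delta> * l * t))" for t
  have cF: "continuous_on A F" for A
    unfolding F_def cis_conv_exp by (intro continuous_intros)
  have hF: "((\<lambda>t. h t * cnj (F t)) has_integral of_real S) {0..P}"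
  proof -
    have "((\<lambda>t. \<Sum>l<N. cnj (\<beta> l) * (h t * cis (\<delta> * l * t))) has_integral (\<Sum>l<N. cnj (\<beta> l) * \<beta> l)) {0..P}"
      by (intro has_integral_sum has_integral_mult_right \<beta>) auto
    moreover have "(\<Sum>l<N. cnj (\<beta> l) * (h t * cis (\<delta> * l * t))) = h t * cnj (F t)" for t
      by (simp add: F_def cnj_sum sum_distrib_left cis_cnj mult_ac)
    moreover have "(\<Sum>l<N. cnj (\<beta> l) * \<beta> l) = of_real S"
      unfolding S_def of_real_sum by (intro sum.cong refl) (simp only: complex_norm_square mult.commute)
    ultimately show ?thesis by simp
  qed
  have hFr: "((\<lambda>t. Re (h t * cnj (F t))) has_integral S) {0..P}"
    using has_integral_linear[OF hF bounded_linear_Re] by (simp add: o_def)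
  have FF: "((\<lambda>t. (cmod (F t))\<^sup>2) has_integral P * S) {0..P}"
    unfolding F_def S_def by (rule parseval_finite[OF \<delta> P])
  have hh: "((\<lambda>t. (cmod (h t))\<^sup>2) has_integral integral {0..P} (\<lambda>t. (cmod (h t))\<^sup>2)) {0..P}"
    by (intro integrable_integral integrable_continuous_interval continuous_intros h)
  have "((\<lambda>t. (cmod (h t))\<^sup>2 - 2 / P * Re (h t * cnj (F t)) + 1 / P\<^sup>2 * (cmod (F t))\<^sup>2) has_integral
     (integral {0..P} (\<lambda>t. (cmod (h t))\<^sup>2) - 2 / P * S + 1 / P\<^sup>2 * (P * S))) {0..P}"
    by (intro has_integral_add has_integral_diff has_integral_mult_right hFr FF hh)
  moreover have "(cmod (h t))\<^sup>2 - 2 / P * Re (h t * cnj (F t)) + 1 / P\<^sup>2 * (cmod (F t))\<^sup>2 \<ge> 0" for t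
  proof -
    have "0 \<le> (cmod (h t - of_real (1 / P) * F t))\<^sup>2" by simp
    also have "\<dots> = (cmod (h t))\<^sup>2 + (cmod (of_real (1 / P) * F t))\<^sup>2 - 2 * Re (h t * cnj (of_real (1 / P) * F t))"
    proof -
      have "(cmod (x - y))\<^sup>2 = (cmod x)\<^sup>2 + (cmod y)\<^sup>2 - 2 * Re (x * cnj y)" for x y
        unfolding cmod_power2 by (simp add: power2_eq_square algebra_simps)
      then show ?thesis .
    qed
    also have "\<dots> = (cmod (h t))\<^sup>2 - 2 / P * Re (h t * cnj (F t)) + 1 / P\<^sup>2 * (cmod (F t))\<^sup>2"
      by (simp add: norm_mult power_mult_distrib power_divide norm_divide field_simps)
    finally show ?thesis .
  qed
  ultimately have "0 \<le> integral {0..P} (\<lambda>t. (cmod (h t))\<^sup>2) - 2 / P * S + 1 / P\<^sup>2 * (P * S)"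
    by (rule has_integral_nonneg)
  also have "\<dots> = integral {0..P} (\<lambda>t. (cmod (h t))\<^sup>2) - S / P" using P0 by (simp add: power2_eq_square)
  finally show ?thesis using P0 by (simp add: S_def field_simps)
qed

text \<open>The kernel $1 / (x - i \eta)$ is $i \int_0^\infty e^{- i x t - \eta t}\, dt$. On the lattice $\delta \mathbb{Z}$
  the exponentials have period $2 \pi / \delta$, so the integral folds onto one period, where Bessel's
  inequality applies.\<close>

lemma discrete_resolvent_bound:
  fixes \<delta> \<eta> :: real and N :: nat and a :: "nat \<Rightarrow> complex"
  assumes \<delta>: "0 < \<delta>" and \<eta>: "\<delta> \<le> \<eta>"
  shows "(\<Sum>l<N. (cmod (\<Sum>k<N. a k / (of_real (\<delta> * (real k - real l)) - \<i> * of_real \<eta>)))\<^sup>2)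
     \<le> 16 * pi\<^sup>2 / \<delta>\<^sup>2 * (\<Sum>k<N. (cmod (a k))\<^sup>2)"
proof -
  define P where "P = 2 * pi / \<delta>"
  have P0: "0 < P" using \<delta> by (simp add: P_def)
  have \<eta>0: "0 < \<eta>" using \<delta> \<eta> by simp
  define q where "q = exp (- \<eta> * P)"
  \<comment> \<open>From \<delta> <= \<eta> the damping exponent over one period is at least 2 pi,
    so q <= 1/2, and the factor 1 / (1 - q) caused by folding all periods into one is at most
    2.\<close>
  have "1 \<le> 2 * pi" using pi_gt3 by simp
  also have "\<dots> = \<delta> * P" using \<delta> by (simp add: P_def)
  also have "\<dots> \<le> \<eta> * P" using \<eta> P0 by simp
  finally have "q \<le> exp (- 1)" by (simp add: q_def)
  also have "\<dots> \<le> 1 / 2" using exp_ge_add_one_self[of 1] by (simp add: exp_minus field_simps)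
  finally have q: "q \<le> 1 / 2" .
  define h where "h t = of_real (exp (- \<eta> * t)) * (\<Sum>k<N. a k * cis (- \<delta> * k * t))" for t
  define b where "b l = (\<Sum>k<N. a k / (of_real (\<delta> * (real k - real l)) - \<i> * of_real \<eta>))" for l :: nat
  have ch: "continuous_on A h" for A
    unfolding h_def cis_conv_exp by (intro continuous_intros)
  have trm: "((\<lambda>t. h t * cis (\<delta> * l * t)) has_integral (- \<i> * of_real (1 - q) * b l)) {0..P}" for l :: nat
  proof -
    have "((\<lambda>t. \<Sum>k<N. a k * (of_real (exp (- \<eta> * t)) * cis (\<delta> * of_int (int l - int k) * t))) has_integral
      (\<Sum>k<N. a k * ((1 - of_real (exp (- \<eta> * P))) / (of_real \<eta> - \<i> * of_real (\<delta> * of_int (int l - int k)))))) {0..P}"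
      using \<eta>0 by (intro has_integral_sum has_integral_mult_right cis_integral[OF \<delta> P_def]) auto
    moreover have "(\<Sum>k<N. a k * (of_real (exp (- \<eta> * t)) * cis (\<delta> * of_int (int l - int k) * t))) = h t * cis (\<delta> * l * t)" for t
    proof -
      have "cis (\<delta> * of_int (int l - int k) * t) = cis (- \<delta> * k * t) * cis (\<delta> * l * t)" for k
        by (simp add: cis_mult algebra_simps)
      then show ?thesis unfolding h_def sum_distrib_left sum_distrib_right
        by (intro sum.cong refl) (simp add: mult_ac)
    qed
    moreover have "(\<Sum>k<N. a k * ((1 - of_real (exp (- \<eta> * P))) / (of_real \<eta> - \<i> * of_real (\<delta> * of_int (int l - int k))))) = - \<i> * of_real (1 - q) * b l"
      unfolding b_def sum_distrib_left
    proof (intro sum.cong refl)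
      fix k
      define w where "w = complex_of_real (\<delta> * (real k - real l)) - \<i> * of_real \<eta>"
      have w: "w \<noteq> 0" using \<eta>0 by (auto simp: w_def complex_eq_iff)
      have "of_real \<eta> - \<i> * of_real (\<delta> * of_int (int l - int k)) = \<i> * w"
        by (simp add: w_def algebra_simps)
      then show "a k * ((1 - of_real (exp (- \<eta> * P))) / (of_real \<eta> - \<i> * of_real (\<delta> * of_int (int l - int k)))) =
        - \<i> * of_real (1 - q) * (a k / (of_real (\<delta> * (real k - real l)) - \<i> * of_real \<eta>))"
        unfolding w_def[symmetric] q_def using w by (simp add: field_simps)
    qed
    ultimately show ?thesis by simp
  qed
  have "(\<Sum>l<N. (cmod (- \<i> * of_real (1 - q) * b l))\<^sup>2) \<le> P * integral {0..P} (\<lambda>t. (cmod (h t))\<^sup>2)"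
    by (rule bessel_finite[OF \<delta> P_def ch trm])
  also have "\<dots> \<le> P * integral {0..P} (\<lambda>t. (cmod (\<Sum>k<N. a k * cis (- \<delta> * k * t)))\<^sup>2)"
  proof (intro mult_left_mono integral_le)
    show "(\<lambda>t. (cmod (h t))\<^sup>2) integrable_on {0..P}" by (intro integrable_continuous_interval continuous_intros ch)
    show "(\<lambda>t. (cmod (\<Sum>k<N. a k * cis (- \<delta> * k * t)))\<^sup>2) integrable_on {0..P}"
      using parseval_finite[OF \<delta> P_def] by blast
    fix t assume t: "t \<in> {0..P}"
    have "cmod (h t) \<le> 1 * cmod (\<Sum>k<N. a k * cis (- \<delta> * k * t))"
      unfolding h_def norm_mult using t \<eta>0 by (intro mult_right_mono) auto
    then show "(cmod (h t))\<^sup>2 \<le> (cmod (\<Sum>k<N. a k * cis (- \<delta> * k * t)))\<^sup>2" by (intro power_mono) auto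
  qed (use P0 in auto)
  also have "\<dots> = P * (P * (\<Sum>k<N. (cmod (a k))\<^sup>2))"
    using integral_unique[OF parseval_finite[OF \<delta> P_def, where N = N and a = a]] by simp
  finally have bess: "(\<Sum>l<N. (cmod (- \<i> * of_real (1 - q) * b l))\<^sup>2) \<le> P * (P * (\<Sum>k<N. (cmod (a k))\<^sup>2))" .
  have "(1 - q)\<^sup>2 * (\<Sum>l<N. (cmod (b l))\<^sup>2) \<le> P\<^sup>2 * (\<Sum>k<N. (cmod (a k))\<^sup>2)"
  proof -
    have "cmod (- \<i> * of_real (1 - q) * b l) = (1 - q) * cmod (b l)" for l
      unfolding norm_mult norm_of_real using q by simp
    then show ?thesis using bess by (simp add: power_mult_distrib sum_distrib_left power2_eq_square mult_ac)
  qed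
  moreover have "(1/2)\<^sup>2 * (\<Sum>l<N. (cmod (b l))\<^sup>2) \<le> (1 - q)\<^sup>2 * (\<Sum>l<N. (cmod (b l))\<^sup>2)"
    using q by (intro mult_right_mono power_mono sum_nonneg) auto
  ultimately have "(\<Sum>l<N. (cmod (b l))\<^sup>2) \<le> 4 * P\<^sup>2 * (\<Sum>k<N. (cmod (a k))\<^sup>2)"
    by (simp add: power2_eq_square)
  then show ?thesis by (simp add: b_def P_def power_divide power2_eq_square mult_ac)
qed


section \<open>Wave packets and their flux\<close>

lemma power2_sum3_le:
  fixes a b c :: real
  shows "(a + b + c)\<^sup>2 \<le> 3 * (a\<^sup>2 + b\<^sup>2 + c\<^sup>2)"
proof -
  have "0 \<le> (a - b)\<^sup>2 + (b - c)\<^sup>2 + (a - c)\<^sup>2" by simp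
  then show ?thesis by (simp add: power2_eq_square algebra_simps)
qed

lemma cmod_sum3_sq_le: "(cmod (u + v + w))\<^sup>2 \<le> 3 * ((cmod u)\<^sup>2 + (cmod v)\<^sup>2 + (cmod w)\<^sup>2)"
proof -
  have "cmod (u + v + w) \<le> cmod u + cmod v + cmod w"
    by (meson add_right_mono norm_triangle_ineq order_trans)
  then have "(cmod (u + v + w))\<^sup>2 \<le> (cmod u + cmod v + cmod w)\<^sup>2" by (intro power_mono) auto
  then show ?thesis using power2_sum3_le[of "cmod u" "cmod v" "cmod w"] by linarith
qed

lemma L2sq_mono_cont:
  assumes "square_integrable f" "F \<in> borel_measurable lborel" "\<And>x. (cmod (F x))\<^sup>2 \<le> K * (cmod (f x))\<^sup>2"
  shows "square_integrable F"
proof -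
  have "integrable lborel (\<lambda>x. (cmod (F x))\<^sup>2)"
  proof (rule Bochner_Integration.integrable_bound)
    show "integrable lborel (\<lambda>x. K * (cmod (f x))\<^sup>2)"
      using assms(1) by (auto simp: square_integrable_def)
    show "(\<lambda>x. (cmod (F x))\<^sup>2) \<in> borel_measurable lborel" using assms(2) by measurable
    show "AE x in lborel. norm ((cmod (F x))\<^sup>2) \<le> norm (K * (cmod (f x))\<^sup>2)"
    proof (rule AE_I2)
      fix x
      have "(cmod (F x))\<^sup>2 \<le> K * (cmod (f x))\<^sup>2" by (rule assms(3))
      then show "norm ((cmod (F x))\<^sup>2) \<le> norm (K * (cmod (f x))\<^sup>2)" by simp
    qed
  qed
  with assms(2) show ?thesis by (simp add: square_integrable_def)
qed

text \<open>A vector with spectral support in [-n0, n0), cut into N energy cells of length \<delta>.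
  \<open>g k\<close> is its part in cell k, \<open>\<rho> k\<close> the defect of \<open>g k\<close>
  as an eigenfunction at the left end of the cell, and \<open>\<gamma> k\<close>, \<open>r k\<close>
  are their squared norms. Absolute continuity is present as
  \<open>\<gamma> k \<le> c * \<delta>\<close>.\<close>

locale packets =
  fixes V :: "real \<Rightarrow> real" and C n0 \<delta> \<eta> c :: real and N :: nat
    and g g' \<rho> :: "nat \<Rightarrow> real \<Rightarrow> complex" and \<gamma> r :: "nat \<Rightarrow> real"
  assumes cV: "continuous_on UNIV V" and bV: "\<And>x. \<bar>V x\<bar> \<le> C"
    and n0: "0 < n0" and N: "0 < N" and \<delta>: "\<delta> = 2 * n0 / N" and \<delta>\<eta>: "\<delta> \<le> \<eta>" and \<eta>: "\<eta> \<le> n0" and \<delta>1: "\<delta> \<le> 1"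
    and g: "\<And>k x. (g k has_vector_derivative g' k x) (at x)"
    and g': "\<And>k x. (g' k has_vector_derivative (of_real (V x - (- n0 + \<delta> * k)) * g k x - \<rho> k x)) (at x)"
    and c\<rho>: "\<And>k. continuous_on UNIV (\<rho> k)"
    and sg: "\<And>k. square_integrable (g k)" and s\<rho>: "\<And>k. square_integrable (\<rho> k)"
    and og: "\<And>j k. (LINT x|lborel. cnj (g j x) * g k x) = (if j = k then complex_of_real (\<gamma> k) else 0)"
    and o\<rho>: "\<And>j k. (LINT x|lborel. cnj (\<rho> j x) * \<rho> k x) = (if j = k then complex_of_real (r k) else 0)"
    and r\<gamma>: "\<And>k. r k \<le> \<delta>\<^sup>2 * \<gamma> k" and \<gamma>c: "\<And>k. \<gamma> k \<le> c * \<delta>"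
begin

text \<open>\<open>res l k\<close> is 1 / (E k - E l - i \<eta>), so \<open>G l\<close> approximates
  the resolvent at E l + i \<eta> applied to \<open>\<phi>\<close>. As the \<open>g k\<close> are
  not exact eigenfunctions, (H - E l) G l exceeds \<phi> + i \<eta> G l by \<open>\<tau>\<close>;
  the whole source is \<open>s\<close>.\<close>

definition "E k = - n0 + \<delta> * real k"
definition "res l k = 1 / (complex_of_real (\<delta> * (real k - real l)) - \<i> * of_real \<eta>)"
definition "\<phi> x = (\<Sum>k<N. g k x)"
definition "G l x = (\<Sum>k<N. res l k * g k x)"
definition "G' l x = (\<Sum>k<N. res l k * g' k x)"
definition "\<tau> l x = (\<Sum>k<N. res l k * \<rho> k x)"
definition "s l x = \<phi> x + \<i> * of_real \<eta> * G l x + \<tau> l x"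
definition "\<Gamma> = (\<Sum>k<N. \<gamma> k)"
text \<open>\<open>K1\<close> combines the Sobolev constant 200 with the bound for the second
  derivative of a packet. \<open>B2 / \<delta>\<close> will bound the sum over l of |G l|^2 at any
  point; the 16 pi^2 is that of \<open>discrete_resolvent_bound\<close>.\<close>

definition "K1 = 200 * (1 + 3 * (C\<^sup>2 + n0\<^sup>2 + 1))"
definition "B2 = 16 * pi\<^sup>2 * K1 * c"

lemma \<delta>0: "0 < \<delta>" using n0 N by (simp add: \<delta>)
lemma \<eta>0: "0 < \<eta>" using \<delta>0 \<delta>\<eta> by simp
lemma N\<delta>: "real N * \<delta> = 2 * n0" using N by (simp add: \<delta>)

lemma \<gamma>0: "0 \<le> \<gamma> k"
proof -
  have "complex_of_real (L2sq (g k)) = of_real (\<gamma> k)" using og[of k k] of_real_L2sq[of "g k"] by simp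
  then show ?thesis using L2sq_nonneg[of "g k"] by simp
qed

lemma c0: "0 \<le> c"
proof -
  have "0 \<le> c * \<delta>" using \<gamma>0[of 0] \<gamma>c[of 0] by linarith
  then show ?thesis using \<delta>0 by (simp add: zero_le_mult_iff)
qed

lemma cont: "continuous_on A (g k)" "continuous_on A (g' k)" "continuous_on A (\<rho> k)" "continuous_on A V"
proof -
  have "continuous_on UNIV (g k)" "continuous_on UNIV (g' k)"
    by (intro continuous_at_imp_continuous_on ballI has_vector_derivative_continuous[OF g] has_vector_derivative_continuous[OF g'])+
  with c\<rho> cV show "continuous_on A (g k)" "continuous_on A (g' k)" "continuous_on A (\<rho> k)" "continuous_on A V"
    by (auto intro: continuous_on_subset)
qed

lemma cont2: "continuous_on A \<phi>" "continuous_on A (G l)" "continuous_on A (G' l)" "continuous_on A (\<tau> l)" "continuous_on A (s l)"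
proof -
  show 1: "continuous_on A \<phi>" "continuous_on A (G l)" "continuous_on A (G' l)" "continuous_on A (\<tau> l)"
    unfolding \<phi>_def[abs_def] G_def[abs_def] G'_def[abs_def] \<tau>_def[abs_def] by (intro continuous_intros cont)+
  then show "continuous_on A (s l)" unfolding s_def[abs_def] by (intro continuous_intros)
qed

lemma L2sq_g_sum: "L2sq (\<lambda>x. \<Sum>k<N. b k * g k x) = (\<Sum>k<N. (cmod (b k))\<^sup>2 * \<gamma> k)"
  by (rule L2sq_orthogonal_sum[OF sg og])

lemma L2sq_\<rho>_sum: "L2sq (\<lambda>x. \<Sum>k<N. b k * \<rho> k x) \<le> \<delta>\<^sup>2 * (\<Sum>k<N. (cmod (b k))\<^sup>2 * \<gamma> k)"
proof -
  have "L2sq (\<lambda>x. \<Sum>k<N. b k * \<rho> k x) = (\<Sum>k<N. (cmod (b k))\<^sup>2 * r k)"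
    by (rule L2sq_orthogonal_sum[OF s\<rho> o\<rho>])
  also have "\<dots> \<le> (\<Sum>k<N. (cmod (b k))\<^sup>2 * (\<delta>\<^sup>2 * \<gamma> k))"
    by (intro sum_mono mult_left_mono r\<gamma>) auto
  also have "\<dots> = \<delta>\<^sup>2 * (\<Sum>k<N. (cmod (b k))\<^sup>2 * \<gamma> k)" by (simp add: sum_distrib_left mult_ac)
  finally show ?thesis .
qed

lemma sq_sums: "square_integrable (\<lambda>x. \<Sum>k<N. b k * g k x)" "square_integrable (\<lambda>x. \<Sum>k<N. b k * \<rho> k x)"
  by (intro square_integrable_sum sg s\<rho>)+

text \<open>The second derivative of a packet is V times the packet, minus the packet with
  coefficients b k * E k, minus the sum of the b k * \<rho> k. Orthogonality and |E k| <= n0 bound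
  all three by the norm of the packet, and the Sobolev estimate yields point values.\<close>

lemma pointwise_sum:
  "(cmod (\<Sum>k<N. b k * g k y))\<^sup>2 \<le> K1 * (\<Sum>k<N. (cmod (b k))\<^sup>2 * \<gamma> k)"
  "(cmod (\<Sum>k<N. b k * g' k y))\<^sup>2 \<le> K1 * (\<Sum>k<N. (cmod (b k))\<^sup>2 * \<gamma> k)"
proof -
  define F where "F x = (\<Sum>k<N. b k * g k x)" for x
  define F' where "F' x = (\<Sum>k<N. b k * g' k x)" for x
  define F1 where "F1 x = (\<Sum>k<N. (b k * of_real (- E k)) * g k x)" for x
  define F2 where "F2 x = (\<Sum>k<N. (- b k) * \<rho> k x)" for x
  define H where "H x = of_real (V x) * F x + F1 x + F2 x" for x
  define S where "S = (\<Sum>k<N. (cmod (b k))\<^sup>2 * \<gamma> k)"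
  have S0: "0 \<le> S" unfolding S_def by (intro sum_nonneg mult_nonneg_nonneg \<gamma>0) auto
  have C0: "0 \<le> C" using bV[of 0] by linarith
  have sF: "square_integrable F" and s1: "square_integrable F1" and s2: "square_integrable F2"
    unfolding F_def F1_def F2_def by (rule sq_sums)+
  have sV: "square_integrable (\<lambda>x. of_real (V x) * F x)"
  proof (rule L2sq_mono_cont[OF sF])
    have "continuous_on UNIV (\<lambda>x. of_real (V x) * F x)"
      unfolding F_def by (intro continuous_intros cont)
    then show "(\<lambda>x. of_real (V x) * F x) \<in> borel_measurable lborel" by (simp add: borel_measurable_continuous_onI)
    show "(cmod (of_real (V x) * F x))\<^sup>2 \<le> C\<^sup>2 * (cmod (F x))\<^sup>2" for x
      unfolding norm_mult power_mult_distrib norm_of_real using bV[of x] C0 by (intro mult_right_mono power_mono) auto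
  qed
  have sH: "square_integrable H"
    unfolding H_def[abs_def] by (intro square_integrable_add sV s1 s2)
  have LF: "L2sq F = S" unfolding F_def S_def by (rule L2sq_g_sum)
  have LF1: "L2sq F1 \<le> n0\<^sup>2 * S"
  proof -
    have "L2sq F1 = (\<Sum>k<N. (cmod (b k * of_real (- E k)))\<^sup>2 * \<gamma> k)" unfolding F1_def by (rule L2sq_g_sum)
    also have "\<dots> \<le> (\<Sum>k<N. n0\<^sup>2 * ((cmod (b k))\<^sup>2 * \<gamma> k))"
    proof (intro sum_mono)
      fix k assume "k \<in> {..<N}"
      then have "\<delta> * real k \<le> \<delta> * N" using \<delta>0 by (intro mult_left_mono) auto
      also have "\<dots> = 2 * n0" using N\<delta> by (simp add: mult.commute)
      finally have "\<delta> * real k \<le> 2 * n0" .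
      moreover have "0 \<le> \<delta> * real k" using \<delta>0 by simp
      ultimately have "\<bar>E k\<bar> \<le> n0" unfolding E_def by linarith
      then have "(E k)\<^sup>2 \<le> n0\<^sup>2" using n0 by (simp add: abs_le_square_iff[symmetric])
      then have "(E k)\<^sup>2 * ((cmod (b k))\<^sup>2 * \<gamma> k) \<le> n0\<^sup>2 * ((cmod (b k))\<^sup>2 * \<gamma> k)"
        by (intro mult_right_mono mult_nonneg_nonneg \<gamma>0) auto
      then show "(cmod (b k * of_real (- E k)))\<^sup>2 * \<gamma> k \<le> n0\<^sup>2 * ((cmod (b k))\<^sup>2 * \<gamma> k)"
        by (simp add: norm_mult power_mult_distrib mult_ac)
    qed
    finally show ?thesis by (simp add: S_def sum_distrib_left)
  qed
  have LF2: "L2sq F2 \<le> 1 * S"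
  proof -
    have "L2sq F2 \<le> \<delta>\<^sup>2 * (\<Sum>k<N. (cmod (- b k))\<^sup>2 * \<gamma> k)" unfolding F2_def by (rule L2sq_\<rho>_sum)
    also have "\<dots> \<le> 1 * S" unfolding S_def norm_minus_cancel
      using \<delta>0 \<delta>1 S0 by (intro mult_right_mono) (auto simp: power_le_one S_def)
    finally show ?thesis .
  qed
  have LH: "L2sq H \<le> 3 * (C\<^sup>2 * S + n0\<^sup>2 * S + 1 * S)"
  proof -
    have "L2sq H \<le> (LINT x|lborel. 3 * (C\<^sup>2 * (cmod (F x))\<^sup>2 + (cmod (F1 x))\<^sup>2 + (cmod (F2 x))\<^sup>2))"
      unfolding L2sq_def
    proof (rule integral_mono)
      show "integrable lborel (\<lambda>x. (cmod (H x))\<^sup>2)" using sH by (simp add: square_integrable_def)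
      show "integrable lborel (\<lambda>x. 3 * (C\<^sup>2 * (cmod (F x))\<^sup>2 + (cmod (F1 x))\<^sup>2 + (cmod (F2 x))\<^sup>2))"
        using sF s1 s2 unfolding square_integrable_def by (intro integrable_mult_right Bochner_Integration.integrable_add) auto
      fix x
      have "(cmod (of_real (V x) * F x))\<^sup>2 \<le> C\<^sup>2 * (cmod (F x))\<^sup>2"
        unfolding norm_mult power_mult_distrib norm_of_real using bV[of x] C0 by (intro mult_right_mono power_mono) auto
      then show "(cmod (H x))\<^sup>2 \<le> 3 * (C\<^sup>2 * (cmod (F x))\<^sup>2 + (cmod (F1 x))\<^sup>2 + (cmod (F2 x))\<^sup>2)"
        unfolding H_def using cmod_sum3_sq_le[of "of_real (V x) * F x" "F1 x" "F2 x"] by simp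
    qed
    also have "\<dots> = 3 * (C\<^sup>2 * L2sq F + L2sq F1 + L2sq F2)"
      using sF s1 s2 unfolding square_integrable_def L2sq_def by simp
    finally show ?thesis using LF LF1 LF2 by simp
  qed
  have dF: "(F has_vector_derivative F' x) (at x)" for x
    unfolding F_def F'_def by (intro has_vector_derivative_sum has_vector_derivative_mult_right g)
  have dF': "(F' has_vector_derivative H x) (at x)" for x
  proof -
    have "(F' has_vector_derivative (\<Sum>k<N. b k * (of_real (V x - (- n0 + \<delta> * k)) * g k x - \<rho> k x))) (at x)"
      unfolding F'_def by (intro has_vector_derivative_sum has_vector_derivative_mult_right g')
    also have "(\<Sum>k<N. b k * (of_real (V x - (- n0 + \<delta> * k)) * g k x - \<rho> k x)) = H x"
      unfolding H_def F_def F1_def F2_def E_def sum_distrib_left sum.distrib[symmetric]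
      by (intro sum.cong refl) (simp add: algebra_simps)
    finally show ?thesis .
  qed
  have cH: "continuous_on UNIV H"
    unfolding H_def F_def F1_def F2_def by (intro continuous_intros cont)
  note sob = sobolev_pointwise[OF dF dF' cH sF sH]
  have T: "L2sq F + L2sq H \<le> (1 + 3 * (C\<^sup>2 + n0\<^sup>2 + 1)) * S" using LF LH by (simp add: algebra_simps)
  have T0: "0 \<le> L2sq F + L2sq H" using L2sq_nonneg by (simp add: add_nonneg_nonneg)
  have fin: "x \<le> K1 * S" if "x \<le> a * (L2sq F + L2sq H)" "0 \<le> a" "a \<le> 200" for x a
  proof -
    have "a * (L2sq F + L2sq H) \<le> 200 * ((1 + 3 * (C\<^sup>2 + n0\<^sup>2 + 1)) * S)"
      using that T T0 by (intro mult_mono) auto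
    from order_trans[OF that(1) this] show ?thesis by (simp only: K1_def mult.assoc)
  qed
  show "(cmod (\<Sum>k<N. b k * g k y))\<^sup>2 \<le> K1 * (\<Sum>k<N. (cmod (b k))\<^sup>2 * \<gamma> k)"
    using fin[OF sob(1)] by (simp add: F_def S_def)
  show "(cmod (\<Sum>k<N. b k * g' k y))\<^sup>2 \<le> K1 * (\<Sum>k<N. (cmod (b k))\<^sup>2 * \<gamma> k)"
    using fin[OF sob(2)] by (simp add: F'_def S_def)
qed

lemma K1_pos: "0 < K1"
  unfolding K1_def by (intro mult_pos_pos add_pos_nonneg mult_nonneg_nonneg add_nonneg_nonneg) auto

text \<open>Evaluation at a point is a bounded functional on packets; this is its Bessel inequality.\<close>

lemma dual_bound:
  fixes z :: "nat \<Rightarrow> complex"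
  assumes "\<And>b. (cmod (\<Sum>k<N. b k * z k))\<^sup>2 \<le> K1 * (\<Sum>k<N. (cmod (b k))\<^sup>2 * \<gamma> k)"
  shows "(\<Sum>k<N. (cmod (z k))\<^sup>2) \<le> K1 * (c * \<delta>)"
proof -
  define S where "S = (\<Sum>k<N. (cmod (z k))\<^sup>2)"
  have S0: "0 \<le> S" by (simp add: S_def sum_nonneg)
  have "(\<Sum>k<N. cnj (z k) * z k) = of_real S"
    unfolding S_def of_real_sum by (intro sum.cong refl) (simp only: complex_norm_square mult.commute)
  \<comment> \<open>The extremal coefficients b = cnj z turn the functional into its own squared
    norm.\<close>
  then have "S\<^sup>2 \<le> K1 * (\<Sum>k<N. (cmod (cnj (z k)))\<^sup>2 * \<gamma> k)"
    using assms[of "\<lambda>k. cnj (z k)"] by simp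
  also have "\<dots> \<le> K1 * (\<Sum>k<N. (cmod (z k))\<^sup>2 * (c * \<delta>))"
    using K1_pos by (intro mult_left_mono sum_mono) (auto intro: mult_left_mono \<gamma>c)
  also have "\<dots> = (K1 * (c * \<delta>)) * S" by (simp add: S_def sum_distrib_right[symmetric])
  finally have "S * S \<le> (K1 * (c * \<delta>)) * S" by (simp add: power2_eq_square)
  then show ?thesis
    using S0 K1_pos c0 \<delta>0 unfolding S_def[symmetric] by (cases "S = 0") auto
qed

text \<open>Absolute continuity at work: because of \<gamma> k <= c \<delta>, the point values of
  the \<open>g k\<close> have a square sum of order \<delta>, and the resolvent matrix has norm at
  most 4 pi / \<delta>. Hence \<delta> times these sums stays bounded, uniformly in \<delta> <=
  \<eta>.\<close>

lemma sum_G_sq: "(\<Sum>l<N. (cmod (G l y))\<^sup>2) \<le> B2 / \<delta>" "(\<Sum>l<N. (cmod (G' l y))\<^sup>2) \<le> B2 / \<delta>"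
proof -
  have *: "(\<Sum>l<N. (cmod (\<Sum>k<N. res l k * z k))\<^sup>2) \<le> B2 / \<delta>"
    if "(\<Sum>k<N. (cmod (z k))\<^sup>2) \<le> K1 * (c * \<delta>)" for z
  proof -
    have "(\<Sum>l<N. (cmod (\<Sum>k<N. res l k * z k))\<^sup>2) \<le> 16 * pi\<^sup>2 / \<delta>\<^sup>2 * (\<Sum>k<N. (cmod (z k))\<^sup>2)"
      using discrete_resolvent_bound[OF \<delta>0 \<delta>\<eta>, where N = N and a = z] by (simp add: res_def)
    also have "\<dots> \<le> 16 * pi\<^sup>2 / \<delta>\<^sup>2 * (K1 * (c * \<delta>))" by (intro mult_left_mono that) auto
    also have "\<dots> = B2 / \<delta>" using \<delta>0 by (simp add: B2_def power2_eq_square)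
    finally show ?thesis .
  qed
  show "(\<Sum>l<N. (cmod (G l y))\<^sup>2) \<le> B2 / \<delta>" "(\<Sum>l<N. (cmod (G' l y))\<^sup>2) \<le> B2 / \<delta>"
    unfolding G_def G'_def by (intro * dual_bound pointwise_sum)+
qed

lemma cmod_res: "cmod (res l k) \<le> 1 / \<eta>" "- Im (cnj (res l k)) = \<eta> / ((\<delta> * (real k - real l))\<^sup>2 + \<eta>\<^sup>2)"
proof -
  define w where "w = complex_of_real (\<delta> * (real k - real l)) - \<i> * of_real \<eta>"
  have "\<eta> \<le> cmod w" using abs_Im_le_cmod[of w] \<eta>0 by (simp add: w_def)
  then have "cmod (1 / w) \<le> 1 / \<eta>" using \<eta>0 by (simp add: norm_divide frac_le)
  then show "cmod (res l k) \<le> 1 / \<eta>" by (simp only: res_def w_def)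
  have "Re w = \<delta> * (real k - real l)" "Im w = - \<eta>" by (auto simp: w_def)
  then have "Im (1 / w) = \<eta> / ((\<delta> * (real k - real l))\<^sup>2 + \<eta>\<^sup>2)" by (simp add: Im_divide)
  then show "- Im (cnj (res l k)) = \<eta> / ((\<delta> * (real k - real l))\<^sup>2 + \<eta>\<^sup>2)"
    by (simp only: res_def w_def cnj.sel minus_minus)
qed

lemma res_sq_sum: "(\<Sum>k<N. (cmod (res l k))\<^sup>2 * \<gamma> k) \<le> \<Gamma> / \<eta>\<^sup>2"
proof -
  have "(\<Sum>k<N. (cmod (res l k))\<^sup>2 * \<gamma> k) \<le> (\<Sum>k<N. (1 / \<eta>)\<^sup>2 * \<gamma> k)"
    by (intro sum_mono mult_right_mono power_mono cmod_res \<gamma>0) auto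
  then show ?thesis by (simp add: \<Gamma>_def sum_divide_distrib power_divide)
qed

lemma L2sq_\<phi>: "L2sq \<phi> = \<Gamma>" and sq_\<phi>: "square_integrable \<phi>"
  using L2sq_g_sum[of "\<lambda>_. 1"] sq_sums(1)[of "\<lambda>_. 1"] by (simp_all add: \<phi>_def[abs_def] \<Gamma>_def)

lemma L2sq_G: "L2sq (G l) \<le> \<Gamma> / \<eta>\<^sup>2" and sq_G: "square_integrable (G l)"
  unfolding G_def[abs_def] using sq_sums(1) L2sq_g_sum res_sq_sum by auto

lemma L2sq_\<tau>: "L2sq (\<tau> l) \<le> (\<delta> / \<eta>)\<^sup>2 * \<Gamma>" and sq_\<tau>: "square_integrable (\<tau> l)"
proof -
  have "L2sq (\<tau> l) \<le> \<delta>\<^sup>2 * (\<Sum>k<N. (cmod (res l k))\<^sup>2 * \<gamma> k)"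
    unfolding \<tau>_def[abs_def] by (rule L2sq_\<rho>_sum)
  also have "\<dots> \<le> \<delta>\<^sup>2 * (\<Gamma> / \<eta>\<^sup>2)" by (intro mult_left_mono res_sq_sum) auto
  finally show "L2sq (\<tau> l) \<le> (\<delta> / \<eta>)\<^sup>2 * \<Gamma>" by (simp add: power_divide)
  show "square_integrable (\<tau> l)" unfolding \<tau>_def[abs_def] by (rule sq_sums)
qed

lemma dG: "(G l has_vector_derivative G' l x) (at x)"
  unfolding G_def[abs_def] G'_def by (intro has_vector_derivative_sum has_vector_derivative_mult_right g)

lemma dG': "(G' l has_vector_derivative (of_real (V x - E l) * G l x - s l x)) (at x)"
proof -
  have "(G' l has_vector_derivative (\<Sum>k<N. res l k * (of_real (V x - (- n0 + \<delta> * k)) * g k x - \<rho> k x))) (at x)"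
    unfolding G'_def[abs_def] by (intro has_vector_derivative_sum has_vector_derivative_mult_right g')
  also have "(\<Sum>k<N. res l k * (of_real (V x - (- n0 + \<delta> * k)) * g k x - \<rho> k x)) = of_real (V x - E l) * G l x - s l x"
  proof -
    have "res l k * (of_real (V x - (- n0 + \<delta> * k)) * z - w) =
       of_real (V x - E l) * (res l k * z) - (z + \<i> * of_real \<eta> * (res l k * z) + res l k * w)" for k z w
    proof -
      define d where "d = complex_of_real (\<delta> * (real k - real l)) - \<i> * of_real \<eta>"
      have "d \<noteq> 0" using \<eta>0 by (auto simp: d_def complex_eq_iff)
      then have "res l k * d = 1" by (simp add: res_def d_def)
      then have z: "res l k * d * z = z" by simp
      \<comment> \<open>E k = E l + d + i \<eta> with d the denominator of \<open>res l k\<close>.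
        The product of \<open>res l k\<close> and d is 1, and this is what produces \<phi> in the
        source.\<close>
      have e: "of_real (V x - (- n0 + \<delta> * k)) = of_real (V x - E l) - d - \<i> * of_real \<eta>"
        by (simp add: E_def d_def algebra_simps)
      have "res l k * ((A - d - \<i> * of_real \<eta>) * z - w) =
         A * (res l k * z) - (res l k * d * z + \<i> * of_real \<eta> * (res l k * z) + res l k * w)" for A
        by (simp add: algebra_simps)
      then show ?thesis unfolding e z .
    qed
    then show ?thesis unfolding s_def G_def \<phi>_def \<tau>_def sum_distrib_left sum.distrib[symmetric] sum_subtractf[symmetric]
      by (intro sum.cong refl)
  qed
  finally show ?thesis .
qed

end

section \<open>The flux identity\<close>

lemma product_le_weighted:
  fixes a b \<theta> :: real
  assumes "0 < \<theta>"
  shows "a * b \<le> (\<theta> * a\<^sup>2 + b\<^sup>2 / \<theta>) / 2"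
proof -
  have "0 \<le> (\<theta> * a - b)\<^sup>2 / (2 * \<theta>)" using assms by simp
  then show ?thesis using assms by (simp add: power2_eq_square field_simps)
qed

lemma cmod_real_combination:
  "cmod (of_real p * z - of_real q * w) \<le> norm (Complex p q) * sqrt ((cmod z)\<^sup>2 + (cmod w)\<^sup>2)"
  "cmod (of_real p * z + of_real q * w) \<le> norm (Complex p q) * sqrt ((cmod z)\<^sup>2 + (cmod w)\<^sup>2)"
proof -
  have *: "\<bar>p\<bar> * cmod z + \<bar>q\<bar> * cmod w \<le> norm (Complex p q) * sqrt ((cmod z)\<^sup>2 + (cmod w)\<^sup>2)"
  proof (rule power2_le_imp_le)
    have "0 \<le> (\<bar>p\<bar> * cmod w - \<bar>q\<bar> * cmod z)\<^sup>2" by simp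
    moreover have "(norm (Complex p q) * sqrt ((cmod z)\<^sup>2 + (cmod w)\<^sup>2))\<^sup>2 = (\<bar>p\<bar>\<^sup>2 + \<bar>q\<bar>\<^sup>2) * ((cmod z)\<^sup>2 + (cmod w)\<^sup>2)"
      by (simp add: power_mult_distrib complex_norm)
    ultimately show "(\<bar>p\<bar> * cmod z + \<bar>q\<bar> * cmod w)\<^sup>2 \<le> (norm (Complex p q) * sqrt ((cmod z)\<^sup>2 + (cmod w)\<^sup>2))\<^sup>2"
      by (simp only:) (simp add: power2_eq_square algebra_simps del: abs_mult_self_eq)
  qed simp
  show "cmod (of_real p * z - of_real q * w) \<le> norm (Complex p q) * sqrt ((cmod z)\<^sup>2 + (cmod w)\<^sup>2)"
    using norm_triangle_ineq4[of "of_real p * z" "of_real q * w"] * by (simp add: norm_mult)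
  show "cmod (of_real p * z + of_real q * w) \<le> norm (Complex p q) * sqrt ((cmod z)\<^sup>2 + (cmod w)\<^sup>2)"
    using norm_triangle_ineq[of "of_real p * z" "of_real q * w"] * by (simp add: norm_mult)
qed

context packets
begin

text \<open>The probability current of \<open>G l\<close>. For an exact solution at a real energy it
  would be constant; only the source changes it.\<close>

definition "J l x = Im (cnj (G l x) * G' l x)"

lemma dJ: "(J l has_vector_derivative - Im (cnj (G l x) * s l x)) (at x)"
proof -
  have 1: "((\<lambda>x. cnj (G l x) * G' l x) has_vector_derivative
      (cnj (G l x) * (of_real (V x - E l) * G l x - s l x) + cnj (G' l x) * G' l x)) (at x)"
    by (intro has_vector_derivative_mult dG dG' has_vector_derivative_cnj)
  have "(J l has_vector_derivative Im (cnj (G l x) * (of_real (V x - E l) * G l x - s l x) + cnj (G' l x) * G' l x)) (at x)"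
    unfolding J_def[abs_def] by (rule bounded_linear.has_vector_derivative[OF bounded_linear_Im 1])
  also have "Im (cnj (G l x) * (of_real (V x - E l) * G l x - s l x) + cnj (G' l x) * G' l x) = - Im (cnj (G l x) * s l x)"
    by (simp add: algebra_simps)
  finally show ?thesis .
qed

lemma flux_integral:
  assumes "a \<le> b"
  shows "((\<lambda>x. - Im (cnj (G l x) * s l x)) has_integral (J l b - J l a)) {a..b}"
  using assms dJ by (intro fundamental_theorem_of_calculus) (auto intro: has_vector_derivative_at_within)

lemma flux_change:
  assumes ab: "A \<le> a" "a \<le> B" "A \<le> b" "b \<le> B"
  shows "\<bar>J l a - J l b\<bar> \<le> integral {A..B} (\<lambda>x. cmod (G l x) * cmod (s l x))"
proof -
  have int: "(\<lambda>x. cmod (G l x) * cmod (s l x)) integrable_on {x..z}" for x z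
    by (intro integrable_continuous_interval continuous_intros cont2)
  have *: "\<bar>J l z - J l x\<bar> \<le> integral {A..B} (\<lambda>x. cmod (G l x) * cmod (s l x))" if "A \<le> x" "x \<le> z" "z \<le> B" for x z
  proof -
    have "norm (J l z - J l x) \<le> integral {x..z} (\<lambda>x. cmod (G l x) * cmod (s l x))"
      unfolding integral_unique[OF flux_integral[OF that(2)], symmetric]
    proof (rule integral_norm_bound_integral[OF _ int])
      show "(\<lambda>x. - Im (cnj (G l x) * s l x)) integrable_on {x..z}" using flux_integral[OF that(2)] by blast
      show "norm (- Im (cnj (G l t) * s l t)) \<le> cmod (G l t) * cmod (s l t)" for t
        using abs_Im_le_cmod[of "cnj (G l t) * s l t"] by (simp add: norm_mult)
    qed
    also have "\<dots> \<le> integral {A..B} (\<lambda>x. cmod (G l x) * cmod (s l x))"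
      using that by (intro integral_subset_le int) auto
    finally show ?thesis by simp
  qed
  show ?thesis using *[of a b] *[of b a] ab by (cases "a \<le> b") (auto simp: abs_minus_commute)
qed

text \<open>Over the whole lattice the sum is about pi / \<delta>. The weaker bound comes from
  counting: at least \<eta> / \<delta> indices lie within distance \<eta> / \<delta> of k, and each
  contributes at least 1 / (2 \<eta>).\<close>

lemma poisson_sum:
  assumes k: "k < N"
  shows "1 / (2 * \<delta>) \<le> (\<Sum>l<N. \<eta> / ((\<delta> * (real k - real l))\<^sup>2 + \<eta>\<^sup>2))"
proof -
  define M where "M = nat \<lfloor>\<eta> / \<delta>\<rfloor> + 1"
  have q: "0 \<le> \<eta> / \<delta>" using \<delta>0 \<eta>0 by simp
  have M: "\<eta> / \<delta> \<le> real M" "real M - 1 \<le> \<eta> / \<delta>" using q unfolding M_def by linarith+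
  have NM: "2 * (real M - 1) \<le> real N"
  proof -
    have "2 * (\<eta> / \<delta>) \<le> 2 * (n0 / \<delta>)" using \<eta> \<delta>0 by (simp add: divide_right_mono)
    also have "\<dots> = real N" using N\<delta> \<delta>0 by (simp add: field_simps)
    finally have "2 * (\<eta> / \<delta>) \<le> real N" .
    moreover have "2 * (real M - 1) \<le> 2 * (\<eta> / \<delta>)" using M(2) by (intro mult_left_mono) auto
    ultimately show ?thesis by (rule order_trans[rotated])
  qed
  \<comment> \<open>M indices on one side of k, with k included: downwards if there is room,
    otherwise upwards. One side always has room because 2 (M - 1) <= N, which follows from \<eta> <=
    n0.\<close>
  obtain A where A: "A \<subseteq> {..<N}" "finite A" "card A = M" "\<And>l. l \<in> A \<Longrightarrow> \<bar>real k - real l\<bar> \<le> real M - 1"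
  proof (cases "M \<le> k + 1")
    case True
    have "{k + 1 - M..k} \<subseteq> {..<N}" using k by auto
    moreover have "card {k + 1 - M..k} = M" using True by simp
    ultimately show ?thesis using True by (intro that[of "{k + 1 - M..k}"]) auto
  next
    case False
    have "real (2 * M) \<le> real (N + 2)" using NM by (simp add: algebra_simps)
    then have "2 * M \<le> N + 2" by (simp only: of_nat_le_iff)
    then have "k + M \<le> N" using False k by linarith
    then have "{k..<k + M} \<subseteq> {..<N}" by auto
    then show ?thesis by (intro that[of "{k..<k + M}"]) auto
  qed
  have "1 / (2 * \<delta>) = (\<eta> / \<delta>) * (1 / (2 * \<eta>))" using \<eta>0 \<delta>0 by simp
  also have "\<dots> \<le> real M * (1 / (2 * \<eta>))" using M \<eta>0 by (intro mult_right_mono) auto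
  also have "\<dots> = (\<Sum>l\<in>A. 1 / (2 * \<eta>))" using A by simp
  also have "\<dots> \<le> (\<Sum>l\<in>A. \<eta> / ((\<delta> * (real k - real l))\<^sup>2 + \<eta>\<^sup>2))"
  proof (rule sum_mono)
    fix l assume "l \<in> A"
    then have "\<bar>real k - real l\<bar> \<le> \<eta> / \<delta>" using A(4)[of l] M by linarith
    then have "\<delta> * \<bar>real k - real l\<bar> \<le> \<eta>" using \<delta>0 by (simp add: field_simps)
    then have "\<bar>\<delta> * (real k - real l)\<bar> \<le> \<bar>\<eta>\<bar>" using \<delta>0 \<eta>0 by (simp add: abs_mult)
    then have sq: "(\<delta> * (real k - real l))\<^sup>2 \<le> \<eta>\<^sup>2" by (simp only: abs_le_square_iff)
    have "1 / (2 * \<eta>) = \<eta> / (\<eta>\<^sup>2 + \<eta>\<^sup>2)" using \<eta>0 by (simp add: power2_eq_square)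
    also have "\<dots> \<le> \<eta> / ((\<delta> * (real k - real l))\<^sup>2 + \<eta>\<^sup>2)"
      using sq \<eta>0 by (intro divide_left_mono mult_pos_pos add_right_mono add_nonneg_pos) auto
    finally show "1 / (2 * \<eta>) \<le> \<eta> / ((\<delta> * (real k - real l))\<^sup>2 + \<eta>\<^sup>2)" .
  qed
  also have "\<dots> \<le> (\<Sum>l<N. \<eta> / ((\<delta> * (real k - real l))\<^sup>2 + \<eta>\<^sup>2))"
    using A \<eta>0 by (intro sum_mono2) auto
  finally show ?thesis .
qed

text \<open>The tail of \<phi> is paired with all \<open>G l\<close> at once. \<open>SG\<close> has
  norm of order 1 / \<delta> uniformly in \<eta>, whereas the norm bounds for the single
  \<open>G l\<close> add up to order 1 / (\<delta> \<eta>), too much when \<eta> goes to 0.\<close>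

definition "SG x = (\<Sum>l<N. G l x)"

lemma SG_eq: "SG x = (\<Sum>k<N. (\<Sum>l<N. res l k) * g k x)"
  unfolding SG_def G_def by (subst sum.swap) (simp add: sum_distrib_right)

lemma sq_SG: "square_integrable SG"
  unfolding SG_eq[abs_def] by (rule sq_sums)

text \<open>Orthogonality makes the pairing diagonal, and the imaginary part of a column sum of
  \<open>res\<close> is a sum of Poisson kernels, so every \<open>\<gamma> k\<close> is weighted by
  at least 1 / (2 \<delta>).\<close>

lemma source_lower: "\<Gamma> / (2 * \<delta>) \<le> - Im (LINT x|lborel. cnj (SG x) * \<phi> x)"
proof -
  have "(LINT x|lborel. cnj (SG x) * \<phi> x) = (\<Sum>k<N. cnj (\<Sum>l<N. res l k) * 1 * \<gamma> k)"
    unfolding SG_eq \<phi>_def using orthogonal_sum[OF sg og, where N = N and a = "\<lambda>k. \<Sum>l<N. res l k" and b = "\<lambda>_. 1"] by simp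
  then have "- Im (LINT x|lborel. cnj (SG x) * \<phi> x) = (\<Sum>k<N. (\<Sum>l<N. - Im (cnj (res l k))) * \<gamma> k)"
    by (simp add: cnj_sum sum_negf)
  also have "\<dots> = (\<Sum>k<N. (\<Sum>l<N. \<eta> / ((\<delta> * (real k - real l))\<^sup>2 + \<eta>\<^sup>2)) * \<gamma> k)" by (simp only: cmod_res(2))
  also have "\<dots> \<ge> (\<Sum>k<N. 1 / (2 * \<delta>) * \<gamma> k)"
    by (intro sum_mono mult_right_mono poisson_sum \<gamma>0) auto
  finally show ?thesis by (simp add: \<Gamma>_def sum_divide_distrib)
qed

lemma L2sq_SG: "L2sq SG \<le> 32 * pi\<^sup>2 * c * n0 / \<delta>\<^sup>2"
proof -
  have "L2sq SG = (\<Sum>k<N. (cmod (\<Sum>l<N. res l k))\<^sup>2 * \<gamma> k)"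
    unfolding SG_eq[abs_def] by (rule L2sq_g_sum)
  also have "\<dots> \<le> (\<Sum>k<N. (cmod (\<Sum>l<N. res l k))\<^sup>2 * (c * \<delta>))"
    by (intro sum_mono mult_left_mono \<gamma>c) auto
  also have "\<dots> = (\<Sum>k<N. (cmod (\<Sum>l<N. res l k))\<^sup>2) * (c * \<delta>)" by (simp only: sum_distrib_right)
  also have "(\<Sum>k<N. (cmod (\<Sum>l<N. res l k))\<^sup>2) \<le> 16 * pi\<^sup>2 / \<delta>\<^sup>2 * (\<Sum>k<N. (cmod (1::complex))\<^sup>2)"
  proof -
    have "cmod (\<Sum>l<N. res l k) = cmod (\<Sum>l<N. 1 / (of_real (\<delta> * (real l - real k)) - \<i> * of_real \<eta>))" for k
    proof -
      \<comment> \<open>Column sums are row sums up to sign and conjugation, so the discrete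
        resolvent bound applies with all coefficients equal to 1.\<close>
      have "res l k = - cnj (1 / (of_real (\<delta> * (real l - real k)) - \<i> * of_real \<eta>))" for l
      proof -
        have "cnj (of_real (\<delta> * (real l - real k)) - \<i> * of_real \<eta>) = - (complex_of_real (\<delta> * (real k - real l)) - \<i> * of_real \<eta>)"
          by (simp add: algebra_simps)
        then show ?thesis unfolding res_def complex_cnj_divide by (simp only: complex_cnj_one minus_divide_right minus_minus)
      qed
      then have "(\<Sum>l<N. res l k) = - cnj (\<Sum>l<N. 1 / (of_real (\<delta> * (real l - real k)) - \<i> * of_real \<eta>))"
        by (simp only: cnj_sum sum_negf)
      then show ?thesis by (simp only: norm_minus_cancel complex_mod_cnj)
    qed
    then show ?thesis using discrete_resolvent_bound[OF \<delta>0 \<delta>\<eta>, where N = N and a = "\<lambda>_. 1"] by simp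
  qed
  finally have "L2sq SG \<le> 16 * pi\<^sup>2 / \<delta>\<^sup>2 * real N * (c * \<delta>)"
    using c0 \<delta>0 by (simp add: mult_right_mono)
  also have "\<dots> = 16 * pi\<^sup>2 / \<delta>\<^sup>2 * c * (real N * \<delta>)" by simp
  also have "\<dots> = 32 * pi\<^sup>2 * c * n0 / \<delta>\<^sup>2" unfolding N\<delta> by simp
  finally show ?thesis .
qed

lemma \<Gamma>0: "0 \<le> \<Gamma>" unfolding \<Gamma>_def by (intro sum_nonneg \<gamma>0)
lemma B20: "0 \<le> B2" unfolding B2_def using K1_pos c0 by simp

lemma int_G_sq: "(\<Sum>l<N. integral {a..b} (\<lambda>x. (cmod (G l x))\<^sup>2)) \<le> (b - a) * (B2 / \<delta>)" if "a \<le> b"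
proof -
  have "(\<Sum>l<N. integral {a..b} (\<lambda>x. (cmod (G l x))\<^sup>2)) = integral {a..b} (\<lambda>x. \<Sum>l<N. (cmod (G l x))\<^sup>2)"
    by (rule integral_sum[symmetric]) (auto intro!: integrable_continuous_interval continuous_intros cont2)
  also have "\<dots> \<le> integral {a..b} (\<lambda>x. B2 / \<delta>)"
    by (intro integral_le sum_G_sq integrable_continuous_interval continuous_intros cont2)
  finally show ?thesis using that by simp
qed

text \<open>Green's identity on [a, b], summed over l. The source \<phi> feeds in at least \<Gamma>
  / (2 \<delta>), which must leave through a and b except for three losses: the i \<eta> term, the
  defect \<open>\<tau>\<close>, and the part of \<phi> outside the interval. Only the first grows
  with b - a, and it is proportional to \<eta>.\<close>

theorem energy_flux:
  assumes ab: "a \<le> b" and \<sigma>: "0 < \<sigma>" and out: "L2sq \<phi> - integral {a..b} (\<lambda>x. (cmod (\<phi> x))\<^sup>2) \<le> \<sigma>\<^sup>2"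
  shows "\<Gamma> / 2 \<le> \<delta> * (\<Sum>l<N. \<bar>J l a\<bar>) + \<delta> * (\<Sum>l<N. \<bar>J l b\<bar>) + \<eta> * (b - a) * B2 + 2 * n0 * \<Gamma> * \<delta> / \<eta>\<^sup>2
     + \<sigma> * (32 * pi\<^sup>2 * c * n0 + 1) / 2"
proof -
  have each: "- Im (integral {a..b} (\<lambda>x. cnj (G l x) * \<phi> x)) \<le> \<bar>J l a\<bar> + \<bar>J l b\<bar> + \<eta> * integral {a..b} (\<lambda>x. (cmod (G l x))\<^sup>2) + \<delta> * \<Gamma> / \<eta>\<^sup>2" for l
  proof -
    have i1: "((\<lambda>x. cnj (G l x) * \<phi> x) has_integral integral {a..b} (\<lambda>x. cnj (G l x) * \<phi> x)) {a..b}"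
      by (intro integrable_integral integrable_continuous_interval continuous_intros cont2)
    have i1': "((\<lambda>x. Im (cnj (G l x) * \<phi> x)) has_integral Im (integral {a..b} (\<lambda>x. cnj (G l x) * \<phi> x))) {a..b}"
      using has_integral_linear[OF i1 bounded_linear_Im] by (simp add: o_def)
    have i2: "((\<lambda>x. (cmod (G l x))\<^sup>2) has_integral integral {a..b} (\<lambda>x. (cmod (G l x))\<^sup>2)) {a..b}"
      by (intro integrable_integral integrable_continuous_interval continuous_intros cont2)
    have i3: "((\<lambda>x. Im (cnj (G l x) * \<tau> l x)) has_integral integral {a..b} (\<lambda>x. Im (cnj (G l x) * \<tau> l x))) {a..b}"
      by (intro integrable_integral integrable_continuous_interval continuous_intros cont2)
    have eq: "- Im (cnj (G l x) * s l x) = - Im (cnj (G l x) * \<phi> x) - \<eta> * (cmod (G l x))\<^sup>2 - Im (cnj (G l x) * \<tau> l x)" for x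
      unfolding cmod_power2 by (simp add: s_def power2_eq_square algebra_simps)
    have "((\<lambda>x. - Im (cnj (G l x) * \<phi> x) - \<eta> * (cmod (G l x))\<^sup>2 - Im (cnj (G l x) * \<tau> l x)) has_integral
      (- Im (integral {a..b} (\<lambda>x. cnj (G l x) * \<phi> x)) - \<eta> * integral {a..b} (\<lambda>x. (cmod (G l x))\<^sup>2) - integral {a..b} (\<lambda>x. Im (cnj (G l x) * \<tau> l x)))) {a..b}"
      by (intro has_integral_diff has_integral_neg has_integral_mult_right i1' i2 i3)
    with flux_integral[OF ab, of l] have J: "J l b - J l a = - Im (integral {a..b} (\<lambda>x. cnj (G l x) * \<phi> x)) - \<eta> * integral {a..b} (\<lambda>x. (cmod (G l x))\<^sup>2) - integral {a..b} (\<lambda>x. Im (cnj (G l x) * \<tau> l x))"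
      unfolding eq by (rule has_integral_unique)
    \<comment> \<open>With weight \<delta> both halves become \<delta> \<Gamma> / (2 \<eta>^2), as
      the squared norm of \<tau> carries a factor \<delta>^2.\<close>
    have "integral {a..b} (\<lambda>x. Im (cnj (G l x) * \<tau> l x)) \<le> integral {a..b} (\<lambda>x. \<delta> / 2 * (cmod (G l x))\<^sup>2 + 1 / (2 * \<delta>) * (cmod (\<tau> l x))\<^sup>2)"
    proof (intro integral_le integrable_continuous_interval continuous_intros cont2)
      fix x
      have "Im (cnj (G l x) * \<tau> l x) \<le> cmod (G l x) * cmod (\<tau> l x)"
        using abs_Im_le_cmod[of "cnj (G l x) * \<tau> l x"] by (simp only: norm_mult complex_mod_cnj)
      also have "\<dots> \<le> (\<delta> * (cmod (G l x))\<^sup>2 + (cmod (\<tau> l x))\<^sup>2 / \<delta>) / 2" by (rule product_le_weighted[OF \<delta>0])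
      finally show "Im (cnj (G l x) * \<tau> l x) \<le> \<delta> / 2 * (cmod (G l x))\<^sup>2 + 1 / (2 * \<delta>) * (cmod (\<tau> l x))\<^sup>2"
        by (simp add: add_divide_distrib)
    qed
    also have "\<dots> = \<delta> / 2 * integral {a..b} (\<lambda>x. (cmod (G l x))\<^sup>2) + 1 / (2 * \<delta>) * integral {a..b} (\<lambda>x. (cmod (\<tau> l x))\<^sup>2)"
      using \<delta>0 by (subst integral_add) (auto intro!: integrable_continuous_interval continuous_intros cont2)
    also have "\<dots> \<le> \<delta> / 2 * (\<Gamma> / \<eta>\<^sup>2) + 1 / (2 * \<delta>) * ((\<delta> / \<eta>)\<^sup>2 * \<Gamma>)"
      using \<delta>0 order_trans[OF integral_norm_sq_le_L2sq[OF sq_G] L2sq_G] order_trans[OF integral_norm_sq_le_L2sq[OF sq_\<tau>] L2sq_\<tau>]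
      by (intro add_mono mult_left_mono) auto
    also have "\<dots> = \<delta> * \<Gamma> / \<eta>\<^sup>2" using \<delta>0 by (simp add: power2_eq_square field_simps)
    finally show ?thesis using J by linarith
  qed
  have "- Im (integral {a..b} (\<lambda>x. cnj (SG x) * \<phi> x)) = (\<Sum>l<N. - Im (integral {a..b} (\<lambda>x. cnj (G l x) * \<phi> x)))"
  proof -
    have "integral {a..b} (\<lambda>x. cnj (SG x) * \<phi> x) = integral {a..b} (\<lambda>x. \<Sum>l<N. cnj (G l x) * \<phi> x)"
      by (simp add: SG_def cnj_sum sum_distrib_right)
    also have "\<dots> = (\<Sum>l<N. integral {a..b} (\<lambda>x. cnj (G l x) * \<phi> x))"
      by (rule integral_sum) (auto intro!: integrable_continuous_interval continuous_intros cont2)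
    finally show ?thesis by (simp add: sum_negf)
  qed
  also have "\<dots> \<le> (\<Sum>l<N. \<bar>J l a\<bar> + \<bar>J l b\<bar> + \<eta> * integral {a..b} (\<lambda>x. (cmod (G l x))\<^sup>2) + \<delta> * \<Gamma> / \<eta>\<^sup>2)"
    by (intro sum_mono each)
  also have "\<dots> = (\<Sum>l<N. \<bar>J l a\<bar>) + (\<Sum>l<N. \<bar>J l b\<bar>) + \<eta> * (\<Sum>l<N. integral {a..b} (\<lambda>x. (cmod (G l x))\<^sup>2)) + real N * (\<delta> * \<Gamma> / \<eta>\<^sup>2)"
    by (simp add: sum.distrib sum_distrib_left)
  also have "\<dots> \<le> (\<Sum>l<N. \<bar>J l a\<bar>) + (\<Sum>l<N. \<bar>J l b\<bar>) + \<eta> * ((b - a) * (B2 / \<delta>)) + real N * (\<delta> * \<Gamma> / \<eta>\<^sup>2)"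
    using int_G_sq[OF ab] \<eta>0 by (intro add_right_mono add_left_mono mult_left_mono) auto
  finally have inner: "- Im (integral {a..b} (\<lambda>x. cnj (SG x) * \<phi> x)) \<le> (\<Sum>l<N. \<bar>J l a\<bar>) + (\<Sum>l<N. \<bar>J l b\<bar>) + \<eta> * ((b - a) * (B2 / \<delta>)) + real N * (\<delta> * \<Gamma> / \<eta>\<^sup>2)" .
  define X where "X = (LINT x|lborel. cnj (SG x) * \<phi> x)"
  define Y where "Y = integral {a..b} (\<lambda>x. cnj (SG x) * \<phi> x)"
  \<comment> \<open>Weight \<sigma> \<delta>: the squared norm of \<open>SG\<close>, of order 1 /
    \<delta>^2, and the tail \<sigma>^2 then both contribute at order \<sigma> / \<delta>.\<close>
  have "cmod (X - Y) \<le> (\<sigma> * \<delta> * L2sq SG + (L2sq \<phi> - integral {a..b} (\<lambda>x. (cmod (\<phi> x))\<^sup>2)) / (\<sigma> * \<delta>)) / 2"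
    unfolding X_def Y_def using \<sigma> \<delta>0 by (intro inner_outside_bound sq_SG sq_\<phi>) auto
  also have "\<dots> \<le> (\<sigma> * \<delta> * (32 * pi\<^sup>2 * c * n0 / \<delta>\<^sup>2) + \<sigma>\<^sup>2 / (\<sigma> * \<delta>)) / 2"
    using \<sigma> \<delta>0 by (intro divide_right_mono add_mono mult_left_mono L2sq_SG out) auto
  also have "\<dots> = \<sigma> * (32 * pi\<^sup>2 * c * n0 + 1) / 2 / \<delta>" using \<sigma> \<delta>0 by (simp add: power2_eq_square field_simps)
  finally have XY: "cmod (X - Y) \<le> \<sigma> * (32 * pi\<^sup>2 * c * n0 + 1) / 2 / \<delta>" .
  have "\<bar>Im X - Im Y\<bar> \<le> cmod (X - Y)" using abs_Im_le_cmod[of "X - Y"] by simp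
  then have "\<Gamma> / (2 * \<delta>) \<le> (\<Sum>l<N. \<bar>J l a\<bar>) + (\<Sum>l<N. \<bar>J l b\<bar>) + \<eta> * ((b - a) * (B2 / \<delta>)) + real N * (\<delta> * \<Gamma> / \<eta>\<^sup>2) + \<sigma> * (32 * pi\<^sup>2 * c * n0 + 1) / 2 / \<delta>"
    using source_lower inner XY unfolding X_def[symmetric] Y_def[symmetric] by linarith
  then have "\<delta> * (\<Gamma> / (2 * \<delta>)) \<le> \<delta> * ((\<Sum>l<N. \<bar>J l a\<bar>) + (\<Sum>l<N. \<bar>J l b\<bar>) + \<eta> * ((b - a) * (B2 / \<delta>)) + real N * (\<delta> * \<Gamma> / \<eta>\<^sup>2) + \<sigma> * (32 * pi\<^sup>2 * c * n0 + 1) / 2 / \<delta>)"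
    using \<delta>0 by (intro mult_left_mono) auto
  also have "\<dots> = \<delta> * (\<Sum>l<N. \<bar>J l a\<bar>) + \<delta> * (\<Sum>l<N. \<bar>J l b\<bar>) + \<eta> * (b - a) * B2 + (real N * \<delta>) * (\<Gamma> * \<delta> / \<eta>\<^sup>2) + \<sigma> * (32 * pi\<^sup>2 * c * n0 + 1) / 2"
  proof -
    have "\<delta> * (P + Q + \<eta> * ((b - a) * (B2 / \<delta>)) + real N * (\<delta> * \<Gamma> / \<eta>\<^sup>2) + K / \<delta>) =
      \<delta> * P + \<delta> * Q + \<eta> * (b - a) * B2 + (real N * \<delta>) * (\<Gamma> * \<delta> / \<eta>\<^sup>2) + K" for P Q K
      using \<delta>0 by (simp add: distrib_left mult_ac)
    then show ?thesis .
  qed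
  finally show ?thesis using \<delta>0 unfolding N\<delta> by simp
qed

end

section \<open>Flux inside a window of growth\<close>

text \<open>Bookkeeping for \<open>window_flux\<close> as identities over free reals: the prefactor
  \<delta> cancels the 1 / \<delta> carried by the sums over l.\<close>

lemma window_sum_scale:
  fixes \<delta> \<theta> \<Lambda> m B2 k R D S :: real
  assumes "0 < \<delta>" "0 < \<theta>" "0 < \<Lambda>" "0 < m"
  shows "\<delta> * ((2 * ((m + 1) * (2 * (B2 / \<delta>))) + k\<^sup>2 * R * (R * (B2 / \<delta>)) / 2 + D\<^sup>2 * R * (S / \<delta>) / 2) / (\<Lambda> * m) + (\<theta> * (R * (B2 / \<delta>)) + (S / \<delta>) / \<theta>) / 2)
  = (4 * (m + 1) * B2 + (k * R)\<^sup>2 * B2 / 2 + D\<^sup>2 * R * S / 2) / (\<Lambda> * m) + (\<theta> * R * B2 + S / \<theta>) / 2"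
proof -
  have "\<delta> * (z / \<delta>) = z" for z using assms by simp
  then have e: "\<delta> * ((2 * ((m + 1) * (2 * b)) + k\<^sup>2 * R * (R * b) / 2 + D\<^sup>2 * R * t / 2) / q + (\<theta> * (R * b) + t / \<theta>) / 2)
    = (4 * (m + 1) * (\<delta> * b) + (k * R)\<^sup>2 * (\<delta> * b) / 2 + D\<^sup>2 * R * (\<delta> * t) / 2) / q + (\<theta> * R * (\<delta> * b) + (\<delta> * t) / \<theta>) / 2" for b t q
    by (simp add: distrib_left power2_eq_square add_divide_distrib mult_ac)
  show ?thesis unfolding e using assms by simp
qed

lemma window_sum_split:
  fixes \<Lambda> m B2 k R D S :: real
  assumes "0 < \<Lambda>" "0 < m" "0 < R"
  shows "(4 * (m + 1) * B2 + (k)\<^sup>2 * B2 / 2 + D\<^sup>2 * R * S / 2) / (\<Lambda> * m) + (1 / (\<Lambda> * R) * R * B2 + S / (1 / (\<Lambda> * R))) / 2 =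
 4 * B2 / \<Lambda> * ((m + 1) / m) + (k)\<^sup>2 * (B2 / 2 / \<Lambda>) * (1 / m) + D\<^sup>2 * R * S / 2 * (1 / (\<Lambda> * m)) + (B2 / \<Lambda> + \<Lambda> * R * S) / 2"
 using assms by (simp add: add_divide_distrib mult_ac) (simp add: field_simps)

lemma window_sum_total:
  fixes \<Lambda> B2 R D S :: real
  shows "4 * B2 / \<Lambda> * 2 + 1 * (B2 / 2 / \<Lambda>) * 1 + D\<^sup>2 * R * S / 2 * \<Lambda> + (B2 / \<Lambda> + \<Lambda> * R * (D\<^sup>2 * S)) / 2 = 9 * B2 / \<Lambda> + \<Lambda> * R * D\<^sup>2 * S"
 by (simp add: add_divide_distrib mult_ac)

context packets
begin

text \<open>For a real solution \<open>v\<close> of the comparison equation and $w = (G, G')$ with Wronskian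
  $\Omega = v G' - v' G$ one has $|v|^2 J = \mathrm{Im}(\overline{v \cdot w}\, \Omega)$; since \<open>\<Omega>\<close> is nearly
  constant, growth of \<open>v\<close> forces the flux \<open>J\<close> to be small.\<close>

lemma window_flux_single:
  assumes v: "sol (\<lambda>t. U t - E l) v v'" and unit: "norm (Complex (v \<alpha>) (v' \<alpha>)) = 1"
    and grow: "M \<le> norm (Complex (v \<beta>) (v' \<beta>))" "0 < M" and D: "\<forall>t\<in>{\<alpha>..\<beta>}. \<bar>v t\<bar> \<le> D" "0 \<le> D"
    and ab: "A \<le> \<alpha>" "\<alpha> \<le> \<beta>" "\<beta> \<le> B" and p: "A \<le> p" "p \<le> B" and R: "R = B - A" "0 < R"
    and close: "\<forall>t\<in>{A..B}. \<bar>V (X + t) - U t\<bar> \<le> \<kappa>" and \<kappa>: "0 \<le> \<kappa>"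
    and W: "(cmod (G l (X + \<alpha>)))\<^sup>2 + (cmod (G' l (X + \<alpha>)))\<^sup>2 \<le> W" "(cmod (G l (X + \<beta>)))\<^sup>2 + (cmod (G' l (X + \<beta>)))\<^sup>2 \<le> W"
    and \<theta>: "0 < \<theta>"
    and I1: "I1 = integral {X + A..X + B} (\<lambda>x. (cmod (G l x))\<^sup>2)" and I2: "I2 = integral {X + A..X + B} (\<lambda>x. (cmod (s l x))\<^sup>2)"
  shows "\<bar>J l (X + p)\<bar> \<le> (2 * W + (\<kappa> * D)\<^sup>2 * R * I1 / 2 + D\<^sup>2 * R * I2 / 2) / M + (\<theta> * I1 + I2 / \<theta>) / 2"
proof -
  \<comment> \<open>\<open>X\<close> places the window on the line; the comparison solution lives in
    window coordinates x - X, the packet on the line itself.\<close>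
  define \<Omega> where "\<Omega> x = of_real (v (x - X)) * G' l x - of_real (v' (x - X)) * G l x" for x
  have XAB: "X + A \<le> X + B" using R by simp
  have vd: "((\<lambda>x. complex_of_real (v (x - X))) has_vector_derivative of_real (v' (x - X))) (at x)"
    "((\<lambda>x. complex_of_real (v' (x - X))) has_vector_derivative of_real ((U (x - X) - E l) * v (x - X))) (at x)" for x
  proof -
    have sh: "((\<lambda>x. f (x - X)) has_real_derivative d) (at x)" if "(f has_real_derivative d) (at (x - X))" for f d
      by (rule DERIV_cong[OF DERIV_chain2[where f = f and g = "\<lambda>x. x - X", OF that]]) (auto intro!: derivative_eq_intros)
    have "((\<lambda>x. v (x - X)) has_real_derivative v' (x - X)) (at x)"
      using v unfolding sol_def by (intro sh) auto
    then show "((\<lambda>x. complex_of_real (v (x - X))) has_vector_derivative of_real (v' (x - X))) (at x)"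
      by (intro has_vector_derivative_of_real) (simp add: has_real_derivative_iff_has_vector_derivative)
    have "((\<lambda>x. v' (x - X)) has_real_derivative ((U (x - X) - E l) * v (x - X))) (at x)"
      using v unfolding sol_def by (intro sh) auto
    then show "((\<lambda>x. complex_of_real (v' (x - X))) has_vector_derivative of_real ((U (x - X) - E l) * v (x - X))) (at x)"
      by (intro has_vector_derivative_of_real) (simp add: has_real_derivative_iff_has_vector_derivative)
  qed
  have d\<Omega>: "(\<Omega> has_vector_derivative (of_real ((V x - U (x - X)) * v (x - X)) * G l x - of_real (v (x - X)) * s l x)) (at x)" for x
  proof -
    have "(\<Omega> has_vector_derivative
      ((of_real (v (x - X)) * (of_real (V x - E l) * G l x - s l x) + of_real (v' (x - X)) * G' l x)
      - (of_real (v' (x - X)) * G' l x + of_real ((U (x - X) - E l) * v (x - X)) * G l x))) (at x)"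
      unfolding \<Omega>_def[abs_def] by (intro has_vector_derivative_diff has_vector_derivative_mult vd dG dG')
    then show ?thesis by (simp add: algebra_simps)
  qed
  define IG where "IG = integral {X + A..X + B} (\<lambda>x. cmod (G l x))"
  define Is where "Is = integral {X + A..X + B} (\<lambda>x. cmod (s l x))"
  have cG: "continuous_on S (\<lambda>x. cmod (G l x))" and cs: "continuous_on S (\<lambda>x. cmod (s l x))" for S
    by (intro continuous_intros cont2)+
  have IG2: "IG\<^sup>2 \<le> R * I1" and Is2: "Is\<^sup>2 \<le> R * I2"
    using cauchy_schwarz_interval[OF cG XAB] cauchy_schwarz_interval[OF cs XAB]
    by (simp_all add: IG_def Is_def I1 I2 R)
  have I0: "0 \<le> IG" "0 \<le> Is" unfolding IG_def Is_def
    by (intro integral_nonneg integrable_continuous_interval cG cs; simp)+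
  have d: "norm (\<Omega> (X + \<beta>) - \<Omega> (X + \<alpha>)) \<le> integral {X + \<alpha>..X + \<beta>} (\<lambda>x. \<kappa> * D * cmod (G l x) + D * cmod (s l x))"
  proof -
    have hi: "((\<lambda>x. of_real ((V x - U (x - X)) * v (x - X)) * G l x - of_real (v (x - X)) * s l x) has_integral (\<Omega> (X + \<beta>) - \<Omega> (X + \<alpha>))) {X + \<alpha>..X + \<beta>}"
      using ab by (intro fundamental_theorem_of_calculus has_vector_derivative_at_within[OF d\<Omega>]) auto
    show ?thesis unfolding integral_unique[OF hi, symmetric]
    proof (rule integral_norm_bound_integral)
      show "(\<lambda>x. of_real ((V x - U (x - X)) * v (x - X)) * G l x - of_real (v (x - X)) * s l x) integrable_on {X + \<alpha>..X + \<beta>}"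
        using hi by blast
      show "(\<lambda>x. \<kappa> * D * cmod (G l x) + D * cmod (s l x)) integrable_on {X + \<alpha>..X + \<beta>}"
        by (intro integrable_continuous_interval continuous_intros cG cs)
      fix x assume x: "x \<in> {X + \<alpha>..X + \<beta>}"
      have vx: "\<bar>v (x - X)\<bar> \<le> D" using D(1) x by auto
      have "\<bar>V (X + (x - X)) - U (x - X)\<bar> \<le> \<kappa>" using close x ab by (intro bspec[OF close]) auto
      then have "\<bar>V x - U (x - X)\<bar> * \<bar>v (x - X)\<bar> \<le> \<kappa> * D" using vx \<kappa> by (intro mult_mono) auto
      then have 1: "cmod (of_real ((V x - U (x - X)) * v (x - X)) * G l x) \<le> \<kappa> * D * cmod (G l x)"
        unfolding norm_mult norm_of_real abs_mult by (intro mult_right_mono) auto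
      have 2: "cmod (of_real (v (x - X)) * s l x) \<le> D * cmod (s l x)"
        unfolding norm_mult norm_of_real using vx by (intro mult_right_mono) auto
      show "norm (of_real ((V x - U (x - X)) * v (x - X)) * G l x - of_real (v (x - X)) * s l x) \<le> \<kappa> * D * cmod (G l x) + D * cmod (s l x)"
        by (rule order_trans[OF norm_triangle_ineq4 add_mono[OF 1 2]])
    qed
  qed
  also have "\<dots> \<le> integral {X + A..X + B} (\<lambda>x. \<kappa> * D * cmod (G l x) + D * cmod (s l x))"
  proof (rule integral_subset_le)
    show "{X + \<alpha>..X + \<beta>} \<subseteq> {X + A..X + B}" using ab by auto
    show "\<forall>x\<in>{X + A..X + B}. 0 \<le> \<kappa> * D * cmod (G l x) + D * cmod (s l x)" using \<kappa> D(2) by simp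
  qed (intro integrable_continuous_interval continuous_intros cG cs)+
  also have "\<dots> = \<kappa> * D * IG + D * Is"
    unfolding IG_def Is_def by (subst integral_add) (auto intro!: integrable_continuous_interval continuous_intros cG cs)
  finally have d\<Omega>2: "norm (\<Omega> (X + \<beta>) - \<Omega> (X + \<alpha>)) \<le> \<kappa> * D * IG + D * Is" .
  define w where "w = sqrt W"
  have W0: "0 \<le> W" using W(1) by (meson add_nonneg_nonneg order_trans zero_le_power2)
  have w0: "0 \<le> w" "w\<^sup>2 = W" using W0 by (auto simp: w_def)
  have wa: "sqrt ((cmod (G l (X + \<alpha>)))\<^sup>2 + (cmod (G' l (X + \<alpha>)))\<^sup>2) \<le> w" "sqrt ((cmod (G' l (X + \<alpha>)))\<^sup>2 + (cmod (G l (X + \<alpha>)))\<^sup>2) \<le> w"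
    "sqrt ((cmod (G l (X + \<beta>)))\<^sup>2 + (cmod (G' l (X + \<beta>)))\<^sup>2) \<le> w"
    using W by (auto simp: w_def add.commute)
  have "cmod (\<Omega> (X + \<alpha>)) \<le> 1 * w"
    using cmod_real_combination(1)[of "v \<alpha>" "G' l (X + \<alpha>)" "v' \<alpha>" "G l (X + \<alpha>)"] wa(2) by (simp add: \<Omega>_def unit)
  then have \<Omega>b: "cmod (\<Omega> (X + \<beta>)) \<le> w + \<kappa> * D * IG + D * Is"
    using d\<Omega>2 norm_triangle_ineq2[of "\<Omega> (X + \<beta>)" "\<Omega> (X + \<alpha>)"] by linarith
  define r where "r = norm (Complex (v \<beta>) (v' \<beta>))"
  have r: "M \<le> r" "0 < r" using grow by (auto simp: r_def)
  define Z where "Z = of_real (v \<beta>) * G l (X + \<beta>) + of_real (v' \<beta>) * G' l (X + \<beta>)"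
  have Zb: "cmod Z \<le> r * w"
  proof -
    have "cmod Z \<le> r * sqrt ((cmod (G l (X + \<beta>)))\<^sup>2 + (cmod (G' l (X + \<beta>)))\<^sup>2)"
      unfolding Z_def r_def by (rule cmod_real_combination(2))
    also have "\<dots> \<le> r * w" using r wa(3) by (intro mult_left_mono) auto
    finally show ?thesis .
  qed
  have "r\<^sup>2 * J l (X + \<beta>) = Im (cnj Z * \<Omega> (X + \<beta>))"
    by (simp add: Z_def \<Omega>_def J_def r_def complex_norm power2_eq_square[of "v \<beta>"] power2_eq_square[of "v' \<beta>"] algebra_simps)
  then have "r\<^sup>2 * \<bar>J l (X + \<beta>)\<bar> = \<bar>Im (cnj Z * \<Omega> (X + \<beta>))\<bar>" by (metis abs_mult abs_power2)
  also have "\<dots> \<le> cmod Z * cmod (\<Omega> (X + \<beta>))"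
    using abs_Im_le_cmod[of "cnj Z * \<Omega> (X + \<beta>)"] by (simp only: norm_mult complex_mod_cnj)
  \<comment> \<open>\<open>Z\<close> takes one of the two factors r, while the Wronskian has not
    grown with the solution. The other factor r is the gain.\<close>
  also have "\<dots> \<le> (r * w) * (w + \<kappa> * D * IG + D * Is)"
    using Zb \<Omega>b r w0 by (intro mult_mono) auto
  finally have "r * (r * \<bar>J l (X + \<beta>)\<bar>) \<le> r * (w * (w + \<kappa> * D * IG + D * Is))"
    by (simp add: power2_eq_square mult_ac)
  then have rJ: "r * \<bar>J l (X + \<beta>)\<bar> \<le> w * (w + \<kappa> * D * IG + D * Is)" using r by simp
  have "M * \<bar>J l (X + \<beta>)\<bar> \<le> r * \<bar>J l (X + \<beta>)\<bar>" using r by (intro mult_right_mono) auto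
  also note rJ
  also have "w * (w + \<kappa> * D * IG + D * Is) = w\<^sup>2 + w * (\<kappa> * D * IG) + w * (D * Is)" by (simp add: power2_eq_square algebra_simps)
  also have "\<dots> \<le> w\<^sup>2 + (1 * w\<^sup>2 + (\<kappa> * D * IG)\<^sup>2 / 1) / 2 + (1 * w\<^sup>2 + (D * Is)\<^sup>2 / 1) / 2"
    by (intro add_mono order_refl product_le_weighted) auto
  also have "\<dots> = 2 * W + (\<kappa> * D)\<^sup>2 * IG\<^sup>2 / 2 + D\<^sup>2 * Is\<^sup>2 / 2" by (simp add: w0 power_mult_distrib add_divide_distrib)
  also have "\<dots> \<le> 2 * W + (\<kappa> * D)\<^sup>2 * (R * I1) / 2 + D\<^sup>2 * (R * I2) / 2"
    by (intro add_mono divide_right_mono mult_left_mono IG2 Is2 order_refl) auto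
  finally have MJ: "\<bar>J l (X + \<beta>)\<bar> \<le> (2 * W + (\<kappa> * D)\<^sup>2 * R * I1 / 2 + D\<^sup>2 * R * I2 / 2) / M"
    using grow by (simp add: pos_le_divide_eq mult_ac)
  \<comment> \<open>The node \<beta> depends on the energy; moving to the common point p costs at
    most the source in between.\<close>
  have "\<bar>J l (X + p) - J l (X + \<beta>)\<bar> \<le> integral {X + A..X + B} (\<lambda>x. cmod (G l x) * cmod (s l x))"
    by (rule flux_change) (use ab p in auto)
  also have "\<dots> \<le> integral {X + A..X + B} (\<lambda>x. \<theta> / 2 * (cmod (G l x))\<^sup>2 + 1 / (2 * \<theta>) * (cmod (s l x))\<^sup>2)"
  proof (intro integral_le)
    fix x
    show "cmod (G l x) * cmod (s l x) \<le> \<theta> / 2 * (cmod (G l x))\<^sup>2 + 1 / (2 * \<theta>) * (cmod (s l x))\<^sup>2"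
      using product_le_weighted[OF \<theta>, of "cmod (G l x)" "cmod (s l x)"] by (simp add: add_divide_distrib)
  qed (use \<theta> in \<open>auto intro!: integrable_continuous_interval continuous_intros cG cs\<close>)
  also have "\<dots> = \<theta> / 2 * I1 + 1 / (2 * \<theta>) * I2"
    unfolding I1 I2 using \<theta> by (subst integral_add) (auto intro!: integrable_continuous_interval continuous_intros cG cs)
  also have "\<dots> = (\<theta> * I1 + I2 / \<theta>) / 2" by (simp add: add_divide_distrib)
  finally have "\<bar>J l (X + p)\<bar> \<le> \<bar>J l (X + \<beta>)\<bar> + (\<theta> * I1 + I2 / \<theta>) / 2" by linarith
  with MJ show ?thesis by linarith
qed

lemma E_bound: "l < N \<Longrightarrow> \<bar>E l\<bar> \<le> n0"
proof -
  assume "l < N"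
  then have "\<delta> * real l \<le> \<delta> * N" using \<delta>0 by (intro mult_left_mono) auto
  also have "\<dots> = 2 * n0" using N\<delta> by (simp add: mult.commute)
  finally have "\<delta> * real l \<le> 2 * n0" .
  moreover have "0 \<le> \<delta> * real l" using \<delta>0 by simp
  ultimately show "\<bar>E l\<bar> \<le> n0" unfolding E_def by linarith
qed

text \<open>Different energies use different windows, so the values of \<open>G l\<close> at all m +
  1 nodes are summed; the growth \<Lambda> * m makes up for the loss. The term besides 9 * B2 /
  \<Lambda> has the factor S, which vanishes when \<delta>, then \<eta> and \<sigma> go to
  0.\<close>

theorem window_flux:
  assumes gw: "growth_windows \<Lambda> U m y D" and \<Lambda>: "n0 \<le> \<Lambda>" "1 \<le> \<Lambda>"
    and R: "R = y m - y 0" and \<kappa>: "0 \<le> \<kappa>" "\<kappa> * D * R \<le> 1" and close: "\<forall>t\<in>{y 0..y m}. \<bar>V (X + t) - U t\<bar> \<le> \<kappa>"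
    and p: "y 0 \<le> p" "p \<le> y m"
    and mass: "integral {X + y 0..X + y m} (\<lambda>x. (cmod (\<phi> x))\<^sup>2) \<le> \<sigma>\<^sup>2"
    and S: "S = 3 * (2 * n0 * \<sigma>\<^sup>2 + \<eta>\<^sup>2 * R * B2 + 2 * n0 * ((\<delta> / \<eta>)\<^sup>2 * \<Gamma>))"
  shows "\<delta> * (\<Sum>l<N. \<bar>J l (X + p)\<bar>) \<le> 9 * B2 / \<Lambda> + \<Lambda> * R * D\<^sup>2 * S"
proof -
  have m: "0 < m" and inc: "\<forall>j<m. y j < y (Suc j)" and D: "1 \<le> D"
    and sols: "\<And>E. \<bar>E\<bar> \<le> \<Lambda> \<Longrightarrow> \<exists>j<m. \<exists>v v'. sol (\<lambda>x. U x - E) v v' \<and> norm (Complex (v (y j)) (v' (y j))) = 1 \<and>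
        \<Lambda> * m \<le> norm (Complex (v (y (Suc j))) (v' (y (Suc j)))) \<and> (\<forall>x\<in>{y j..y (Suc j)}. \<bar>v x\<bar> \<le> D)"
    using gw unfolding growth_windows_def by blast+
  have "y 0 < y (Suc 0)" "y (Suc 0) \<le> y m" using inc m increasing_nodes[OF inc, of "Suc 0" m] by auto
  then have R0: "0 < R" by (simp add: R)
  have \<Lambda>0: "0 < \<Lambda>" using \<Lambda> by simp
  define W where "W l = (\<Sum>i\<le>m. (cmod (G l (X + y i)))\<^sup>2 + (cmod (G' l (X + y i)))\<^sup>2)" for l
  define I1 where "I1 l = integral {X + y 0..X + y m} (\<lambda>x. (cmod (G l x))\<^sup>2)" for l
  define I2 where "I2 l = integral {X + y 0..X + y m} (\<lambda>x. (cmod (s l x))\<^sup>2)" for l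
  \<comment> \<open>Makes the contribution of the squared \<open>G l\<close> between the nodes of
    order B2 / \<Lambda>; the price \<Lambda> * R falls on the source term.\<close>
  define \<theta> where "\<theta> = 1 / (\<Lambda> * R)"
  have \<theta>: "0 < \<theta>" using \<Lambda>0 R0 by (simp add: \<theta>_def)
  have W1: "(cmod (G l (X + y i)))\<^sup>2 + (cmod (G' l (X + y i)))\<^sup>2 \<le> W l" if "i \<le> m" for i l
    unfolding W_def using that by (intro member_le_sum) auto
  have each: "\<bar>J l (X + p)\<bar> \<le> (2 * W l + (\<kappa> * D)\<^sup>2 * R * I1 l / 2 + D\<^sup>2 * R * I2 l / 2) / (\<Lambda> * m) + (\<theta> * I1 l + I2 l / \<theta>) / 2"
    if l: "l < N" for l
  proof -
    have "\<bar>E l\<bar> \<le> \<Lambda>" using E_bound[OF l] \<Lambda> by simp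
    from sols[OF this] obtain j v v' where j: "j < m" and v: "sol (\<lambda>x. U x - E l) v v'" "norm (Complex (v (y j)) (v' (y j))) = 1"
        "\<Lambda> * m \<le> norm (Complex (v (y (Suc j))) (v' (y (Suc j))))" "\<forall>x\<in>{y j..y (Suc j)}. \<bar>v x\<bar> \<le> D" by blast
    have yy: "y 0 \<le> y j" "y j \<le> y (Suc j)" "y (Suc j) \<le> y m"
      using inc j increasing_nodes[OF inc, of 0 j] increasing_nodes[OF inc, of "Suc j" m] by (auto intro: less_imp_le)
    show ?thesis
      by (rule window_flux_single[OF v(1,2,3) _ v(4) _ yy p R R0 close \<kappa>(1) W1 W1 \<theta> I1_def I2_def]) (use \<Lambda>0 m D j in auto)
  qed
  have cG: "continuous_on A (\<lambda>x. cmod (G l x))" and cs: "continuous_on A (\<lambda>x. cmod (s l x))"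
    and c\<phi>: "continuous_on A (\<lambda>x. cmod (\<phi> x))" and c\<tau>: "continuous_on A (\<lambda>x. cmod (\<tau> l x))" for A l
    by (intro continuous_intros cont2)+
  have sW: "(\<Sum>l<N. W l) \<le> (real m + 1) * (2 * (B2 / \<delta>))"
  proof -
    have "(\<Sum>l<N. W l) = (\<Sum>i\<le>m. (\<Sum>l<N. (cmod (G l (X + y i)))\<^sup>2) + (\<Sum>l<N. (cmod (G' l (X + y i)))\<^sup>2))"
      unfolding W_def by (subst sum.swap) (simp add: sum.distrib)
    also have "\<dots> \<le> (\<Sum>i\<le>m. B2 / \<delta> + B2 / \<delta>)" by (intro sum_mono add_mono sum_G_sq)
    finally show ?thesis by (simp add: algebra_simps)
  qed
  have sI1: "(\<Sum>l<N. I1 l) \<le> R * (B2 / \<delta>)"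
    unfolding I1_def using int_G_sq[of "X + y 0" "X + y m"] R0 by (simp add: R)
  have sI2: "(\<Sum>l<N. I2 l) \<le> S / \<delta>"
  proof -
    have "I2 l \<le> 3 * (\<sigma>\<^sup>2 + \<eta>\<^sup>2 * I1 l + (\<delta> / \<eta>)\<^sup>2 * \<Gamma>)" for l
    proof -
      have "I2 l \<le> integral {X + y 0..X + y m} (\<lambda>x. 3 * ((cmod (\<phi> x))\<^sup>2 + \<eta>\<^sup>2 * (cmod (G l x))\<^sup>2 + (cmod (\<tau> l x))\<^sup>2))"
        unfolding I2_def
      proof (intro integral_le integrable_continuous_interval continuous_intros cG cs c\<phi> c\<tau> cont2)
        fix x
        show "(cmod (s l x))\<^sup>2 \<le> 3 * ((cmod (\<phi> x))\<^sup>2 + \<eta>\<^sup>2 * (cmod (G l x))\<^sup>2 + (cmod (\<tau> l x))\<^sup>2)"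
          unfolding s_def using cmod_sum3_sq_le[of "\<phi> x" "\<i> * of_real \<eta> * G l x" "\<tau> l x"]
          by (simp add: norm_mult power_mult_distrib)
      qed
      also have "\<dots> = 3 * (integral {X + y 0..X + y m} (\<lambda>x. (cmod (\<phi> x))\<^sup>2) + \<eta>\<^sup>2 * I1 l + integral {X + y 0..X + y m} (\<lambda>x. (cmod (\<tau> l x))\<^sup>2))"
      proof -
        have "((\<lambda>x. 3 * ((cmod (\<phi> x))\<^sup>2 + \<eta>\<^sup>2 * (cmod (G l x))\<^sup>2 + (cmod (\<tau> l x))\<^sup>2)) has_integral
          3 * (integral {X + y 0..X + y m} (\<lambda>x. (cmod (\<phi> x))\<^sup>2) + \<eta>\<^sup>2 * I1 l + integral {X + y 0..X + y m} (\<lambda>x. (cmod (\<tau> l x))\<^sup>2))) {X + y 0..X + y m}"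
          unfolding I1_def
          by (intro has_integral_mult_right has_integral_add integrable_integral integrable_continuous_interval continuous_intros cG c\<phi> c\<tau>)
        then show ?thesis by (rule integral_unique)
      qed
      also have "\<dots> \<le> 3 * (\<sigma>\<^sup>2 + \<eta>\<^sup>2 * I1 l + (\<delta> / \<eta>)\<^sup>2 * \<Gamma>)"
        using mass order_trans[OF integral_norm_sq_le_L2sq[OF sq_\<tau>] L2sq_\<tau>, of "X + y 0" "X + y m" l]
        by (intro mult_left_mono add_mono) auto
      finally show ?thesis .
    qed
    then have "(\<Sum>l<N. I2 l) \<le> (\<Sum>l<N. 3 * (\<sigma>\<^sup>2 + \<eta>\<^sup>2 * I1 l + (\<delta> / \<eta>)\<^sup>2 * \<Gamma>))" by (intro sum_mono)
    also have "\<dots> = 3 * (real N * \<sigma>\<^sup>2 + \<eta>\<^sup>2 * (\<Sum>l<N. I1 l) + real N * ((\<delta> / \<eta>)\<^sup>2 * \<Gamma>))"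
      by (simp add: sum_distrib_left[symmetric] sum.distrib)
    also have "\<dots> \<le> 3 * (real N * \<sigma>\<^sup>2 + \<eta>\<^sup>2 * (R * (B2 / \<delta>)) + real N * ((\<delta> / \<eta>)\<^sup>2 * \<Gamma>))"
      using sI1 by (intro mult_left_mono add_mono) auto
    also have "\<dots> = 3 * ((real N * \<delta>) * \<sigma>\<^sup>2 + \<eta>\<^sup>2 * R * B2 + (real N * \<delta>) * ((\<delta> / \<eta>)\<^sup>2 * \<Gamma>)) / \<delta>"
      using \<delta>0 by (simp add: field_simps)
    also have "\<dots> = S / \<delta>" unfolding N\<delta> S ..
    finally show ?thesis .
  qed
  have S0: "0 \<le> S" unfolding S using n0 R0 B20 \<Gamma>0 by (intro mult_nonneg_nonneg add_nonneg_nonneg) auto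
  have "\<delta> * (\<Sum>l<N. \<bar>J l (X + p)\<bar>) \<le> \<delta> * (\<Sum>l<N. (2 * W l + (\<kappa> * D)\<^sup>2 * R * I1 l / 2 + D\<^sup>2 * R * I2 l / 2) / (\<Lambda> * m) + (\<theta> * I1 l + I2 l / \<theta>) / 2)"
    using \<delta>0 by (intro mult_left_mono sum_mono each) auto
  also have "\<dots> = \<delta> * ((2 * (\<Sum>l<N. W l) + (\<kappa> * D)\<^sup>2 * R * (\<Sum>l<N. I1 l) / 2 + D\<^sup>2 * R * (\<Sum>l<N. I2 l) / 2) / (\<Lambda> * m) + (\<theta> * (\<Sum>l<N. I1 l) + (\<Sum>l<N. I2 l) / \<theta>) / 2)"
    by (simp add: sum.distrib sum_divide_distrib[symmetric] sum_distrib_left[symmetric])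
  also have "\<dots> \<le> \<delta> * ((2 * ((real m + 1) * (2 * (B2 / \<delta>))) + (\<kappa> * D)\<^sup>2 * R * (R * (B2 / \<delta>)) / 2 + D\<^sup>2 * R * (S / \<delta>) / 2) / (\<Lambda> * m) + (\<theta> * (R * (B2 / \<delta>)) + (S / \<delta>) / \<theta>) / 2)"
    using \<delta>0 \<Lambda>0 m R0 \<theta> by (intro mult_left_mono add_mono divide_right_mono sW sI1 sI2) auto
  also have "\<dots> = (4 * (real m + 1) * B2 + (\<kappa> * D * R)\<^sup>2 * B2 / 2 + D\<^sup>2 * R * S / 2) / (\<Lambda> * m) + (\<theta> * R * B2 + S / \<theta>) / 2"
    by (rule window_sum_scale) (use \<delta>0 \<theta> \<Lambda>0 m in auto)
  also have "\<dots> = 4 * B2 / \<Lambda> * ((real m + 1) / m) + (\<kappa> * D * R)\<^sup>2 * (B2 / 2 / \<Lambda>) * (1 / m) + D\<^sup>2 * R * S / 2 * (1 / (\<Lambda> * m)) + (B2 / \<Lambda> + \<Lambda> * R * S) / 2"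
    unfolding \<theta>_def by (rule window_sum_split) (use \<Lambda>0 R0 m in auto)
  \<comment> \<open>Removes \<open>m\<close>: (m + 1) / m is at most 2 and 1 / m at most 1. The 9 is
    8 + 1/2 + 1/2.\<close>
  also have "\<dots> \<le> 4 * B2 / \<Lambda> * 2 + 1 * (B2 / 2 / \<Lambda>) * 1 + D\<^sup>2 * R * S / 2 * \<Lambda> + (B2 / \<Lambda> + \<Lambda> * R * (D\<^sup>2 * S)) / 2"
  proof (intro add_mono mult_mono divide_right_mono order_refl)
    show "(real m + 1) / m \<le> 2" "1 / real m \<le> 1" using m by (auto simp: field_simps)
    show "(\<kappa> * D * R)\<^sup>2 \<le> 1" using \<kappa> D R0 by (intro power_le_one) auto
    have "1 \<le> \<Lambda> * real m" using \<Lambda> m by (intro mult_ge1_I) auto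
    then have "1 / (\<Lambda> * m) \<le> 1" by simp
    then show "1 / (\<Lambda> * m) \<le> \<Lambda>" using \<Lambda> by linarith
    have "1 * S \<le> D\<^sup>2 * S" using D S0 by (intro mult_right_mono) auto
    then show "S \<le> D\<^sup>2 * S" by simp
  qed (use B20 S0 R0 \<Lambda>0 D \<kappa> m in auto)
  also have "\<dots> = 9 * B2 / \<Lambda> + \<Lambda> * R * D\<^sup>2 * S" by (rule window_sum_total)
  finally show ?thesis .
qed

end


section \<open>Spectral pieces of a Schroedinger operator\<close>

lemma L2_rel_refl [simp]: "L2_rel f f \<longleftrightarrow> square_integrable f"
  by (simp add: L2_rel_def)

lemma L2_cases:
  obtains f where "square_integrable f" "\<psi> = abs_L2 f"
proof -
  have "abs_L2 (rep_L2 \<psi>) = \<psi>" "L2_rel (rep_L2 \<psi>) (rep_L2 \<psi>)"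
    using Quotient_L2 by (auto simp: Quotient_def)
  then show ?thesis using that[of "rep_L2 \<psi>"] by simp
qed

lemma abs_L2_eq_iff:
  assumes "square_integrable f" "square_integrable g"
  shows "abs_L2 f = abs_L2 g \<longleftrightarrow> (AE x in lborel. f x = g x)"
proof -
  have "L2_rel f g \<longleftrightarrow> abs_L2 f = abs_L2 g"
    using Quotient_L2 assms by (auto simp: Quotient_def)
  then show ?thesis using assms by (auto simp: L2_rel_def)
qed

lemma abs_L2_ops:
  assumes "square_integrable f" "square_integrable g"
  shows "abs_L2 f + abs_L2 g = abs_L2 (\<lambda>x. f x + g x)" "scaleC_L2 c (abs_L2 f) = abs_L2 (\<lambda>x. c * f x)"
    "cinner_L2 (abs_L2 f) (abs_L2 g) = (LINT x|lborel. cnj (f x) * g x)"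
  using assms by (simp_all add: plus_L2.abs_eq scaleC_L2.abs_eq cinner_L2.abs_eq)

lemma scaleC_L2_simps:
  "scaleC_L2 1 \<psi> = \<psi>" "scaleC_L2 (of_real r) \<psi> = r *\<^sub>R \<psi>" "scaleC_L2 c (scaleC_L2 d \<psi>) = scaleC_L2 (c * d) \<psi>"
  "scaleC_L2 c (\<phi> + \<psi>) = scaleC_L2 c \<phi> + scaleC_L2 c \<psi>"
proof -
  obtain f g where f: "square_integrable f" "\<psi> = abs_L2 f" and g: "square_integrable g" "\<phi> = abs_L2 g"
    by (metis L2_cases)
  show "scaleC_L2 1 \<psi> = \<psi>" "scaleC_L2 c (scaleC_L2 d \<psi>) = scaleC_L2 (c * d) \<psi>"
    "scaleC_L2 c (\<phi> + \<psi>) = scaleC_L2 c \<phi> + scaleC_L2 c \<psi>"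
    using f g by (simp_all add: abs_L2_ops square_integrable_cmult square_integrable_add mult.assoc distrib_left)
  show "scaleC_L2 (of_real r) \<psi> = r *\<^sub>R \<psi>" by (simp add: scaleR_L2_def)
qed

lemma cinner_L2_simps:
  "cinner_L2 \<phi> (scaleC_L2 c \<psi>) = c * cinner_L2 \<phi> \<psi>" "cinner_L2 (scaleC_L2 c \<phi>) \<psi> = cnj c * cinner_L2 \<phi> \<psi>"
  "cinner_L2 (\<phi> + \<phi>') \<psi> = cinner_L2 \<phi> \<psi> + cinner_L2 \<phi>' \<psi>" "cinner_L2 \<phi> (\<psi> + \<psi>') = cinner_L2 \<phi> \<psi> + cinner_L2 \<phi> \<psi>'"
  "cinner_L2 \<psi> \<phi> = cnj (cinner_L2 \<phi> \<psi>)"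
proof -
  obtain f g f' g' where *: "square_integrable f" "\<phi> = abs_L2 f" "square_integrable g" "\<psi> = abs_L2 g"
    "square_integrable f'" "\<phi>' = abs_L2 f'" "square_integrable g'" "\<psi>' = abs_L2 g'"
    by (metis L2_cases)
  note sm = square_integrable_mult
  show "cinner_L2 \<phi> (scaleC_L2 c \<psi>) = c * cinner_L2 \<phi> \<psi>" "cinner_L2 (scaleC_L2 c \<phi>) \<psi> = cnj c * cinner_L2 \<phi> \<psi>"
    using * by (simp_all add: abs_L2_ops square_integrable_cmult mult.left_commute[of _ c] mult.assoc)
  show "cinner_L2 (\<phi> + \<phi>') \<psi> = cinner_L2 \<phi> \<psi> + cinner_L2 \<phi>' \<psi>" "cinner_L2 \<phi> (\<psi> + \<psi>') = cinner_L2 \<phi> \<psi> + cinner_L2 \<phi> \<psi>'"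
    using * by (simp_all add: abs_L2_ops square_integrable_add distrib_left distrib_right sm)
  have "(LINT x|lborel. cnj (g x) * f x) = (LINT x|lborel. cnj (cnj (f x) * g x))" by (simp add: mult.commute)
  also have "\<dots> = cnj (LINT x|lborel. cnj (f x) * g x)" by (rule Bochner_Integration.integral_cnj)
  finally show "cinner_L2 \<psi> \<phi> = cnj (cinner_L2 \<phi> \<psi>)" using * by (simp add: abs_L2_ops)
qed

lemma cinner_L2_self: "cinner_L2 \<psi> \<psi> = of_real ((norm \<psi>)\<^sup>2)"
proof -
  have "cinner_L2 \<psi> \<psi> = cnj (cinner_L2 \<psi> \<psi>)" by (rule cinner_L2_simps(5))
  then have "Im (cinner_L2 \<psi> \<psi>) = 0" by (metis cnj.simps(2) equal_neg_zero)
  then show ?thesis by (simp add: complex_eq_iff power2_norm_eq_inner inner_L2_def)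
qed

lemma norm_abs_L2: "square_integrable f \<Longrightarrow> (norm (abs_L2 f))\<^sup>2 = L2sq f"
  using cinner_L2_self[of "abs_L2 f"] of_real_L2sq[of f]
  by (simp add: abs_L2_ops(3) del: of_real_power)

lemma zero_L2_abs: "0 = abs_L2 (\<lambda>_. 0)"
  by (simp add: zero_L2_def)

section \<open>Projection-valued measures and spectral measures of vectors\<close>

locale pvm =
  fixes E :: "real set \<Rightarrow> L2 \<Rightarrow> L2"
  assumes pvm: "projection_valued_measure E"
begin

lemma proj: "B \<in> sets borel \<Longrightarrow> orthogonal_projection (E B)"
  using pvm by (simp add: projection_valued_measure_def)

lemma E_scaleC_add: "B \<in> sets borel \<Longrightarrow> E B (scaleC_L2 c \<phi> + \<psi>) = scaleC_L2 c (E B \<phi>) + E B \<psi>"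
  using proj by (simp add: orthogonal_projection_def)

lemma E_add: "B \<in> sets borel \<Longrightarrow> E B (\<phi> + \<psi>) = E B \<phi> + E B \<psi>"
  using E_scaleC_add[of B 1] by (simp add: scaleC_L2_simps)

lemma E_0: "B \<in> sets borel \<Longrightarrow> E B 0 = 0"
  using E_add[of B 0 0] by simp

lemma E_scaleC: "B \<in> sets borel \<Longrightarrow> E B (scaleC_L2 c \<phi>) = scaleC_L2 c (E B \<phi>)"
  using E_scaleC_add[of B c \<phi> 0] E_0 by simp

lemma E_scaleR: "B \<in> sets borel \<Longrightarrow> E B (t *\<^sub>R \<phi>) = t *\<^sub>R E B \<phi>"
  using E_scaleC[of B "of_real t" \<phi>] by (simp add: scaleC_L2_simps)

lemma E_diff: "B \<in> sets borel \<Longrightarrow> E B (\<phi> - \<psi>) = E B \<phi> - E B \<psi>"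
  using E_add[of B \<phi> "(-1) *\<^sub>R \<psi>"] E_scaleR[of B "-1" \<psi>] by simp

lemma E_self_adjoint: "B \<in> sets borel \<Longrightarrow> cinner_L2 (E B \<phi>) \<psi> = cinner_L2 \<phi> (E B \<psi>)"
  using proj by (simp add: orthogonal_projection_def)

lemma E_inner: "B \<in> sets borel \<Longrightarrow> inner (E B \<phi>) \<psi> = inner \<phi> (E B \<psi>)"
  by (simp add: inner_L2_def E_self_adjoint)

lemma E_inter: "A \<in> sets borel \<Longrightarrow> B \<in> sets borel \<Longrightarrow> E A (E B \<psi>) = E (A \<inter> B) \<psi>"
  using pvm by (simp add: projection_valued_measure_def)

lemma E_empty: "E {} \<psi> = 0" and E_UNIV: "E UNIV \<psi> = \<psi>"
  using pvm by (auto simp: projection_valued_measure_def)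

lemma E_sums: "range B \<subseteq> sets borel \<Longrightarrow> disjoint_family B \<Longrightarrow> (\<lambda>n. E (B n) \<psi>) sums E (\<Union>n. B n) \<psi>" for B :: "nat \<Rightarrow> real set"
  using pvm by (simp add: projection_valued_measure_def)

lemma E_union:
  assumes "A \<in> sets borel" "B \<in> sets borel" "A \<inter> B = {}"
  shows "E (A \<union> B) \<psi> = E A \<psi> + E B \<psi>"
proof -
  define D where "D n = (if n = 0 then A else if n = 1 then B else {})" for n :: nat
  have "disjoint_family D" using assms(3) by (auto simp: disjoint_family_on_def D_def)
  moreover have "range D \<subseteq> sets borel" using assms by (auto simp: D_def)
  ultimately have "(\<lambda>n. E (D n) \<psi>) sums E (\<Union>n. D n) \<psi>" by (intro E_sums)
  moreover have "(\<lambda>n. E (D n) \<psi>) sums (\<Sum>n\<in>{0,1}. E (D n) \<psi>)"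
    by (rule sums_finite) (auto simp: D_def E_empty)
  moreover have "(\<Union>n. D n) = A \<union> B" by (auto simp: D_def split: if_splits)
  ultimately show ?thesis by (auto simp: D_def dest: sums_unique2)
qed

lemma E_Compl: "A \<in> sets borel \<Longrightarrow> E (- A) \<psi> = \<psi> - E A \<psi>"
  using E_union[of A "- A" \<psi>] by (simp add: Compl_partition E_UNIV eq_diff_eq add.commute)

lemma E_norm: "B \<in> sets borel \<Longrightarrow> inner \<psi> (E B \<psi>) = (norm (E B \<psi>))\<^sup>2"
  using E_inner[of B \<psi> "E B \<psi>"] E_inter[of B B \<psi>] by (simp add: power2_norm_eq_inner)

abbreviation "\<mu> \<equiv> spectral_measure E"

lemma emeasure_\<mu>: "B \<in> sets borel \<Longrightarrow> emeasure (\<mu> \<psi>) B = ennreal ((norm (E B \<psi>))\<^sup>2)"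
  using emeasure_spectral_measure[OF pvm, of B \<psi>] E_norm[of B \<psi>] by (simp add: inner_L2_def)

lemma space_\<mu>: "space (\<mu> \<psi>) = UNIV"
  using sets_eq_imp_space_eq[OF sets_spectral_measure[of E \<psi>]] by simp

lemma finite_\<mu>: "finite_measure (\<mu> \<psi>)"
  by (rule finite_measureI) (simp add: space_\<mu> emeasure_\<mu>)

lemma measure_\<mu>: "B \<in> sets borel \<Longrightarrow> measure (\<mu> \<psi>) B = (norm (E B \<psi>))\<^sup>2"
  by (simp add: measure_def emeasure_\<mu>)

text \<open>Multiplicativity E B (E A \<psi>) = E (A \<inter> B) \<psi> says that cutting a vector
  restricts its spectral measure. Forms on spectral subspaces thereby become integrals over
  A.\<close>

lemma \<mu>_restrict:
  assumes A: "A \<in> sets borel"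
  shows "\<mu> (E A \<psi>) = density (\<mu> \<psi>) (indicator A)"
proof (rule measure_eqI)
  fix B assume "B \<in> sets (\<mu> (E A \<psi>))"
  then have B: "B \<in> sets borel" by simp
  have "emeasure (density (\<mu> \<psi>) (indicator A)) B = emeasure (\<mu> \<psi>) (A \<inter> B)"
  proof (subst emeasure_density)
    show "(indicator A :: real \<Rightarrow> ennreal) \<in> borel_measurable (\<mu> \<psi>)" using A by (intro borel_measurable_indicator) simp
  qed (use A B in \<open>auto simp: indicator_inter_arith[symmetric]\<close>)
  then show "emeasure (\<mu> (E A \<psi>)) B = emeasure (density (\<mu> \<psi>) (indicator A)) B"
    using A B by (simp add: emeasure_\<mu> E_inter Int_commute)
qed simp

lemma integral_\<mu>_restrict:
  fixes f :: "real \<Rightarrow> real"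
  assumes A: "A \<in> sets borel" and f: "f \<in> borel_measurable borel"
  shows "(LINT x|\<mu> (E A \<psi>). f x) = (LINT x|\<mu> \<psi>. indicator A x * f x)"
    "integrable (\<mu> (E A \<psi>)) f \<longleftrightarrow> integrable (\<mu> \<psi>) (\<lambda>x. indicator A x * f x)"
proof -
  have d: "density (\<mu> \<psi>) (indicator A) = density (\<mu> \<psi>) (\<lambda>x. ennreal (indicator A x))"
  proof (rule density_cong)
    show "(indicator A :: real \<Rightarrow> ennreal) \<in> borel_measurable (\<mu> \<psi>)" using A by (intro borel_measurable_indicator) simp
    have "(indicator A :: real \<Rightarrow> real) \<in> borel_measurable (\<mu> \<psi>)" using A by (intro borel_measurable_indicator) simp
    then show "(\<lambda>x. ennreal (indicator A x)) \<in> borel_measurable (\<mu> \<psi>)" by measurable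
  qed (simp add: indicator_def)
  have m: "f \<in> borel_measurable (\<mu> \<psi>)" "(indicator A :: real \<Rightarrow> real) \<in> borel_measurable (\<mu> \<psi>)"
    using f A by (simp_all add: measurable_cong_sets[OF sets_spectral_measure refl] borel_measurable_indicator)
  show "(LINT x|\<mu> (E A \<psi>). f x) = (LINT x|\<mu> \<psi>. indicator A x * f x)"
    unfolding \<mu>_restrict[OF A] d using integral_density[OF m] by simp
  show "integrable (\<mu> (E A \<psi>)) f \<longleftrightarrow> integrable (\<mu> \<psi>) (\<lambda>x. indicator A x * f x)"
    unfolding \<mu>_restrict[OF A] d using integrable_density[OF m] by simp
qed

lemma integrable_\<mu>_bounded:
  assumes "f \<in> borel_measurable borel" "\<And>x. \<bar>f x\<bar> \<le> K"
  shows "integrable (\<mu> \<psi>) (f :: real \<Rightarrow> real)"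
proof (rule finite_measure.integrable_const_bound[OF finite_\<mu>])
  show "f \<in> borel_measurable (\<mu> \<psi>)" using assms by (simp add: measurable_cong_sets[OF sets_spectral_measure refl])
qed (use assms in auto)

end

section \<open>Linearity of the Schroedinger operator\<close>

text \<open>Splitting the integrals needs integrability: a test function and its derivative are
  continuous with compact support, hence square integrable, and so are integrable against any
  element of L2.\<close>

lemma weak_deriv_lin:
  assumes "has_weak_deriv u u'" "has_weak_deriv w w'"
  shows "has_weak_deriv (scaleC_L2 c u + w) (scaleC_L2 c u' + w')"
proof -
  obtain f f' g g' where *: "square_integrable f" "u = abs_L2 f" "square_integrable f'" "u' = abs_L2 f'"
    "square_integrable g" "w = abs_L2 g" "square_integrable g'" "w' = abs_L2 g'"
    by (metis L2_cases)
  have int: "integrable lborel (\<lambda>x. \<phi> x *\<^sub>R h x)" "integrable lborel (\<lambda>x. deriv \<phi> x *\<^sub>R h x)"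
    if "test_function \<phi>" "square_integrable h" for \<phi> h
  proof -
    have co: "continuous_on UNIV ((deriv ^^ n) \<phi>)" for n
      using that by (auto simp: test_function_def intro: differentiable_imp_continuous_on)
    have c0: "continuous_on UNIV \<phi>" and c1: "continuous_on UNIV (deriv \<phi>)" using co[of 0] co[of 1] by simp_all
    define K where "K = closure {x. \<phi> x \<noteq> 0}"
    have K: "compact K" using that by (simp add: test_function_def K_def)
    have z: "\<phi> x = 0" if "x \<notin> K" for x using that closure_subset[of "{x. \<phi> x \<noteq> 0}"] by (auto simp: K_def)
    have z': "deriv \<phi> x = 0" if "x \<notin> K" for x
    proof -
      have "open (- K)" using K by (simp add: compact_imp_closed open_Compl)
      then have "(\<phi> has_field_derivative 0) (at x)"
        by (intro has_field_derivative_transform_within_open[where f = "\<lambda>_. 0" and g = \<phi> and S = "- K"]) (use z that in auto)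
      then show ?thesis by (simp add: DERIV_imp_deriv)
    qed
    have si: "square_integrable (\<lambda>x. complex_of_real (q x))" if q: "continuous_on UNIV q" "\<And>x. x \<notin> K \<Longrightarrow> q x = 0" for q :: "real \<Rightarrow> real"
    proof -
      obtain B where B: "K \<subseteq> {-B..B}" using compact_imp_bounded[OF K] by (auto simp: bounded_iff abs_le_iff) (metis abs_le_iff abs_le_D1 abs_le_D2 minus_le_iff subsetI atLeastAtMost_iff)
      have "integrable lborel (\<lambda>x. indicator {-B..B} x *\<^sub>R (q x)\<^sup>2)"
        by (rule borel_integrable_compact) (auto intro!: continuous_intros continuous_on_subset[OF q(1)])
      moreover have eq: "indicator {-B..B} x *\<^sub>R (q x)\<^sup>2 = (cmod (complex_of_real (q x)))\<^sup>2" for x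
        using q(2)[of x] B by (cases "x \<in> K"; cases "x \<in> {-B..B}") auto
      ultimately have "integrable lborel (\<lambda>x. (cmod (complex_of_real (q x)))\<^sup>2)" by (simp only: eq)
      moreover have "(\<lambda>x. complex_of_real (q x)) \<in> borel_measurable lborel"
        using q(1) by (simp add: borel_measurable_continuous_onI continuous_on_of_real)
      ultimately show ?thesis by (simp add: square_integrable_def)
    qed
    show "integrable lborel (\<lambda>x. \<phi> x *\<^sub>R h x)"
      using square_integrable_mult[OF si[OF c0 z] that(2)] by (simp add: scaleR_conv_of_real)
    show "integrable lborel (\<lambda>x. deriv \<phi> x *\<^sub>R h x)"
      using square_integrable_mult[OF si[OF c1 z'] that(2)] by (simp add: scaleR_conv_of_real)
  qed
  have "(LINT x|lborel. deriv \<phi> x *\<^sub>R (c * f x + g x)) = - (LINT x|lborel. \<phi> x *\<^sub>R (c * f' x + g' x))"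
    if \<phi>: "test_function \<phi>" for \<phi>
  proof -
    have 1: "(LINT x|lborel. deriv \<phi> x *\<^sub>R f x) = - (LINT x|lborel. \<phi> x *\<^sub>R f' x)"
      "(LINT x|lborel. deriv \<phi> x *\<^sub>R g x) = - (LINT x|lborel. \<phi> x *\<^sub>R g' x)"
      using assms * \<phi> by (auto simp: has_weak_deriv.abs_eq)
    have sp: "(LINT x|lborel. q x *\<^sub>R (c * a x + b x)) = c * (LINT x|lborel. q x *\<^sub>R a x) + (LINT x|lborel. q x *\<^sub>R b x)"
      if "integrable lborel (\<lambda>x. q x *\<^sub>R a x)" "integrable lborel (\<lambda>x. q x *\<^sub>R b x)" for q a b
    proof -
      have "(LINT x|lborel. q x *\<^sub>R (c * a x + b x)) = (LINT x|lborel. c * (q x *\<^sub>R a x) + q x *\<^sub>R b x)"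
        by (simp add: scaleR_add_right)
      also have "\<dots> = (LINT x|lborel. c * (q x *\<^sub>R a x)) + (LINT x|lborel. q x *\<^sub>R b x)"
        by (rule Bochner_Integration.integral_add[OF integrable_mult_right that(2)]) (rule that(1))
      also have "(LINT x|lborel. c * (q x *\<^sub>R a x)) = c * (LINT x|lborel. q x *\<^sub>R a x)"
        by (rule integral_mult_right_zero)
      finally show ?thesis .
    qed
    show ?thesis using int[OF \<phi>] * 1 by (simp add: sp)
  qed
  then show ?thesis using * by (simp add: abs_L2_ops square_integrable_cmult square_integrable_add has_weak_deriv.abs_eq)
qed

lemma is_product_lin:
  assumes "is_product V u u'" "is_product V w w'"
  shows "is_product V (scaleC_L2 c u + w) (scaleC_L2 c u' + w')"
proof -
  obtain f f' g g' where *: "square_integrable f" "u = abs_L2 f" "square_integrable f'" "u' = abs_L2 f'"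
    "square_integrable g" "w = abs_L2 g" "square_integrable g'" "w' = abs_L2 g'"
    by (metis L2_cases)
  have "AE x in lborel. f' x = V x *\<^sub>R f x" "AE x in lborel. g' x = V x *\<^sub>R g x"
    using assms * by (auto simp: is_product.abs_eq)
  then have "AE x in lborel. c * f' x + g' x = V x *\<^sub>R (c * f x + g x)"
    by eventually_elim (simp add: scaleR_add_right)
  then show ?thesis using * by (simp add: abs_L2_ops square_integrable_cmult square_integrable_add is_product.abs_eq)
qed

lemma schrodinger_lin:
  assumes "(u, u') \<in> schrodinger V" "(w, w') \<in> schrodinger V"
  shows "(scaleC_L2 c u + w, scaleC_L2 c u' + w') \<in> schrodinger V"
proof -
  obtain u1 u2 \<xi> where u: "has_weak_deriv u u1" "has_weak_deriv u1 u2" "is_product V u \<xi>" "u' = - u2 + \<xi>"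
    using assms(1) unfolding schrodinger_def by blast
  obtain w1 w2 \<zeta> where w: "has_weak_deriv w w1" "has_weak_deriv w1 w2" "is_product V w \<zeta>" "w' = - w2 + \<zeta>"
    using assms(2) unfolding schrodinger_def by blast
  have m: "scaleC_L2 c (- x) = - scaleC_L2 c x" for x
    by (simp add: uminus_L2_def scaleC_L2_simps)
  have "scaleC_L2 c u' + w' = - (scaleC_L2 c u2 + w2) + (scaleC_L2 c \<xi> + \<zeta>)"
    unfolding u(4) w(4) scaleC_L2_simps m by (simp add: algebra_simps)
  then show ?thesis
    using weak_deriv_lin[OF u(1) w(1)] weak_deriv_lin[OF u(2) w(2)] is_product_lin[OF u(3) w(3)]
    unfolding schrodinger_def by blast
qed

section \<open>Spectral calculus from the quadratic form\<close>

locale spectral_op = pvm E for E +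
  fixes V :: "real \<Rightarrow> real"
  assumes dom: "Domain (schrodinger V) = {\<psi>. integrable (\<mu> \<psi>) (\<lambda>x. x\<^sup>2)}"
    and form: "\<And>\<psi> \<eta>. (\<psi>, \<eta>) \<in> schrodinger V \<Longrightarrow> cinner_L2 \<psi> \<eta> = of_real (LINT x|\<mu> \<psi>. x)"
begin

lemma in_domain_bounded:
  assumes A: "A \<in> sets borel" "\<And>x. x \<in> A \<Longrightarrow> \<bar>x\<bar> \<le> K"
  shows "\<exists>\<eta>. (E A \<psi>, \<eta>) \<in> schrodinger V"
proof -
  have "integrable (\<mu> \<psi>) (\<lambda>x. indicator A x * x\<^sup>2)"
  proof (rule integrable_\<mu>_bounded)
    show "(\<lambda>x. indicator A x * x\<^sup>2) \<in> borel_measurable borel" using A(1) by measurable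
    show "\<bar>indicator A x * x\<^sup>2\<bar> \<le> K\<^sup>2" for x
    proof (cases "x \<in> A")
      case True
      then have "\<bar>x\<bar>\<^sup>2 \<le> K\<^sup>2" using A(2) by (intro power_mono) auto
      with True show ?thesis by simp
    qed simp
  qed
  then have "integrable (\<mu> (E A \<psi>)) (\<lambda>x. x\<^sup>2)"
    using integral_\<mu>_restrict(2)[OF A(1), of "\<lambda>x. x\<^sup>2" \<psi>] by simp
  then show ?thesis using dom by blast
qed

lemma integrable_id:
  assumes "(u, u') \<in> schrodinger V"
  shows "integrable (\<mu> u) (\<lambda>x. x)"
proof -
  have "integrable (\<mu> u) (\<lambda>x. x\<^sup>2)" using assms dom by blast
  moreover have "integrable (\<mu> u) (\<lambda>x. 1 :: real)" by (rule integrable_\<mu>_bounded[where K = 1]) auto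
  ultimately have i: "integrable (\<mu> u) (\<lambda>x. x\<^sup>2 + 1)" by simp
  show ?thesis
  proof (rule Bochner_Integration.integrable_bound[OF i])
    show "(\<lambda>x. x) \<in> borel_measurable (\<mu> u)" by (simp add: measurable_cong_sets[OF sets_spectral_measure refl])
    show "AE x in \<mu> u. norm x \<le> norm (x\<^sup>2 + 1)"
    proof (rule AE_I2)
      fix x :: real
      have "0 \<le> (\<bar>x\<bar> - 1)\<^sup>2" by simp
      then have "2 * \<bar>x\<bar> \<le> x\<^sup>2 + 1" by (simp add: power2_eq_square algebra_simps)
      then show "norm x \<le> norm (x\<^sup>2 + 1)" by simp
    qed
  qed
qed

lemma form_real: "(u, u') \<in> schrodinger V \<Longrightarrow> inner u u' = (LINT x|\<mu> u. x)"
  using form[of u u'] by (simp add: inner_L2_def)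

text \<open>The form is known to be real on the domain. On i w + u its imaginary part is the
  difference of the two mixed terms, which is therefore 0.\<close>

lemma symmetric:
  assumes u: "(u, u') \<in> schrodinger V" and w: "(w, w') \<in> schrodinger V"
  shows "inner u w' = inner w u'"
proof -
  have z: "(scaleC_L2 \<i> w + u, scaleC_L2 \<i> w' + u') \<in> schrodinger V"
    by (rule schrodinger_lin[OF w u])
  have "Im (cinner_L2 u u') = 0" "Im (cinner_L2 w w') = 0"
    "Im (cinner_L2 (scaleC_L2 \<i> w + u) (scaleC_L2 \<i> w' + u')) = 0"
    using form[OF u] form[OF w] form[OF z] by simp_all
  then show ?thesis by (simp add: cinner_L2_simps(1-4) inner_L2_def)
qed

lemma schrodinger_real_lin:
  assumes "(u, u') \<in> schrodinger V" "(w, w') \<in> schrodinger V"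
  shows "(t *\<^sub>R u + w, t *\<^sub>R u' + w') \<in> schrodinger V"
  using schrodinger_lin[OF assms, of "of_real t"] by (simp add: scaleC_L2_simps)

text \<open>If E A w = 0, the spectral measure of u + w consists of that of u on A and that of w off
  A, so the form is additive; with symmetry the mixed term \<open>inner w u'\<close> vanishes.
  Enough such w exist in the domain to conclude E (- A) u' = 0.\<close>

lemma range_invariant:
  assumes A: "A \<in> sets borel" and u: "(u, u') \<in> schrodinger V" "E A u = u"
  shows "E A u' = u'"
proof -
  have orth: "inner w u' = 0" if w: "(w, w') \<in> schrodinger V" "E A w = 0" for w w'
  proof -
    have s: "(u + w, u' + w') \<in> schrodinger V" using schrodinger_real_lin[OF u(1) w(1), of 1] by simp
    have Au: "E A (u + w) = u" using E_add[OF A, of u w] u w by simp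
    have Aw: "E (- A) (u + w) = w" using E_Compl[OF A, of "u + w"] Au by simp
    have "(LINT x|\<mu> u. x) = (LINT x|\<mu> (u + w). indicator A x * x)"
      using integral_\<mu>_restrict(1)[OF A, of "\<lambda>x. x" "u + w"] unfolding Au by simp
    moreover have "(LINT x|\<mu> w. x) = (LINT x|\<mu> (u + w). indicator (- A) x * x)"
      using integral_\<mu>_restrict(1)[of "- A" "\<lambda>x. x" "u + w"] A unfolding Aw by simp
    moreover have "(LINT x|\<mu> (u + w). x) = (LINT x|\<mu> (u + w). indicator A x * x) + (LINT x|\<mu> (u + w). indicator (- A) x * x)"
    proof -
      have "integrable (\<mu> (u + w)) (\<lambda>x. indicator A x * x)" "integrable (\<mu> (u + w)) (\<lambda>x. indicator (- A) x * x)"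
        using integrable_id[OF s] A
        using integrable_mult_indicator[of A "\<mu> (u + w)" "\<lambda>x. x"] integrable_mult_indicator[of "- A" "\<mu> (u + w)" "\<lambda>x. x"] by auto
      then have "(LINT x|\<mu> (u + w). indicator A x * x) + (LINT x|\<mu> (u + w). indicator (- A) x * x)
         = (LINT x|\<mu> (u + w). indicator A x * x + indicator (- A) x * x)" by simp
      also have "\<dots> = (LINT x|\<mu> (u + w). x)" by (intro Bochner_Integration.integral_cong) (auto simp: indicator_def)
      finally show ?thesis ..
    qed
    ultimately have "inner (u + w) (u' + w') = inner u u' + inner w w'"
      using form_real[OF s] form_real[OF u(1)] form_real[OF w(1)] by simp
    then have "inner u w' + inner w u' = 0" by (simp add: inner_add_left inner_add_right)
    then show ?thesis using symmetric[OF u(1) w(1)] by simp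
  qed
  \<comment> \<open>Bounded pieces of the complement of A: \<open>E (D n) u'\<close> lies in the
    domain, so \<open>orth\<close> applies to this very vector and shows that its norm is 0.\<close>
  define D where "D n = {x :: real. real n \<le> \<bar>x\<bar> \<and> \<bar>x\<bar> < real n + 1} \<inter> - A" for n :: nat
  have Db: "D n \<in> sets borel" for n
  proof -
    have "{x :: real. real n \<le> \<bar>x\<bar> \<and> \<bar>x\<bar> < real n + 1} \<in> sets borel" by measurable
    then show ?thesis unfolding D_def using A by auto
  qed
  have "E (D n) u' = 0" for n
  proof -
    obtain w' where w': "(E (D n) u', w') \<in> schrodinger V"
      using in_domain_bounded[OF Db[of n], of "real n + 1" u'] by (auto simp: D_def)
    have "A \<inter> D n = {}" by (auto simp: D_def)
    then have "E A (E (D n) u') = 0" using E_inter[OF A Db[of n]] E_empty by simp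
    from orth[OF w' this] have "inner (E (D n) u') u' = 0" .
    then show ?thesis using E_norm[OF Db[of n], of u'] by (simp add: inner_commute)
  qed
  moreover have "(\<lambda>n. E (D n) u') sums E (\<Union>n. D n) u'"
  proof (rule E_sums)
    show "disjoint_family D" unfolding disjoint_family_on_def
    proof (intro ballI impI)
      fix m n :: nat assume "m \<noteq> n"
      then show "D m \<inter> D n = {}" by (auto simp: D_def)
    qed
  qed (use Db in auto)
  moreover have "(\<Union>n. D n) = - A"
  proof -
    have "\<exists>n. real n \<le> \<bar>x\<bar> \<and> \<bar>x\<bar> < real n + 1" for x :: real
      by (rule exI[of _ "nat \<lfloor>\<bar>x\<bar>\<rfloor>"]) (simp add: of_nat_floor)
    then show ?thesis by (auto simp: D_def)
  qed
  ultimately have "E (- A) u' = 0" by (simp add: sums_iff)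
  then show ?thesis using E_Compl[OF A, of u'] by simp
qed

text \<open>On the range of E A the form of H - e0 lies between 0 and \<delta> times the squared
  norm. To get an operator bound from forms alone, nonnegativity is tested at u + t r with r = (H -
  e0) u, where the mixed terms reproduce the squared norm of r.\<close>

lemma near_eigenvector:
  assumes A: "A \<in> sets borel" "\<And>x. x \<in> A \<Longrightarrow> e0 \<le> x \<and> x \<le> e0 + \<delta>" and \<delta>: "0 < \<delta>"
    and u: "(u, u') \<in> schrodinger V" "E A u = u"
  shows "norm (u' - e0 *\<^sub>R u) \<le> \<delta> * norm u" "E A (u' - e0 *\<^sub>R u) = u' - e0 *\<^sub>R u"
    "\<exists>r'. (u' - e0 *\<^sub>R u, r') \<in> schrodinger V"
proof -
  have bd: "\<bar>x\<bar> \<le> \<bar>e0\<bar> + \<delta>" if "x \<in> A" for x using A(2)[OF that] \<delta> by linarith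
  define r where "r = u' - e0 *\<^sub>R u"
  have Ar: "E A r = r" unfolding r_def using range_invariant[OF A(1) u] u A(1) by (simp add: E_diff E_scaleR)
  obtain r' where r': "(r, r') \<in> schrodinger V"
    using in_domain_bounded[OF A(1) bd, of r] Ar by auto
  have q: "0 \<le> inner z z' - e0 * inner z z \<and> inner z z' - e0 * inner z z \<le> \<delta> * inner z z"
    if z: "(z, z') \<in> schrodinger V" "E A z = z" for z z'
  proof -
    have i1: "integrable (\<mu> z) (\<lambda>x. indicator A x * x)"
      using integrable_mult_indicator[OF _ integrable_id[OF z(1)], of A] A(1) by simp
    have i2: "integrable (\<mu> z) (\<lambda>x. indicator A x * c)" for c :: real
    proof (rule integrable_\<mu>_bounded)
      show "(\<lambda>x. indicator A x * c) \<in> borel_measurable borel" using A(1) by measurable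
      show "\<bar>indicator A x * c\<bar> \<le> \<bar>c\<bar>" for x by (simp add: indicator_def)
    qed
    note i = i1 i2
    have z1: "inner z z' = (LINT x|\<mu> z. indicator A x * x)"
      using form_real[OF z(1)] integral_\<mu>_restrict(1)[OF A(1), of "\<lambda>x. x" z] unfolding z(2) by simp
    have z2: "(LINT x|\<mu> z. indicator A x * c) = c * inner z z" for c
    proof -
      have 1: "(LINT x|\<mu> z. indicator A x * c) = (LINT x|\<mu> z. c)"
        using integral_\<mu>_restrict(1)[of A "\<lambda>x. c" z] A(1) unfolding z(2) by (metis borel_measurable_const)
      have 2: "(LINT x|\<mu> z. c) = measure (\<mu> z) UNIV * c" by (simp only: lebesgue_integral_const space_\<mu> real_scaleR_def)
      have 3: "measure (\<mu> z) UNIV = inner z z" using measure_\<mu>[of UNIV z] by (simp only: E_UNIV power2_norm_eq_inner) simp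
      show ?thesis unfolding 1 2 3 by (rule mult.commute)
    qed
    have "(LINT x|\<mu> z. indicator A x * e0) \<le> (LINT x|\<mu> z. indicator A x * x)"
      using A(2) by (intro integral_mono i) (auto simp: indicator_def)
    moreover have "(LINT x|\<mu> z. indicator A x * x) \<le> (LINT x|\<mu> z. indicator A x * (e0 + \<delta>))"
      using A(2) by (intro integral_mono i) (auto simp: indicator_def)
    ultimately show ?thesis unfolding z1 z2 by (simp add: algebra_simps)
  qed
  \<comment> \<open>The minimizer of \<delta> t^2 |r|^2 + 2 t |r|^2.\<close>
  define t where "t = - 1 / \<delta>"
  have z: "(t *\<^sub>R r + u, t *\<^sub>R r' + u') \<in> schrodinger V" by (rule schrodinger_real_lin[OF r' u(1)])
  have Az: "E A (t *\<^sub>R r + u) = t *\<^sub>R r + u" using A(1) Ar u by (simp add: E_add E_scaleR)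
  define b where "b = inner r r' - e0 * inner r r"
  define a where "a = inner u u' - e0 * inner u u"
  have ur: "inner u r' - e0 * inner u r = inner r r"
    using symmetric[OF u(1) r'] by (simp add: r_def inner_diff_right inner_diff_left inner_commute algebra_simps)
  have ru: "inner r u' - e0 * inner r u = inner r r"
    by (simp add: r_def inner_diff_right inner_diff_left inner_commute algebra_simps)
  have "0 \<le> inner (t *\<^sub>R r + u) (t *\<^sub>R r' + u') - e0 * inner (t *\<^sub>R r + u) (t *\<^sub>R r + u)"
    using q[OF z Az] by simp
  also have "\<dots> = t\<^sup>2 * b + t * (inner u r' - e0 * inner u r) + t * (inner r u' - e0 * inner r u) + a"
    by (simp add: a_def b_def inner_add_left inner_add_right power2_eq_square algebra_simps)
  also have "\<dots> = t\<^sup>2 * b + 2 * t * inner r r + a" unfolding ur ru by simp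
  also have "\<dots> \<le> t\<^sup>2 * (\<delta> * inner r r) + 2 * t * inner r r + \<delta> * inner u u"
  proof (rule add_mono[OF add_right_mono])
    show "t\<^sup>2 * b \<le> t\<^sup>2 * (\<delta> * inner r r)" using q[OF r' Ar] unfolding b_def by (intro mult_left_mono) auto
    show "a \<le> \<delta> * inner u u" using q[OF u] unfolding a_def by blast
  qed
  also have "\<dots> = \<delta> * inner u u - inner r r / \<delta>" using \<delta> by (simp add: t_def power2_eq_square field_simps)
  finally have "inner r r \<le> \<delta>\<^sup>2 * inner u u" using \<delta> by (simp add: power2_eq_square field_simps)
  then have "(norm r)\<^sup>2 \<le> (\<delta> * norm u)\<^sup>2" unfolding power2_norm_eq_inner power_mult_distrib .
  then show "norm (u' - e0 *\<^sub>R u) \<le> \<delta> * norm u"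
    using \<delta> unfolding r_def[symmetric] by (elim power2_le_imp_le) simp
  show "E A (u' - e0 *\<^sub>R u) = u' - e0 *\<^sub>R u" using Ar by (simp add: r_def)
  show "\<exists>r'. (u' - e0 *\<^sub>R u, r') \<in> schrodinger V" using r' by (auto simp: r_def)
qed

lemma cinner_disjoint:
  assumes "A \<in> sets borel" "B \<in> sets borel" "A \<inter> B = {}" "E A u = u" "E B w = w"
  shows "cinner_L2 u w = 0"
proof -
  have "cinner_L2 u w = cinner_L2 (E A u) (E B w)" using assms(4,5) by simp
  also have "\<dots> = cinner_L2 u (E A (E B w))" by (rule E_self_adjoint[OF assms(1)])
  also have "E A (E B w) = 0" using E_inter[OF assms(1,2), of w] assms(3) E_empty by simp
  finally show ?thesis using cinner_L2_simps(4)[of u 0 0] by simp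
qed

end


section \<open>Regularity of weak derivatives\<close>

text \<open>The graded form of the smoothness in \<open>test_function\<close>; closure properties
  can then be shown by induction on n.\<close>

definition smooth_upto :: "nat \<Rightarrow> (real \<Rightarrow> real) \<Rightarrow> bool" where
  "smooth_upto n f \<longleftrightarrow> (\<forall>m\<le>n. (deriv ^^ m) f differentiable_on UNIV)"

lemma smooth_upto_0: "smooth_upto 0 f \<longleftrightarrow> f differentiable_on UNIV"
  by (simp add: smooth_upto_def)

lemma smooth_upto_Suc: "smooth_upto (Suc n) f \<longleftrightarrow> f differentiable_on UNIV \<and> smooth_upto n (deriv f)"
  (is "?L \<longleftrightarrow> ?R")
proof
  assume L: ?L
  have "(deriv ^^ m) (deriv f) differentiable_on UNIV" if "m \<le> n" for m
    using L[unfolded smooth_upto_def, rule_format, of "Suc m"] that unfolding funpow_Suc_right o_def by blast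
  then show ?R using L[unfolded smooth_upto_def, rule_format, of 0] by (simp add: smooth_upto_def)
next
  assume R: ?R
  have "(deriv ^^ m) f differentiable_on UNIV" if "m \<le> Suc n" for m
  proof (cases m)
    case 0
    then show ?thesis using R by simp
  next
    case (Suc k)
    then show ?thesis using R that unfolding smooth_upto_def Suc funpow_Suc_right o_def by auto
  qed
  then show ?L by (simp add: smooth_upto_def)
qed

lemma smooth_upto_mono: "smooth_upto n f \<Longrightarrow> m \<le> n \<Longrightarrow> smooth_upto m f"
  by (simp add: smooth_upto_def)

lemma smooth_upto_DERIV:
  assumes "smooth_upto n f" shows "(f has_real_derivative deriv f x) (at x)"
proof -
  have "f differentiable at x"
    using smooth_upto_mono[OF assms, of 0] by (simp add: smooth_upto_0 differentiable_on_def)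
  then show ?thesis using DERIV_deriv_iff_real_differentiable by blast
qed

lemma smooth_uptoI:
  assumes "\<And>x. (f has_real_derivative f' x) (at x)" "smooth_upto n f'"
  shows "smooth_upto (Suc n) f"
proof -
  have "deriv f = f'" using assms(1) by (auto intro: DERIV_imp_deriv)
  moreover have "f differentiable_on UNIV"
    using assms(1) by (auto simp: differentiable_on_def real_differentiable_def)
  ultimately show ?thesis using assms(2) by (simp add: smooth_upto_Suc)
qed

lemma smooth_upto_0I: "(\<And>x. (f has_real_derivative f' x) (at x)) \<Longrightarrow> smooth_upto 0 f"
  unfolding smooth_upto_0 differentiable_on_def real_differentiable_def by auto

text \<open>Linear combination and affine substitution are treated together because the derivative
  again has this shape, so one induction covers both.\<close>

lemma smooth_upto_lin:
  assumes "smooth_upto n f" "smooth_upto n g"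
  shows "smooth_upto n (\<lambda>x. a * f (k * x + d) + b * g x)"
  using assms
proof (induction n arbitrary: f g a b)
  case 0
  have "((\<lambda>x. a * f (k * x + d) + b * g x) has_real_derivative a * (k * deriv f (k * x + d)) + b * deriv g x) (at x)" for x
  proof -
    have "((\<lambda>x. f (k * x + d)) has_real_derivative deriv f (k * x + d) * k) (at x)"
      by (rule DERIV_chain'[OF _ smooth_upto_DERIV[OF 0(1)]]) (auto intro!: derivative_eq_intros)
    then show ?thesis using smooth_upto_DERIV[OF 0(2), of x] by (auto intro!: derivative_eq_intros)
  qed
  then show ?case by (rule smooth_upto_0I)
next
  case (Suc n)
  have "((\<lambda>x. a * f (k * x + d) + b * g x) has_real_derivative (a * k) * deriv f (k * x + d) + b * deriv g x) (at x)" for x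
  proof -
    have "((\<lambda>x. f (k * x + d)) has_real_derivative deriv f (k * x + d) * k) (at x)"
      by (rule DERIV_chain'[OF _ smooth_upto_DERIV[OF Suc.prems(1)]]) (auto intro!: derivative_eq_intros)
    then show ?thesis using smooth_upto_DERIV[OF Suc.prems(2), of x] by (auto intro!: derivative_eq_intros)
  qed
  moreover have "smooth_upto n (\<lambda>x. (a * k) * deriv f (k * x + d) + b * deriv g x)"
    using Suc.prems by (intro Suc.IH) (simp_all add: smooth_upto_Suc)
  ultimately show ?case by (rule smooth_uptoI)
qed

lemma smooth_upto_mult:
  assumes "smooth_upto n f" "smooth_upto n g"
  shows "smooth_upto n (\<lambda>x. f x * g x)"
  using assms
proof (induction n arbitrary: f g)
  case 0
  show ?case
    by (rule smooth_upto_0I[OF DERIV_mult[OF smooth_upto_DERIV[OF 0(1)] smooth_upto_DERIV[OF 0(2)]]])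
next
  case (Suc n)
  have d: "smooth_upto n f" "smooth_upto n g" "smooth_upto n (deriv f)" "smooth_upto n (deriv g)"
    using Suc.prems smooth_upto_mono[of "Suc n" _ n] by (auto simp: smooth_upto_Suc)
  have "smooth_upto n (\<lambda>x. deriv f x * g x + deriv g x * f x)"
    using smooth_upto_lin[OF Suc.IH[OF d(3,2)] Suc.IH[OF d(4,1)], of 1 1 0 1] by simp
  then show ?case
    by (rule smooth_uptoI[OF DERIV_mult[OF smooth_upto_DERIV[OF Suc.prems(1)] smooth_upto_DERIV[OF Suc.prems(2)]]])
qed

text \<open>Multiples of $e^{-1/t}$ by polynomials in $1/t$ are closed under differentiation, also at \<open>0\<close>.\<close>

definition flat :: "real poly \<Rightarrow> real \<Rightarrow> real" where
  "flat p t = (if 0 < t then poly p (1 / t) * exp (- 1 / t) else 0)"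

lemma flat_DERIV: "(flat p has_real_derivative flat ([:0, 0, 1:] * (p - pderiv p)) t) (at t)"
proof (cases "t \<noteq> 0")
  case True
  show ?thesis
  proof (cases "0 < t")
    case True
    have "((\<lambda>t. poly p (1 / t) * exp (- 1 / t)) has_real_derivative
        poly ([:0, 0, 1:] * (p - pderiv p)) (1 / t) * exp (- 1 / t)) (at t)"
      using True by (auto intro!: derivative_eq_intros simp: field_simps power2_eq_square)
    then have "(flat p has_real_derivative poly ([:0, 0, 1:] * (p - pderiv p)) (1 / t) * exp (- 1 / t)) (at t)"
      by (rule has_field_derivative_transform_within_open[where S = "{0<..}"]) (use True in \<open>auto simp: flat_def\<close>)
    then show ?thesis using True by (simp add: flat_def)
  next
    case False
    have "((\<lambda>t. 0) has_real_derivative 0) (at t)" by simp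
    then have "(flat p has_real_derivative 0) (at t)"
      by (rule has_field_derivative_transform_within_open[where S = "{..<0}"]) (use False \<open>t \<noteq> 0\<close> in \<open>auto simp: flat_def\<close>)
    then show ?thesis using False by (simp add: flat_def)
  qed
next
  case False
  have mono: "((\<lambda>s. s ^ k * exp (- s :: real)) \<longlongrightarrow> 0) at_top" for k by real_asymp
  have "((\<lambda>s. poly q s * exp (- s)) \<longlongrightarrow> 0) at_top" for q :: "real poly"
  proof -
    have "((\<lambda>s. \<Sum>i\<le>degree q. coeff q i * (s ^ i * exp (- s))) \<longlongrightarrow> (\<Sum>i\<le>degree q. coeff q i * 0)) at_top"
      by (intro tendsto_sum tendsto_mult_left mono)
    then show ?thesis by (simp add: poly_altdef sum_distrib_right mult.assoc)
  qed
  \<comment> \<open>With s = 1 / t the difference quotient of \<open>flat p\<close> at 0 is s * p(s)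
    * exp (- s), and \<open>pCons 0 p\<close> is the polynomial s * p(s).\<close>
  from this[of "pCons 0 p"] have "((\<lambda>t. poly (pCons 0 p) (1 / t) * exp (- (1 / t))) \<longlongrightarrow> 0) (at_right (0::real))"
    by (rule filterlim_compose) real_asymp
  then have "((\<lambda>t. flat p t / t) \<longlongrightarrow> 0) (at_right 0)"
    by (rule tendsto_cong[THEN iffD1, rotated]) (auto simp: flat_def eventually_at_right_less o_def intro!: eventually_at_right_field[THEN iffD2] exI[of _ 1])
  moreover have "((\<lambda>t. flat p t / t) \<longlongrightarrow> 0) (at_left 0)"
    by (rule tendsto_cong[THEN iffD1, of "\<lambda>_. 0"]) (auto simp: flat_def intro!: eventually_at_left_field[THEN iffD2] exI[of _ "-1"])
  ultimately have "((\<lambda>t. flat p t / t) \<longlongrightarrow> 0) (at 0)" by (simp add: filterlim_split_at)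
  then show ?thesis using False by (simp add: has_field_derivative_iff flat_def)
qed

lemma smooth_flat: "smooth_upto n (flat p)"
  by (induction n arbitrary: p) (auto intro: smooth_upto_0I[OF flat_DERIV] smooth_uptoI[OF flat_DERIV])

lemma smooth_antiderivative:
  assumes "\<And>n. smooth_upto n f'" "\<And>x. (f has_real_derivative f' x) (at x)"
  shows "smooth_upto n f"
  using smooth_uptoI[OF assms(2,1)] smooth_upto_mono[of "Suc n" f n] by simp

text \<open>\<open>S\<close> is a smoothed ramp and \<open>\<Phi>\<close> its derivative, a smoothed
  step. A flat bump on [0, 1], integrated and normalized, gives \<Phi>; integrated again it gives S.
  The last bound makes the rescaled ramps converge to max x 0.\<close>

lemma smooth_step_exists:
  obtains S \<Phi> :: "real \<Rightarrow> real" where "\<forall>n. smooth_upto n S" "\<forall>x. (S has_real_derivative \<Phi> x) (at x)"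
    "\<forall>x\<le>0. S x = 0" "\<forall>x\<le>0. \<Phi> x = 0" "\<forall>x\<ge>1. \<Phi> x = 1" "\<forall>x. 0 \<le> \<Phi> x \<and> \<Phi> x \<le> 1"
    "\<forall>x\<ge>1. S x = S 1 + (x - 1)" "\<forall>x. \<bar>S x - max x 0\<bar> \<le> 1"
proof -
  define b where "b x = flat 1 x * flat 1 (1 - x)" for x
  have sb: "smooth_upto n b" for n
    unfolding b_def using smooth_upto_mult[OF smooth_flat[of n 1] smooth_upto_lin[OF smooth_flat[of n 1] smooth_flat[of n 0], of 1 "-1" 1 0]]
    by simp
  have b0: "b x = 0" if "x \<le> 0 \<or> 1 \<le> x" for x using that by (auto simp: b_def flat_def)
  have bp: "0 < b x" if "0 < x" "x < 1" for x using that by (simp add: b_def flat_def)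
  have bn: "0 \<le> b x" for x using b0[of x] bp[of x] by linarith
  have cont: "continuous_on UNIV f" if "smooth_upto 0 f" for f
    using that by (simp add: smooth_upto_0 differentiable_imp_continuous_on)
  obtain F where F: "\<And>x. (F has_real_derivative b x) (at x)" "F 0 = 0"
    using antiderivative_real[OF cont[OF sb], where a = 0] by blast
  have const: "F x = F y" if h: "\<And>z. x \<le> z \<Longrightarrow> z \<le> y \<Longrightarrow> b z = 0" "x \<le> y" for x y
  proof (cases "x = y")
    case False
    then obtain z where "x < z" "z < y" "F y - F x = (y - x) * b z"
      using MVT2[of x y F b] F(1) h(2) by (metis less_le)
    then show ?thesis using h(1)[of z] by simp
  qed simp
  have F1: "0 < F 1"
  proof -
    obtain z where "0 < z" "z < 1" "F 1 - F 0 = (1 - 0) * b z" using MVT2[of 0 1 F b] F(1) by auto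
    then show ?thesis using bp[of z] F(2) by simp
  qed
  have Fmono: "F x \<le> F y" if "x \<le> y" for x y
    by (rule DERIV_nonneg_imp_nondecreasing[OF that]) (use F(1) bn in blast)
  define \<Phi> where "\<Phi> x = F x / F 1" for x
  have \<Phi>0: "\<Phi> x = 0" if "x \<le> 0" for x using const[of x 0] b0 that F(2) by (simp add: \<Phi>_def)
  have \<Phi>1: "\<Phi> x = 1" if "1 \<le> x" for x using const[of 1 x] b0 that F1 by (simp add: \<Phi>_def)
  have \<Phi>b: "0 \<le> \<Phi> x \<and> \<Phi> x \<le> 1" for x
  proof -
    have "F 0 \<le> F x \<or> x \<le> 0" "F x \<le> F 1 \<or> 1 \<le> x" using Fmono by fastforce+
    then show ?thesis using F1 F(2) \<Phi>0 \<Phi>1 by (auto simp: \<Phi>_def field_simps)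
  qed
  have s\<Phi>: "smooth_upto n \<Phi>" for n
  proof (rule smooth_antiderivative[where f' = "\<lambda>x. b x / F 1"])
    show "smooth_upto n (\<lambda>x. b x / F 1)" for n
      using smooth_upto_lin[OF sb sb, of n "1 / F 1" 1 0 0] by simp
    show "(\<Phi> has_real_derivative b x / F 1) (at x)" for x unfolding \<Phi>_def using F(1) by (rule DERIV_cdivide)
  qed
  obtain S where S: "\<And>x. (S has_real_derivative \<Phi> x) (at x)" "S 0 = 0"
    using antiderivative_real[OF cont[OF s\<Phi>], where a = 0] by blast
  have mv: "\<exists>z. x \<le> z \<and> z \<le> y \<and> S y - S x = (y - x) * \<Phi> z" if "x \<le> y" for x y
  proof (cases "x = y")
    case False
    then show ?thesis using MVT2[of x y S \<Phi>] S(1) that by (metis less_le)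
  qed auto
  have S0: "S x = 0" if "x \<le> 0" for x using mv[of x 0] that \<Phi>0 S(2) by auto
  have S1: "S x = S 1 + (x - 1)" if "1 \<le> x" for x using mv[of 1 x] that \<Phi>1 by auto
  have S01: "0 \<le> S x \<and> S x \<le> x" if p: "0 \<le> x" for x
  proof -
    obtain z where "S x = x * \<Phi> z" using mv[of 0 x] p S(2) by auto
    then show ?thesis using \<Phi>b[of z] p by (simp add: mult_left_le)
  qed
  have "\<bar>S x - max x 0\<bar> \<le> 1" for x
  proof (cases "x \<le> 1")
    case True
    then show ?thesis using S0[of x] S01[of x] by (cases "x \<le> 0") (auto simp: max_def)
  next
    case False
    then show ?thesis using S1[of x] S01[of 1] by auto
  qed
  then show ?thesis
    using that smooth_antiderivative[OF s\<Phi> S(1)] S S0 \<Phi>0 \<Phi>1 \<Phi>b S1 by blast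
qed

section \<open>From weak derivatives to continuous representatives\<close>

lemma square_integrable_loc:
  assumes "square_integrable f"
  shows "set_integrable lborel {a..b} f" "f integrable_on {a..b}"
proof -
  have "square_integrable (\<lambda>x. indicator {a..b} x)"
    unfolding square_integrable_def
  proof
    have "(\<lambda>x. (cmod (indicator {a..b} x))\<^sup>2) = (indicator {a..b} :: real \<Rightarrow> real)" by (auto simp: indicator_def)
    then show "integrable lborel (\<lambda>x. (cmod (indicator {a..b} x))\<^sup>2)"
      by (simp add: integrable_indicator_iff emeasure_lborel_Icc_eq)
  qed simp
  from square_integrable_mult[OF this assms]
  have "integrable lborel (\<lambda>x. cnj (indicator {a..b} x) * f x)" .
  moreover have "cnj (indicator {a..b} x) * f x = indicator {a..b} x *\<^sub>R f x" for x by (simp add: indicator_def)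
  ultimately show 1: "set_integrable lborel {a..b} f" by (simp add: set_integrable_def)
  show "f integrable_on {a..b}" using set_borel_integral_eq_integral(1)[OF 1] .
qed

lemma dominated_sequence:
  fixes q :: "nat \<Rightarrow> real \<Rightarrow> real"
  assumes f: "square_integrable f" and q: "\<And>n. q n \<in> borel_measurable borel" "q' \<in> borel_measurable borel"
    and lim: "AE x in lborel. (\<lambda>n. q n x) \<longlonglongrightarrow> q' x"
    and bd: "\<And>n x. \<bar>q n x\<bar> \<le> K" "\<And>n x. x \<notin> {a..b} \<Longrightarrow> q n x = 0"
  shows "(\<lambda>n. LINT x|lborel. q n x *\<^sub>R f x) \<longlonglongrightarrow> (LINT x|lborel. q' x *\<^sub>R f x)"
proof (rule integral_dominated_convergence[where w = "\<lambda>x. K * norm (indicator {a..b} x *\<^sub>R f x)"])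
  have fm: "f \<in> borel_measurable borel" using f by (simp add: square_integrable_def)
  show "(\<lambda>x. q' x *\<^sub>R f x) \<in> borel_measurable lborel" using fm q by simp
  show "(\<lambda>x. q n x *\<^sub>R f x) \<in> borel_measurable lborel" for n using fm q(1)[of n] by simp
  show "integrable lborel (\<lambda>x. K * norm (indicator {a..b} x *\<^sub>R f x))"
    using square_integrable_loc(1)[OF f, of a b] unfolding set_integrable_def
    by (intro integrable_mult_right integrable_norm) auto
  show "AE x in lborel. (\<lambda>n. q n x *\<^sub>R f x) \<longlonglongrightarrow> q' x *\<^sub>R f x"
    using lim by eventually_elim (intro tendsto_intros)
  show "AE x in lborel. norm (q n x *\<^sub>R f x) \<le> K * norm (indicator {a..b} x *\<^sub>R f x)" for n
  proof (rule AE_I2)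
    fix x
    show "norm (q n x *\<^sub>R f x) \<le> K * norm (indicator {a..b} x *\<^sub>R f x)"
      using bd(1)[of n x] bd(2)[of x n] by (cases "x \<in> {a..b}") (auto intro!: mult_right_mono)
  qed
qed

text \<open>The test functions are differences of smoothed ramps and converge to a trapezoid, whose
  derivative is a difference of two indicator functions.\<close>

lemma weak_deriv_trapezoid:
  assumes f: "square_integrable f" and g: "square_integrable g"
    and weak: "\<And>\<phi>. test_function \<phi> \<Longrightarrow> (LINT x|lborel. deriv \<phi> x *\<^sub>R f x) = - (LINT x|lborel. \<phi> x *\<^sub>R g x)"
    and w: "0 \<le> w" and ab: "a \<le> b"
  shows "(LINT x|lborel. (indicator {a..a+w} x - indicator {b..b+w} x) *\<^sub>R f x)
    = - (LINT x|lborel. (max (x - a) 0 - max (x - a - w) 0 - max (x - b) 0 + max (x - b - w) 0) *\<^sub>R g x)"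
proof -
  obtain S \<Phi> :: "real \<Rightarrow> real" where S: "\<forall>n. smooth_upto n S" "\<forall>x. (S has_real_derivative \<Phi> x) (at x)"
    "\<forall>x\<le>0. S x = 0" "\<forall>x\<le>0. \<Phi> x = 0" "\<forall>x\<ge>1. \<Phi> x = 1" "\<forall>x. 0 \<le> \<Phi> x \<and> \<Phi> x \<le> 1"
    "\<forall>x\<ge>1. S x = S 1 + (x - 1)" "\<forall>x. \<bar>S x - max x 0\<bar> \<le> 1"
    by (rule smooth_step_exists)
  define h where "h n = real n + 1" for n
  have h: "0 < h n" "1 \<le> h n" for n by (simp_all add: h_def)
  \<comment> \<open>Rescaled ramps: the smoothing happens on a length 1 / h n and alters the ramp by
    at most 1 / h n.\<close>
  define s where "s n y = S (h n * y) / h n" for n y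
  define \<tau> where "\<tau> n x = s n (x - a) - s n (x - a - w) - s n (x - b) + s n (x - b - w)" for n x
  define \<tau>' where "\<tau>' n x = \<Phi> (h n * (x - a)) - \<Phi> (h n * (x - a - w)) - \<Phi> (h n * (x - b)) + \<Phi> (h n * (x - b - w))" for n x
  have sd: "(s n has_real_derivative \<Phi> (h n * y)) (at y)" for n y
  proof -
    have "((\<lambda>y. S (h n * y)) has_real_derivative \<Phi> (h n * y) * h n) (at y)"
      by (rule DERIV_chain'[OF _ S(2)[rule_format]]) (auto intro!: derivative_eq_intros)
    moreover have "s n = (\<lambda>y. S (h n * y) / h n)" by (auto simp: s_def)
    ultimately show ?thesis using DERIV_cdivide[of "\<lambda>y. S (h n * y)", of _ y UNIV "h n"] h(1)[of n] by fastforce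
  qed
  have sd': "((\<lambda>x. s n (x - c)) has_real_derivative \<Phi> (h n * (x - c))) (at x)" for n c x
  proof -
    have "((\<lambda>x. x - c) has_real_derivative 1) (at x)" by (auto intro!: derivative_eq_intros)
    from DERIV_chain'[OF this sd] show ?thesis by simp
  qed
  have \<tau>d: "(\<tau> n has_real_derivative \<tau>' n x) (at x)" for n x
    unfolding \<tau>_def \<tau>'_def using sd'[of n _ x]
    by (intro DERIV_add DERIV_diff) (auto simp: diff_diff_eq)
  have s0: "s n y = 0" "\<Phi> (h n * y) = 0" if "y \<le> 0" for n y
  proof -
    have "h n * y \<le> 0" using h(1)[of n] that by (simp add: mult_le_0_iff)
    then show "s n y = 0" "\<Phi> (h n * y) = 0" using S(3,4) by (auto simp: s_def)
  qed
  \<comment> \<open>Past its transition a smoothed ramp is the exact one plus a constant. In the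
    alternating sum of four ramps the constants cancel, which gives \<open>\<tau>\<close> compact
    support.\<close>
  have s1: "s n y = (S 1 - 1) / h n + y" "\<Phi> (h n * y) = 1" if "1 / h n \<le> y" for n y
  proof -
    have "1 \<le> h n * y" using h(1)[of n] that by (simp add: field_simps)
    then have "S (h n * y) = S 1 + (h n * y - 1)" "\<Phi> (h n * y) = 1" by (rule S(7)[rule_format], rule S(5)[rule_format])
    then show "s n y = (S 1 - 1) / h n + y" "\<Phi> (h n * y) = 1" using h(1)[of n] by (simp_all add: s_def field_simps)
  qed
  have out: "\<tau> n x = 0 \<and> \<tau>' n x = 0" if "x \<notin> {a..b+w+1}" for n x
  proof (cases "x < a")
    case True
    then show ?thesis using w ab by (simp add: \<tau>_def \<tau>'_def s0)
  next
    case False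
    then have "1 \<le> x - b - w" using that by auto
    moreover have "1 / h n \<le> 1" using h[of n] by simp
    ultimately have "1 / h n \<le> x - b - w" "1 / h n \<le> x - b" "1 / h n \<le> x - a - w" "1 / h n \<le> x - a"
      using w ab by linarith+
    then show ?thesis by (simp add: \<tau>_def \<tau>'_def s1)
  qed
  have smooth: "smooth_upto m (\<tau> n)" for m n
  proof -
    have s: "smooth_upto m (\<lambda>x. c * s n (x - d) + 1 * q x)" if "smooth_upto m q" for c d q
      using smooth_upto_lin[OF S(1)[rule_format] that, of "c / h n" "h n" "- h n * d" 1]
      by (simp add: s_def algebra_simps)
    have z: "smooth_upto m (\<lambda>x. 0 * S (0 * x + 0) + 0 * S x)"
      by (rule smooth_upto_lin) (use S(1) in auto)
    have "smooth_upto m (\<lambda>x. 1 * s n (x - a) + 1 * (- 1 * s n (x - (a + w)) + 1 * (- 1 * s n (x - b) + 1 * (1 * s n (x - (b + w)) + 1 * (0 * S (0 * x + 0) + 0 * S x)))))"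
      by (intro s z)
    moreover have "(\<lambda>x. 1 * s n (x - a) + 1 * (- 1 * s n (x - (a + w)) + 1 * (- 1 * s n (x - b) + 1 * (1 * s n (x - (b + w)) + 1 * (0 * S (0 * x + 0) + 0 * S x))))) = \<tau> n"
      by (auto simp: \<tau>_def diff_diff_eq)
    ultimately show ?thesis by simp
  qed
  have test: "test_function (\<tau> n)" for n
    unfolding test_function_def
  proof
    show "\<forall>m. (deriv ^^ m) (\<tau> n) differentiable_on UNIV"
      using smooth by (auto simp: smooth_upto_def)
    have "{x. \<tau> n x \<noteq> 0} \<subseteq> {a..b+w+1}" using out by blast
    then have "bounded {x. \<tau> n x \<noteq> 0}" by (rule bounded_subset[OF bounded_closed_interval])
    then show "compact (closure {x. \<tau> n x \<noteq> 0})" by (simp add: compact_closure)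
  qed
  have eq: "(LINT x|lborel. \<tau>' n x *\<^sub>R f x) = - (LINT x|lborel. \<tau> n x *\<^sub>R g x)" for n
  proof -
    have "deriv (\<tau> n) = \<tau>' n" using \<tau>d by (auto intro: DERIV_imp_deriv)
    then show ?thesis using weak[OF test] by metis
  qed
  have contd: "continuous_on UNIV q" if "\<And>x. (q has_real_derivative q' x) (at x)" for q q'
    using that by (auto intro!: continuous_at_imp_continuous_on DERIV_isCont)
  have c\<Phi>: "continuous_on UNIV \<Phi>"
  proof -
    have "deriv S = \<Phi>" using S(2) by (auto intro: DERIV_imp_deriv)
    then show ?thesis using S(1)[rule_format, of 1] by (auto simp: smooth_upto_Suc smooth_upto_0 differentiable_imp_continuous_on)
  qed
  \<comment> \<open>The pointwise limit of \<open>\<tau>'\<close>. It agrees with the difference of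
    the closed indicator functions off the points a and b.\<close>
  define d where "d x = (if x > a then 1 else 0) - (if x > a + w then 1 else 0) - (if x > b then 1 else 0) + (if x > b + w then 1 else 0 :: real)" for x
  define t where "t x = max (x - a) 0 - max (x - a - w) 0 - max (x - b) 0 + max (x - b - w) 0" for x
  have \<Phi>lim: "(\<lambda>n. \<Phi> (h n * (x - c))) \<longlonglongrightarrow> (if x > c then 1 else 0)" for x c
  proof (cases "x > c")
    case True
    obtain N where N: "1 / (x - c) < real N" using reals_Archimedean2 by blast
    have "\<Phi> (h n * (x - c)) = 1" if "n \<ge> N" for n
    proof (rule s1(2))
      have "1 / (x - c) < h n" using N that by (simp add: h_def)
      then show "1 / h n \<le> x - c" using h(1)[of n] True by (simp add: field_simps)
    qed
    then have "eventually (\<lambda>n. \<Phi> (h n * (x - c)) = 1) sequentially" by (auto simp: eventually_sequentially)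
    then show ?thesis using True by (auto intro: tendsto_eventually)
  next
    case False
    then show ?thesis by (simp add: s0)
  qed
  have slim: "\<bar>s n y - max y 0\<bar> \<le> 1 / h n" for n y
  proof -
    have "s n y - max y 0 = (S (h n * y) - max (h n * y) 0) / h n"
      using h(1)[of n] by (auto simp: s_def max_def field_simps zero_le_mult_iff mult_le_0_iff)
    then show ?thesis using S(8)[rule_format, of "h n * y"] h(1)[of n] by (simp add: divide_right_mono)
  qed
  have slim': "(\<lambda>n. s n y) \<longlonglongrightarrow> max y 0" for y
  proof -
    have "(\<lambda>n. 1 / h n) \<longlonglongrightarrow> 0" unfolding h_def by real_asymp
    then have "(\<lambda>n. s n y - max y 0) \<longlonglongrightarrow> 0"
      by (rule Lim_null_comparison[rotated]) (use slim in auto)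
    then show ?thesis by (simp add: LIM_zero_iff)
  qed
  have l1: "(\<lambda>n. LINT x|lborel. \<tau>' n x *\<^sub>R f x) \<longlonglongrightarrow> (LINT x|lborel. d x *\<^sub>R f x)"
  proof (rule dominated_sequence[OF f, where K = 2 and a = a and b = "b + w + 1"])
    show "\<tau>' n \<in> borel_measurable borel" for n
      unfolding \<tau>'_def by (intro borel_measurable_continuous_onI continuous_intros continuous_on_compose2[OF c\<Phi>]) auto
    show "d \<in> borel_measurable borel" unfolding d_def by measurable
    show "AE x in lborel. (\<lambda>n. \<tau>' n x) \<longlonglongrightarrow> d x"
      unfolding \<tau>'_def d_def using \<Phi>lim[of _ "a + w"] \<Phi>lim[of _ "b + w"]
      by (intro AE_I2 tendsto_add tendsto_diff \<Phi>lim) (simp_all add: diff_diff_eq)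
    show "\<bar>\<tau>' n x\<bar> \<le> 2" for n x
    proof -
      have e: "\<bar>p - q - r + u\<bar> \<le> 2" if "0 \<le> p \<and> p \<le> 1" "0 \<le> q \<and> q \<le> 1" "0 \<le> r \<and> r \<le> 1" "0 \<le> u \<and> u \<le> 1" for p q r u :: real
        using that by linarith
      show ?thesis unfolding \<tau>'_def by (intro e S(6)[rule_format])
    qed
  qed (use out in blast)
  have l2: "(\<lambda>n. LINT x|lborel. \<tau> n x *\<^sub>R g x) \<longlonglongrightarrow> (LINT x|lborel. t x *\<^sub>R g x)"
  proof (rule dominated_sequence[OF g, where K = "2 * (b + w + 1 - a) + 4" and a = a and b = "b + w + 1"])
    show "\<tau> n \<in> borel_measurable borel" for n
      using contd[OF \<tau>d] by (rule borel_measurable_continuous_onI)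
    show "t \<in> borel_measurable borel" unfolding t_def by measurable
    show "AE x in lborel. (\<lambda>n. \<tau> n x) \<longlonglongrightarrow> t x"
      unfolding \<tau>_def t_def by (intro AE_I2 tendsto_add tendsto_diff slim')
    show "\<bar>\<tau> n x\<bar> \<le> 2 * (b + w + 1 - a) + 4" for n x
    proof (cases "x \<in> {a..b+w+1}")
      case True
      define M where "M = b + w + 1 - a"
      have e: "\<bar>p - q - r + u\<bar> \<le> 2 * M + 4"
        if "-1 \<le> p \<and> p \<le> M + 1" "-1 \<le> q \<and> q \<le> M + 1" "-1 \<le> r \<and> r \<le> M + 1" "-1 \<le> u \<and> u \<le> M + 1" for p q r u :: real
        using that by linarith
      have "-1 \<le> s n (x - c) \<and> s n (x - c) \<le> M + 1" if "a \<le> c" for c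
      proof -
        have "1 / h n \<le> 1" using h[of n] by simp
        moreover have "max (x - c) 0 \<le> M" "0 \<le> max (x - c) 0" using True that w ab by (auto simp: M_def)
        ultimately show ?thesis using slim[of n "x - c"] by (simp only: abs_le_iff) linarith
      qed
      from this[of a] this[of "a + w"] this[of b] this[of "b + w"]
      show ?thesis using w ab unfolding \<tau>_def M_def[symmetric] by (intro e) (auto simp: diff_diff_eq)
    qed (use out w ab in auto)
  qed (use out in blast)
  have "(LINT x|lborel. d x *\<^sub>R f x) = - (LINT x|lborel. t x *\<^sub>R g x)"
    using LIMSEQ_unique[OF l1[unfolded eq] tendsto_minus[OF l2]] .
  moreover have "(LINT x|lborel. d x *\<^sub>R f x) = (LINT x|lborel. (indicator {a..a+w} x - indicator {b..b+w} x) *\<^sub>R f x)"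
  proof (rule integral_cong_AE)
    have fm: "f \<in> borel_measurable borel" using f by (simp add: square_integrable_def)
    have "d \<in> borel_measurable borel" unfolding d_def by measurable
    then show "(\<lambda>x. d x *\<^sub>R f x) \<in> borel_measurable lborel" using fm by simp
    show "(\<lambda>x. (indicator {a..a+w} x - indicator {b..b+w} x) *\<^sub>R f x) \<in> borel_measurable lborel" using fm by simp
    show "AE x in lborel. d x *\<^sub>R f x = (indicator {a..a+w} x - indicator {b..b+w} x) *\<^sub>R f x"
      using AE_lborel_singleton[of a] AE_lborel_singleton[of b]
    proof eventually_elim
      case (elim x)
      have "d x = indicator {a..a+w} x - indicator {b..b+w} x"
        using elim w by (auto simp: d_def indicator_def)
      then show ?case by simp
    qed
  qed
  ultimately show ?thesis unfolding t_def by simp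
qed

lemma integral_indicator_interval:
  assumes "square_integrable f"
  shows "integrable lborel (\<lambda>x. indicator {a..b} x *\<^sub>R f x)"
    "(LINT x|lborel. indicator {a..b} x *\<^sub>R f x) = integral {a..b} f"
  using square_integrable_loc(1)[OF assms, of a b] set_borel_integral_eq_integral(2)[OF square_integrable_loc(1)[OF assms, of a b]]
  by (simp_all add: set_integrable_def set_lebesgue_integral_def)

text \<open>Divide the trapezoid identity by the ramp width w and let w go to 0: at Lebesgue points
  a and b of f it becomes the fundamental theorem of calculus. A base point outside the exceptional
  null set then defines F everywhere.\<close>

lemma weak_deriv_continuous_rep:
  assumes f: "square_integrable f" and g: "square_integrable g"
    and weak: "\<And>\<phi>. test_function \<phi> \<Longrightarrow> (LINT x|lborel. deriv \<phi> x *\<^sub>R f x) = - (LINT x|lborel. \<phi> x *\<^sub>R g x)"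
  obtains F where "AE x in lborel. f x = F x" "continuous_on UNIV F"
    "\<forall>a b. a \<le> b \<longrightarrow> F b - F a = integral {a..b} g"
proof -
  obtain N where N: "negligible N" "\<And>x e. x \<notin> N \<Longrightarrow> 0 < e \<Longrightarrow>
     \<exists>d>0. \<forall>h. 0 < h \<and> h < d \<longrightarrow> norm (integral (cbox x (x + h *\<^sub>R One)) f /\<^sub>R h ^ DIM(real) - f x) < e"
    using integrable_ccontinuous_explicit[of f] square_integrable_loc(2)[OF f] by (metis box_real(2))
  define w where "w n = 1 / (real n + 1)" for n
  have w: "0 < w n" "w n \<le> 1" for n by (simp_all add: w_def)
  have w0: "w \<longlonglongrightarrow> 0" unfolding w_def by real_asymp
  have leb: "(\<lambda>n. integral {x..x + w n} f /\<^sub>R w n) \<longlonglongrightarrow> f x" if x: "x \<notin> N" for x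
  proof (rule LIMSEQ_I)
    fix e :: real assume e: "0 < e"
    obtain d where d: "d > 0" "\<And>h. 0 < h \<Longrightarrow> h < d \<Longrightarrow> norm (integral {x..x + h} f /\<^sub>R h - f x) < e"
      using N(2)[OF x e] by auto
    have "eventually (\<lambda>n. w n < d) sequentially" using w0 d(1) by (simp add: order_tendsto_iff)
    then show "\<exists>no. \<forall>n\<ge>no. norm (integral {x..x + w n} f /\<^sub>R w n - f x) < e"
      using d(2) w(1) by (auto simp: eventually_sequentially)
  qed
  have key: "f b - f a = integral {a..b} g" if ab: "a \<le> b" "a \<notin> N" "b \<notin> N" for a b
  proof -
    define t where "t n x = (max (x - a) 0 - max (x - a - w n) 0 - max (x - b) 0 + max (x - b - w n) 0) / w n" for n x
    have "integral {a..a + w n} f /\<^sub>R w n - integral {b..b + w n} f /\<^sub>R w n = - (LINT x|lborel. t n x *\<^sub>R g x)" for n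
    proof -
      have "integral {a..a + w n} f - integral {b..b + w n} f
          = (LINT x|lborel. indicator {a..a + w n} x *\<^sub>R f x - indicator {b..b + w n} x *\<^sub>R f x)"
        using integral_indicator_interval[OF f] by simp
      also have "\<dots> = - (LINT x|lborel. (max (x - a) 0 - max (x - a - w n) 0 - max (x - b) 0 + max (x - b - w n) 0) *\<^sub>R g x)"
        using weak_deriv_trapezoid[OF f g weak less_imp_le[OF w(1)[of n]] ab(1)] by (simp add: scaleR_diff_left)
      also have "\<dots> = - (LINT x|lborel. w n *\<^sub>R (t n x *\<^sub>R g x))"
        using w(1)[of n] by (simp add: t_def)
      also have "\<dots> = - (w n *\<^sub>R (LINT x|lborel. t n x *\<^sub>R g x))" by (subst integral_scaleR_right) simp
      finally have "(integral {a..a + w n} f - integral {b..b + w n} f) /\<^sub>R w n = - (LINT x|lborel. t n x *\<^sub>R g x)"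
        using w(1)[of n] by simp
      then show ?thesis by (simp add: scaleR_diff_right)
    qed
    then have "(\<lambda>n. - (LINT x|lborel. t n x *\<^sub>R g x)) \<longlonglongrightarrow> f a - f b"
      using tendsto_diff[OF leb[OF ab(2)] leb[OF ab(3)]] by simp
    moreover have "(\<lambda>n. LINT x|lborel. t n x *\<^sub>R g x) \<longlonglongrightarrow> (LINT x|lborel. indicator {a..b} x *\<^sub>R g x)"
    proof (rule dominated_sequence[OF g, where K = 2 and a = a and b = "b + 1"])
      show "t n \<in> borel_measurable borel" for n unfolding t_def by measurable
      show "(indicator {a..b} :: real \<Rightarrow> real) \<in> borel_measurable borel" by simp
      show "t n x = 0" if x: "x \<notin> {a..b + 1}" for n x
        using x w[of n] ab(1) by (auto simp: t_def max_def)
      show "\<bar>t n x\<bar> \<le> 2" for n x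
      proof -
        have "\<bar>max (x - a) 0 - max (x - a - w n) 0 - max (x - b) 0 + max (x - b - w n) 0\<bar> \<le> 2 * w n"
          using w(1)[of n] by (auto simp: max_def)
        then show ?thesis using w(1)[of n] by (simp add: t_def field_simps)
      qed
      show "AE x in lborel. (\<lambda>n. t n x) \<longlonglongrightarrow> indicator {a..b} x"
        using AE_lborel_singleton[of a] AE_lborel_singleton[of b]
      proof eventually_elim
        case (elim x)
        define d where "d = min \<bar>x - a\<bar> \<bar>x - b\<bar>"
        have "0 < d" using elim by (simp add: d_def)
        then have "eventually (\<lambda>n. w n < d) sequentially" using w0 by (simp add: order_tendsto_iff)
        then have "eventually (\<lambda>n. t n x = indicator {a..b} x) sequentially"
        proof eventually_elim
          case (elim n)
          consider "x < a" | "a < x" "x < b" | "b < x" using \<open>x \<noteq> a\<close> \<open>x \<noteq> b\<close> by linarith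
          then show ?case
            using elim w(1)[of n] ab(1) by cases (auto simp: d_def t_def max_def indicator_def)
        qed
        then show ?case by (rule tendsto_eventually)
      qed
    qed
    ultimately have "f a - f b = - (LINT x|lborel. indicator {a..b} x *\<^sub>R g x)"
      using LIMSEQ_unique tendsto_minus by blast
    then show ?thesis using integral_indicator_interval(2)[OF g, of a b] by (simp add: algebra_simps)
  qed
  have gi: "g integrable_on {a..b}" for a b by (rule square_integrable_loc(2)[OF g])
  obtain c where c: "c \<notin> N" using N(1) non_negligible_UNIV by (metis UNIV_eq_I)
  define F where "F x = f c + (if c \<le> x then integral {c..x} g else - integral {x..c} g)" for x
  have comb: "integral {x..y} g + integral {y..z} g = integral {x..z} g" if "x \<le> y" "y \<le> z" for x y z
    by (rule Henstock_Kurzweil_Integration.integral_combine[OF that gi])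
  have FF: "F b - F a = integral {a..b} g" if "a \<le> b" for a b
    using that comb[of c a b] comb[of a c b] comb[of a b c]
    by (cases "c \<le> a"; cases "c \<le> b") (auto simp: F_def algebra_simps)
  have fF: "f x = F x" if "x \<notin> N" for x
    using key[of c x] key[of x c] c that by (cases "c \<le> x") (auto simp: F_def algebra_simps)
  have "AE x in lborel. f x = F x"
  proof -
    have "N \<in> null_sets lebesgue" using N(1) by (simp add: negligible_iff_null_sets)
    then have "AE x in lebesgue. f x = F x" using fF by (intro AE_I'[of N]) auto
    then show ?thesis by (simp add: AE_completion_iff)
  qed
  moreover have "continuous_on UNIV F"
  proof (rule continuous_at_imp_continuous_on, rule ballI)
    fix x
    have "continuous_on {x - 1..x + 1} (\<lambda>y. F (x - 1) + integral {x - 1..y} g)"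
      by (intro continuous_intros indefinite_integral_continuous_1 gi)
    then have "continuous_on {x - 1..x + 1} F"
      by (rule continuous_on_eq) (simp add: FF[symmetric])
    then have "continuous_on {x - 1<..<x + 1} F" by (rule continuous_on_subset) auto
    then show "isCont F x" by (auto simp: continuous_on_eq_continuous_at)
  qed
  ultimately show ?thesis using that FF by blast
qed

text \<open>Changing g on a null set does not change its integrals, so a continuous representative
  of the weak derivative is a classical derivative.\<close>

lemma vector_derivative_of_integral:
  assumes F: "\<forall>a b. a \<le> b \<longrightarrow> F b - F a = integral {a..b} g"
    and G: "continuous_on UNIV (G :: real \<Rightarrow> complex)" and ae: "AE x in lborel. g x = G x"
  shows "(F has_vector_derivative G x) (at x)"
proof -
  have eq: "integral {a..b} g = integral {a..b} G" for a b
  proof -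
    have "AE x in lebesgue. g x = G x" using ae by (simp add: AE_completion_iff)
    then obtain M where "M \<in> null_sets lebesgue" "{x. \<not> g x = G x} \<subseteq> M" by (auto simp: eventually_ae_filter)
    then have "negligible M" "\<And>x. x \<notin> M \<Longrightarrow> g x = G x" by (auto simp: negligible_iff_null_sets)
    then show ?thesis by (intro integral_spike[of M]) auto
  qed
  have "((\<lambda>y. F (x - 1) + integral {x - 1..y} G) has_vector_derivative G x) (at x within {x - 1..x + 1})"
    using integral_has_vector_derivative[OF continuous_on_subset[OF G], of "x - 1" "x + 1" x]
    by (auto intro!: derivative_eq_intros)
  then have "(F has_vector_derivative G x) (at x within {x - 1..x + 1})"
    by (rule has_vector_derivative_transform[rotated 2]) (use F eq in \<open>auto simp: algebra_simps\<close>)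
  then show ?thesis by (simp add: at_within_Icc_at)
qed

text \<open>\<eta> = H u is itself required to be in the domain, which gives it a continuous
  representative r. Then V u - r is continuous, and two integrations make u a classical
  solution.\<close>

lemma schrodinger_classical:
  assumes V: "continuous_on UNIV V"
    and u: "(u, \<eta>) \<in> schrodinger V" and \<eta>: "(\<eta>, \<theta>) \<in> schrodinger V"
  obtains g g' r where "square_integrable g" "u = abs_L2 g" "square_integrable r" "\<eta> = abs_L2 r"
    "continuous_on UNIV r" "\<forall>x. (g has_vector_derivative g' x) (at x)"
    "\<forall>x. (g' has_vector_derivative of_real (V x) * g x - r x) (at x)"
proof -
  have rep: "\<exists>F. square_integrable F \<and> a = abs_L2 F \<and> continuous_on UNIV F \<and>
      (\<forall>x y. x \<le> y \<longrightarrow> F y - F x = integral {x..y} g)"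
    if h: "has_weak_deriv a b" "square_integrable g" "b = abs_L2 g" for a b :: L2 and g :: "real \<Rightarrow> complex"
  proof -
    obtain f where f: "square_integrable f" "a = abs_L2 f" by (metis L2_cases)
    have w: "\<And>\<phi>. test_function \<phi> \<Longrightarrow> (LINT x|lborel. deriv \<phi> x *\<^sub>R f x) = - (LINT x|lborel. \<phi> x *\<^sub>R g x)"
      using h f by (auto simp: has_weak_deriv.abs_eq)
    obtain F where F: "AE x in lborel. f x = F x" "continuous_on UNIV F"
      "\<forall>x y. x \<le> y \<longrightarrow> F y - F x = integral {x..y} g"
      by (rule weak_deriv_continuous_rep[OF f(1) h(2) w])
    have Fm: "F \<in> borel_measurable lborel" using F(2) by (simp add: borel_measurable_continuous_onI)
    have "integrable lborel (\<lambda>x. (cmod (F x))\<^sup>2)"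
    proof (rule integrable_cong_AE_imp)
      show "integrable lborel (\<lambda>x. (cmod (f x))\<^sup>2)" using f(1) by (simp add: square_integrable_def)
      show "(\<lambda>x. (cmod (F x))\<^sup>2) \<in> borel_measurable lborel" using Fm by measurable
      show "AE x in lborel. (cmod (f x))\<^sup>2 = (cmod (F x))\<^sup>2" using F(1) by eventually_elim simp
    qed
    then have "square_integrable F" using Fm by (simp add: square_integrable_def)
    moreover from this have "a = abs_L2 F" using f F(1) abs_L2_eq_iff by blast
    ultimately show ?thesis using F by blast
  qed
  obtain u1 u2 \<xi> where u': "has_weak_deriv u u1" "has_weak_deriv u1 u2" "is_product V u \<xi>" "\<eta> = - u2 + \<xi>"
    using u unfolding schrodinger_def by blast
  obtain \<eta>1 where "has_weak_deriv \<eta> \<eta>1" using \<eta> unfolding schrodinger_def by blast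
  moreover obtain g1 where "square_integrable g1" "\<eta>1 = abs_L2 g1" by (metis L2_cases)
  ultimately obtain r where r: "square_integrable r" "\<eta> = abs_L2 r" "continuous_on UNIV r" using rep by blast
  obtain f2 where f2: "square_integrable f2" "u2 = abs_L2 f2" by (metis L2_cases)
  obtain F1 where F1: "square_integrable F1" "u1 = abs_L2 F1" "continuous_on UNIV F1"
      "\<forall>x y. x \<le> y \<longrightarrow> F1 y - F1 x = integral {x..y} f2"
    using rep[OF u'(2) f2] by blast
  obtain F where F: "square_integrable F" "u = abs_L2 F" "continuous_on UNIV F"
      "\<forall>x y. x \<le> y \<longrightarrow> F y - F x = integral {x..y} F1"
    using rep[OF u'(1) F1(1,2)] by blast
  obtain h where h: "square_integrable h" "\<xi> = abs_L2 h" by (metis L2_cases)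
  have "AE x in lborel. h x = V x *\<^sub>R F x" using u'(3) h F by (simp add: is_product.abs_eq)
  moreover have "AE x in lborel. r x = - f2 x + h x"
  proof -
    have "- u2 = abs_L2 (\<lambda>x. - 1 * f2 x)" unfolding uminus_L2_def using f2 by (simp add: abs_L2_ops)
    then have "abs_L2 r = abs_L2 (\<lambda>x. - 1 * f2 x + h x)"
      using u'(4) h r(2) square_integrable_cmult[OF f2(1), of "-1"] by (simp add: abs_L2_ops)
    moreover have "square_integrable (\<lambda>x. - 1 * f2 x + h x)"
      by (intro square_integrable_add square_integrable_cmult f2 h)
    ultimately show ?thesis using r(1) by (simp add: abs_L2_eq_iff)
  qed
  ultimately have "AE x in lborel. f2 x = of_real (V x) * F x - r x"
    by eventually_elim (simp add: scaleR_conv_of_real)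
  moreover have "continuous_on UNIV (\<lambda>x. of_real (V x) * F x - r x)"
    using V F(3) r(3) by (auto intro!: continuous_intros)
  ultimately have "\<forall>x. (F1 has_vector_derivative of_real (V x) * F x - r x) (at x)"
    using vector_derivative_of_integral[OF F1(4)] by blast
  moreover have "\<forall>x. (F has_vector_derivative F1 x) (at x)"
    using vector_derivative_of_integral[OF F(4) F1(3)] by simp
  ultimately show ?thesis using that F r by blast
qed


section \<open>Recurrent windows exclude absolutely continuous spectrum\<close>

text \<open>On [-k, k) let Y n k be a Hahn set where \<mu> dominates n times Lebesgue measure. If no
  set A as claimed exists, \<mu> vanishes on [-k, k) off each Y n k. The intersection over n is a
  Lebesgue null set, since n times its length is at most its finite \<mu>-measure. The union over k
  of these null sets then carries \<mu>.\<close>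

lemma not_singular_imp_absolutely_continuous_part:
  assumes fin: "finite_measure \<mu>" and sets: "sets \<mu> = sets borel" and ns: "\<not> singular_lebesgue \<mu>"
  shows "\<exists>A\<in>sets borel. \<exists>n k :: nat. A \<subseteq> {- real k..<real k} \<and> emeasure \<mu> A \<noteq> 0 \<and>
    (\<forall>B\<in>sets borel. B \<subseteq> A \<longrightarrow> emeasure \<mu> B \<le> of_nat n * emeasure lborel B)"
proof (rule ccontr)
  assume none: "\<not> ?thesis"
  interpret finite_measure \<mu> by (rule fin)
  define J where "J k = {- real k..<real k}" for k :: nat
  have Jb: "J k \<in> sets borel" for k by (simp add: J_def)
  have "\<forall>n k. \<exists>Y\<in>sets borel. Y \<subseteq> J k \<and> (\<forall>X\<in>sets borel. X \<subseteq> Y \<longrightarrow> of_nat n * emeasure lborel X \<le> emeasure \<mu> X) \<and>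
      (\<forall>X\<in>sets borel. X \<subseteq> J k \<longrightarrow> X \<inter> Y = {} \<longrightarrow> emeasure \<mu> X \<le> of_nat n * emeasure lborel X)"
  proof (intro allI)
    fix n k :: nat
    have "\<exists>Y\<in>sets \<mu>. Y \<subseteq> J k \<and> (\<forall>X\<in>sets \<mu>. X \<subseteq> Y \<longrightarrow> emeasure (scale_measure (of_nat n) lborel) X \<le> emeasure \<mu> X) \<and>
      (\<forall>X\<in>sets \<mu>. X \<subseteq> J k \<longrightarrow> X \<inter> Y = {} \<longrightarrow> emeasure \<mu> X \<le> emeasure (scale_measure (of_nat n) lborel) X)"
    proof (rule unsigned_Hahn_decomposition)
      show "emeasure (scale_measure (of_nat n) lborel) (J k) \<noteq> top"
        by (simp add: J_def ennreal_mult_eq_top_iff)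
    qed (use sets Jb in \<open>auto simp: emeasure_eq_measure\<close>)
    then show "\<exists>Y\<in>sets borel. Y \<subseteq> J k \<and> (\<forall>X\<in>sets borel. X \<subseteq> Y \<longrightarrow> of_nat n * emeasure lborel X \<le> emeasure \<mu> X) \<and>
      (\<forall>X\<in>sets borel. X \<subseteq> J k \<longrightarrow> X \<inter> Y = {} \<longrightarrow> emeasure \<mu> X \<le> of_nat n * emeasure lborel X)"
      by (simp add: sets)
  qed
  then obtain Y where Y: "\<And>n k. Y n k \<in> sets borel" "\<And>n k. Y n k \<subseteq> J k"
      "\<And>n k X. X \<in> sets borel \<Longrightarrow> X \<subseteq> Y n k \<Longrightarrow> of_nat n * emeasure lborel X \<le> emeasure \<mu> X"
      "\<And>n k X. X \<in> sets borel \<Longrightarrow> X \<subseteq> J k \<Longrightarrow> X \<inter> Y n k = {} \<Longrightarrow> emeasure \<mu> X \<le> of_nat n * emeasure lborel X"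
    by metis
  have null1: "J k - Y n k \<in> null_sets \<mu>" for n k
  proof -
    have "J k - Y n k \<in> sets borel" using Jb Y(1) by auto
    moreover have "J k - Y n k \<subseteq> {- real k..<real k}" by (auto simp: J_def)
    moreover have "\<forall>B\<in>sets borel. B \<subseteq> J k - Y n k \<longrightarrow> emeasure \<mu> B \<le> of_nat n * emeasure lborel B"
      using Y(4)[of _ k n] by blast
    ultimately have "emeasure \<mu> (J k - Y n k) = 0" using none by blast
    then show ?thesis using \<open>J k - Y n k \<in> sets borel\<close> sets by (simp add: null_sets_def)
  qed
  define Z where "Z k = (\<Inter>n. Y n k)" for k
  have Zb: "Z k \<in> sets borel" for k unfolding Z_def using Y(1) by auto
  have null2: "Z k \<in> null_sets lborel" for k
  proof -
    have fin': "emeasure lborel (Z k) < top"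
    proof -
      have "emeasure lborel (Z k) \<le> emeasure lborel (J k)"
        using Y(2)[of 0 k] Jb by (intro emeasure_mono) (auto simp: Z_def)
      also have "\<dots> < top" by (simp add: J_def)
      finally show ?thesis .
    qed
    have "real n * measure lborel (Z k) \<le> measure \<mu> (Z k)" for n
    proof -
      have "of_nat n * emeasure lborel (Z k) \<le> emeasure \<mu> (Z k)" by (rule Y(3)[OF Zb]) (auto simp: Z_def)
      then have "ennreal (real n * measure lborel (Z k)) \<le> ennreal (measure \<mu> (Z k))"
        using fin' by (simp add: emeasure_eq_measure emeasure_eq_ennreal_measure ennreal_mult ennreal_of_nat_eq_real_of_nat less_top)
      then show ?thesis by (simp add: ennreal_le_iff)
    qed
    then have "\<not> 0 < measure lborel (Z k)"
      by (meson ex_less_of_nat_mult not_less)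
    then have "measure lborel (Z k) = 0" using measure_nonneg[of lborel "Z k"] by linarith
    then have "emeasure lborel (Z k) = 0" using fin' by (simp add: emeasure_eq_ennreal_measure less_top)
    then show ?thesis using Zb by (simp add: null_sets_def)
  qed
  define N where "N = (\<Union>k. Z k)"
  have "N \<in> null_sets lborel" unfolding N_def using null2 by (intro null_sets_UN) auto
  moreover have "- N \<in> null_sets \<mu>"
  proof (rule null_sets_subset)
    show "(\<Union>k. \<Union>n. J k - Y n k) \<in> null_sets \<mu>" using null1 by (intro null_sets_UN) auto
    show "- N \<in> sets \<mu>" unfolding N_def sets using Zb by auto
    show "- N \<subseteq> (\<Union>k. \<Union>n. J k - Y n k)"
    proof
      fix x assume x: "x \<in> - N"
      obtain k where "\<bar>x\<bar> < real k" using reals_Archimedean2 by blast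
      then have "x \<in> J k" by (auto simp: J_def)
      then show "x \<in> (\<Union>k. \<Union>n. J k - Y n k)" using x by (auto simp: N_def Z_def)
    qed
  qed
  ultimately have "singular_lebesgue \<mu>"
    unfolding singular_lebesgue_def by (intro bexI[of _ N]) (auto simp: null_sets_def)
  with ns show False ..
qed

section \<open>Packets of a spectral vector between two windows\<close>

context packets
begin

text \<open>\<open>energy_flux\<close> between two recurrences of the same windows; both end points
  are put at the first node, where \<open>window_flux\<close> bounds the current.\<close>

lemma two_window_bound:
  assumes gw: "growth_windows \<Lambda> U m y D" and \<Lambda>: "n0 \<le> \<Lambda>" "1 \<le> \<Lambda>"
    and R: "R = y m - y 0" and \<kappa>: "0 \<le> \<kappa>" "\<kappa> * D * R \<le> 1"
    and close: "\<forall>t\<in>{y 0..y m}. \<bar>V (X + t) - U t\<bar> \<le> \<kappa>" "\<forall>t\<in>{y 0..y m}. \<bar>V (X' + t) - U t\<bar> \<le> \<kappa>"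
    and XX: "X \<le> X'" and \<sigma>: "0 < \<sigma>"
    and mass: "integral {X + y 0..X + y m} (\<lambda>x. (cmod (\<phi> x))\<^sup>2) \<le> \<sigma>\<^sup>2" "integral {X' + y 0..X' + y m} (\<lambda>x. (cmod (\<phi> x))\<^sup>2) \<le> \<sigma>\<^sup>2"
    and out: "L2sq \<phi> - integral {X + y 0..X' + y 0} (\<lambda>x. (cmod (\<phi> x))\<^sup>2) \<le> \<sigma>\<^sup>2"
  shows "\<Gamma> / 2 \<le> 2 * (9 * B2 / \<Lambda> + \<Lambda> * R * D\<^sup>2 * (3 * (2 * n0 * \<sigma>\<^sup>2 + \<eta>\<^sup>2 * R * B2 + 2 * n0 * ((\<delta> / \<eta>)\<^sup>2 * \<Gamma>))))
     + \<eta> * (X' - X) * B2 + 2 * n0 * \<Gamma> * \<delta> / \<eta>\<^sup>2 + \<sigma> * (32 * pi\<^sup>2 * c * n0 + 1) / 2"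
proof -
  have "0 < m" and inc: "\<forall>j<m. y j < y (Suc j)" using gw by (auto simp: growth_windows_def)
  then have y: "y 0 \<le> y m" using increasing_nodes[OF inc, of 0 m] by simp
  define W where "W = 9 * B2 / \<Lambda> + \<Lambda> * R * D\<^sup>2 * (3 * (2 * n0 * \<sigma>\<^sup>2 + \<eta>\<^sup>2 * R * B2 + 2 * n0 * ((\<delta> / \<eta>)\<^sup>2 * \<Gamma>)))"
  have 1: "\<delta> * (\<Sum>l<N. \<bar>J l (X + y 0)\<bar>) \<le> W" "\<delta> * (\<Sum>l<N. \<bar>J l (X' + y 0)\<bar>) \<le> W"
    unfolding W_def using window_flux[OF gw \<Lambda> R \<kappa> close(1) order_refl y mass(1) refl]
      window_flux[OF gw \<Lambda> R \<kappa> close(2) order_refl y mass(2) refl] by blast+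
  have "\<Gamma> / 2 \<le> \<delta> * (\<Sum>l<N. \<bar>J l (X + y 0)\<bar>) + \<delta> * (\<Sum>l<N. \<bar>J l (X' + y 0)\<bar>)
     + \<eta> * ((X' + y 0) - (X + y 0)) * B2 + 2 * n0 * \<Gamma> * \<delta> / \<eta>\<^sup>2 + \<sigma> * (32 * pi\<^sup>2 * c * n0 + 1) / 2"
    by (rule energy_flux[OF _ \<sigma> out]) (use XX in simp)
  also have "\<dots> \<le> W + W + \<eta> * ((X' + y 0) - (X + y 0)) * B2 + 2 * n0 * \<Gamma> * \<delta> / \<eta>\<^sup>2 + \<sigma> * (32 * pi\<^sup>2 * c * n0 + 1) / 2"
    by (intro add_mono 1 order_refl)
  also have "(X' + y 0) - (X + y 0) = X' - X" by simp
  finally show ?thesis unfolding W_def[symmetric] by simp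
qed

end

context spectral_op
begin

lemma packets_exist:
  assumes cV: "continuous_on UNIV V" and bV: "\<And>x. \<bar>V x\<bar> \<le> C"
    and n0: "0 < n0" and supp: "E {-n0..<n0} \<psi> = \<psi>"
    and ac: "\<And>a \<delta>. 0 \<le> \<delta> \<Longrightarrow> (norm (E {a..<a+\<delta>} \<psi>))\<^sup>2 \<le> c * \<delta>"
    and N: "0 < N" and \<delta>: "\<delta> = 2 * n0 / real N" "\<delta> \<le> \<eta>" "\<eta> \<le> n0" "\<delta> \<le> 1"
  obtains g g' \<rho> \<gamma> r where "packets V C n0 \<delta> \<eta> c N g g' \<rho> \<gamma> r"
    "square_integrable (packets.\<phi> N g)" "abs_L2 (packets.\<phi> N g) = \<psi>" "packets.\<Gamma> N \<gamma> = (norm \<psi>)\<^sup>2"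
proof -
  have \<delta>0: "0 < \<delta>" using n0 N by (simp add: \<delta>)
  define e0 where "e0 k = - n0 + \<delta> * real k" for k
  \<comment> \<open>Half-open cells, so that they are disjoint and tile [-n0, n0) without
    remainder.\<close>
  define I where "I k = {e0 k..<e0 k + \<delta>}" for k
  have Ib: "I k \<in> sets borel" for k by (simp add: I_def)
  have Ibd: "\<bar>x\<bar> \<le> \<bar>e0 k\<bar> + \<delta>" if "x \<in> I k" for k x using that \<delta>0 by (auto simp: I_def)
  have Idis: "I j \<inter> I k = {}" if "j \<noteq> k" for j k
  proof -
    have "I j \<inter> I k = {}" if "j < k" for j k
    proof -
      have "\<delta> * (real j + 1) \<le> \<delta> * real k" using that \<delta>0 by (intro mult_left_mono) auto
      then show ?thesis by (auto simp: I_def e0_def algebra_simps)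
    qed
    then show ?thesis using that by (metis Int_commute linorder_neqE_nat)
  qed
  define e where "e k = E (I k) \<psi>" for k
  have Ee: "E (I k) (e k) = e k" for k using E_inter[OF Ib Ib] by (simp add: e_def)
  have "\<exists>h. (e k, h) \<in> schrodinger V" for k
    using in_domain_bounded[OF Ib Ibd, where \<psi> = \<psi>] by (simp add: e_def)
  then obtain h where h: "\<And>k. (e k, h k) \<in> schrodinger V" by metis
  have Eh: "E (I k) (h k) = h k" for k by (rule range_invariant[OF Ib h Ee])
  \<comment> \<open>H (e k) stays in the bounded spectral cell and so lies in the domain again, as
    the classical regularity of the pieces demands.\<close>
  have "\<exists>h'. (h k, h') \<in> schrodinger V" for k
    using in_domain_bounded[OF Ib Ibd, where \<psi> = "h k"] Eh[of k] by metis
  then obtain h' where h': "\<And>k. (h k, h' k) \<in> schrodinger V" by metis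
  have "\<forall>k. \<exists>g g' q. square_integrable g \<and> e k = abs_L2 g \<and> square_integrable q \<and> h k = abs_L2 q \<and>
    continuous_on UNIV q \<and> (\<forall>x. (g has_vector_derivative g' x) (at x)) \<and>
    (\<forall>x. (g' has_vector_derivative of_real (V x) * g x - q x) (at x))"
    using schrodinger_classical[OF cV h h'] by (metis (no_types))
  then obtain g g' q where gq: "\<And>k. square_integrable (g k)" "\<And>k. e k = abs_L2 (g k)" "\<And>k. square_integrable (q k)" "\<And>k. h k = abs_L2 (q k)"
    "\<And>k. continuous_on UNIV (q k)" "\<And>k x. (g k has_vector_derivative g' k x) (at x)"
    "\<And>k x. (g' k has_vector_derivative of_real (V x) * g k x - q k x) (at x)" by metis
  define \<rho> where "\<rho> k x = of_real (- e0 k) * g k x + q k x" for k x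
  define f where "f k = h k - e0 k *\<^sub>R e k" for k
  have s\<rho>: "square_integrable (\<rho> k)" for k
    unfolding \<rho>_def by (intro square_integrable_add square_integrable_cmult gq)
  have f\<rho>: "f k = abs_L2 (\<rho> k)" for k
  proof -
    have "f k = (- e0 k) *\<^sub>R e k + h k" by (simp add: f_def)
    also have "\<dots> = scaleC_L2 (of_real (- e0 k)) (e k) + h k" by (simp only: scaleC_L2_simps)
    also have "\<dots> = abs_L2 (\<rho> k)"
      unfolding gq(2,4) \<rho>_def using gq(1,3)[of k] square_integrable_cmult[OF gq(1)[of k], of "of_real (- e0 k)"]
      by (simp only: abs_L2_ops)
    finally show ?thesis .
  qed
  have near: "norm (f k) \<le> \<delta> * norm (e k)" "E (I k) (f k) = f k" for k
    unfolding f_def using near_eigenvector[OF Ib _ \<delta>0 h Ee, of k "e0 k"] by (auto simp: I_def)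
  define \<gamma> where "\<gamma> k = (norm (e k))\<^sup>2" for k
  define r where "r k = (norm (f k))\<^sup>2" for k
  have P: "packets V C n0 \<delta> \<eta> c N g g' \<rho> \<gamma> r"
  proof (unfold_locales)
    show "\<delta> = 2 * n0 / N" "0 < n0" "0 < N" "\<delta> \<le> \<eta>" "\<eta> \<le> n0" "\<delta> \<le> 1" by fact+
    show "continuous_on UNIV V" "\<And>x. \<bar>V x\<bar> \<le> C" by fact+
    show "(g k has_vector_derivative g' k x) (at x)" for k x by (rule gq)
    show "(g' k has_vector_derivative (of_real (V x - (- n0 + \<delta> * k)) * g k x - \<rho> k x)) (at x)" for k x
    proof -
      have "of_real (V x - (- n0 + \<delta> * k)) * g k x - \<rho> k x = of_real (V x) * g k x - q k x"
        by (simp add: \<rho>_def e0_def algebra_simps)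
      then show ?thesis using gq(7)[of k x] by simp
    qed
    have "continuous_on UNIV (g k)" for k
      by (intro continuous_at_imp_continuous_on ballI has_vector_derivative_continuous[OF gq(6)])
    then show "continuous_on UNIV (\<rho> k)" for k unfolding \<rho>_def using gq(5) by (intro continuous_intros) auto
    show "square_integrable (g k)" "square_integrable (\<rho> k)" for k by (rule gq, rule s\<rho>)
    show "(LINT x|lborel. cnj (g j x) * g k x) = (if j = k then complex_of_real (\<gamma> k) else 0)" for j k
    proof -
      have "(LINT x|lborel. cnj (g j x) * g k x) = cinner_L2 (e j) (e k)" using gq(1,2) by (simp add: abs_L2_ops)
      also have "\<dots> = (if j = k then complex_of_real (\<gamma> k) else 0)"
        using cinner_disjoint[OF Ib Ib Idis Ee Ee, of j k] by (simp add: cinner_L2_self \<gamma>_def)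
      finally show ?thesis .
    qed
    show "(LINT x|lborel. cnj (\<rho> j x) * \<rho> k x) = (if j = k then complex_of_real (r k) else 0)" for j k
    proof -
      have "(LINT x|lborel. cnj (\<rho> j x) * \<rho> k x) = cinner_L2 (f j) (f k)" using s\<rho> f\<rho> by (simp add: abs_L2_ops)
      also have "\<dots> = (if j = k then complex_of_real (r k) else 0)"
        using cinner_disjoint[OF Ib Ib Idis near(2) near(2), of j k] by (simp add: cinner_L2_self r_def)
      finally show ?thesis .
    qed
    show "r k \<le> \<delta>\<^sup>2 * \<gamma> k" for k
      using power_mono[OF near(1)[of k], of 2] by (simp add: r_def \<gamma>_def power_mult_distrib)
    show "\<gamma> k \<le> c * \<delta>" for k
      unfolding \<gamma>_def e_def I_def using ac[of \<delta> "e0 k"] \<delta>0 by simp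
  qed
  interpret packets V C n0 \<delta> \<eta> c N g g' \<rho> \<gamma> r by (rule P)
  \<comment> \<open>The cells add up one by one; the right end e0 N equals n0, so for M = N the sum
    is E {-n0..<n0} \<psi>, that is \<psi>.\<close>
  have Esum: "(\<Sum>k<M. e k) = E {- n0..<e0 M} \<psi>" for M
  proof (induction M)
    case 0
    then show ?case by (simp add: e0_def E_empty)
  next
    case (Suc M)
    have "- n0 \<le> e0 M" using \<delta>0 by (simp add: e0_def)
    moreover have "e0 (Suc M) = e0 M + \<delta>" by (simp add: e0_def algebra_simps)
    ultimately have "{- n0..<e0 (Suc M)} = {- n0..<e0 M} \<union> I M" using \<delta>0 by (auto simp: I_def)
    moreover have "E ({- n0..<e0 M} \<union> I M) \<psi> = E {- n0..<e0 M} \<psi> + E (I M) \<psi>"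
      by (rule E_union) (auto simp: I_def)
    ultimately show ?case using Suc.IH by (simp add: e_def)
  qed
  have "abs_L2 (\<lambda>x. \<Sum>k<M. g k x) = (\<Sum>k<M. e k) \<and> square_integrable (\<lambda>x. \<Sum>k<M. g k x)" for M
  proof (induction M)
    case 0
    then show ?case by (simp add: zero_L2_abs square_integrable_def)
  next
    case (Suc M)
    then have "abs_L2 (\<lambda>x. (\<Sum>k<M. g k x) + g M x) = (\<Sum>k<M. e k) + e M"
      using gq(1,2)[of M] abs_L2_ops(1)[of "\<lambda>x. \<Sum>k<M. g k x" "g M"] by simp
    then show ?case using Suc gq(1)[of M] by (simp add: square_integrable_add)
  qed
  moreover have "\<phi> = (\<lambda>x. \<Sum>k<N. g k x)" by (auto simp: \<phi>_def)
  moreover have "e0 N = n0" using N by (simp add: e0_def \<delta>)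
  ultimately have \<phi>: "abs_L2 \<phi> = \<psi>" "square_integrable \<phi>" using Esum[of N] supp by simp_all
  have "(norm \<psi>)\<^sup>2 = \<Gamma>" using norm_abs_L2[OF \<phi>(2)] \<phi>(1) L2sq_\<phi> by simp
  then show ?thesis using that[OF P] \<phi> by simp
qed

end

section \<open>Exclusion of absolutely continuous vectors\<close>

lemma square_integrable_tail:
  assumes f: "square_integrable f" and \<sigma>: "0 < \<sigma>"
  obtains K where "\<forall>a b. K < a \<or> b < - K \<longrightarrow> integral {a..b} (\<lambda>x. (cmod (f x))\<^sup>2) \<le> \<sigma>"
    "\<forall>a b. a \<le> - K \<longrightarrow> K \<le> b \<longrightarrow> L2sq f - integral {a..b} (\<lambda>x. (cmod (f x))\<^sup>2) \<le> \<sigma>"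
proof -
  define q where "q x = (cmod (f x))\<^sup>2" for x
  have q: "integrable lborel q" "q \<in> borel_measurable borel" using f by (auto simp: q_def[abs_def] square_integrable_def)
  have q0: "0 \<le> q x" for x by (simp add: q_def)
  have qi: "integrable lborel (\<lambda>x. indicator {a..b} x * q x)" for a b
    using integrable_mult_indicator[OF _ q(1), of "{a..b}"] by simp
  have I: "integral {a..b} (\<lambda>x. (cmod (f x))\<^sup>2) = (LINT x|lborel. indicator {a..b} x * q x)" for a b
    using set_borel_integral_eq_integral(2)[of "{a..b}" q] qi[of a b]
    by (simp add: set_integrable_def set_lebesgue_integral_def q_def[abs_def])
  have L: "L2sq f = (LINT x|lborel. q x)" by (simp add: L2sq_def q_def)
  have "(\<lambda>n. LINT x|lborel. indicator {- real n..real n} x * q x) \<longlonglongrightarrow> (LINT x|lborel. q x)"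
  proof (rule integral_dominated_convergence[where w = q])
    show "AE x in lborel. (\<lambda>n. indicator {- real n..real n} x * q x) \<longlonglongrightarrow> q x"
    proof (rule AE_I2)
      fix x
      obtain N where N: "\<bar>x\<bar> < real N" using reals_Archimedean2 by blast
      have "indicator {- real n..real n} x * q x = q x" if "n \<ge> N" for n
        using N that by (auto simp: indicator_def)
      then have "eventually (\<lambda>n. indicator {- real n..real n} x * q x = q x) sequentially"
        by (auto simp: eventually_sequentially)
      then show "(\<lambda>n. indicator {- real n..real n} x * q x) \<longlonglongrightarrow> q x" by (rule tendsto_eventually)
    qed
    show "AE x in lborel. norm (indicator {- real n..real n} x * q x) \<le> q x" for n
      using q0 by (auto simp: indicator_def)
  qed (use q in auto)
  then have "eventually (\<lambda>n. (LINT x|lborel. q x) - \<sigma> < (LINT x|lborel. indicator {- real n..real n} x * q x)) sequentially"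
    using \<sigma> by (simp add: order_tendsto_iff)
  then obtain n where n: "(LINT x|lborel. q x) - \<sigma> < (LINT x|lborel. indicator {- real n..real n} x * q x)"
    by (auto simp: eventually_sequentially)
  show ?thesis
  proof (rule that[of "real n"])
    show "\<forall>a b. real n < a \<or> b < - real n \<longrightarrow> integral {a..b} (\<lambda>x. (cmod (f x))\<^sup>2) \<le> \<sigma>"
    proof (intro allI impI)
      fix a b assume ab: "real n < a \<or> b < - real n"
      have "(LINT x|lborel. indicator {a..b} x * q x) + (LINT x|lborel. indicator {- real n..real n} x * q x)
        = (LINT x|lborel. indicator {a..b} x * q x + indicator {- real n..real n} x * q x)"
        using qi by simp
      also have "\<dots> \<le> (LINT x|lborel. q x)"
        using ab q0 by (intro integral_mono q Bochner_Integration.integrable_add qi) (auto simp: indicator_def)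
      finally show "integral {a..b} (\<lambda>x. (cmod (f x))\<^sup>2) \<le> \<sigma>" using n I by simp
    qed
    show "\<forall>a b. a \<le> - real n \<longrightarrow> real n \<le> b \<longrightarrow> L2sq f - integral {a..b} (\<lambda>x. (cmod (f x))\<^sup>2) \<le> \<sigma>"
    proof (intro allI impI)
      fix a b assume ab: "a \<le> - real n" "real n \<le> b"
      have "(LINT x|lborel. indicator {- real n..real n} x * q x) \<le> (LINT x|lborel. indicator {a..b} x * q x)"
        using ab q0 by (intro integral_mono qi) (auto simp: indicator_def)
      then show "L2sq f - integral {a..b} (\<lambda>x. (cmod (f x))\<^sup>2) \<le> \<sigma>" using n I L by simp
    qed
  qed
qed

text \<open>The packet sum changes with the number of cells but always represents \<psi>. The
  position of the windows can thus be read off from one representative before the cells are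
  chosen.\<close>

lemma mass_cong:
  assumes "square_integrable f" "square_integrable g" "abs_L2 f = abs_L2 g"
  shows "integral {a..b} (\<lambda>x. (cmod (f x))\<^sup>2) = integral {a..b} (\<lambda>x. (cmod (g x))\<^sup>2)" "L2sq f = L2sq g"
proof -
  have "AE x in lebesgue. f x = g x" using assms by (simp add: abs_L2_eq_iff AE_completion_iff)
  then obtain M where "M \<in> null_sets lebesgue" "{x. \<not> f x = g x} \<subseteq> M" by (auto simp: eventually_ae_filter)
  then have "negligible M" "\<And>x. x \<notin> M \<Longrightarrow> f x = g x" by (auto simp: negligible_iff_null_sets)
  then show "integral {a..b} (\<lambda>x. (cmod (f x))\<^sup>2) = integral {a..b} (\<lambda>x. (cmod (g x))\<^sup>2)" by (intro integral_spike[of M]) auto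
  show "L2sq f = L2sq g" using norm_abs_L2 assms by metis
qed

text \<open>The potential \<open>U\<close> is only compared with \<open>V\<close> on the nodes' interval; its values elsewhere are
  irrelevant.\<close>

definition recurrent_windows :: "(real \<Rightarrow> real) \<Rightarrow> bool" where
  "recurrent_windows V \<longleftrightarrow> (\<forall>n::nat. 0 < n \<longrightarrow> (\<exists>U m y D \<kappa>. growth_windows (real n) U m y D \<and> 0 \<le> \<kappa> \<and>
     \<kappa> * D * (y m - y 0) \<le> 1 \<and>
     (\<forall>K. \<exists>X\<ge>K. \<forall>t\<in>{y 0..y m}. \<bar>V (X + t) - U t\<bar> \<le> \<kappa>) \<and>
     (\<forall>K. \<exists>X\<le>K. \<forall>t\<in>{y 0..y m}. \<bar>V (X + t) - U t\<bar> \<le> \<kappa>)))"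

context spectral_op
begin

text \<open>The limits are iterated. For fixed n the window data are fixed, and for fixed \<sigma>
  also the distance L of the two windows. Then \<delta> goes to 0 with N to infinity, next \<eta>,
  which removes L, next \<sigma>; what is left, 18 * b2 / n, vanishes with n to infinity.\<close>

lemma recurrent_windows_imp_zero:
  assumes cV: "continuous_on UNIV V" and bV: "\<And>x. \<bar>V x\<bar> \<le> C" and rec: "recurrent_windows V"
    and n0: "0 < n0" and supp: "E {-n0..<n0} \<psi> = \<psi>"
    and ac: "\<And>a \<delta>. 0 \<le> \<delta> \<Longrightarrow> (norm (E {a..<a+\<delta>} \<psi>))\<^sup>2 \<le> c * \<delta>"
  shows "\<psi> = 0"
proof -
  define P where "P = (norm \<psi>)\<^sup>2"
  define b2 where "b2 = 16 * pi\<^sup>2 * (200 * (1 + 3 * (C\<^sup>2 + n0\<^sup>2 + 1))) * c"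
  obtain f where f: "square_integrable f" "\<psi> = abs_L2 f" by (rule L2_cases)
  have bound: "P / 2 \<le> 18 * b2 / real n" if n: "0 < n" "n0 \<le> real n" for n :: nat
  proof -
    obtain U m y D \<kappa> where gw: "growth_windows (real n) U m y D" and \<kappa>: "0 \<le> \<kappa>" "\<kappa> * D * (y m - y 0) \<le> 1"
      and right: "\<forall>K. \<exists>X\<ge>K. \<forall>t\<in>{y 0..y m}. \<bar>V (X + t) - U t\<bar> \<le> \<kappa>"
      and left: "\<forall>K. \<exists>X\<le>K. \<forall>t\<in>{y 0..y m}. \<bar>V (X + t) - U t\<bar> \<le> \<kappa>"
      using rec[unfolded recurrent_windows_def, rule_format, OF n(1)] by (elim exE conjE) (rule that)
    define R where "R = y m - y 0"
    define Q where "Q \<delta> \<eta> \<sigma> L = 2 * (9 * b2 / real n + real n * R * D\<^sup>2 * (3 * (2 * n0 * \<sigma>\<^sup>2 + \<eta>\<^sup>2 * R * b2 + 2 * n0 * ((\<delta> / \<eta>)\<^sup>2 * P))))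
     + \<eta> * L * b2 + 2 * n0 * P * \<delta> / \<eta>\<^sup>2 + \<sigma> * (32 * pi\<^sup>2 * c * n0 + 1) / 2" for \<delta> \<eta> \<sigma> L :: real
    have 1: "\<exists>L. \<forall>\<eta> N. 0 < N \<longrightarrow> 2 * n0 / real N \<le> \<eta> \<longrightarrow> \<eta> \<le> n0 \<longrightarrow> 2 * n0 / real N \<le> 1 \<longrightarrow> P / 2 \<le> Q (2 * n0 / real N) \<eta> \<sigma> L"
      if \<sigma>: "0 < \<sigma>" for \<sigma>
    proof -
      obtain K where K: "\<forall>a b. K < a \<or> b < - K \<longrightarrow> integral {a..b} (\<lambda>x. (cmod (f x))\<^sup>2) \<le> \<sigma>\<^sup>2"
        "\<forall>a b. a \<le> - K \<longrightarrow> K \<le> b \<longrightarrow> L2sq f - integral {a..b} (\<lambda>x. (cmod (f x))\<^sup>2) \<le> \<sigma>\<^sup>2"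
        using square_integrable_tail[OF f(1), of "\<sigma>\<^sup>2"] \<sigma> by auto
      \<comment> \<open>So far to the right, and X below so far to the left, that each window
        carries mass at most \<sigma>^2 and all but \<sigma>^2 lies between them. The 0 in both
        bounds ensures X <= X'.\<close>
      obtain X' where X': "max (K + 1 - y 0) 0 \<le> X'" "\<forall>t\<in>{y 0..y m}. \<bar>V (X' + t) - U t\<bar> \<le> \<kappa>"
        using right by blast
      obtain X where X: "X \<le> min (min (- K - 1 - y m) (- K - y 0)) 0" "\<forall>t\<in>{y 0..y m}. \<bar>V (X + t) - U t\<bar> \<le> \<kappa>"
        using left by blast
      have XX: "X \<le> X'" "K < X' + y 0" "X + y m < - K" "X + y 0 \<le> - K" using X X' by auto
      show ?thesis
      proof (intro exI[of _ "X' - X"] allI impI)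
        fix \<eta> and N :: nat
        assume N: "0 < N" "2 * n0 / real N \<le> \<eta>" "\<eta> \<le> n0" "2 * n0 / real N \<le> 1"
        define \<delta> where "\<delta> = 2 * n0 / real N"
        obtain g g' \<rho> \<gamma> r where pk: "packets V C n0 \<delta> \<eta> c N g g' \<rho> \<gamma> r" and
          \<phi>: "square_integrable (packets.\<phi> N g)" "abs_L2 (packets.\<phi> N g) = \<psi>" "packets.\<Gamma> N \<gamma> = (norm \<psi>)\<^sup>2"
          by (rule packets_exist[OF cV bV n0 supp ac N(1) \<delta>_def]) (use N in \<open>auto simp: \<delta>_def\<close>)
        interpret packets V C n0 \<delta> \<eta> c N g g' \<rho> \<gamma> r by (rule pk)
        have ph: "integral {a..b} (\<lambda>x. (cmod (\<phi> x))\<^sup>2) = integral {a..b} (\<lambda>x. (cmod (f x))\<^sup>2)" "L2sq \<phi> = L2sq f" for a b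
          using mass_cong[OF \<phi>(1) f(1)] \<phi>(2) f(2) by simp_all
        have "\<Gamma> / 2 \<le> 2 * (9 * B2 / real n + real n * R * D\<^sup>2 * (3 * (2 * n0 * \<sigma>\<^sup>2 + \<eta>\<^sup>2 * R * B2 + 2 * n0 * ((\<delta> / \<eta>)\<^sup>2 * \<Gamma>))))
           + \<eta> * (X' - X) * B2 + 2 * n0 * \<Gamma> * \<delta> / \<eta>\<^sup>2 + \<sigma> * (32 * pi\<^sup>2 * c * n0 + 1) / 2"
        proof (rule two_window_bound[OF gw n(2) _ R_def \<kappa>(1) _ X(2) X'(2) XX(1) \<sigma>])
          show "1 \<le> real n" using n by simp
          show "\<kappa> * D * R \<le> 1" using \<kappa>(2) by (simp add: R_def)
          show "integral {X + y 0..X + y m} (\<lambda>x. (cmod (\<phi> x))\<^sup>2) \<le> \<sigma>\<^sup>2" using K(1) XX ph by simp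
          show "integral {X' + y 0..X' + y m} (\<lambda>x. (cmod (\<phi> x))\<^sup>2) \<le> \<sigma>\<^sup>2" using K(1) XX ph by simp
          show "L2sq \<phi> - integral {X + y 0..X' + y 0} (\<lambda>x. (cmod (\<phi> x))\<^sup>2) \<le> \<sigma>\<^sup>2" using K(2) XX ph by simp
        qed
        moreover have "B2 = b2" "\<Gamma> = P" using \<phi>(3) by (simp_all add: B2_def K1_def b2_def P_def)
        ultimately show "P / 2 \<le> Q (2 * n0 / real N) \<eta> \<sigma> (X' - X)" by (simp add: Q_def \<delta>_def)
      qed
    qed
    have 2: "\<exists>L. \<forall>\<eta>. 0 < \<eta> \<longrightarrow> \<eta> \<le> n0 \<longrightarrow> P / 2 \<le> Q 0 \<eta> \<sigma> L" if \<sigma>: "0 < \<sigma>" for \<sigma>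
    proof -
      obtain L where L: "\<forall>\<eta> N. 0 < N \<longrightarrow> 2 * n0 / real N \<le> \<eta> \<longrightarrow> \<eta> \<le> n0 \<longrightarrow> 2 * n0 / real N \<le> 1 \<longrightarrow> P / 2 \<le> Q (2 * n0 / real N) \<eta> \<sigma> L"
        using 1[OF \<sigma>] by blast
      have "P / 2 \<le> Q 0 \<eta> \<sigma> L" if \<eta>: "0 < \<eta>" "\<eta> \<le> n0" for \<eta>
      proof (rule tendsto_lowerbound)
        have l: "(\<lambda>N. 2 * n0 / real N) \<longlonglongrightarrow> 0" by real_asymp
        show "(\<lambda>N. Q (2 * n0 / real N) \<eta> \<sigma> L) \<longlonglongrightarrow> Q 0 \<eta> \<sigma> L"
          unfolding Q_def by (intro tendsto_intros l) (use \<eta> in auto)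
        have "eventually (\<lambda>N. 2 * n0 / real N < min \<eta> 1) sequentially"
          using \<eta> by (intro order_tendstoD(2)[OF l]) simp
        then show "eventually (\<lambda>N. P / 2 \<le> Q (2 * n0 / real N) \<eta> \<sigma> L) sequentially"
          using eventually_gt_at_top[of 0]
        proof eventually_elim
          case (elim N)
          then show ?case using L \<eta> by auto
        qed
      qed simp
      then show ?thesis by blast
    qed
    \<comment> \<open>At \<eta> = 0 the distance L no longer occurs in Q, so any value, here 0, may
      stand for it.\<close>
    have 3: "P / 2 \<le> Q 0 0 \<sigma> 0" if \<sigma>: "0 < \<sigma>" for \<sigma>
    proof -
      obtain L where L: "\<And>\<eta>. 0 < \<eta> \<Longrightarrow> \<eta> \<le> n0 \<Longrightarrow> P / 2 \<le> Q 0 \<eta> \<sigma> L" using 2[OF \<sigma>] by blast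
      have "P / 2 \<le> Q 0 0 \<sigma> L"
      proof (rule tendsto_lowerbound)
        have Q0: "Q 0 \<eta> \<sigma> L = 2 * (9 * b2 / real n + real n * R * D\<^sup>2 * (3 * (2 * n0 * \<sigma>\<^sup>2 + \<eta>\<^sup>2 * R * b2)))
            + \<eta> * L * b2 + \<sigma> * (32 * pi\<^sup>2 * c * n0 + 1) / 2" for \<eta> by (simp add: Q_def)
        show "((\<lambda>\<eta>. Q 0 \<eta> \<sigma> L) \<longlongrightarrow> Q 0 0 \<sigma> L) (at_right 0)"
          unfolding Q0 by (rule tendsto_eq_intros refl | simp)+
        show "eventually (\<lambda>\<eta>. P / 2 \<le> Q 0 \<eta> \<sigma> L) (at_right 0)"
          using L n0 by (auto simp: eventually_at_right_field intro!: exI[of _ n0])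
      qed simp
      then show ?thesis by (simp add: Q_def)
    qed
    have "P / 2 \<le> Q 0 0 0 0"
    proof (rule tendsto_lowerbound)
      have Q0: "Q 0 0 \<sigma> 0 = 2 * (9 * b2 / real n + real n * R * D\<^sup>2 * (3 * (2 * n0 * \<sigma>\<^sup>2)))
          + \<sigma> * (32 * pi\<^sup>2 * c * n0 + 1) / 2" for \<sigma> by (simp add: Q_def)
      show "((\<lambda>\<sigma>. Q 0 0 \<sigma> 0) \<longlongrightarrow> Q 0 0 0 0) (at_right 0)"
        unfolding Q0 by (rule tendsto_eq_intros refl | simp)+
      show "eventually (\<lambda>\<sigma>. P / 2 \<le> Q 0 0 \<sigma> 0) (at_right 0)"
        using 3 by (auto simp: eventually_at_right_field intro!: exI[of _ 1])
    qed simp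
    then show ?thesis by (simp add: Q_def)
  qed
  have "P / 2 \<le> 0"
  proof (rule tendsto_lowerbound)
    show "(\<lambda>n. 18 * b2 / real n) \<longlonglongrightarrow> 0" by real_asymp
    obtain M :: nat where "n0 < real M" using reals_Archimedean2 by blast
    then show "eventually (\<lambda>n. P / 2 \<le> 18 * b2 / real n) sequentially"
      using bound n0 by (auto simp: eventually_sequentially intro!: exI[of _ M])
  qed simp
  then show ?thesis by (simp add: P_def)
qed

text \<open>Otherwise a bounded Borel set A has positive measure with density at most n. The cut
  vector E A \<psi> satisfies the hypotheses of \<open>recurrent_windows_imp_zero\<close>, but its
  squared norm is the measure of A.\<close>

lemma singular_if_recurrent:
  assumes cV: "continuous_on UNIV V" and bV: "\<And>x. \<bar>V x\<bar> \<le> C" and rec: "recurrent_windows V"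
  shows "singular_lebesgue (\<mu> \<psi>)"
proof (rule ccontr)
  assume "\<not> singular_lebesgue (\<mu> \<psi>)"
  from not_singular_imp_absolutely_continuous_part[OF finite_\<mu> sets_spectral_measure this]
  obtain A n k where A: "A \<in> sets borel" "A \<subseteq> {- real k..<real k}" "emeasure (\<mu> \<psi>) A \<noteq> 0"
    "\<And>B. B \<in> sets borel \<Longrightarrow> B \<subseteq> A \<Longrightarrow> emeasure (\<mu> \<psi>) B \<le> of_nat n * emeasure lborel B" by blast
  have "A \<noteq> {}" using A(3) by auto
  then have k: "0 < real k" using A(2) by (cases k) auto
  have "E A \<psi> = 0"
  proof (rule recurrent_windows_imp_zero[OF cV bV rec k])
    show "E {- real k..<real k} (E A \<psi>) = E A \<psi>"
      using A(1,2) E_inter[of "{- real k..<real k}" A \<psi>] by (simp add: Int_absorb1)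
    show "(norm (E {a..<a + \<delta>} (E A \<psi>)))\<^sup>2 \<le> real n * \<delta>" if "0 \<le> \<delta>" for a \<delta>
    proof -
      have "ennreal ((norm (E ({a..<a + \<delta>} \<inter> A) \<psi>))\<^sup>2) = emeasure (\<mu> \<psi>) ({a..<a + \<delta>} \<inter> A)"
        using A(1) by (subst emeasure_\<mu>) auto
      also have "\<dots> \<le> of_nat n * emeasure lborel ({a..<a + \<delta>} \<inter> A)" using A(1) by (intro A(4)) auto
      also have "\<dots> \<le> of_nat n * emeasure lborel {a..<a + \<delta>}"
        using A(1) by (intro mult_left_mono emeasure_mono) auto
      also have "\<dots> = ennreal (real n * \<delta>)" using that by (simp add: ennreal_mult ennreal_of_nat_eq_real_of_nat)
      finally show ?thesis using A(1) that by (simp add: E_inter)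
    qed
  qed
  then show False using A(1,3) by (simp add: emeasure_\<mu>)
qed

end

lemma purely_singular_if_recurrent:
  assumes "continuous_on UNIV V" "\<And>x. \<bar>V x\<bar> \<le> C" "recurrent_windows V"
  shows "purely_singular_spectrum (schrodinger V)"
  unfolding purely_singular_spectrum_def
proof (intro allI impI)
  fix E \<psi> assume "spectral_resolution (schrodinger V) E"
  then have "spectral_op E V" unfolding spectral_resolution_def by unfold_locales blast+
  then show "singular_lebesgue (spectral_measure E \<psi>)" by (rule spectral_op.singular_if_recurrent[OF _ assms])
qed


section \<open>The flow on the torus\<close>

lemma to_torus_eq_iff: "to_torus x = to_torus y \<longleftrightarrow> (\<forall>i. x $ i - y $ i \<in> \<int>)"
  by (simp add: torus.abs_eq_iff torus_rel_def)

lemma to_torus_add: "to_torus (x + y) = to_torus x + to_torus y"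
  by (simp add: plus_torus.abs_eq)

lemma to_torus_cases: obtains x where "\<omega> = to_torus x"
proof -
  have "\<exists>x. \<omega> = to_torus x" by (induction \<omega> rule: torus.abs_induct) blast
  then show ?thesis using that by blast
qed

lemma to_torus_box_cases: obtains x where "\<omega> = to_torus x" "x \<in> cbox 0 1"
proof -
  obtain z where z: "\<omega> = to_torus z" by (rule to_torus_cases)
  have "z $ i - frac (z $ i) \<in> \<int>" for i by (simp add: frac_def)
  then have "to_torus z = to_torus (\<chi> i. frac (z $ i))" by (auto simp: to_torus_eq_iff)
  moreover have "(\<chi> i. frac (z $ i)) \<in> cbox 0 1" by (auto simp: mem_box_cart frac_lt_1 less_imp_le)
  ultimately show ?thesis using that z by simp
qed

lemma continuous_on_torus_iff: "continuous_on UNIV h \<longleftrightarrow> continuous_on UNIV (\<lambda>x. h (to_torus x))"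
  by (simp add: continuous_on_open_vimage open_torus_def vimage_def)

text \<open>The preimage of the image is the union of the integer translates. Openness of the
  projection converts density of orbits into returns with a small lift.\<close>

lemma open_to_torus_image:
  assumes "open U" shows "open (to_torus ` U)"
proof -
  have "to_torus -` (to_torus ` U) = (\<Union>z\<in>{z. \<forall>i. z $ i \<in> \<int>}. (\<lambda>x. x + z) ` U)"
  proof (intro equalityI subsetI)
    fix x assume "x \<in> to_torus -` (to_torus ` U)"
    then obtain u where u: "u \<in> U" "to_torus x = to_torus u" by auto
    then have "\<forall>i. (x - u) $ i \<in> \<int>" by (simp add: to_torus_eq_iff)
    moreover have "x = u + (x - u)" by simp
    ultimately show "x \<in> (\<Union>z\<in>{z. \<forall>i. z $ i \<in> \<int>}. (\<lambda>x. x + z) ` U)" using u(1) by blast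
  next
    fix x assume "x \<in> (\<Union>z\<in>{z. \<forall>i. z $ i \<in> \<int>}. (\<lambda>x. x + z) ` U)"
    then obtain z u where "\<forall>i. z $ i \<in> \<int>" "u \<in> U" "x = u + z" by auto
    then have "to_torus x = to_torus u" by (simp add: to_torus_eq_iff)
    then show "x \<in> to_torus -` (to_torus ` U)" using \<open>u \<in> U\<close> by auto
  qed
  moreover have "open ((\<lambda>x. x + z) ` U)" for z using open_translation[OF assms, of z] by (simp add: add.commute)
  ultimately show ?thesis unfolding open_torus_def by (simp only:) (intro open_UN ballI)
qed

text \<open>A sum of terms 1 - cos, each 1-periodic, vanishes at the lattice translates of one point
  only. Such functions separate points; the torus is then Hausdorff and, being compact, normal, as
  Tietze's theorem requires.\<close>

lemma torus_separating_function:
  fixes \<omega> :: "'d::finite torus"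
  obtains h :: "'d torus \<Rightarrow> real" where "continuous_on UNIV h" "\<And>x. h x = 0 \<longleftrightarrow> x = \<omega>"
proof -
  obtain a where a: "\<omega> = to_torus a" by (rule to_torus_cases)
  define h where "h x = (\<Sum>i\<in>UNIV. 1 - cos (2 * pi * (rep_torus x $ i - a $ i)))" for x :: "'d torus"
  have h: "h (to_torus x) = (\<Sum>i\<in>UNIV. 1 - cos (2 * pi * (x $ i - a $ i)))" for x
  proof -
    have "to_torus (rep_torus (to_torus x)) = to_torus x" by (rule Quotient3_abs_rep[OF Quotient3_torus])
    then have i: "rep_torus (to_torus x) $ i - x $ i \<in> \<int>" for i by (simp add: to_torus_eq_iff)
    have "cos (2 * pi * (rep_torus (to_torus x) $ i - a $ i)) = cos (2 * pi * (x $ i - a $ i))" for i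
    proof -
      obtain k where "rep_torus (to_torus x) $ i - x $ i = of_int k" using i[of i] by (auto elim: Ints_cases)
      then have "2 * pi * (rep_torus (to_torus x) $ i - a $ i) = 2 * pi * (x $ i - a $ i) + 2 * pi * of_int k"
        by (simp add: algebra_simps)
      then show ?thesis by (simp add: cos_add sin_int_2pin cos_int_2pin)
    qed
    then show ?thesis by (simp add: h_def)
  qed
  have c1: "1 - cos t = 0 \<longleftrightarrow> (\<exists>k. t = 2 * pi * of_int k)" for t :: real
    using cos_one_2pi_int[of t] by (auto simp: mult_ac)
  have "h x = 0 \<longleftrightarrow> x = \<omega>" for x
  proof -
    obtain z where z: "x = to_torus z" by (rule to_torus_cases)
    have "h x = 0 \<longleftrightarrow> (\<forall>i. 1 - cos (2 * pi * (z $ i - a $ i)) = 0)"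
      unfolding z h by (subst sum_nonneg_eq_0_iff) auto
    also have "\<dots> \<longleftrightarrow> (\<forall>i. z $ i - a $ i \<in> \<int>)" unfolding c1 by (auto simp: Ints_def)
    finally show ?thesis by (simp add: z a to_torus_eq_iff)
  qed
  moreover have "continuous_on UNIV h"
    unfolding continuous_on_torus_iff h by (intro continuous_intros)
  ultimately show ?thesis using that by blast
qed

instance torus :: (finite) t2_space
proof
  fix x y :: "'a torus" assume "x \<noteq> y"
  obtain h where h: "continuous_on UNIV h" "\<And>z. h z = (0::real) \<longleftrightarrow> z = x" using torus_separating_function[of x] by blast
  have "h x \<noteq> h y" using h(2) \<open>x \<noteq> y\<close> by metis
  from hausdorff[OF this] obtain U V where UV: "open U" "open V" "h x \<in> U" "h y \<in> V" "U \<inter> V = {}"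
    by (elim exE conjE)
  then have "open (h -` U)" "open (h -` V)" using h(1) by (simp_all add: continuous_on_open_vimage)
  then show "\<exists>U V. open U \<and> open V \<and> x \<in> U \<and> y \<in> V \<and> U \<inter> V = {}"
    using UV by (intro exI[of _ "h -` U"] exI[of _ "h -` V"]) auto
qed

lemma normal_space_torus: "normal_space (euclidean :: 'd::finite torus topology)"
proof (rule compact_Hausdorff_or_regular_imp_normal_space)
  show "compact_space (euclidean :: 'd torus topology)"
    using compact_torus by (simp add: compact_space_def)
  show "Hausdorff_space (euclidean :: 'd torus topology) \<or> regular_space (euclidean :: 'd torus topology)"
  proof (intro disjI1, unfold Hausdorff_space_def disjnt_def, intro allI impI, elim conjE)
    fix x y :: "'d torus" assume "x \<noteq> y"
    from hausdorff[OF this] show "\<exists>U V. openin euclidean U \<and> openin euclidean V \<and> x \<in> U \<and> y \<in> V \<and> U \<inter> V = {}"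
      by (simp only: open_openin[symmetric])
  qed
qed

text \<open>Here d >= 2 enters: the lift of the image of a line is a countable union of its
  translates, a null set in dimension at least 2.\<close>

lemma line_translates_not_everything:
  fixes \<alpha> :: "real ^ 'd"
  assumes d: "2 \<le> CARD('d)"
  shows "range (\<lambda>x. to_torus (x *\<^sub>R \<alpha>)) \<noteq> UNIV"
proof
  assume r: "range (\<lambda>x. to_torus (x *\<^sub>R \<alpha>)) = UNIV"
  define Z where "Z = range (\<lambda>f :: 'd \<Rightarrow> int. \<chi> i. real_of_int (f i))"
  have "negligible (span {\<alpha>})"
  proof (rule negligible_lowdim)
    have "dim (span {\<alpha>}) \<le> card {\<alpha>}" using dim_le_card'[of "{\<alpha>}"] by simp
    then show "dim (span {\<alpha>}) < DIM(real ^ 'd)" using d by simp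
  qed
  then have ns: "negligible ((+) z ` span {\<alpha>})" for z by (rule negligible_translation)
  have "countable Z" unfolding Z_def by (intro countable_image countableI_type)
  then have "negligible (\<Union>z\<in>Z. (+) z ` span {\<alpha>})"
    using ns by (intro negligible_countable_Union countable_image) blast+
  moreover have "(\<Union>z\<in>Z. (+) z ` span {\<alpha>}) = UNIV"
  proof (intro equalityI subsetI UNIV_I)
    fix y :: "real ^ 'd"
    have "to_torus y \<in> range (\<lambda>x. to_torus (x *\<^sub>R \<alpha>))" unfolding r by (rule UNIV_I)
    then obtain x where "to_torus y = to_torus (x *\<^sub>R \<alpha>)" by (rule rangeE)
    then have "\<forall>i. \<exists>k. y $ i - (x *\<^sub>R \<alpha>) $ i = real_of_int k" by (auto simp: to_torus_eq_iff elim!: Ints_cases)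
    then obtain f where f: "\<And>i. y $ i - (x *\<^sub>R \<alpha>) $ i = real_of_int (f i)" by metis
    have "y = (\<chi> i. real_of_int (f i)) + x *\<^sub>R \<alpha>"
    proof (rule vec_eq_iff[THEN iffD2], rule allI)
      fix i
      show "y $ i = ((\<chi> i. real_of_int (f i)) + x *\<^sub>R \<alpha>) $ i" using f[of i] by simp
    qed
    moreover have "x *\<^sub>R \<alpha> \<in> span {\<alpha>}" by (simp add: span_base span_scale)
    ultimately show "y \<in> (\<Union>z\<in>Z. (+) z ` span {\<alpha>})" unfolding Z_def by blast
  qed
  ultimately show False by (simp add: non_negligible_UNIV)
qed

locale torus_flow =
  fixes \<alpha> :: "real ^ 'd::finite"
  assumes d2: "2 \<le> CARD('d)"
    and minimal: "minimal_flow (\<lambda>x \<omega>. \<omega> + to_torus (x *\<^sub>R \<alpha>))"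
begin

lemma continuous_orbit: "continuous_on S (\<lambda>x. to_torus (a + x *\<^sub>R \<alpha>))"
  by (intro continuous_on_compose2[OF continuous_to_torus] continuous_intros) auto

lemma orbit_dense: "closure (range (\<lambda>x. \<omega> + to_torus (x *\<^sub>R \<alpha>))) = UNIV"
  using minimal by (simp add: minimal_flow_def)

text \<open>A coincidence would make the orbit of 0 periodic, hence the image of a compact interval
  and closed; being dense, it would be the whole torus.\<close>

lemma orbit_injective:
  assumes "to_torus (x *\<^sub>R \<alpha>) = to_torus (y *\<^sub>R \<alpha>)"
  shows "x = y"
proof (rule ccontr)
  assume "x \<noteq> y"
  define T where "T = \<bar>x - y\<bar>"
  have T: "0 < T" using \<open>x \<noteq> y\<close> by (simp add: T_def)
  have TZ: "T * \<alpha> $ i \<in> \<int>" for i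
  proof -
    have "x * \<alpha> $ i - y * \<alpha> $ i \<in> \<int>" using assms by (simp add: to_torus_eq_iff)
    then have "(x - y) * \<alpha> $ i \<in> \<int>" "- ((x - y) * \<alpha> $ i) \<in> \<int>" by (simp_all only: left_diff_distrib Ints_minus)
    then show ?thesis by (cases "0 \<le> x - y") (simp_all add: T_def left_diff_distrib)
  qed
  have "range (\<lambda>x. to_torus (x *\<^sub>R \<alpha>)) = (\<lambda>x. to_torus (x *\<^sub>R \<alpha>)) ` {0..T}"
  proof (intro equalityI subsetI)
    fix z assume "z \<in> range (\<lambda>x. to_torus (x *\<^sub>R \<alpha>))"
    then obtain s where s: "z = to_torus (s *\<^sub>R \<alpha>)" by auto
    define k where "k = \<lfloor>s / T\<rfloor>"
    have "of_int k * (T * \<alpha> $ i) \<in> \<int>" for i by (intro Ints_mult[OF Ints_of_int TZ])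
    then have "to_torus (s *\<^sub>R \<alpha>) = to_torus ((s - of_int k * T) *\<^sub>R \<alpha>)"
      by (simp add: to_torus_eq_iff algebra_simps)
    moreover have "of_int k * T \<le> s" "s < (of_int k + 1) * T"
      using T unfolding k_def by (simp_all add: pos_le_divide_eq[symmetric] pos_divide_less_eq[symmetric])
    then have "s - of_int k * T \<in> {0..T}" by (auto simp: algebra_simps)
    ultimately show "z \<in> (\<lambda>x. to_torus (x *\<^sub>R \<alpha>)) ` {0..T}" using s by blast
  qed auto
  moreover have "compact ((\<lambda>x. to_torus (x *\<^sub>R \<alpha>)) ` {0..T})"
    using compact_continuous_image[OF continuous_orbit[of _ 0]] by simp
  ultimately have "closed (range (\<lambda>x. to_torus (x *\<^sub>R \<alpha>)))" by (metis compact_imp_closed)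
  moreover have "closure (range (\<lambda>x. to_torus (x *\<^sub>R \<alpha>))) = UNIV"
    using orbit_dense[of "to_torus 0"] by (simp add: to_torus_add[symmetric])
  ultimately show False using line_translates_not_everything[OF d2, of \<alpha>] by simp
qed

section \<open>Recurrence and extension from the orbit\<close>

text \<open>Dirichlet's argument by compactness: the fractional parts at the times n * M have a
  convergent subsequence, and the difference of two late times is an almost-period of length at
  least M.\<close>

lemma near_period:
  assumes "0 < r" "0 < M"
  obtains T \<zeta> where "M \<le> T" "norm \<zeta> < r" "to_torus (T *\<^sub>R \<alpha>) = to_torus \<zeta>"
proof -
  define v where "v n = (\<chi> i. frac (real n * M * \<alpha> $ i))" for n :: nat
  have "v n \<in> cbox 0 1" for n by (auto simp: v_def mem_box_cart frac_lt_1 less_imp_le)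
  moreover have "seq_compact (cbox 0 1 :: (real ^ 'd) set)" using compact_cbox compact_eq_seq_compact_metric by blast
  ultimately obtain l \<phi> where "strict_mono \<phi>" "(v \<circ> \<phi>) \<longlonglongrightarrow> l" unfolding seq_compact_def by metis
  then have "Cauchy (v \<circ> \<phi>)" by (auto intro: LIMSEQ_imp_Cauchy)
  then obtain N where N: "\<And>m n. N \<le> m \<Longrightarrow> N \<le> n \<Longrightarrow> dist ((v \<circ> \<phi>) m) ((v \<circ> \<phi>) n) < r"
    using assms(1) unfolding Cauchy_def by metis
  define p q where "p = \<phi> N" and "q = \<phi> (Suc N)"
  have pq: "p < q" using \<open>strict_mono \<phi>\<close> by (simp add: p_def q_def strict_mono_def)
  show ?thesis
  proof (rule that)
    have "1 * M \<le> (real q - real p) * M" using pq assms(2) by (intro mult_right_mono) auto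
    then show "M \<le> (real q - real p) * M" by simp
    show "norm (v q - v p) < r" using N[of "Suc N" N] by (simp add: dist_norm p_def q_def)
    have "((real q - real p) * M) * \<alpha> $ i - (frac (real q * M * \<alpha> $ i) - frac (real p * M * \<alpha> $ i)) \<in> \<int>" for i
    proof -
      have "((real q - real p) * M) * \<alpha> $ i - (frac (real q * M * \<alpha> $ i) - frac (real p * M * \<alpha> $ i))
        = of_int \<lfloor>real q * M * \<alpha> $ i\<rfloor> - of_int \<lfloor>real p * M * \<alpha> $ i\<rfloor>" by (simp add: frac_def algebra_simps)
      then show ?thesis by simp
    qed
    then show "to_torus (((real q - real p) * M) *\<^sub>R \<alpha>) = to_torus (v q - v p)"
      by (simp add: to_torus_eq_iff v_def)
  qed
qed

text \<open>Density of the two-sided orbit gives one visit near the origin, at a time that cannot be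
  prescribed. Adding or subtracting a long almost-period moves the visit as far right or left as
  desired.\<close>

lemma recurrence:
  assumes r: "0 < r"
  shows "\<exists>x\<ge>K. \<exists>\<zeta>. norm \<zeta> < r \<and> \<omega> + to_torus (x *\<^sub>R \<alpha>) = to_torus \<zeta>"
    "\<exists>x\<le>K. \<exists>\<zeta>. norm \<zeta> < r \<and> \<omega> + to_torus (x *\<^sub>R \<alpha>) = to_torus \<zeta>"
proof -
  have "open (to_torus ` ball (0 :: real ^ 'd) (r / 2))" by (intro open_to_torus_image open_ball)
  moreover have "to_torus 0 \<in> to_torus ` ball (0 :: real ^ 'd) (r / 2)" using r by simp
  moreover have "to_torus 0 \<in> closure (range (\<lambda>x. \<omega> + to_torus (x *\<^sub>R \<alpha>)))" unfolding orbit_dense by simp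
  ultimately obtain x where "\<omega> + to_torus (x *\<^sub>R \<alpha>) \<in> to_torus ` ball 0 (r / 2)"
    unfolding closure_iff_nhds_not_empty by blast
  then obtain \<zeta> where \<zeta>: "norm \<zeta> < r / 2" "\<omega> + to_torus (x *\<^sub>R \<alpha>) = to_torus \<zeta>" by auto
  obtain T \<xi> where T: "\<bar>K\<bar> + \<bar>x\<bar> + 1 \<le> T" "norm \<xi> < r / 2" "to_torus (T *\<^sub>R \<alpha>) = to_torus \<xi>"
    by (rule near_period[of "r / 2" "\<bar>K\<bar> + \<bar>x\<bar> + 1"]) (use r in auto)
  have "\<omega> + to_torus ((x + T) *\<^sub>R \<alpha>) = to_torus (\<zeta> + \<xi>)"
    by (simp add: scaleR_add_left to_torus_add \<zeta>(2)[symmetric] T(3)[symmetric] add.assoc)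
  moreover have "norm (\<zeta> + \<xi>) < r" using \<zeta>(1) T(2) norm_triangle_ineq[of \<zeta> \<xi>] by linarith
  ultimately show "\<exists>x\<ge>K. \<exists>\<zeta>. norm \<zeta> < r \<and> \<omega> + to_torus (x *\<^sub>R \<alpha>) = to_torus \<zeta>"
    using T(1) by (intro exI[of _ "x + T"]) auto
  have neg: "to_torus ((- T) *\<^sub>R \<alpha>) = to_torus (- \<xi>)"
  proof -
    have "to_torus (- u) = - to_torus u" for u :: "real ^ 'd" by (simp add: uminus_torus.abs_eq)
    then show ?thesis using T(3) by simp
  qed
  have "\<omega> + to_torus ((x + - T) *\<^sub>R \<alpha>) = to_torus (\<zeta> + - \<xi>)"
    unfolding scaleR_add_left to_torus_add neg \<zeta>(2)[symmetric] by (simp add: add.assoc)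
  moreover have "norm (\<zeta> + - \<xi>) < r" using \<zeta>(1) T(2) norm_triangle_ineq[of \<zeta> "- \<xi>"] by simp
  ultimately show "\<exists>x\<le>K. \<exists>\<zeta>. norm \<zeta> < r \<and> \<omega> + to_torus (x *\<^sub>R \<alpha>) = to_torus \<zeta>"
    using T(1) by (intro exI[of _ "x + - T"]) auto
qed

lemma extend_from_orbit:
  assumes W: "continuous_on {0..b} W" "\<forall>t\<in>{0..b}. \<bar>W t\<bar> \<le> \<epsilon>" and "0 \<le> b" "0 \<le> \<epsilon>"
  obtains h where "continuous_on UNIV h" "\<forall>t\<in>{0..b}. h (to_torus (t *\<^sub>R \<alpha>)) = W t" "\<forall>\<omega>. \<bar>h \<omega>\<bar> \<le> (\<epsilon>::real)"
proof -
  define o' where "o' t = to_torus (t *\<^sub>R \<alpha>)" for t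
  have co: "continuous_on {0..b} o'" unfolding o'_def using continuous_orbit[of _ 0] by simp
  have inj: "inj_on o' {0..b}" using orbit_injective by (auto simp: inj_on_def o'_def)
  define S where "S = o' ` {0..b}"
  have "compact S" unfolding S_def by (intro compact_continuous_image co) simp
  then have clS: "closed S" by (rule compact_imp_closed)
  define w where "w \<omega> = W (the_inv_into {0..b} o' \<omega>)" for \<omega>
  have inv: "the_inv_into {0..b} o' (o' t) = t" if "t \<in> {0..b}" for t by (rule the_inv_into_f_f[OF inj that])
  \<comment> \<open>The orbit map is injective on a compact interval, so its inverse on the segment
    is continuous and W can be transported there.\<close>
  have "continuous_on S (the_inv_into {0..b} o')"
    unfolding S_def by (rule continuous_on_inv[OF co]) (use inv in auto)
  moreover have "the_inv_into {0..b} o' ` S \<subseteq> {0..b}" using inv by (auto simp: S_def)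
  ultimately have "continuous_on S w" unfolding w_def by (rule continuous_on_compose2[OF W(1)])
  then have "continuous_map (subtopology euclidean S) euclideanreal w" by simp
  moreover have "w ` S \<subseteq> {-\<epsilon>..\<epsilon>}"
  proof -
    have "w (o' t) \<in> {-\<epsilon>..\<epsilon>}" if "t \<in> {0..b}" for t
    proof -
      have "\<bar>W t\<bar> \<le> \<epsilon>" using W(2) that by blast
      then show ?thesis unfolding w_def inv[OF that] by auto
    qed
    then show ?thesis by (auto simp: S_def)
  qed
  ultimately obtain h where h: "continuous_map euclidean euclideanreal h" "\<And>x. x \<in> S \<Longrightarrow> h x = w x"
      "h ` topspace euclidean \<subseteq> {-\<epsilon>..\<epsilon>}"
    using Tietze_extension_closed_real_interval[OF normal_space_torus, of S w "-\<epsilon>" \<epsilon>] clS \<open>0 \<le> \<epsilon>\<close>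
    by (metis closed_closedin neg_le_0_iff_le order_trans)
  show ?thesis
  proof (rule that)
    show "continuous_on UNIV h" using h(1) by simp
    show "\<forall>t\<in>{0..b}. h (to_torus (t *\<^sub>R \<alpha>)) = W t"
      using h(2) inv by (auto simp: S_def w_def o'_def)
    show "\<forall>\<omega>. \<bar>h \<omega>\<bar> \<le> \<epsilon>" using h(3) by (simp add: image_subset_iff abs_le_iff minus_le_iff)
  qed
qed

end

section \<open>Uniform continuity on the torus and Baire category\<close>

text \<open>Closeness on the torus is expressed by a small lift \<open>\<zeta>\<close> of the
  difference. The radius B + 1 leaves room for \<zeta> + x, which may fall outside the unit
  cube.\<close>

lemma torus_uniform_continuity:
  fixes f :: "'d::finite torus \<Rightarrow> real"
  assumes f: "continuous_on UNIV f" and e: "0 < e"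
  obtains r where "0 < r" "\<forall>\<zeta> \<omega>. norm \<zeta> < r \<longrightarrow> \<bar>f (to_torus \<zeta> + \<omega>) - f \<omega>\<bar> < e"
proof -
  have "continuous_on UNIV (\<lambda>x. f (to_torus x))" using f by (simp add: continuous_on_torus_iff)
  then have "uniformly_continuous_on (cball 0 (B + 1)) (\<lambda>x. f (to_torus x))" for B :: real
    by (intro compact_uniformly_continuous compact_cball) (auto intro: continuous_on_subset)
  moreover obtain B where B: "\<forall>x\<in>cbox 0 (1 :: real ^ 'd). norm x \<le> B" using bounded_cbox bounded_iff by blast
  ultimately obtain r where r: "0 < r" "\<And>x x'. x \<in> cball 0 (B + 1) \<Longrightarrow> x' \<in> cball 0 (B + 1) \<Longrightarrow> dist x' x < r \<Longrightarrow>
      dist (f (to_torus x')) (f (to_torus x)) < e" using e unfolding uniformly_continuous_on_def by metis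
  show ?thesis
  proof (rule that)
    show "0 < min r 1" using r(1) by simp
    show "\<forall>\<zeta> \<omega>. norm \<zeta> < min r 1 \<longrightarrow> \<bar>f (to_torus \<zeta> + \<omega>) - f \<omega>\<bar> < e"
    proof (intro allI impI)
      fix \<zeta> :: "real ^ 'd" and \<omega> :: "'d torus" assume \<zeta>: "norm \<zeta> < min r 1"
      obtain x where x: "\<omega> = to_torus x" "x \<in> cbox 0 1" by (rule to_torus_box_cases)
      have "norm x \<le> B" using B x(2) by blast
      moreover have "norm (\<zeta> + x) \<le> norm \<zeta> + norm x" by (rule norm_triangle_ineq)
      ultimately have "norm (\<zeta> + x) \<le> B + 1" "norm x \<le> B + 1" using \<zeta> by simp_all
      then have "dist (f (to_torus (\<zeta> + x))) (f (to_torus x)) < e"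
        using \<zeta> by (intro r(2), simp_all only: mem_cball_0) (simp add: dist_norm)
      then show "\<bar>f (to_torus \<zeta> + \<omega>) - f \<omega>\<bar> < e" by (simp add: x to_torus_add dist_real_def)
    qed
  qed
qed

text \<open>Uniform limits exist and stay continuous for any topology on the domain, so completeness
  of the values suffices. Baire's theorem rests on this.\<close>

lemma complete_bcontfun: "complete (UNIV :: ('a::topological_space \<Rightarrow>\<^sub>C 'b::complete_space) set)"
  unfolding complete_def
proof (intro allI impI)
  fix f :: "nat \<Rightarrow> 'a \<Rightarrow>\<^sub>C 'b" assume f: "(\<forall>n. f n \<in> UNIV) \<and> Cauchy f"
  have "uniformly_Cauchy_on UNIV (\<lambda>n. apply_bcontfun (f n))"
  proof (rule uniformly_Cauchy_onI)
    fix e :: real assume "0 < e"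
    then obtain N where "\<And>m n. N \<le> m \<Longrightarrow> N \<le> n \<Longrightarrow> dist (f m) (f n) < e" using f unfolding Cauchy_def by metis
    then show "\<exists>M. \<forall>x\<in>UNIV. \<forall>m\<ge>M. \<forall>n\<ge>M. dist (apply_bcontfun (f m) x) (apply_bcontfun (f n) x) < e"
      by (intro exI[of _ N]) (auto intro: dist_fun_lt_imp_dist_val_lt)
  qed
  then obtain g where "uniform_limit UNIV (\<lambda>n. apply_bcontfun (f n)) g sequentially"
    using Cauchy_uniformly_convergent by (auto simp: uniformly_convergent_on_def)
  then obtain l where "f \<longlonglongrightarrow> l" using uniform_limit_bcontfunE sequentially_bot by blast
  then show "\<exists>l\<in>UNIV. f \<longlonglongrightarrow> l" by blast
qed

lemma dense_gdelta_bcontfun: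
  fixes G :: "nat \<Rightarrow> ('a::topological_space \<Rightarrow>\<^sub>C 'b::complete_space) set"
  assumes "\<And>n. open (G n)" "\<And>n. closure (G n) = UNIV"
  shows "gdelta_in euclidean (\<Inter>n. G n)" "closure (\<Inter>n. G n) = UNIV"
proof -
  show "gdelta_in euclidean (\<Inter>n. G n)"
    by (rule gdelta_in_Inter) (use assms(1) in \<open>auto intro!: open_imp_gdelta_in\<close>)
  have "Met_TC.mcomplete TYPE('a \<Rightarrow>\<^sub>C 'b)" using complete_bcontfun by simp
  then have "Met_TC.mtopology closure_of (\<Inter>(range G)) = UNIV"
    by (rule Met_TC.metric_Baire_category) (use assms in auto)
  then show "closure (\<Inter>n. G n) = UNIV" by simp
qed


section \<open>The generic set\<close>

context torus_flow
begin

text \<open>A union of balls around functions g with growth windows along the orbit of the origin.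
  The radius is half of the tolerance 1 / (D * (y m - y 0)) that \<open>recurrent_windows\<close>
  admits; the other half is reserved for the variation of g.\<close>

definition windowed :: "nat \<Rightarrow> ('d torus \<Rightarrow>\<^sub>C real) set" where
  "windowed n = {f. \<exists>g U m y D. growth_windows (real n) U m y D \<and>
     (\<forall>t\<in>{y 0..y m}. apply_bcontfun g (to_torus (t *\<^sub>R \<alpha>)) = U t) \<and> dist f g < 1 / (2 * D * (y m - y 0))}"

lemma growth_windows_length:
  assumes "growth_windows \<Lambda> U m y D" shows "0 < y m - y 0"
proof -
  have m: "0 < m" and inc: "\<forall>j<m. y j < y (Suc j)" using assms by (auto simp: growth_windows_def)
  have "y 0 < y (Suc 0)" using inc m by blast
  also have "y (Suc 0) \<le> y m" using increasing_nodes[OF inc, of "Suc 0" m] m by simp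
  finally show ?thesis by simp
qed

lemma open_windowed: "open (windowed n)"
  unfolding windowed_def
  by (intro open_Collect_ex open_Collect_conj open_Collect_const open_Collect_less continuous_intros)

lemma dense_windowed: "closure (windowed n) = UNIV"
proof -
  have "\<exists>g\<in>windowed n. dist g f < e" if e: "0 < e" for f :: "'d torus \<Rightarrow>\<^sub>C real" and e :: real
  proof -
    \<comment> \<open>The cap 1 is the size of perturbation up to which the growth estimates were
      established.\<close>
    define \<epsilon> where "\<epsilon> = min 1 (e / 2)"
    have \<epsilon>: "0 < \<epsilon>" "\<epsilon> \<le> 1" "\<epsilon> < e" using e by (auto simp: \<epsilon>_def)
    define u where "u t = apply_bcontfun f (to_torus (t *\<^sub>R \<alpha>))" for t
    have "bounded (range (apply_bcontfun f))" by (rule bounded_apply_bcontfun)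
    then obtain C where C: "\<And>\<omega>. \<bar>apply_bcontfun f \<omega>\<bar> \<le> C" by (auto simp: bounded_iff)
    have cf: "continuous_on UNIV (apply_bcontfun f)" by (rule continuous_on_apply_bcontfun)
    have cu: "continuous_on UNIV u"
      unfolding u_def using continuous_on_compose2[OF cf continuous_orbit[of UNIV 0]] by simp
    have "0 \<le> C" using C[of 0] by linarith
    then obtain m y W D where w: "y 0 = 0" "adm \<epsilon> 0 (y m) W" "growth_windows (real n) (\<lambda>t. u t + W t) m y D"
      using growth_windows_exist[of C \<epsilon> "real n" u] \<epsilon>(1,2) cu C by (auto simp: u_def)
    have ym: "0 < y m" using growth_windows_length[OF w(3)] w(1) by simp
    have W: "continuous_on {0..y m} W" "\<forall>t\<in>{0..y m}. \<bar>W t\<bar> \<le> \<epsilon>"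
      using w(2) by (auto simp: adm_def intro: continuous_on_subset)
    obtain h where h: "continuous_on UNIV h" "\<forall>t\<in>{0..y m}. h (to_torus (t *\<^sub>R \<alpha>)) = W t" "\<forall>\<omega>. \<bar>h \<omega>\<bar> \<le> \<epsilon>"
      by (rule extend_from_orbit[OF W less_imp_le[OF ym] less_imp_le[OF \<epsilon>(1)]])
    define g where "g = Bcontfun (\<lambda>\<omega>. apply_bcontfun f \<omega> + h \<omega>)"
    have "(\<lambda>\<omega>. apply_bcontfun f \<omega> + h \<omega>) \<in> bcontfun"
      unfolding continuous_torus_bcontfun by (intro continuous_intros h(1) cf)
    then have g: "apply_bcontfun g \<omega> = apply_bcontfun f \<omega> + h \<omega>" for \<omega> by (simp add: g_def Bcontfun_inverse)
    have "dist g f \<le> \<epsilon>" by (rule dist_bound) (use g h(3) in \<open>simp add: dist_real_def\<close>)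
    moreover have "g \<in> windowed n"
    proof -
      have "0 < 1 / (2 * D * (y m - y 0))"
        using growth_windows_length[OF w(3)] w(3) by (simp add: growth_windows_def)
      moreover have "\<forall>t\<in>{y 0..y m}. apply_bcontfun g (to_torus (t *\<^sub>R \<alpha>)) = u t + W t"
        using h(2) by (simp add: g u_def w(1))
      ultimately show ?thesis unfolding windowed_def using w(3)
        by (intro CollectI exI[of _ g] exI[of _ "\<lambda>t. u t + W t"] exI[of _ m] exI[of _ y] exI[of _ D]) simp
    qed
    ultimately show ?thesis using \<epsilon>(3) by (intro bexI[of _ g]) auto
  qed
  then show ?thesis by (intro UNIV_eq_I[symmetric]) (auto simp: closure_approachable)
qed

text \<open>If \<omega> + X \<alpha> has a small lift \<zeta>, the potential at X + t is the value
  of f at \<zeta> + t \<alpha>. It is within \<kappa> / 2 of the value of g there, which in turn is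
  within \<kappa> / 2 of the value of g at t \<alpha>, that is U t. The windows are those of the
  orbit of the origin, whatever \<omega> is.\<close>

lemma recurrent_windows_of_windowed:
  assumes f: "\<And>n. 0 < n \<Longrightarrow> f \<in> windowed n"
  shows "recurrent_windows (\<lambda>x. apply_bcontfun f (\<omega> + to_torus (x *\<^sub>R \<alpha>)))"
  unfolding recurrent_windows_def
proof (intro allI impI)
  fix n :: nat assume "0 < n"
  then obtain g U m y D where gw: "growth_windows (real n) U m y D"
    and gU: "\<forall>t\<in>{y 0..y m}. apply_bcontfun g (to_torus (t *\<^sub>R \<alpha>)) = U t"
    and fg: "dist f g < 1 / (2 * D * (y m - y 0))" using f unfolding windowed_def by blast
  define \<kappa> where "\<kappa> = 1 / (D * (y m - y 0))"
  have D: "1 \<le> D" and R: "0 < y m - y 0" using gw growth_windows_length[OF gw] by (auto simp: growth_windows_def)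
  have \<kappa>: "0 < \<kappa>" "\<kappa> * D * (y m - y 0) = 1" using D R by (simp_all add: \<kappa>_def)
  obtain r where r: "0 < r" "\<forall>\<zeta> \<omega>. norm \<zeta> < r \<longrightarrow> \<bar>apply_bcontfun g (to_torus \<zeta> + \<omega>) - apply_bcontfun g \<omega>\<bar> < \<kappa> / 2"
    using torus_uniform_continuity[of "apply_bcontfun g" "\<kappa> / 2"] \<kappa>(1) continuous_on_apply_bcontfun by auto
  have close: "\<bar>apply_bcontfun f (\<omega> + to_torus ((X + t) *\<^sub>R \<alpha>)) - U t\<bar> \<le> \<kappa>"
    if X: "norm \<zeta> < r" "\<omega> + to_torus (X *\<^sub>R \<alpha>) = to_torus \<zeta>" and t: "t \<in> {y 0..y m}" for X \<zeta> t
  proof -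
    define p where "p = to_torus (t *\<^sub>R \<alpha>)"
    have e: "\<omega> + to_torus ((X + t) *\<^sub>R \<alpha>) = to_torus \<zeta> + p"
      by (simp add: scaleR_add_left to_torus_add X(2)[symmetric] p_def add.assoc)
    have "dist (apply_bcontfun f (to_torus \<zeta> + p)) (apply_bcontfun g (to_torus \<zeta> + p)) \<le> dist f g" by (rule dist_bounded)
    also have "\<dots> < 1 / (2 * D * (y m - y 0))" by (rule fg)
    also have "\<dots> = \<kappa> / 2" using D R by (simp add: \<kappa>_def)
    finally have "\<bar>apply_bcontfun f (to_torus \<zeta> + p) - apply_bcontfun g (to_torus \<zeta> + p)\<bar> < \<kappa> / 2"
      by (simp add: dist_real_def)
    moreover have "\<bar>apply_bcontfun g (to_torus \<zeta> + p) - apply_bcontfun g p\<bar> < \<kappa> / 2" using r(2) X(1) by blast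
    moreover have "apply_bcontfun g p = U t" using gU t by (simp add: p_def)
    ultimately show ?thesis unfolding e by (simp only: abs_less_iff abs_le_iff) linarith
  qed
  show "\<exists>U m y D \<kappa>. growth_windows (real n) U m y D \<and> 0 \<le> \<kappa> \<and> \<kappa> * D * (y m - y 0) \<le> 1 \<and>
     (\<forall>K. \<exists>X\<ge>K. \<forall>t\<in>{y 0..y m}. \<bar>apply_bcontfun f (\<omega> + to_torus ((X + t) *\<^sub>R \<alpha>)) - U t\<bar> \<le> \<kappa>) \<and>
     (\<forall>K. \<exists>X\<le>K. \<forall>t\<in>{y 0..y m}. \<bar>apply_bcontfun f (\<omega> + to_torus ((X + t) *\<^sub>R \<alpha>)) - U t\<bar> \<le> \<kappa>)"
  proof (rule exI[of _ U], rule exI[of _ m], rule exI[of _ y], rule exI[of _ D], rule exI[of _ \<kappa>], intro conjI allI)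
    show "growth_windows (real n) U m y D" by (rule gw)
    show "0 \<le> \<kappa>" "\<kappa> * D * (y m - y 0) \<le> 1" using \<kappa> by simp_all
    show "\<exists>X\<ge>K. \<forall>t\<in>{y 0..y m}. \<bar>apply_bcontfun f (\<omega> + to_torus ((X + t) *\<^sub>R \<alpha>)) - U t\<bar> \<le> \<kappa>" for K
      using recurrence(1)[OF r(1), of K \<omega>] close by blast
    show "\<exists>X\<le>K. \<forall>t\<in>{y 0..y m}. \<bar>apply_bcontfun f (\<omega> + to_torus ((X + t) *\<^sub>R \<alpha>)) - U t\<bar> \<le> \<kappa>" for K
      using recurrence(2)[OF r(1), where K = K and \<omega> = \<omega>] close by blast
  qed
qed

lemma singular_of_windowed:
  assumes "\<And>n. 0 < n \<Longrightarrow> f \<in> windowed n"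
  shows "purely_singular_spectrum (schrodinger (\<lambda>x. apply_bcontfun f (\<omega> + to_torus (x *\<^sub>R \<alpha>))))"
proof -
  have "bounded (range (apply_bcontfun f))" by (rule bounded_apply_bcontfun)
  then obtain C where C: "\<And>\<omega>. \<bar>apply_bcontfun f \<omega>\<bar> \<le> C" by (auto simp: bounded_iff)
  obtain a where a: "\<omega> = to_torus a" by (rule to_torus_cases)
  have cf: "continuous_on UNIV (apply_bcontfun f)" by (rule continuous_on_apply_bcontfun)
  have "continuous_on UNIV (\<lambda>x. apply_bcontfun f (\<omega> + to_torus (x *\<^sub>R \<alpha>)))"
    unfolding a to_torus_add[symmetric] by (rule continuous_on_compose2[OF cf continuous_orbit]) auto
  then show ?thesis using C recurrent_windows_of_windowed[OF assms] by (rule purely_singular_if_recurrent)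
qed

end

theorem theorem1p1:
  fixes \<alpha> :: "real ^ 'd"
  assumes "2 \<le> CARD('d)"
    and "minimal_flow (\<lambda>x \<omega>. \<omega> + to_torus (x *\<^sub>R \<alpha>))"
  shows "\<exists>S :: ('d torus \<Rightarrow>\<^sub>C real) set.
    gdelta_in euclidean S \<and> closure S = UNIV \<and>
    (\<forall>f\<in>S. \<forall>\<omega>. purely_singular_spectrum
       (schrodinger (\<lambda>x. apply_bcontfun f (\<omega> + to_torus (x *\<^sub>R \<alpha>)))))"
proof -
  interpret torus_flow \<alpha> by unfold_locales (fact assms)+
  show ?thesis
    using dense_gdelta_bcontfun[of windowed, OF open_windowed dense_windowed]
    by (intro exI[of _ "\<Inter>n. windowed n"]) (auto intro: singular_of_windowed)
qed

end
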